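(* Let $R$ be a commutative ring with unit and let $X$ be a simplicial complex with a total ordering of its vertices. Let $(C_\bullet(X),\partial)$ be the simplicial chain complex of $X$ over $R$ and $(\mathbb{L}_\bullet(X),D)$ the necklace complex of $X$. Let $\rho,\chi\colon(C_\bullet(X),\partial)\to(\mathbb{L}_\bullet(X),D)$ be the chain maps defined in the context. Then $\rho$ and $\chi$ are chain homotopic.
   Context: **Simplices.** $X_j$ is the set of $j$-simplices of $X$. A $k$-simplex with vertices $i_0<\dots<i_k$ is written $[i_0,\dots,i_k]$. $C_k(X)$ is the free $R$-module on $X_k$, $\partial[i_0,\dots,i_k]=\sum_{j=0}^k(-1)^j[i_0,\dots,\widehat{i_j},\dots,i_k]$, and $\widetilde\partial[i_0,\dots,i_k]=\sum_{j=1}^{k-1}(-1)^j[i_0,\dots,\widehat{i_j},\dots,i_k]$. Let $\mathsf{s},\mathsf{t}$ send a simplex to its first, resp. last, vertex. Let $X_1^{-1}=\{\sigma^{-1}:\sigma\in X_1\}$ be a set of formal inverses of $1$-simplices, with $\mathsf{s}(\sigma^{-1})=\mathsf{t}(\sigma)$, $\mathsf{t}(\sigma^{-1})=\mathsf{s}(\sigma)$, dimension $1$; the formal inverse of $[a,b]$ is written $[b,a]$. $|\sigma|$ denotes the dimension of a simplex. **The path complex $\mathbb{P}_\bullet(X)$.** It is the graded $R$-module generated by symbols $(\mathrm{id}_a)$, $a\in X_0$ (degree $0$), and sequences $(\sigma_1|\cdots|\sigma_p)$, $p\ge1$, with $\sigma_i\in\bigcup_{j\ge1}X_j\cup X_1^{-1}$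 and $\mathsf{t}(\sigma_i)=\mathsf{s}(\sigma_{i+1})$, of degree $\sum_i(|\sigma_i|-1)$, modulo deleting an adjacent pair consisting of a $1$-simplex and its formal inverse in either order (an empty sequence based at $a$ being $\mathrm{id}_a$). Reduced sequences, i.e. those in which no $1$-simplex is adjacent to its formal inverse, together with the $(\mathrm{id}_a)$ form an $R$-basis. $\mathbb{P}_\bullet(X)(a,b)$ is the submodule spanned by sequences starting at $a$ and ending at $b$. Concatenation of composable sequences gives a product $\mu$, with units $\mathrm{id}_a$. For $x\in\mathbb{P}_\bullet(X)$, $|x|$ is its degree in $\mathbb{P}_\bullet(X)$. The differential $d$ is the degree $-1$ derivation for concatenation ($d(xy)=d(x)y+(-1)^{|x|}x\,d(y)$) with $d=0$ on $(\mathrm{id}_a)$ and on $X_1\cup X_1^{-1}$, and, for $k\geq 2$, $$d([i_0,\dots,i_k])=-\sum_{j=1}^{k-1}(-1)^j([i_0,\dots,\widehat{i_j},\dots,i_k])+\sum_{j=1}^{k-1}(-1)^{j}([i_0,\dots,i_j]\,|\,[i_j,\dots,i_k]).$$ **The necklace complex $(\mathbb{L}_\bullet(X),D)$.** $\mathbb{L}_\bullet(X)$ is the free graded $R$-module on necklaces $(\alpha)c$, where $\alpha$ is a basis element of $\mathbb{P}_\bullet(X)$ and $c\in\bigcup_{j\ge0}X_j$ is a simplex (the marked bead), such that $\alpha$ ends at $\mathsf{s}(c)$ and starts at $\mathsf{t}(c)$; its degree is $|\alpha|+|c|$. For arbitrary $\alpha\in\mathbb{P}_\bullet(X)$ with these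 endpoints, $(\alpha)c$ is defined by linearity; $(\alpha|\beta)$ denotes the concatenation of $\alpha,\beta\in\mathbb{P}_\bullet(X)$. The differential is $$D((\alpha)c)=(d\alpha)c+(-1)^{|\alpha|}(\alpha)\widetilde\partial c+(-1)^{|\alpha|}\sum_{|c'|>0}(\alpha|c')c''+\sum_{|c''|>0}(-1)^{|\alpha|+|c'|+1+(|c''|-1)(|\alpha|+|c'|)}(c''|\alpha)c',$$ where the last two sums run over the Alexander–Whitney splittings $c'=[i_0,\dots,i_j]$, $c''=[i_j,\dots,i_k]$, $0\le j\le k$, of $c=[i_0,\dots,i_k]$. **The map $\rho$.** For $k\ge0,\ell\ge1$, $\mathcal{S}^{(\ell)}_k$ is the set of sequences $s=((p_1,q_1),\dots,(p_\ell,q_\ell))$ of pairs of non-negative integers such that $p_1+q_1<p_2+q_2<\dots<p_\ell+q_\ell$; $0=p_1\le p_2\le\dots\le p_\ell\le q_1\le q_2\le\dots\le q_\ell=k$; and $p_2<q_1,\ p_3<q_2,\dots,p_\ell<q_{\ell-1}$. Put $\epsilon(s)=\ell+1+p_\ell+q_1(q_\ell+1)+\sum_{j=2}^\ell p_j(q_j-q_{j-1})$. Then $\rho([i_0])=(\mathrm{id}_{[i_0]})[i_0]$, and for $\sigma=[i_0,\dots,i_k]$, $k>0$, $\rho(\sigma)=\sum_{\ell\ge1}\sum_{s\in\mathcal{S}^{(\ell)}_k}(-1)^{\epsilon(s)}\sigma\llbracket s\rrbracket$ with $$\sigma\llbracket s\rrbracket=\Big([i_{q_1},i_{p_1}]\Big|[i_{p_1},\dots,i_{p_2},i_{q_1},\dots,i_{q_2}]\Big|[i_{q_2},i_{p_2}]\Big|\cdots\Big|[i_{q_{\ell-1}},i_{p_{\ell-1}}]\Big|[i_{p_{\ell-1}},\dots,i_{p_\ell},i_{q_{\ell-1}},\dots,i_{q_\ell}]\Big|[i_{q_\ell},i_{p_\ell}]\Big)[i_{p_\ell},\dots,i_{q_1}],$$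 where $i_{p_r},\dots,i_{p_{r+1}}$ denotes all vertices with indices from $p_r$ to $p_{r+1}$ inclusive, and similarly for the $q$'s and the marked bead. In what follows the vertices of a $k$-simplex are denoted $0<1<\dots<k$ for simplicity. Products in $\mathbb{P}_\bullet(X)\otimes\mathbb{P}_\bullet(X)$ are $(x\otimes y)\cdot(x'\otimes y')=(-1)^{|y||x'|}xx'\otimes yy'$. **The coproduct $\nabla_0$.** $\nabla_0\colon\mathbb{P}_\bullet(X)(a,b)\to\mathbb{P}_\bullet(X)(a,b)\otimes\mathbb{P}_\bullet(X)(a,b)$ is the degree $0$ multiplicative map with $\nabla_0(\mathrm{id}_a)=\mathrm{id}_a\otimes\mathrm{id}_a$, $\nabla_0(\sigma)=(\sigma)\otimes(\sigma)$ for $\sigma\in X_1\cup X_1^{-1}$, and for a $k$-simplex $$\nabla_0([0,\dots,k])=\sum_{i}(-1)^{\epsilon(i)}\big([0,\dots,i_1]|[i_1,\dots,i_2]|\cdots|[i_l,\dots,k]\big)\otimes\big([0,i_1,\dots,i_l,k]\big),$$ the sum over all $l\ge0$ and $i=(i_1<\dots<i_l)$ with $0<i_1$, $i_l<k$ (including the empty sequence), with $\epsilon(i)=\sum_{j=1}^{l+1}(j-1)(i_j-i_{j-1}-1)$, $i_0=0$, $i_{l+1}=k$. **The antipode $S$.** $S\colon\mathbb{P}_\bullet(X)\to\mathbb{P}_\bullet(X)$ is the degree $0$ map sending $\mathbb{P}_\bullet(X)(a,b)$ to $\mathbb{P}_\bullet(X)(b,a)$ with $S(\mathrm{id}_a)=\mathrm{id}_a$,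 $S(xy)=(-1)^{|x||y|}S(y)S(x)$, $S([a,b])=([b,a])$ and $S([b,a])=([a,b])$ for $[a,b]\in X_1$, and, recursively for $k\ge2$, $$S([0,\dots,k])=-\big([k,k-1]|\cdots|[1,0]\big)\cdot\sum_{i\ne(1,\dots,k-1)}(-1)^{\epsilon(i)}\big([0,\dots,i_1]|\cdots|[i_l,\dots,k]\big)\cdot S([0,i_1,\dots,i_l,k]),$$ with $i$ and $\epsilon(i)$ as in $\nabla_0$. Equivalently, $\mu\circ(\mathrm{id}\otimes S)\circ\nabla_0$ vanishes on every simplex of dimension $\ge2$. **The homotopy $\nabla_1$.** $\nabla_1\colon\mathbb{P}_\bullet(X)(a,b)\to\mathbb{P}_\bullet(X)(a,b)\otimes\mathbb{P}_\bullet(X)(a,b)$ is the degree $+1$ map vanishing on $\mathbb{P}_0(X)$, given for $k\ge2$ by $$\nabla_1([0,\dots,k])=\sum_{l=1}^{k-1}\sum_{(i,j)}(-1)^{\epsilon(i,j)}\big([0,i_1,\dots,i_m,l,l+1,\dots,j_1]|[j_1,\dots,j_2]|\cdots|[j_n,\dots,k]\big)\otimes\big([0,\dots,i_1]|[i_1,\dots,i_2]|\cdots|[i_m,\dots,l,j_1,j_2,\dots,j_n,k]\big),$$ the inner sum over all $m,n\ge0$, $i=(0<i_1<\dots<i_m<l)$, $j=(l<j_1<\dots<j_n<k)$. Here $[i_m,\dots,l,j_1,\dots,j_n,k]$ has as vertices all integers from $i_m$ to $l$ together with $j_1,\dots,j_n,k$; and $i_0=0$, $i_{m+1}=l$, $j_0=l$,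 $j_{n+1}=k$ (so for $n=0$ the first factor is $([0,i_1,\dots,i_m,l,l+1,\dots,k])$). The sign is $$\epsilon(i,j)=\sum_{r=1}^{m+1}(r-1)(i_r-i_{r-1}-1)+\sum_{s=1}^{n+1}(s-1)(j_s-j_{s-1}-1)+(m+l)(n+k).$$ It is extended to longer sequences by $\nabla_1(\sigma_1|\cdots|\sigma_p)=\sum_{r=1}^p(-1)^{|\sigma_1|+\dots+|\sigma_{r-1}|-r+1}\nabla_0^{op}(\sigma_1)\cdots\nabla_0^{op}(\sigma_{r-1})\cdot\nabla_1(\sigma_r)\cdot\nabla_0(\sigma_{r+1})\cdots\nabla_0(\sigma_p)$, where $\nabla_0^{op}$ is $\nabla_0$ followed by the Koszul-signed switch $x\otimes y\mapsto(-1)^{|x||y|}y\otimes x$. **The map $\chi$.** $\chi(\sigma)=(\mathrm{id}_\sigma)\sigma$ for $\sigma\in X_0$, and for $\sigma\in X_k$, $k>0$, $$\chi(\sigma)=(-1)^{|(\sigma)^{0,1}|}\big(S((\sigma)^{0,1})\big)\sigma^{0,2}+\big((\sigma)^{1,1}\,|\,S((\sigma)^{1,2})\big)\mathsf{s}(\sigma)+(-1)^{|\sigma'||\sigma''|+|(\sigma')^{0,1}|}\big((\sigma'')^{1,1}\,|\,S((\sigma'')^{1,2})\,|\,S((\sigma')^{0,1})\big)\sigma'^{\,0,2}.$$ Here, for a simplex $\sigma$ of positive dimension, $\nabla_\varepsilon(\sigma)=(\sigma)^{\varepsilon,1}\otimes(\sigma)^{\varepsilon,2}$ (summation and signs implicit),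 $\varepsilon=0,1$. In $\nabla_0(\sigma)$ the second factor is always a single simplex, and one writes $(\sigma)^{0,2}=(\sigma^{0,2})$, with $\sigma^{0,2}$ used as a marked bead. $\sigma'\otimes\sigma''$ stands for the sum over Alexander–Whitney splittings of $\sigma$; in the last term only splittings in which both $\sigma'$ and $\sigma''$ have positive dimension contribute. $|\sigma'|,|\sigma''|$ are dimensions of simplices; $|(\sigma)^{0,1}|$ is the degree in $\mathbb{P}_\bullet(X)$. *)

theory Defs
  imports Complex_Main "HOL-Library.Poly_Mapping"
begin

section \<open>Free modules and linear extension\<close>

text \<open>The free module on a set of symbols is modelled by finitely supported functions
  \<^typ>\<open>'b \<Rightarrow>\<^sub>0 'r\<close>; the tensor product of two free modules is the free module on pairs.\<close>

definition scale :: "'r::comm_ring_1 \<Rightarrow> ('b \<Rightarrow>\<^sub>0 'r) \<Rightarrow> ('b \<Rightarrow>\<^sub>0 'r)" where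
  "scale c x = Poly_Mapping.map ((*) c) x"

definition basis :: "'b \<Rightarrow> ('b \<Rightarrow>\<^sub>0 'r::comm_ring_1)" where
  "basis b = Poly_Mapping.single b 1"

definition lin_ext :: "('b \<Rightarrow> ('c \<Rightarrow>\<^sub>0 'r)) \<Rightarrow> ('b \<Rightarrow>\<^sub>0 'r) \<Rightarrow> ('c \<Rightarrow>\<^sub>0 'r::comm_ring_1)" where
  "lin_ext f x = (\<Sum>b\<in>Poly_Mapping.keys x. scale (Poly_Mapping.lookup x b) (f b))"

definition span_on :: "'b set \<Rightarrow> ('b \<Rightarrow>\<^sub>0 'r::comm_ring_1) set" where
  "span_on B = {x. Poly_Mapping.keys x \<subseteq> B}"

lemma lookup_scale: "Poly_Mapping.lookup (scale c x) b = c * Poly_Mapping.lookup x b"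
  by (simp add: scale_def Poly_Mapping.map.rep_eq when_def)

lemma module_scale: "module (scale :: 'r::comm_ring_1 \<Rightarrow> ('b \<Rightarrow>\<^sub>0 'r) \<Rightarrow> _)"
  by unfold_locales
    (auto intro!: poly_mapping_eqI simp: lookup_scale lookup_add algebra_simps)

section \<open>Chain maps and chain homotopies\<close>

text \<open>A graded module is a family of submodules of a free module; the differential is a map of
  the ambient free module, of degree \<open>-1\<close>.\<close>

definition chain_map ::
  "(nat \<Rightarrow> ('b \<Rightarrow>\<^sub>0 'r) set) \<Rightarrow> (('b \<Rightarrow>\<^sub>0 'r) \<Rightarrow> ('b \<Rightarrow>\<^sub>0 'r)) \<Rightarrow>
   (nat \<Rightarrow> ('c \<Rightarrow>\<^sub>0 'r) set) \<Rightarrow> (('c \<Rightarrow>\<^sub>0 'r) \<Rightarrow> ('c \<Rightarrow>\<^sub>0 'r)) \<Rightarrow>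
   (('b \<Rightarrow>\<^sub>0 'r) \<Rightarrow> ('c \<Rightarrow>\<^sub>0 'r::comm_ring_1)) \<Rightarrow> bool" where
  "chain_map A dA B dB f \<longleftrightarrow>
     module_hom scale scale f \<and>
     (\<forall>n. f ` A n \<subseteq> B n) \<and>
     (\<forall>n. \<forall>x\<in>A n. dB (f x) = f (dA x))"

definition chain_homotopic ::
  "(nat \<Rightarrow> ('b \<Rightarrow>\<^sub>0 'r) set) \<Rightarrow> (('b \<Rightarrow>\<^sub>0 'r) \<Rightarrow> ('b \<Rightarrow>\<^sub>0 'r)) \<Rightarrow>
   (nat \<Rightarrow> ('c \<Rightarrow>\<^sub>0 'r) set) \<Rightarrow> (('c \<Rightarrow>\<^sub>0 'r) \<Rightarrow> ('c \<Rightarrow>\<^sub>0 'r)) \<Rightarrow>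
   (('b \<Rightarrow>\<^sub>0 'r) \<Rightarrow> ('c \<Rightarrow>\<^sub>0 'r)) \<Rightarrow> (('b \<Rightarrow>\<^sub>0 'r) \<Rightarrow> ('c \<Rightarrow>\<^sub>0 'r::comm_ring_1)) \<Rightarrow> bool" where
  "chain_homotopic A dA B dB f g \<longleftrightarrow>
     chain_map A dA B dB f \<and> chain_map A dA B dB g \<and>
     (\<exists>H. module_hom scale scale H \<and>
          (\<forall>n. H ` A n \<subseteq> B (Suc n)) \<and>
          (\<forall>n. \<forall>x\<in>A n. f x - g x = dB (H x) + H (dA x)))"

section \<open>Simplicial complexes with totally ordered vertices\<close>

text \<open>The vertex order is that of the type \<^typ>\<open>'a::linorder\<close>.  The simplex
  \<open>[i\<^sub>0, \<dots>, i\<^sub>k]\<close> is the strictly increasing list of its vertices.\<close>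

definition abstract_simplicial_complex :: "'a set set \<Rightarrow> bool" where
  "abstract_simplicial_complex X \<longleftrightarrow>
     (\<forall>s\<in>X. finite s \<and> s \<noteq> {} \<and> (\<forall>t. t \<subseteq> s \<and> t \<noteq> {} \<longrightarrow> t \<in> X))"

definition simplices :: "'a::linorder set set \<Rightarrow> nat \<Rightarrow> 'a list set" where
  "simplices X k = {c. sorted_wrt (<) c \<and> length c = Suc k \<and> set c \<in> X}"

definition omit :: "nat \<Rightarrow> 'a list \<Rightarrow> 'a list" where
  "omit j c = take j c @ drop (Suc j) c"

text \<open>A list of length \<open>k + 1\<close> has dimension \<open>k\<close>, and its Alexander-Whitney splittings are the
  pairs \<open>(front j c, rear j c)\<close> with \<open>j \<le> k\<close>.\<close>

definition sdim :: "'a list \<Rightarrow> nat" where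
  "sdim c = length c - 1"

definition front :: "nat \<Rightarrow> 'a list \<Rightarrow> 'a list" where
  "front j c = take (Suc j) c"

definition rear :: "nat \<Rightarrow> 'a list \<Rightarrow> 'a list" where
  "rear j c = drop j c"

definition simplicial_chains :: "'a::linorder set set \<Rightarrow> nat \<Rightarrow> ('a list \<Rightarrow>\<^sub>0 'r::comm_ring_1) set" where
  "simplicial_chains X k = span_on (simplices X k)"

definition simplicial_boundary :: "('a list \<Rightarrow>\<^sub>0 'r) \<Rightarrow> ('a list \<Rightarrow>\<^sub>0 'r::comm_ring_1)" where
  "simplicial_boundary =
     lin_ext (\<lambda>c. if sdim c = 0 then 0 else \<Sum>j\<le>sdim c. scale ((-1) ^ j) (basis (omit j c)))"

section \<open>The path complex\<close>

text \<open>A bead is a simplex of positive dimension or the formal inverse \<open>[b, a]\<close> of a 1-simplex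
  \<open>[a, b]\<close>; the latter is the decreasing list \<open>[b, a]\<close>, hence not a simplex.  Source and target
  of a bead are the first and the last entry in both cases.\<close>

definition beads :: "'a::linorder set set \<Rightarrow> 'a list set" where
  "beads X = (\<Union>j\<in>{1..}. simplices X j) \<union> rev ` simplices X 1"

definition inverse_beads :: "'a list \<Rightarrow> 'a list \<Rightarrow> bool" where
  "inverse_beads x y \<longleftrightarrow> length x = 2 \<and> y = rev x"

text \<open>The basis element \<open>(\<sigma>\<^sub>1 | \<dots> | \<sigma>\<^sub>p)\<close> is the pair of its starting vertex and the list of its
  beads, and \<open>id\<^sub>a\<close> is \<open>(a, [])\<close>.  The quotient by the deletion of mutually inverse neighbours is
  represented by the reduced sequences, see \<open>reduce_delete\<close> and \<open>reduced_reduce\<close> below.\<close>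

type_synonym 'a path = "'a \<times> 'a list list"

definition reduced :: "'a list list \<Rightarrow> bool" where
  "reduced ws \<longleftrightarrow> successively (\<lambda>x y. \<not> inverse_beads x y) ws"

fun push :: "'a list \<Rightarrow> 'a list list \<Rightarrow> 'a list list" where
  "push x [] = [x]"
| "push x (y # ws) = (if inverse_beads x y then ws else x # y # ws)"

definition reduce :: "'a list list \<Rightarrow> 'a list list" where
  "reduce ws = foldr push ws []"

lemma reduced_push: "reduced ws \<Longrightarrow> reduced (push x ws)"
  by (cases ws) (auto simp: reduced_def successively_Cons)

lemma reduced_reduce: "reduced (reduce ws)"
proof (induction ws)
  case (Cons x ws)
  then show ?case
    using reduced_push by (simp add: reduce_def)
qed (simp add: reduce_def reduced_def)

lemma reduce_reduced: "reduced ws \<Longrightarrow> reduce ws = ws"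
proof (induction ws)
  case (Cons x ws)
  then show ?case
    by (cases ws) (auto simp: reduced_def reduce_def successively_Cons)
qed (simp add: reduce_def)

lemma reduce_delete:
  assumes "inverse_beads x y"
  shows "reduce (u @ x # y # v) = reduce (u @ v)"
proof -
  have "push x (push y r) = r" if "reduced r" for r
    using that assms
    by (cases r; cases "tl r") (auto simp: inverse_beads_def reduced_def)
  then have "push x (push y (reduce v)) = reduce v"
    using reduced_reduce by blast
  then show ?thesis
    by (simp add: reduce_def)
qed

definition psrc :: "'a path \<Rightarrow> 'a" where
  "psrc p = fst p"

definition ptgt :: "'a path \<Rightarrow> 'a" where
  "ptgt p = (if snd p = [] then fst p else last (last (snd p)))"

definition pdeg :: "'a path \<Rightarrow> nat" where
  "pdeg p = (\<Sum>x\<leftarrow>snd p. sdim x - 1)"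

definition paths :: "'a::linorder set set \<Rightarrow> 'a path set" where
  "paths X = {(a, ws). {a} \<in> X \<and> set ws \<subseteq> beads X \<and> (ws \<noteq> [] \<longrightarrow> hd (hd ws) = a) \<and>
     successively (\<lambda>x y. last x = hd y) ws \<and> reduced ws}"

definition seq :: "'a list list \<Rightarrow> 'a path" where
  "seq ws = (hd (hd ws), ws)"

text \<open>The product \<open>\<mu>\<close>, extended by \<open>0\<close> to non-composable pairs.\<close>

definition pmul :: "('a path \<Rightarrow>\<^sub>0 'r) \<Rightarrow> ('a path \<Rightarrow>\<^sub>0 'r) \<Rightarrow> ('a path \<Rightarrow>\<^sub>0 'r::comm_ring_1)" where
  "pmul x y = lin_ext (\<lambda>p. lin_ext (\<lambda>q.
     if ptgt p = psrc q then basis (psrc p, reduce (snd p @ snd q)) else 0) y) x"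

definition diff_bead :: "'a list \<Rightarrow> ('a path \<Rightarrow>\<^sub>0 'r::comm_ring_1)" where
  "diff_bead x =
     - (\<Sum>j\<in>{1..<sdim x}. scale ((-1) ^ j) (basis (seq [omit j x])))
     + (\<Sum>j\<in>{1..<sdim x}. scale ((-1) ^ j) (basis (seq [front j x, rear j x])))"

fun diff_path :: "'a \<Rightarrow> 'a list list \<Rightarrow> ('a path \<Rightarrow>\<^sub>0 'r::comm_ring_1)" where
  "diff_path a [] = 0"
| "diff_path a (x # ws) =
     pmul (diff_bead x) (basis (last x, ws))
     + scale ((-1) ^ (sdim x - 1)) (pmul (basis (seq [x])) (diff_path (last x) ws))"

section \<open>The necklace complex\<close>

text \<open>The necklace \<open>(\<alpha>)c\<close> is the pair of a basis path \<open>\<alpha>\<close> and the marked bead \<open>c\<close>.\<close>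

type_synonym 'a necklace = "'a path \<times> 'a list"

definition necklaces :: "'a::linorder set set \<Rightarrow> nat \<Rightarrow> 'a necklace set" where
  "necklaces X n = {(p, c). p \<in> paths X \<and> c \<in> (\<Union>j. simplices X j) \<and>
     ptgt p = hd c \<and> psrc p = last c \<and> pdeg p + sdim c = n}"

definition necklace_chains :: "'a::linorder set set \<Rightarrow> nat \<Rightarrow> ('a necklace \<Rightarrow>\<^sub>0 'r::comm_ring_1) set" where
  "necklace_chains X n = span_on (necklaces X n)"

definition neck :: "('a path \<Rightarrow>\<^sub>0 'r) \<Rightarrow> 'a list \<Rightarrow> ('a necklace \<Rightarrow>\<^sub>0 'r::comm_ring_1)" where
  "neck x c = lin_ext (\<lambda>p. basis (p, c)) x"

definition necklace_diff :: "('a necklace \<Rightarrow>\<^sub>0 'r) \<Rightarrow> ('a necklace \<Rightarrow>\<^sub>0 'r::comm_ring_1)" where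
  "necklace_diff = lin_ext (\<lambda>(p, c).
     neck (diff_path (fst p) (snd p)) c
     + scale ((-1) ^ pdeg p) (\<Sum>j\<in>{1..<sdim c}. scale ((-1) ^ j) (basis (p, omit j c)))
     + scale ((-1) ^ pdeg p)
         (\<Sum>j | j \<le> sdim c \<and> sdim (front j c) > 0.
            neck (pmul (basis p) (basis (seq [front j c]))) (rear j c))
     + (\<Sum>j | j \<le> sdim c \<and> sdim (rear j c) > 0.
          scale ((-1) ^ (pdeg p + sdim (front j c) + 1
                         + (sdim (rear j c) - 1) * (pdeg p + sdim (front j c))))
            (neck (pmul (basis (seq [rear j c])) (basis p)) (front j c))))"

section \<open>The map \<open>\<rho>\<close>\<close>

text \<open>The union over \<open>\<ell> \<ge> 1\<close> of the sets \<open>\<S>\<^sub>k\<^bsup>(\<ell>)\<^esup>\<close>; the list index is shifted, so that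
  \<open>s ! r\<close> is \<open>(p\<^bsub>r+1\<^esub>, q\<^bsub>r+1\<^esub>)\<close>.\<close>

definition rho_index :: "nat \<Rightarrow> (nat \<times> nat) list set" where
  "rho_index k = {s. s \<noteq> [] \<and>
     sorted_wrt (<) (map (\<lambda>(p, q). p + q) s) \<and>
     fst (hd s) = 0 \<and> sorted (map fst s) \<and> fst (last s) \<le> snd (hd s) \<and>
     sorted (map snd s) \<and> snd (last s) = k \<and>
     (\<forall>r. Suc r < length s \<longrightarrow> fst (s ! Suc r) < snd (s ! r))}"

lemma finite_rho_index: "finite (rho_index k)"
proof (rule finite_subset)
  show "rho_index k \<subseteq> {s. set s \<subseteq> {..k} \<times> {..k} \<and> length s \<le> card ({..k} \<times> {..k})}"
  proof
    fix s assume s: "s \<in> rho_index k"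
    have le: "xs ! i \<le> last xs" if "sorted xs" "i < length xs" for xs :: "nat list" and i
      using that by (cases "xs = []") (auto simp: last_conv_nth intro!: sorted_nth_mono)
    have sub: "set s \<subseteq> {..k} \<times> {..k}"
    proof
      fix z assume "z \<in> set s"
      then obtain i where i: "i < length s" "z = s ! i"
        by (auto simp: in_set_conv_nth)
      have "fst z \<le> fst (last s)" "snd z \<le> snd (last s)" "snd (hd s) \<le> snd (last s)"
        using le[of "map fst s" i] le[of "map snd s" i] le[of "map snd s" 0] i s
        by (auto simp: rho_index_def last_map hd_conv_nth)
      then show "z \<in> {..k} \<times> {..k}"
        using s by (cases z) (auto simp: rho_index_def)
    qed
    have "distinct (map (\<lambda>(p, q). p + q) s)"
      using s by (simp add: rho_index_def strict_sorted_iff)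
    then have "distinct s"
      by (simp add: distinct_map)
    then have "length s \<le> card ({..k} \<times> {..k})"
      using sub by (metis card_mono distinct_card finite_SigmaI finite_atMost)
    with sub show "s \<in> {s. set s \<subseteq> {..k} \<times> {..k} \<and> length s \<le> card ({..k} \<times> {..k})}"
      by blast
  qed
  show "finite {s. set s \<subseteq> {..k} \<times> {..k} \<and> length s \<le> card ({..k} \<times> {..k})}"
    by (rule finite_lists_length_le) simp
qed

definition rho_sign :: "(nat \<times> nat) list \<Rightarrow> nat" where
  "rho_sign s = length s + 1 + fst (last s) + snd (hd s) * (snd (last s) + 1)
     + (\<Sum>j\<in>{1..<length s}. fst (s ! j) * (snd (s ! j) - snd (s ! (j - 1))))"

text \<open>\<open>pick c js\<close> lists the vertices of \<open>c\<close> at the positions \<open>js\<close>.\<close>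

definition pick :: "'a list \<Rightarrow> nat list \<Rightarrow> 'a list" where
  "pick c js = map ((!) c) js"

fun rho_beads :: "'a list \<Rightarrow> (nat \<times> nat) list \<Rightarrow> 'a list list" where
  "rho_beads c [] = []"
| "rho_beads c [(p, q)] = [pick c [q, p]]"
| "rho_beads c ((p, q) # (p', q') # s) =
     pick c [q, p] # pick c ([p..<Suc p'] @ [q..<Suc q']) # rho_beads c ((p', q') # s)"

definition rho_term :: "'a list \<Rightarrow> (nat \<times> nat) list \<Rightarrow> 'a necklace" where
  "rho_term c s = (seq (rho_beads c s), pick c [fst (last s)..<Suc (snd (hd s))])"

definition rho_map :: "('a list \<Rightarrow>\<^sub>0 'r) \<Rightarrow> ('a necklace \<Rightarrow>\<^sub>0 'r::comm_ring_1)" where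
  "rho_map = lin_ext (\<lambda>c.
     if sdim c = 0 then basis ((hd c, []), c)
     else \<Sum>s\<in>rho_index (sdim c). scale ((-1) ^ rho_sign s) (basis (rho_term c s)))"

section \<open>The operations \<open>\<nabla>\<^sub>0\<close>, \<open>S\<close> and \<open>\<nabla>\<^sub>1\<close>\<close>

definition increasing_between :: "nat \<Rightarrow> nat \<Rightarrow> nat list set" where
  "increasing_between a b = {js. sorted_wrt (<) js \<and> set js \<subseteq> {a<..<b}}"

lemma finite_increasing_between: "finite (increasing_between a b)"
proof (rule finite_subset)
  show "increasing_between a b \<subseteq> {js. set js \<subseteq> {a<..<b} \<and> length js \<le> card {a<..<b}}"
    unfolding increasing_between_def strict_sorted_iff
    by (auto, metis card_mono distinct_card finite_greaterThanLessThan card_greaterThanLessThan)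
  show "finite {js. set js \<subseteq> {a<..<b} \<and> length js \<le> card {a<..<b}}"
    by (rule finite_lists_length_le) simp
qed

text \<open>For \<open>js = (j\<^sub>0 < \<dots> < j\<^sub>n)\<close>: the beads with vertices from position \<open>j\<^sub>r\<close> to position
  \<open>j\<^bsub>r+1\<^esub>\<close>, and the sign exponent \<open>\<Sum>\<^bsub>r\<ge>1\<^esub> (r - 1) (j\<^sub>r - j\<^bsub>r-1\<^esub> - 1)\<close>.\<close>

fun cuts :: "'a list \<Rightarrow> nat list \<Rightarrow> 'a list list" where
  "cuts x (j # j' # js) = pick x [j..<Suc j'] # cuts x (j' # js)"
| "cuts x js = []"

definition cut_sign :: "nat list \<Rightarrow> nat" where
  "cut_sign js = (\<Sum>r<length js - 1. r * (js ! Suc r - js ! r - 1))"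

text \<open>Only the values of \<open>\<nabla>\<^sub>0\<close> and \<open>\<nabla>\<^sub>1\<close> on single simplices enter the definition of \<open>\<chi>\<close>.\<close>

definition nabla0 :: "'a list \<Rightarrow> ('a path \<times> 'a path \<Rightarrow>\<^sub>0 'r::comm_ring_1)" where
  "nabla0 x = (\<Sum>js\<in>increasing_between 0 (sdim x).
     let ps = 0 # js @ [sdim x] in
     scale ((-1) ^ cut_sign ps) (basis (seq (cuts x ps), seq [pick x ps])))"

definition nabla1 :: "'a list \<Rightarrow> ('a path \<times> 'a path \<Rightarrow>\<^sub>0 'r::comm_ring_1)" where
  "nabla1 x = (let k = sdim x in
     \<Sum>l\<in>{1..<k}. \<Sum>ps\<in>increasing_between 0 l. \<Sum>js\<in>increasing_between l k.
       scale ((-1) ^ (cut_sign (0 # ps @ [l]) + cut_sign (l # js @ [k])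
                      + (length ps + l) * (length js + k)))
         (basis
           (seq (pick x (0 # ps @ [l..<Suc (hd (js @ [k]))]) # cuts x (js @ [k])),
            seq (cuts x (0 # ps) @ [pick x ([last (0 # ps)..<Suc l] @ js @ [k])]))))"

text \<open>The antipode on a bead; on a bead of dimension \<open>1\<close>, in either direction, it is the inverse.\<close>

function antipode_bead :: "'a list \<Rightarrow> ('a path \<Rightarrow>\<^sub>0 'r::comm_ring_1)" where
  "antipode_bead x =
     (if sdim x \<le> 1 then basis (seq [rev x])
      else - pmul (basis (seq (map (\<lambda>j. pick x [j, j - 1]) (rev [1..<Suc (sdim x)]))))
               (\<Sum>js\<in>increasing_between 0 (sdim x) - {[1..<sdim x]}.
                  scale ((-1) ^ cut_sign (0 # js @ [sdim x]))
                    (pmul (basis (seq (cuts x (0 # js @ [sdim x]))))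
                       (antipode_bead (pick x (0 # js @ [sdim x]))))))"
  by auto
termination
proof (relation "measure length")
  fix x :: "'a list" and js
  assume x: "\<not> sdim x \<le> 1" and js: "js \<in> increasing_between 0 (sdim x) - {[1..<sdim x]}"
  have sub: "set js \<subseteq> {1..<sdim x}" and dist: "distinct js" and srt: "sorted js"
    using js by (auto simp: increasing_between_def strict_sorted_iff)
  have "set js \<noteq> {1..<sdim x}"
  proof
    assume "set js = {1..<sdim x}"
    then have "js = [1..<sdim x]"
      using dist srt by (intro sorted_distinct_set_unique) auto
    with js show False by simp
  qed
  then have "card (set js) < card {1..<sdim x}"
    using sub by (intro psubset_card_mono) auto
  then have "length js < sdim x - 1"
    using dist by (simp add: distinct_card)
  then show "(pick x (0 # js @ [sdim x]), x) \<in> measure length"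
    using x by (auto simp: pick_def sdim_def)
qed simp

declare antipode_bead.simps [simp del]

fun antipode_path :: "'a \<Rightarrow> 'a list list \<Rightarrow> ('a path \<Rightarrow>\<^sub>0 'r::comm_ring_1)" where
  "antipode_path a [] = basis (a, [])"
| "antipode_path a (x # ws) =
     scale ((-1) ^ ((sdim x - 1) * pdeg (last x, ws)))
       (pmul (antipode_path (last x) ws) (antipode_bead x))"

definition antipode :: "'a path \<Rightarrow> ('a path \<Rightarrow>\<^sub>0 'r::comm_ring_1)" where
  "antipode p = antipode_path (fst p) (snd p)"

section \<open>The map \<open>\<chi>\<close>\<close>

text \<open>The second tensor factor of each term of \<open>nabla0 x\<close> is a single bead; \<open>hd (snd q)\<close> is that
  bead, used as the marked bead.\<close>

definition chi_map :: "('a list \<Rightarrow>\<^sub>0 'r) \<Rightarrow> ('a necklace \<Rightarrow>\<^sub>0 'r::comm_ring_1)" where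
  "chi_map = lin_ext (\<lambda>c.
     if sdim c = 0 then basis ((hd c, []), c)
     else
       lin_ext (\<lambda>(p, q). scale ((-1) ^ pdeg p) (neck (antipode p) (hd (snd q)))) (nabla0 c)
       + lin_ext (\<lambda>(p, q). neck (pmul (basis p) (antipode q)) [hd c]) (nabla1 c)
       + (\<Sum>j | j \<le> sdim c \<and> sdim (front j c) > 0 \<and> sdim (rear j c) > 0.
            lin_ext (\<lambda>(p, q). lin_ext (\<lambda>(u, v).
                scale ((-1) ^ (sdim (front j c) * sdim (rear j c) + pdeg p))
                  (neck (pmul (pmul (basis u) (antipode v)) (antipode p)) (hd (snd q))))
              (nabla1 (rear j c)))
            (nabla0 (front j c))))"

end

theory Submission
  imports Defs
begin

text \<open>Path algebra elements are contracted by a word derivation (a Fox derivative) along a spanning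
  tree of a simplex.  A cycle in the necklace complex of a simplex is zero as soon as its augmentation
  to simplicial chains vanishes and all its coefficients are killed by such contractions.  Since
  \<open>\<rho>\<close> and \<open>\<chi>\<close> both send a simplex to a chain with augmentation that simplex, this reduces the two
  chain map identities to computations modulo the kernels of the contractions, in which most terms
  disappear.  The same contractions show that necklace cycles of a simplex with vanishing augmentation
  are boundaries, and as \<open>\<rho>(\<sigma>)\<close> and \<open>\<chi>(\<sigma>)\<close> are carried by the simplex \<open>\<sigma>\<close>, a homotopy can be
  built degree by degree.\<close>

section \<open>Linear maps of free modules\<close>

text \<open>That \<open>\<rho>\<close> and \<open>\<chi>\<close> are chain maps is part of the
  conclusion, and it is the costly part: their signs and index sets resist a term-by-term
  comparison. The vanishing criterion copes with this because the base vertex of the contraction may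
  be chosen separately for every marked bead. For \<open>\<rho>\<close> the first vertex always
  works: each word opens with an edge into it, followed by a bead leaving it. For
  \<open>\<chi>\<close> the base is the last vertex of the marked bead, where the word starts: words
  with a \<open>\<nabla>\<^sub>1\<close> factor open with a bead of dimension at least 2 leaving the
  base, the other words are antipodes of blocks of consecutive vertices ending there. The tree is
  shaped for both: the star from the base to later vertices kills simplices leaving the base, and
  the line through the earlier vertices kills simplices on consecutive vertices up to the base. Tree
  paths consist of edges and are invertible, so multiplying by them loses nothing. To have an honest
  ring, paths are replaced by reduced words without endpoints, all of whose products are defined;
  the ends are tracked by membership in submodules.\<close>

definition lin :: "(('b \<Rightarrow>\<^sub>0 'r::comm_ring_1) \<Rightarrow> ('c \<Rightarrow>\<^sub>0 'r)) \<Rightarrow> bool" where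
  "lin f \<longleftrightarrow> (\<forall>x y. f (x + y) = f x + f y) \<and> (\<forall>c x. f (scale c x) = scale c (f x))"

lemma linI:
  "(\<And>x y. f (x + y) = f x + f y) \<Longrightarrow> (\<And>c x. f (scale c x) = scale c (f x)) \<Longrightarrow> lin f"
  by (simp add: lin_def)

lemma lin_add: "lin f \<Longrightarrow> f (x + y) = f x + f y"
  and lin_scale: "lin f \<Longrightarrow> f (scale c x) = scale c (f x)"
  by (simp_all add: lin_def)

lemma scale_add [simp]: "scale c (x + y) = scale c x + scale c y"
  and scale_add_left: "scale (a + b) x = scale a x + scale b x"
  and scale_scale [simp]: "scale a (scale b x) = scale (a * b) x"
  and scale_one [simp]: "scale 1 x = x"
  and scale_zero_left [simp]: "scale 0 x = 0"
  and scale_zero [simp]: "scale c 0 = 0"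
  and scale_minus [simp]: "scale c (- x) = - scale c x"
  and scale_minus_left [simp]: "scale (- c) x = - scale c x"
  and scale_diff [simp]: "scale c (x - y) = scale c x - scale c y"
  by (auto intro!: poly_mapping_eqI simp: lookup_scale lookup_add lookup_minus algebra_simps)

lemma scale_sum: "scale c (sum f I) = (\<Sum>i\<in>I. scale c (f i))"
  by (induction I rule: infinite_finite_induct) auto

lemma lin_module_hom: "lin f \<longleftrightarrow> module_hom scale scale f"
  unfolding lin_def module_hom_def module_hom_axioms_def by (auto simp: module_scale)

lemma lin_zero: "lin f \<Longrightarrow> f 0 = 0"
  using lin_add[of f 0 0] by simp

lemma lin_minus: "lin f \<Longrightarrow> f (- x) = - f x"
  using lin_add[of f x "- x"] lin_zero[of f] by (simp add: add_eq_0_iff)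

lemma lin_diff: "lin f \<Longrightarrow> f (x - y) = f x - f y"
  using lin_add[of f x "- y"] lin_minus[of f y] by simp

lemma lin_sum: "lin f \<Longrightarrow> f (sum g I) = (\<Sum>i\<in>I. f (g i))"
  by (induction I rule: infinite_finite_induct) (auto simp: lin_zero lin_add)

lemmas lin_simps = lin_zero lin_add lin_minus lin_diff lin_scale lin_sum

lemma lin_id: "lin (\<lambda>x. x)"
  and lin_const0: "lin (\<lambda>x. 0)"
  and lin_plus: "lin f \<Longrightarrow> lin g \<Longrightarrow> lin (\<lambda>x. f x + g x)"
  and lin_uminus: "lin f \<Longrightarrow> lin (\<lambda>x. - f x)"
  and lin_sub: "lin f \<Longrightarrow> lin g \<Longrightarrow> lin (\<lambda>x. f x - g x)"
  and lin_scaled: "lin f \<Longrightarrow> lin (\<lambda>x. scale c (f x))"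
  by (auto simp: lin_def mult.commute)

lemma lin_compose: "lin f \<Longrightarrow> lin g \<Longrightarrow> lin (\<lambda>x. f (g x))"
  by (simp add: lin_def)

lemma lin_sums: "(\<And>i. i \<in> I \<Longrightarrow> lin (f i)) \<Longrightarrow> lin (\<lambda>x. \<Sum>i\<in>I. f i x)"
  by (auto simp: lin_def sum.distrib scale_sum)

text \<open>The supports of \<open>x + y\<close> and \<open>scale c x\<close> may shrink through
  cancellation; summing over one common finite set makes the sums comparable.\<close>

lemma lin_ext_superset:
  assumes "finite S" "Poly_Mapping.keys x \<subseteq> S"
  shows "lin_ext f x = (\<Sum>b\<in>S. scale (Poly_Mapping.lookup x b) (f b))"
  unfolding lin_ext_def using assms
  by (intro sum.mono_neutral_left) (auto simp: in_keys_iff)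

lemma lin_lin_ext: "lin (lin_ext f)"
proof (rule linI)
  fix x y :: "'a \<Rightarrow>\<^sub>0 'b" and c
  let ?S = "Poly_Mapping.keys x \<union> Poly_Mapping.keys y"
  show "lin_ext f (x + y) = lin_ext f x + lin_ext f y"
    by (subst (1 2 3) lin_ext_superset[of ?S])
      (use keys_add[of x y] in \<open>auto simp: lookup_add scale_add_left sum.distrib\<close>)
  have "Poly_Mapping.keys (scale c x) \<subseteq> ?S"
    by (auto simp: in_keys_iff lookup_scale)
  then show "lin_ext f (scale c x) = scale c (lin_ext f x)"
    by (subst (1 2) lin_ext_superset[of ?S]) (auto simp: lookup_scale scale_sum)
qed

lemma lin_ext_basis [simp]: "lin_ext f (basis b) = f b"
  by (subst lin_ext_superset[of "{b}"]) (auto simp: basis_def)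

lemma scale_basis: "scale v (basis k) = Poly_Mapping.single k v"
  by (auto intro!: poly_mapping_eqI simp: lookup_scale basis_def lookup_single when_def)

lemma chain_expand: "x = (\<Sum>b\<in>Poly_Mapping.keys x. scale (Poly_Mapping.lookup x b) (basis b))"
  by (auto intro!: poly_mapping_eqI simp: lookup_sum lookup_scale basis_def lookup_single when_def
      sum.delta in_keys_iff if_distrib cong: if_cong)

lemma span_on_induct [consumes 1, case_names zero add basis]:
  assumes "x \<in> span_on B" "P 0" "\<And>x y. x \<in> span_on B \<Longrightarrow> y \<in> span_on B \<Longrightarrow> P x \<Longrightarrow> P y \<Longrightarrow> P (x + y)"
    "\<And>b c. b \<in> B \<Longrightarrow> P (scale c (basis b))"
  shows "P x"
proof -
  have "S \<subseteq> B \<Longrightarrow> finite S \<Longrightarrow> (\<Sum>b\<in>S. scale (Poly_Mapping.lookup x b) (basis b)) \<in> span_on B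
     \<and> P (\<Sum>b\<in>S. scale (Poly_Mapping.lookup x b) (basis b))" for S
  proof (induction S rule: infinite_finite_induct)
    case (insert b S)
    let ?u = "scale (Poly_Mapping.lookup x b) (basis b)"
    let ?v = "(\<Sum>b\<in>S. scale (Poly_Mapping.lookup x b) (basis b))"
    have u: "?u \<in> span_on B" "P ?u"
      using insert by (auto simp: span_on_def scale_basis assms(4)[unfolded scale_basis])
    have "?u + ?v \<in> span_on B"
      using u insert keys_add[of ?u ?v] by (auto simp: span_on_def)
    with u insert assms(3)[of ?u ?v] show ?case by simp
  qed (use assms in \<open>auto simp: span_on_def\<close>)
  from this[of "Poly_Mapping.keys x"] assms(1) show ?thesis
    by (simp add: chain_expand[symmetric] span_on_def)
qed

lemma span_on_zero [simp]: "0 \<in> span_on B"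
  and span_on_add: "x \<in> span_on B \<Longrightarrow> y \<in> span_on B \<Longrightarrow> x + y \<in> span_on B"
  and span_on_uminus: "x \<in> span_on B \<Longrightarrow> - x \<in> span_on B"
  using keys_add[of x y] by (auto simp: span_on_def in_keys_iff)

lemma span_on_scale: "x \<in> span_on B \<Longrightarrow> scale c x \<in> span_on B"
  by (auto simp: span_on_def in_keys_iff lookup_scale subset_iff) (metis mult_zero_right)

lemma span_on_diff: "x \<in> span_on B \<Longrightarrow> y \<in> span_on B \<Longrightarrow> x - y \<in> span_on B"
  using span_on_add[of x B "- y"] span_on_uminus[of y B] by simp

lemma span_on_basis: "b \<in> B \<Longrightarrow> basis b \<in> span_on B"
  by (auto simp: span_on_def basis_def split: if_splits)

lemma span_on_sum: "(\<And>i. i \<in> I \<Longrightarrow> f i \<in> span_on B) \<Longrightarrow> sum f I \<in> span_on B"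
  by (induction I rule: infinite_finite_induct) (auto intro: span_on_add)

lemma span_on_mono: "x \<in> span_on B \<Longrightarrow> B \<subseteq> C \<Longrightarrow> x \<in> span_on C"
  by (auto simp: span_on_def)

lemma span_on_UNIV [simp]: "x \<in> span_on UNIV"
  by (simp add: span_on_def)

lemma lin_eq_on:
  assumes "x \<in> span_on B" "lin f" "lin g" "\<And>b. b \<in> B \<Longrightarrow> f (basis b) = g (basis b)"
  shows "f x = g x"
  using assms(1) by (induction rule: span_on_induct) (auto simp: assms lin_simps)

lemma lin_eq: "lin f \<Longrightarrow> lin g \<Longrightarrow> (\<And>b. f (basis b) = g (basis b)) \<Longrightarrow> f x = g x"
  using lin_eq_on[of x UNIV f g] by simp

lemma lin_span_on:
  assumes "x \<in> span_on B" "lin f" "\<And>b. b \<in> B \<Longrightarrow> f (basis b) \<in> span_on C"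
  shows "f x \<in> span_on C"
  using assms(1)
  by (induction rule: span_on_induct) (auto simp: assms lin_simps intro: span_on_add span_on_scale)

section \<open>Signs\<close>

text \<open>Signs act on an arbitrary abelian group, so the same notation serves chains, necklaces
  and word algebras, and exponents count only by parity (\<open>sg_cong\<close>,
  \<open>sg_minus_cong\<close>).\<close>

definition sg :: "nat \<Rightarrow> 'm::ab_group_add \<Rightarrow> 'm" where
  "sg n x = (if even n then x else - x)"

lemma sg_0 [simp]: "sg 0 x = x"
  and sg_Suc [simp]: "sg (Suc n) x = - sg n x"
  and sg_sg [simp]: "sg n (sg m x) = sg (n + m) x"
  and sg_zero [simp]: "sg n 0 = 0"
  and sg_add: "sg n (x + y) = sg n x + sg n y"
  and sg_uminus: "sg n (- x) = - sg n x"
  and sg_diff: "sg n (x - y) = sg n x - sg n y"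
  by (auto simp: sg_def)

lemma sg_sum: "sg n (sum f I) = (\<Sum>i\<in>I. sg n (f i))"
  by (auto simp: sg_def sum_negf)

lemma sg_mult_left [simp]: "sg n (x::'m::ring) * y = sg n (x * y)"
  and sg_mult_right [simp]: "x * sg n (y::'m::ring) = sg n (x * y)"
  by (auto simp: sg_def)

lemma sg_cong: "even n = even m \<Longrightarrow> x = y \<Longrightarrow> sg n x = sg m y"
  by (simp add: sg_def)

lemma sg_minus_cong: "even n \<noteq> even m \<Longrightarrow> x = y \<Longrightarrow> sg n x = - sg m y"
  by (auto simp: sg_def)

lemma scale_sign: "scale ((-1) ^ n) x = sg n x"
  by (simp add: sg_def)

lemma lin_sg: "lin f \<Longrightarrow> f (sg n x) = sg n (f x)"
  by (simp add: sg_def lin_minus)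

lemma lin_sg': "lin f \<Longrightarrow> lin (\<lambda>x. sg n (f x))"
  by (auto simp: lin_def sg_def)

lemma scale_sg: "scale c (sg n x) = sg n (scale c x)"
  by (simp add: sg_def)

lemma span_on_sg: "x \<in> span_on B \<Longrightarrow> sg n x \<in> span_on B"
  by (simp add: sg_def span_on_uminus)

section \<open>The monoid of reduced words and its algebra\<close>

lemma push_push:
  assumes "reduced r" "inverse_beads x y"
  shows "push x (push y r) = r"
  using assms by (cases r; cases "tl r") (auto simp: inverse_beads_def reduced_def)

lemma reduced_foldr_push: "reduced r \<Longrightarrow> reduced (foldr push u r)"
  by (induction u) (auto intro: reduced_push)

text \<open>If \<open>x\<close> cancels the head of \<open>w\<close>, pushing that head and then
  \<open>x\<close> onto a reduced word gives the word back, so it is irrelevant whether the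
  cancellation is done beforehand. Associativity of reduced concatenation rests on this.\<close>

lemma foldr_push_push:
  assumes "reduced r"
  shows "foldr push (push x w) r = push x (foldr push w r)"
proof (cases w)
  case (Cons y ws)
  then show ?thesis
    using push_push[of "foldr push ws r" x y] reduced_foldr_push[OF assms] by auto
qed simp

lemma foldr_push_reduce: "reduced r \<Longrightarrow> foldr push (reduce u) r = foldr push u r"
  by (induction u) (auto simp: reduce_def foldr_push_push)

lemma reduce_append_left: "reduce (reduce u @ v) = reduce (u @ v)"
  using foldr_push_reduce[of "reduce v" u] reduced_reduce[of v] by (simp add: reduce_def)

lemma reduce_append_right: "reduce (u @ reduce v) = reduce (u @ v)"
proof -
  have "foldr push (reduce v) [] = reduce v"
    using reduce_reduced[OF reduced_reduce] unfolding reduce_def .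
  then show ?thesis by (simp add: reduce_def)
qed

text \<open>Words carry no endpoints, so every product is defined and they form a monoid. It is
  written additively because convolution of finitely supported functions is taken over an additive
  monoid; chains on words thereby become a ring.\<close>

typedef 'a rword = "{ws :: 'a list list. reduced ws}"
  morphisms wbeads Abs_rword
  by (rule exI[of _ "[]"]) (simp add: reduced_def)

definition word :: "'a list list \<Rightarrow> 'a rword" where
  "word ws = Abs_rword (reduce ws)"

lemma wbeads_word: "wbeads (word ws) = reduce ws"
  by (simp add: word_def Abs_rword_inverse reduced_reduce)

lemma reduced_wbeads [simp]: "reduced (wbeads w)"
  using wbeads by blast

lemma word_wbeads [simp]: "word (wbeads w) = w"
  by (simp add: word_def reduce_reduced wbeads_inverse)

instantiation rword :: (type) monoid_add
begin

definition zero_rword :: "'a rword" where "zero_rword = word []"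

definition plus_rword :: "'a rword \<Rightarrow> 'a rword \<Rightarrow> 'a rword" where
  "plus_rword u v = word (wbeads u @ wbeads v)"

instance
proof
  fix a b c :: "'a rword"
  show "a + b + c = a + (b + c)"
    by (simp add: plus_rword_def word_def Abs_rword_inverse reduced_reduce
        reduce_append_left reduce_append_right)
  have "wbeads (word []) = ([] :: 'a list list)"
    by (simp add: wbeads_word reduce_def)
  then show "0 + a = a" "a + 0 = a"
    by (simp_all add: zero_rword_def plus_rword_def)
qed

end

lemma word_Nil: "word [] = 0"
  by (simp add: zero_rword_def)

lemma word_append: "word (u @ v) = word u + word v"
  by (simp add: plus_rword_def word_def Abs_rword_inverse reduced_reduce
      reduce_append_left reduce_append_right)

lemma word_Cons: "word (x # ws) = word [x] + word ws"
  using word_append[of "[x]" ws] by simp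

type_synonym ('a, 'r) walg = "'a rword \<Rightarrow>\<^sub>0 'r"

definition wd :: "'a list list \<Rightarrow> ('a, 'r::comm_ring_1) walg" where
  "wd ws = basis (word ws)"

abbreviation bd :: "'a list \<Rightarrow> ('a, 'r::comm_ring_1) walg" where
  "bd x \<equiv> wd [x]"

lemma basis_mult: "basis u * basis v = (basis (u + v) :: 'a::monoid_add \<Rightarrow>\<^sub>0 'r::comm_ring_1)"
  by (simp add: basis_def mult_single)

lemma wd_Nil [simp]: "wd [] = 1"
  by (simp add: wd_def word_Nil basis_def)

lemma wd_append: "wd (u @ v) = wd u * wd v"
  by (simp add: wd_def basis_mult word_append)

lemma wd_Cons: "wd (x # ws) = bd x * wd ws"
  using wd_append[of "[x]" ws] by simp

lemma basis_wbeads: "basis w = wd (wbeads w)"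
  by (simp add: wd_def)

lemma bd_inverse:
  assumes "length x = 2"
  shows "bd x * bd (rev x) = (1 :: ('a, 'r::comm_ring_1) walg)"
proof -
  have "word [x, rev x] = word []"
    using assms reduce_delete[of x "rev x" "[]" "[]"] by (simp add: word_def inverse_beads_def)
  then have "wd [x, rev x] = (wd [] :: ('a, 'r) walg)"
    by (simp add: wd_def)
  then show ?thesis
    by (simp add: wd_Cons[of x "[rev x]"])
qed

lemma bd_inverse2: "bd [a, b] * bd [b, a] = 1"
  using bd_inverse[of "[a, b]"] by simp

lemma bd_inverse3 [simp]: "bd [a, b] * (bd [b, a] * x) = x"
  by (simp add: mult.assoc[symmetric] bd_inverse2)

lemma scale_mult: "scale c x = Poly_Mapping.single 0 c * (x :: 'a::monoid_add \<Rightarrow>\<^sub>0 'r::comm_ring_1)"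
  by (simp add: scale_def mult_map_scale_conv_mult)

lemma scale_mult_left: "scale c x * y = scale c (x * (y :: 'a::monoid_add \<Rightarrow>\<^sub>0 'r::comm_ring_1))"
  by (simp add: scale_mult mult.assoc)

text \<open>Scalars sit at the neutral word and are central although the monoid of words is not
  commutative; it suffices to check this on single words.\<close>

lemma scale_mult_right: "x * scale c y = scale c (x * (y :: 'a::monoid_add \<Rightarrow>\<^sub>0 'r::comm_ring_1))"
proof -
  have "x * Poly_Mapping.single 0 c = scale c x"
    using span_on_UNIV[of x]
    by (induction rule: span_on_induct)
      (auto simp: scale_basis mult_single algebra_simps, simp add: scale_mult mult_single mult.commute)
  then show ?thesis
    by (simp add: scale_mult mult.assoc[symmetric])
qed

lemma lin_mult_left: "lin f \<Longrightarrow> lin (\<lambda>x. f x * (y :: 'a::monoid_add \<Rightarrow>\<^sub>0 'r::comm_ring_1))"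
  and lin_mult_right: "lin f \<Longrightarrow> lin (\<lambda>x. (y :: 'a::monoid_add \<Rightarrow>\<^sub>0 'r::comm_ring_1) * f x)"
  by (auto simp: lin_def scale_mult_left scale_mult_right algebra_simps)

lemma lin_ext_lin: "lin f \<Longrightarrow> lin (\<lambda>x. lin_ext g (f x))"
  by (rule lin_compose[OF lin_lin_ext])

lemmas lin_intros = lin_id lin_const0 lin_plus lin_uminus lin_sub lin_scaled lin_sums lin_sg'
  lin_mult_left lin_mult_right lin_ext_lin

definition wdeg :: "'a rword \<Rightarrow> nat" where
  "wdeg w = (\<Sum>x\<leftarrow>wbeads w. sdim x - 1)"

text \<open>Cancelling neighbours are lists of length 2 and contribute degree 0, so reduction
  preserves the degree.\<close>

lemma sum_push: "(\<Sum>y\<leftarrow>push x ws. sdim y - 1) = (sdim x - 1) + (\<Sum>y\<leftarrow>ws. sdim y - 1)"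
  by (cases ws) (auto simp: inverse_beads_def sdim_def)

lemma wdeg_word: "wdeg (word ws) = (\<Sum>x\<leftarrow>ws. sdim x - 1)"
  unfolding wdeg_def wbeads_word
  by (induction ws) (auto simp: reduce_def sum_push simp del: One_nat_def)

lemma wdeg_plus: "wdeg (u + v) = wdeg u + wdeg v"
  unfolding plus_rword_def wdeg_word by (simp add: wdeg_def)

lemma wdeg_0 [simp]: "wdeg 0 = 0"
  by (simp add: word_Nil[symmetric] wdeg_word)

lemma wd_reduce: "wd (reduce u) = wd u"
  by (simp add: wd_def word_def reduce_reduced reduced_reduce)

text \<open>Fox calculus: a derivation with D(uv) = D(u) v + \<open>lam\<close>(u) D(v) and
  prescribed values \<open>g\<close> on beads. The condition \<open>cancel\<close> says that D
  vanishes on a bead followed by its formal inverse, which is what is needed to pass from sequences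
  to reduced words. With \<open>lam\<close> the signed word one obtains the differential, with
  \<open>lam\<close> the augmentation the contractions.\<close>

locale fox =
  fixes lam :: "'a rword \<Rightarrow> ('a, 'r::comm_ring_1) walg" and g :: "'a list \<Rightarrow> ('a, 'r) walg"
  assumes lam_0: "lam 0 = 1" and lam_plus: "lam (u + v) = lam u * lam v"
    and cancel: "length x = 2 \<Longrightarrow> g x * bd (rev x) + lam (word [x]) * g (rev x) = 0"
begin

fun foxw :: "'a list list \<Rightarrow> ('a, 'r) walg" where
  "foxw [] = 0"
| "foxw (x # ws) = g x * wd ws + lam (word [x]) * foxw ws"

definition der :: "('a, 'r) walg \<Rightarrow> ('a, 'r) walg" where
  "der = lin_ext (\<lambda>w. foxw (wbeads w))"

lemma foxw_push: "foxw (push x ws) = foxw (x # ws)"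
proof (cases ws)
  case (Cons y vs)
  show ?thesis
  proof (cases "inverse_beads x y")
    case True
    then have y: "y = rev x" "length x = 2" by (auto simp: inverse_beads_def)
    have 1: "lam (word [x]) * lam (word [y]) = 1"
      using lam_plus[of "word [x]" "word [y]"] word_append[of "[x]" "[y]"] True
        reduce_delete[of x y "[]" "[]"] lam_0 by (simp add: word_def zero_rword_def)
    have "foxw (x # ws) = (g x * bd y + lam (word [x]) * g y) * wd vs
        + (lam (word [x]) * lam (word [y])) * foxw vs"
      by (simp add: Cons wd_Cons[of y vs] algebra_simps)
    also have "\<dots> = foxw vs" using cancel[OF y(2)] y(1) 1 by simp
    finally show ?thesis using True Cons by simp
  qed (simp add: Cons)
qed simp

lemma foxw_reduce: "foxw (reduce ws) = foxw ws"
proof (induction ws)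
  case (Cons x ws)
  have "foxw (reduce (x # ws)) = foxw (push x (reduce ws))"
    by (simp add: reduce_def)
  also have "\<dots> = foxw (x # ws)"
    unfolding foxw_push by (simp add: Cons wd_reduce)
  finally show ?case .
qed (simp add: reduce_def)

lemma foxw_append: "foxw (u @ v) = foxw u * wd v + lam (word u) * foxw v"
proof (induction u)
  case (Cons x u)
  then show ?case
    by (simp add: wd_append algebra_simps word_Cons[of x u] lam_plus)
qed (simp add: word_Nil lam_0)

lemma lin_der: "lin der"
  by (simp add: der_def lin_lin_ext)

lemma der_wd: "der (wd ws) = foxw ws"
  by (simp add: der_def wd_def wbeads_word foxw_reduce)

lemma der_bd: "der (bd x) = g x"
  by (simp add: der_wd)

lemma der_1: "der 1 = 0"
  using der_wd[of "[]"] by simp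

lemma der_mult: "der (x * y) = der x * y + lin_ext lam x * der y"
proof -
  have b: "der (wd u * wd v) = der (wd u) * wd v + lin_ext lam (wd u) * der (wd v)" for u v
    by (simp add: wd_append[symmetric] der_wd foxw_append) (simp add: wd_def)
  have l: "lin der" "lin (lin_ext lam)" by (auto simp: lin_der lin_lin_ext)
  have "der (basis u * y) = der (basis u) * y + lin_ext lam (basis u) * der y" for u
    using lin_eq[of "\<lambda>y. der (basis u * y)" "\<lambda>y. der (basis u) * y + lin_ext lam (basis u) * der y" y]
    by (simp add: lin_intros lin_der lin_compose[OF lin_der] b[folded basis_wbeads] basis_wbeads b)
  then show ?thesis
    using lin_eq[of "\<lambda>x. der (x * y)" "\<lambda>x. der x * y + lin_ext lam x * der y" x]
    by (simp add: lin_intros lin_der lin_compose[OF lin_der])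
qed

end

lemma lin_ext_hom:
  assumes "\<And>u v. f (u + v) = f u * f v"
  shows "lin_ext f (x * y) = lin_ext f x * (lin_ext f y :: ('b::monoid_add \<Rightarrow>\<^sub>0 'r::comm_ring_1))"
proof -
  have "lin_ext f (basis u * y) = f u * lin_ext f y" for u
    using lin_eq[of "\<lambda>y. lin_ext f (basis u * y)" "\<lambda>y. f u * lin_ext f y" y]
    by (simp add: lin_intros basis_mult assms)
  then show ?thesis
    using lin_eq[of "\<lambda>x. lin_ext f (x * y)" "\<lambda>x. lin_ext f x * lin_ext f y" x]
    by (simp add: lin_intros)
qed

text \<open>The degree involution. Written with it instead of a sign, the Leibniz rule for the
  differential holds for inhomogeneous elements too.\<close>

definition tau :: "('a, 'r::comm_ring_1) walg \<Rightarrow> ('a, 'r) walg" where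
  "tau = lin_ext (\<lambda>w. sg (wdeg w) (basis w))"

text \<open>The augmentation of the path algebra, an algebra map to the scalars. It takes its values
  in the word algebra itself so that it can stand as a factor in a Leibniz rule.\<close>

definition aug :: "('a, 'r::comm_ring_1) walg \<Rightarrow> ('a, 'r) walg" where
  "aug = lin_ext (\<lambda>w. if wdeg w = 0 then 1 else 0)"

lemma lin_tau: "lin tau" and lin_aug: "lin aug"
  by (auto simp: tau_def aug_def lin_lin_ext)

lemma tau_mult: "tau (x * y) = tau x * tau y"
  unfolding tau_def by (rule lin_ext_hom) (auto simp: basis_mult wdeg_plus ac_simps)

lemma aug_mult: "aug (x * y) = aug x * aug y"
  unfolding aug_def by (rule lin_ext_hom) (auto simp: wdeg_plus)

lemma basis_0: "basis 0 = 1"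
  by (simp add: basis_def)

lemma tau_1: "tau 1 = 1" and aug_1: "aug 1 = 1"
  by (simp_all add: tau_def aug_def basis_0[symmetric])

lemma tau_bd: "tau (bd x) = sg (sdim x - 1) (bd x)"
  by (simp add: tau_def wd_def wdeg_word)

lemma aug_bd: "aug (bd x) = (if sdim x \<le> 1 then 1 else 0)"
  by (auto simp: aug_def wd_def wdeg_word)

lemma tau_tau: "tau (tau x) = x"
proof (rule lin_eq[of "\<lambda>x. tau (tau x)" "\<lambda>x. x"])
  show "tau (tau (basis b)) = (basis b :: ('a, 'b) walg)" for b :: "'a rword"
    by (simp add: tau_def lin_sg[OF lin_lin_ext]) (simp add: sg_def)
qed (simp_all add: lin_id lin_compose lin_tau)

declare One_nat_def [simp del]

section \<open>The differential of the path algebra\<close>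

text \<open>The face and the cut at each interior vertex are put under a common sign. For an edge
  and for a formal inverse the sum is empty, as the differential requires.\<close>

definition dbd :: "'a list \<Rightarrow> ('a, 'r::comm_ring_1) walg" where
  "dbd x = (\<Sum>j\<in>{1..<sdim x}. sg j (bd (front j x) * bd (rear j x) - bd (omit j x)))"

interpretation pdf: fox "\<lambda>w. sg (wdeg w) (basis w)" dbd
  by unfold_locales (auto simp: basis_0 wdeg_plus basis_mult dbd_def sdim_def ac_simps)

definition pd :: "('a, 'r::comm_ring_1) walg \<Rightarrow> ('a, 'r) walg" where
  "pd = pdf.der"

lemma lin_pd: "lin pd"
  by (simp add: pd_def pdf.lin_der)

lemma pd_mult: "pd (x * y) = pd x * y + tau x * pd y"
  by (simp add: pd_def pdf.der_mult tau_def)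

lemma pd_bd: "pd (bd x) = dbd x"
  by (simp add: pd_def pdf.der_bd)

lemma pd_1 [simp]: "pd 1 = 0"
  by (simp add: pd_def pdf.der_1)

lemmas pd_lin = lin_simps[OF lin_pd]

lemma pd_bd_edge: "sdim x \<le> 1 \<Longrightarrow> pd (bd x) = 0"
  by (simp add: pd_bd dbd_def)

lemma walg_induct [case_names zero add scaled one bead]:
  assumes "P 0" "\<And>x y. P x \<Longrightarrow> P y \<Longrightarrow> P (x + y)" "\<And>c x. P x \<Longrightarrow> P (scale c x)"
    "P 1" "\<And>x y. P y \<Longrightarrow> P (bd x * y)"
  shows "P (x :: ('a, 'r::comm_ring_1) walg)"
proof -
  have "P (wd ws)" for ws
    by (induction ws) (simp_all add: assms(4), subst wd_Cons, rule assms(5))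
  note wd = this
  show ?thesis
    using span_on_UNIV[of x]
    by (induction rule: span_on_induct) (auto simp: assms basis_wbeads wd)
qed

text \<open>In dimension 2 the cut and the face both have augmentation 1 and cancel; in higher
  dimensions every summand contains a bead of dimension at least 2.\<close>

lemma aug_dbd: "aug (dbd x) = (0 :: ('a, 'r::comm_ring_1) walg)"
proof -
  have *: "aug (bd (front j x) * bd (rear j x) - bd (omit j x)) = (0 :: ('a, 'r) walg)" if "j \<in> {1..<sdim x}" for j
    using that by (auto simp: lin_diff[OF lin_aug] aug_mult aug_bd sdim_def front_def rear_def omit_def)
  then show ?thesis
    unfolding dbd_def lin_sum[OF lin_aug] lin_sg[OF lin_aug] by (intro sum.neutral ballI) (simp add: *)
qed

lemma aug_pd: "aug (pd x) = 0"
  by (induction x rule: walg_induct)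
    (simp_all add: pd_lin pd_mult pd_bd aug_dbd aug_mult lin_simps[OF lin_aug])

lemma tau_dbd: "tau (dbd x) = - sg (sdim x - 1) (dbd x :: ('a, 'r::comm_ring_1) walg)"
proof -
  have "tau (sg j (bd (front j x) * bd (rear j x) - bd (omit j x)) :: ('a, 'r) walg)
      = - sg (sdim x - 1) (sg j (bd (front j x) * bd (rear j x) - bd (omit j x)))"
    if "j \<in> {1..<sdim x}" for j
    using that
    by (auto simp: lin_sg[OF lin_tau] lin_diff[OF lin_tau] tau_mult tau_bd sdim_def front_def
        rear_def omit_def sg_def)
  then show ?thesis
    unfolding dbd_def lin_sum[OF lin_tau] sg_sum sum_negf[symmetric] by (rule sum.cong[OF refl])
qed

lemma tau_pd: "tau (pd x) = - pd (tau x)"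
  by (induction x rule: walg_induct)
    (simp_all add: pd_lin pd_mult pd_bd tau_dbd tau_mult lin_simps[OF lin_tau] tau_bd tau_1
      lin_sg[OF lin_pd] lin_sg[OF lin_tau] sg_uminus sg_add algebra_simps)

section \<open>Words with prescribed ends\<close>

text \<open>Supplies the ends that words have lost. The set \<open>B\<close> of admissible beads
  varies: those of a complex, the faces of one simplex, or a single bead.\<close>

fun wpath :: "'a list set \<Rightarrow> 'a \<Rightarrow> 'a list list \<Rightarrow> 'a \<Rightarrow> bool" where
  "wpath B a [] b \<longleftrightarrow> a = b"
| "wpath B a (x # ws) b \<longleftrightarrow> x \<in> B \<and> hd x = a \<and> wpath B (last x) ws b"

lemma wpath_append: "wpath B a (u @ v) b \<longleftrightarrow> (\<exists>c. wpath B a u c \<and> wpath B c v b)"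
  by (induction u arbitrary: a) auto

lemma wpath_push: "x \<in> B \<Longrightarrow> wpath B (last x) ws b \<Longrightarrow> wpath B (hd x) (push x ws) b"
  by (cases ws) (auto simp: inverse_beads_def last_rev)

lemma wpath_reduce: "wpath B a ws b \<Longrightarrow> wpath B a (reduce ws) b"
  by (induction ws arbitrary: a) (auto simp: reduce_def wpath_push)

lemma wpath_mono: "wpath B a ws b \<Longrightarrow> B \<subseteq> C \<Longrightarrow> wpath C a ws b"
  by (induction ws arbitrary: a) auto

definition PA :: "'a list set \<Rightarrow> 'a \<Rightarrow> 'a \<Rightarrow> nat \<Rightarrow> ('a, 'r::comm_ring_1) walg set" where
  "PA B a b n = span_on {w. wpath B a (wbeads w) b \<and> wdeg w = n}"

lemma PA_zero [simp]: "0 \<in> PA B a b n"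
  and PA_add: "x \<in> PA B a b n \<Longrightarrow> y \<in> PA B a b n \<Longrightarrow> x + y \<in> PA B a b n"
  and PA_scale: "x \<in> PA B a b n \<Longrightarrow> scale c x \<in> PA B a b n"
  and PA_uminus: "x \<in> PA B a b n \<Longrightarrow> - x \<in> PA B a b n"
  and PA_diff: "x \<in> PA B a b n \<Longrightarrow> y \<in> PA B a b n \<Longrightarrow> x - y \<in> PA B a b n"
  and PA_sg: "x \<in> PA B a b n \<Longrightarrow> sg m x \<in> PA B a b n"
  by (auto simp: PA_def span_on_add span_on_scale span_on_uminus span_on_diff span_on_sg)

lemma PA_sum: "(\<And>i. i \<in> I \<Longrightarrow> f i \<in> PA B a b n) \<Longrightarrow> sum f I \<in> PA B a b n"
  unfolding PA_def by (rule span_on_sum)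

lemma PA_wd:
  assumes "wpath B a ws b" "n = (\<Sum>x\<leftarrow>ws. sdim x - 1)"
  shows "wd ws \<in> PA B a b n"
  unfolding PA_def wd_def using assms
  by (intro span_on_basis) (auto simp: wdeg_word wbeads_word wpath_reduce)

lemma PA_bd: "x \<in> B \<Longrightarrow> hd x = a \<Longrightarrow> last x = b \<Longrightarrow> n = sdim x - 1 \<Longrightarrow> bd x \<in> PA B a b n"
  by (rule PA_wd) auto

lemma PA_1: "1 \<in> PA B a a 0"
  using PA_wd[of B a "[]" a 0] by simp

lemma PA_induct [consumes 1, case_names zero add word]:
  assumes "x \<in> PA B a b n" "P 0"
    "\<And>x y. x \<in> PA B a b n \<Longrightarrow> y \<in> PA B a b n \<Longrightarrow> P x \<Longrightarrow> P y \<Longrightarrow> P (x + y)"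
    "\<And>ws c. wpath B a ws b \<Longrightarrow> reduced ws \<Longrightarrow> (\<Sum>x\<leftarrow>ws. sdim x - 1) = n \<Longrightarrow> P (scale c (wd ws))"
  shows "P x"
  using assms(1) unfolding PA_def
proof (induction rule: span_on_induct)
  case (basis w c)
  then show ?case
    using assms(4)[of "wbeads w" c] by (auto simp: basis_wbeads wdeg_def)
qed (use assms(2,3) in \<open>auto simp: PA_def\<close>)

lemma PA_mult:
  assumes "x \<in> PA B a b n" "y \<in> PA B b c m"
  shows "x * y \<in> PA B a c (n + m)"
  using assms(1)
proof (induction rule: PA_induct)
  case (word u k)
  show ?case using assms(2)
  proof (induction rule: PA_induct)
    case (word v l)
    then show ?case
      using \<open>wpath B a u b\<close> \<open>(\<Sum>x\<leftarrow>u. sdim x - 1) = n\<close>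
      by (auto simp: scale_mult_left scale_mult_right wd_append[symmetric] wpath_append
          intro!: PA_scale PA_wd)
  qed (auto simp: algebra_simps intro: PA_add)
qed (auto simp: algebra_simps intro: PA_add)

lemma PA_mult': "x \<in> PA B a b n \<Longrightarrow> y \<in> PA B b c m \<Longrightarrow> k = n + m \<Longrightarrow> x * y \<in> PA B a c k"
  by (simp add: PA_mult)

lemma PA_tau: "x \<in> PA B a b n \<Longrightarrow> tau x = sg n x"
  by (induction rule: PA_induct)
    (auto simp: lin_simps[OF lin_tau] sg_add scale_sg, auto simp: tau_def wd_def wdeg_word scale_sg)

lemma PA_aug: "x \<in> PA B a b n \<Longrightarrow> n > 0 \<Longrightarrow> aug x = 0"
  by (induction rule: PA_induct)
    (auto simp: lin_simps[OF lin_aug], auto simp: aug_def wd_def wdeg_word simp del: sum_list_eq_0_iff sum_list_nonneg_eq_0_iff)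

lemma PA_lin:
  assumes "x \<in> PA B a b n" "lin f"
    "\<And>ws. wpath B a ws b \<Longrightarrow> reduced ws \<Longrightarrow> (\<Sum>x\<leftarrow>ws. sdim x - 1) = n \<Longrightarrow> f (wd ws) \<in> PA C a' b' m"
  shows "f x \<in> PA C a' b' m"
  using assms(1) by (induction rule: PA_induct) (auto simp: lin_simps[OF assms(2)] assms(3) PA_add PA_scale)

lemma PA_eq:
  assumes "x \<in> PA B a b n" "lin f" "lin g"
    "\<And>ws. wpath B a ws b \<Longrightarrow> reduced ws \<Longrightarrow> (\<Sum>x\<leftarrow>ws. sdim x - 1) = n \<Longrightarrow> f (wd ws) = g (wd ws)"
  shows "f x = g x"
  using assms(1) by (induction rule: PA_induct) (auto simp: lin_simps[OF assms(2)] lin_simps[OF assms(3)] assms(4))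

lemma beads_iff: "x \<in> beads X \<longleftrightarrow> (\<exists>y. sorted_wrt (<) y \<and> set y \<in> X \<and> 2 \<le> length y
    \<and> (x = y \<or> length y = 2 \<and> x = rev y))"
proof -
  have "x \<in> (\<Union>j\<in>{1..}. simplices X j) \<longleftrightarrow> sorted_wrt (<) x \<and> set x \<in> X \<and> 2 \<le> length x"
  proof
    assume "sorted_wrt (<) x \<and> set x \<in> X \<and> 2 \<le> length x"
    then have "x \<in> simplices X (length x - 1)" "length x - 1 \<in> {1..}"
      by (auto simp: simplices_def)
    then show "x \<in> (\<Union>j\<in>{1..}. simplices X j)" by blast
  qed (auto simp: simplices_def)
  moreover have "x \<in> rev ` simplices X 1 \<longleftrightarrow>
      (\<exists>y. sorted_wrt (<) y \<and> set y \<in> X \<and> length y = 2 \<and> x = rev y)"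
    by (auto simp: simplices_def numeral_2_eq_2 image_iff One_nat_def)
  ultimately show ?thesis
    unfolding beads_def Un_iff by auto
qed

lemma bead_simplex: "sorted_wrt (<) x \<Longrightarrow> set x \<in> X \<Longrightarrow> 2 \<le> length x \<Longrightarrow> x \<in> beads X"
  by (auto simp: beads_iff)

lemma bead_edge_rev: "a < b \<Longrightarrow> {a, b} \<in> X \<Longrightarrow> [b, a] \<in> beads X"
  unfolding beads_iff by (intro exI[of _ "[a, b]"]) auto

lemma beads_mono: "X \<subseteq> Y \<Longrightarrow> beads X \<subseteq> beads Y"
  unfolding beads_def by (intro Un_mono UN_mono image_mono) (auto simp: simplices_def)

lemma asc_subset: "abstract_simplicial_complex X \<Longrightarrow> s \<in> X \<Longrightarrow> t \<subseteq> s \<Longrightarrow> t \<noteq> {} \<Longrightarrow> t \<in> X"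
  unfolding abstract_simplicial_complex_def by blast

lemma sorted_omit: "sorted_wrt R x \<Longrightarrow> sorted_wrt R (omit j x)"
  and sorted_front: "sorted_wrt R x \<Longrightarrow> sorted_wrt R (front j x)"
  and sorted_rear: "sorted_wrt R x \<Longrightarrow> sorted_wrt R (rear j x)"
  subgoal
    using sorted_wrt_append[of R "take j x" "drop j x"] set_drop_subset_set_drop[of j "Suc j" x]
    by (auto simp: omit_def sorted_wrt_append sorted_wrt_drop sorted_wrt_take subset_iff)
  by (auto simp: front_def rear_def sorted_wrt_take sorted_wrt_drop)

lemma set_omit: "set (omit j x) \<subseteq> set x"
  and set_front: "set (front j x) \<subseteq> set x"
  and set_rear: "set (rear j x) \<subseteq> set x"
  using set_take_subset set_drop_subset by (fastforce simp: omit_def front_def rear_def)+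

lemma length_omit: "j < length x \<Longrightarrow> length (omit j x) = length x - 1"
  and length_front: "j < length x \<Longrightarrow> length (front j x) = Suc j"
  and length_rear: "length (rear j x) = length x - j"
  by (auto simp: omit_def front_def rear_def)

lemma hd_omit: "0 < j \<Longrightarrow> x \<noteq> [] \<Longrightarrow> hd (omit j x) = hd x"
  by (cases x; cases j) (auto simp: omit_def)

lemma last_omit: "Suc j < length x \<Longrightarrow> last (omit j x) = last x"
  by (auto simp: omit_def)

lemma hd_front: "x \<noteq> [] \<Longrightarrow> hd (front j x) = hd x"
  and last_rear: "j < length x \<Longrightarrow> last (rear j x) = last x"
  and last_front: "j < length x \<Longrightarrow> last (front j x) = x ! j"
  and hd_rear: "j < length x \<Longrightarrow> hd (rear j x) = x ! j"
  by (auto simp: front_def rear_def hd_drop_conv_nth take_Suc_conv_app_nth)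

lemma sdim_omit: "j < length x \<Longrightarrow> sdim (omit j x) = sdim x - 1"
  and sdim_front: "j < length x \<Longrightarrow> sdim (front j x) = j"
  and sdim_rear: "sdim (rear j x) = sdim x - j"
  by (auto simp: sdim_def length_omit length_front length_rear)

lemmas face_simps = length_omit length_front length_rear hd_omit last_omit hd_front last_rear
  last_front hd_rear sdim_omit sdim_front sdim_rear

lemma PA_dbd:
  assumes X: "abstract_simplicial_complex X" and x: "x \<in> beads X"
  shows "dbd x \<in> PA (beads X) (hd x) (last x) (sdim x - 2)"
proof (cases "sdim x \<le> 1")
  case False
  then have x': "sorted_wrt (<) x" "set x \<in> X" "3 \<le> length x"
    using x by (auto simp: beads_iff sdim_def)
  have sub: "set y \<in> X" if "set y \<subseteq> set x" "y \<noteq> []" for y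
    using asc_subset[OF X x'(2) that(1)] that(2) by auto
  show ?thesis
    unfolding dbd_def
  proof (rule PA_sum, rule PA_sg, rule PA_diff)
    fix j assume j: "j \<in> {1..<sdim x}"
    then have j': "0 < j" "Suc j < length x" "x \<noteq> []" by (auto simp: sdim_def)
    have "bd (front j x) \<in> PA (beads X) (hd x) (x ! j) (j - 1)"
      using j' x' by (intro PA_bd bead_simplex sub sorted_front set_front)
        (auto simp: face_simps simp flip: length_greater_0_conv)
    moreover have "bd (rear j x) \<in> PA (beads X) (x ! j) (last x) (sdim x - j - 1)"
      using j' x' by (intro PA_bd bead_simplex sub sorted_rear set_rear)
        (auto simp: face_simps simp flip: length_greater_0_conv)
    ultimately show "bd (front j x) * bd (rear j x) \<in> PA (beads X) (hd x) (last x) (sdim x - 2)"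
      by (rule PA_mult') (use j in auto)
    show "bd (omit j x) \<in> PA (beads X) (hd x) (last x) (sdim x - 2)"
      using j' x' by (intro PA_bd bead_simplex sub sorted_omit set_omit)
        (auto simp: face_simps simp flip: length_greater_0_conv)
  qed
qed (simp add: dbd_def)

lemma PA_pd_wd:
  assumes X: "abstract_simplicial_complex X"
  shows "wpath (beads X) a ws b \<Longrightarrow> (pd (wd ws) :: ('a::linorder, 'r::comm_ring_1) walg)
    \<in> PA (beads X) a b ((\<Sum>x\<leftarrow>ws. sdim x - 1) - 1)"
proof (induction ws arbitrary: a)
  case (Cons x ws)
  let ?s = "\<Sum>x\<leftarrow>ws. sdim x - 1"
  have w: "(wd ws :: ('a, 'r) walg) \<in> PA (beads X) (last x) b ?s"
    using Cons by (intro PA_wd) auto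
  have x: "(bd x :: ('a, 'r) walg) \<in> PA (beads X) a (last x) (sdim x - 1)"
    using Cons by (intro PA_bd) auto
  have 1: "dbd x * (wd ws :: ('a, 'r) walg) \<in> PA (beads X) a b (sdim x - 1 + ?s - 1)"
  proof (cases "sdim x \<le> 1")
    case False
    then show ?thesis using PA_mult'[OF PA_dbd[OF X, of x] w] Cons by auto
  qed (simp add: dbd_def)
  have 2: "bd x * (pd (wd ws) :: ('a, 'r) walg) \<in> PA (beads X) a b (sdim x - 1 + ?s - 1)"
  \<comment> \<open>Truncated subtraction makes \<open>?s - 1\<close> wrong for
    \<open>?s = 0\<close>; there all beads are edges and the differential vanishes.\<close>
  proof (cases "?s = 0")
    case True
    have "pd (wd ws) = (0 :: ('a, 'r) walg)"
      using True
    proof (induction ws)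
      case (Cons y ws)
      then show ?case
        by (subst wd_Cons) (simp add: pd_mult pd_bd_edge)
    qed simp
    then show ?thesis by simp
  next
    case False
    have "sdim x - 1 + (?s - 1) = sdim x - 1 + ?s - 1"
      using False by linarith
    then show ?thesis using PA_mult[OF x Cons.IH[of "last x"]] Cons.prems by auto
  qed
  show ?case
    using 1 2 by (subst wd_Cons) (simp add: pd_mult pd_bd tau_bd PA_add PA_sg)
qed simp

lemma PA_pd: "abstract_simplicial_complex X \<Longrightarrow> x \<in> PA (beads X) a b n \<Longrightarrow> pd x \<in> PA (beads X) a b (n - 1)"
  by (rule PA_lin[OF _ lin_pd]) (auto dest: PA_pd_wd)

section \<open>Contractions of the path algebra of a simplex\<close>

text \<open>An operator on functions of the tail of a simplex. Prefixing one vertex turns it into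
  the bead differential (\<open>dbd_Cons\<close>); applied to \<open>fill\<close> it describes the
  contraction of a differential (\<open>ctr_dbd\<close>).\<close>

definition cob :: "('a list \<Rightarrow> ('a, 'r::comm_ring_1) walg) \<Rightarrow> 'a list \<Rightarrow> ('a, 'r) walg" where
  "cob g ys = (\<Sum>r<length ys - 1. sg r (g (omit r ys) - g (front r ys) * bd (rear r ys)))"

lemma omit_Suc_Cons: "omit (Suc r) (a # ys) = a # omit r ys"
  and front_Suc_Cons: "front (Suc r) (a # ys) = a # front r ys"
  and rear_Suc_Cons: "rear (Suc r) (a # ys) = rear r ys"
  and omit_0_Cons: "omit 0 (a # ys) = ys"
  and front_0_Cons: "front 0 (a # ys) = [a]"
  and rear_0: "rear 0 ys = ys"
  by (auto simp: omit_def front_def rear_def)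

lemmas cons_simps = omit_Suc_Cons front_Suc_Cons rear_Suc_Cons omit_0_Cons front_0_Cons rear_0

lemma dbd_Cons: "dbd (a # ys) = cob (\<lambda>z. bd (a # z)) ys"
proof -
  have "dbd (a # ys) = (\<Sum>r\<in>{0..<length ys - 1}. sg (Suc r) (bd (front (Suc r) (a # ys)) * bd (rear (Suc r) (a # ys))
      - bd (omit (Suc r) (a # ys))))"
    unfolding dbd_def
    by (rule sum.reindex_bij_witness[of _ Suc "\<lambda>j. j - 1"]) (auto simp: sdim_def)
  then show ?thesis
    by (simp add: cob_def cons_simps sg_diff lessThan_atLeast0)
qed

text \<open>Separates the face and the cut at the second vertex from the rest. When the first two
  vertices are the new one and the old leading one, these two terms produce the main terms of the
  homotopy identity.\<close>

lemma dbd_Cons_Cons: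
  assumes "ys \<noteq> []"
  shows "dbd (a # b # ys) = bd (a # ys) - bd [a, b] * bd (b # ys) - cob (\<lambda>z. bd (a # b # z)) ys"
proof -
  have l: "length ys = Suc (length ys - 1)"
    using assms by (cases ys) auto
  show ?thesis
    unfolding dbd_Cons cob_def[of _ "b # ys"]
    by (simp del: sum.lessThan_Suc, subst l, subst sum.lessThan_Suc_shift)
      (simp add: cons_simps cob_def sum_negf)
qed

lemma cob_add: "cob (\<lambda>z. f z + g z) ys = cob f ys + cob g ys"
  and cob_mult: "cob (\<lambda>z. k * f z) ys = k * cob f ys"
  and cob_uminus: "cob (\<lambda>z. - f z) ys = - cob f ys"
  and cob_zero: "cob (\<lambda>z. 0) ys = 0"
  by (auto simp: cob_def sum.distrib[symmetric] sum_distrib_left sum_negf[symmetric] algebra_simps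
      sg_add sg_diff sg_uminus simp flip: sg_mult_right intro!: sum.cong)

lemma cob_cong:
  assumes "\<And>r. Suc r < length ys \<Longrightarrow> f (omit r ys) = g (omit r ys)"
    "\<And>r. Suc r < length ys \<Longrightarrow> f (front r ys) = g (front r ys)"
  shows "cob f ys = cob g ys"
  unfolding cob_def using assms by (intro sum.cong) auto

definition pos :: "'a list \<Rightarrow> 'a \<Rightarrow> nat" where
  "pos c v = (LEAST i. c ! i = v)"

lemma pos_nth: "sorted_wrt (<) (c :: 'a::linorder list) \<Longrightarrow> i < length c \<Longrightarrow> pos c (c ! i) = i"
  unfolding pos_def
  by (rule Least_equality, rule refl, rule leI)
    (metis less_irrefl order.strict_trans sorted_wrt_nth_less)

lemma sorted_nth_less_iff:
  "sorted_wrt (<) (c :: 'a::linorder list) \<Longrightarrow> i < length c \<Longrightarrow> j < length c \<Longrightarrow> c ! i < c ! j \<longleftrightarrow> i < j"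
  by (metis linorder_neqE_nat not_less_iff_gr_or_eq sorted_wrt_nth_less)

text \<open>A spanning tree of the simplex \<open>c\<close>: the vertices after position \<open>b\<close> are joined to \<open>c ! b\<close>,
  the earlier ones to their successors.  \<open>tree_path c b i\<close> leads from \<open>c ! b\<close> to \<open>c ! i\<close>, and
  \<open>fill\<close> gives the values on simplices of the contraction along the tree.\<close>

function tree_path :: "'a::linorder list \<Rightarrow> nat \<Rightarrow> nat \<Rightarrow> ('a, 'r::comm_ring_1) walg" where
  "tree_path c b i =
     (if i < b then tree_path c b (Suc i) * bd [c ! Suc i, c ! i]
      else if i = b then 1 else bd [c ! b, c ! i])"
  by auto
termination by (relation "measure (\<lambda>(c, b, i). b - i)") auto

declare tree_path.simps [simp del]

function fill :: "'a::linorder list \<Rightarrow> nat \<Rightarrow> nat \<Rightarrow> 'a list \<Rightarrow> ('a, 'r::comm_ring_1) walg" where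
  "fill c b i ys =
     (if i < b then
        (if c ! Suc i < hd ys then tree_path c b i * bd (c ! i # c ! Suc i # ys) + fill c b (Suc i) ys
         else 0)
      else if i = b then 0 else - bd (c ! b # c ! i # ys))"
  by auto
termination by (relation "measure (\<lambda>(c, b, i, ys). b - i)") auto

declare fill.simps [simp del]

text \<open>A formal inverse is a decreasing pair, and its value is forced by the derivation rule on
  a product equal to 1. The value 0 on a pair of equal vertices makes the rule hold for every list
  of length 2.\<close>

definition fill_bead :: "'a::linorder list \<Rightarrow> nat \<Rightarrow> 'a list \<Rightarrow> ('a, 'r::comm_ring_1) walg" where
  "fill_bead c b x =
     (if length x = 2 \<and> hd x \<ge> last x
      then if hd x = last x then 0 else - fill c b (pos c (last x)) [hd x] * bd x
      else fill c b (pos c (hd x)) (tl x))"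

interpretation ctr: fox "\<lambda>w. if wdeg w = 0 then 1 else 0" "fill_bead c b" for c b
proof unfold_locales
  fix x :: "'a list" assume "length x = 2"
  then obtain u v where x: "x = [u, v]"
    by (cases x; cases "tl x") auto
  show "fill_bead c b x * bd (rev x) + (if wdeg (word [x]) = 0 then 1 else 0) * fill_bead c b (rev x)
      = (0 :: ('a, 'b) walg)"
    by (auto simp: x fill_bead_def wdeg_word sdim_def mult.assoc bd_inverse2)
qed (auto simp: wdeg_plus)

definition ctr :: "'a::linorder list \<Rightarrow> nat \<Rightarrow> ('a, 'r::comm_ring_1) walg \<Rightarrow> ('a, 'r) walg" where
  "ctr c b = ctr.der c b"

lemma lin_ctr: "lin (ctr c b)"
  by (simp add: ctr_def ctr.lin_der)

lemma ctr_mult: "ctr c b (x * y) = ctr c b x * y + aug x * ctr c b y"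
  by (simp add: ctr_def ctr.der_mult aug_def)

lemma ctr_bd: "ctr c b (bd x) = fill_bead c b x"
  by (simp add: ctr_def ctr.der_bd)

lemma ctr_1 [simp]: "ctr c b 1 = 0"
  by (simp add: ctr_def ctr.der_1)

lemma ctr_edge_rev: "u < v \<Longrightarrow> ctr c b (bd [v, u]) = - ctr c b (bd [u, v]) * bd [v, u]"
  by (auto simp: ctr_bd fill_bead_def)

lemma ctr_simplex: "sorted_wrt (<) (v # ys) \<Longrightarrow> ys \<noteq> [] \<Longrightarrow> ctr c b (bd (v # ys)) = fill c b (pos c v) ys"
  by (cases ys) (auto simp: ctr_bd fill_bead_def)

definition full :: "'a list \<Rightarrow> 'a set set" where
  "full c = {s. s \<subseteq> set c \<and> s \<noteq> {}}"

lemma asc_full: "abstract_simplicial_complex (full c)"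
  by (auto simp: abstract_simplicial_complex_def full_def intro: finite_subset)

lemma pd_tree_path: "pd (tree_path c b i) = 0"
proof (induction "b - i" arbitrary: i)
  case 0
  then show ?case by (subst tree_path.simps) (auto simp: pd_bd_edge sdim_def)
next
  case (Suc n)
  then show ?case
    by (subst tree_path.simps) (auto simp: pd_mult pd_bd_edge sdim_def)
qed

lemma tau_tree_path: "tau (tree_path c b i) = tree_path c b i"
proof (induction "b - i" arbitrary: i)
  case 0
  then show ?case by (subst (1 2) tree_path.simps) (auto simp: tau_bd tau_1 sdim_def)
next
  case (Suc n)
  then show ?case by (subst (1 2) tree_path.simps) (auto simp: tau_mult tau_bd sdim_def)
qed

text \<open>Contracting a cut \<open>front * rear\<close> leaves, besides the filled front, the
  augmentation of the front times the contracted rear. That augmentation is nonzero only if the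
  front is the initial edge, whence the single extra term.\<close>

lemma ctr_dbd:
  assumes ys: "sorted_wrt (<) (v # ys)" "ys \<noteq> []"
  shows "ctr c b (dbd (v # ys)) = cob (fill c b (pos c v)) ys
    - (if length ys \<ge> 2 then ctr c b (bd ys) else 0)"
proof -
  have *: "ctr c b (bd (v # omit r ys) - bd (v # front r ys) * bd (rear r ys))
     = fill c b (pos c v) (omit r ys) - fill c b (pos c v) (front r ys) * bd (rear r ys)
       - (if r = 0 then ctr c b (bd ys) else 0)" if r: "r < length ys - 1" for r
  proof -
    have "omit r ys \<noteq> []" "front r ys \<noteq> []"
      using r by (auto simp: omit_def front_def)
    moreover have "sorted_wrt (<) (v # omit r ys)" "sorted_wrt (<) (v # front r ys)"
      using ys sorted_omit[of "(<)" ys r] sorted_front[of "(<)" ys r] set_omit[of r ys] set_front[of r ys]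
      by auto
    moreover have "sdim (v # front r ys) = Suc r"
      using r by (simp add: sdim_def length_front)
    ultimately show ?thesis
      by (simp add: lin_diff[OF lin_ctr] ctr_mult ctr_simplex aug_bd rear_0 One_nat_def)
  qed
  have "ctr c b (dbd (v # ys)) = (\<Sum>r<length ys - 1. sg r (ctr c b (bd (v # omit r ys)
      - bd (v # front r ys) * bd (rear r ys))))"
    by (simp add: dbd_Cons cob_def lin_sum[OF lin_ctr] lin_sg[OF lin_ctr])
  also have "\<dots> = (\<Sum>r<length ys - 1. sg r (fill c b (pos c v) (omit r ys)
      - fill c b (pos c v) (front r ys) * bd (rear r ys)) - (if r = 0 then ctr c b (bd ys) else 0))"
    by (intro sum.cong refl) (auto simp: * sg_diff)
  also have "\<dots> = cob (fill c b (pos c v)) ys - (if length ys \<ge> 2 then ctr c b (bd ys) else 0)"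
    by (auto simp: sum_subtractf cob_def sum.delta)
  finally show ?thesis .
qed

text \<open>Beyond the base, \<open>fill\<close> is minus the cone with apex \<open>c ! b\<close>.
  Before the base it adds the next vertex to the simplex, then moves the leading vertex one step
  towards the base and repeats, stopping at the base or when the next vertex already belongs to the
  simplex. Each step contributes one edge of the tree path, and the intermediate terms telescope.
  The second term on the right is confined to edges because only they have augmentation 1.\<close>

lemma contraction_simplex:
  assumes c: "sorted_wrt (<) c" and b: "b < length c"
  shows "sorted_wrt (<) (c ! i # ys) \<Longrightarrow> set ys \<subseteq> set c \<Longrightarrow> ys \<noteq> [] \<Longrightarrow> i < length c \<Longrightarrow>
    pd (fill c b i ys) + ctr c b (dbd (c ! i # ys)) =
    (tree_path c b i * bd (c ! i # ys) - (if length ys = 1 then tree_path c b (pos c (last ys)) else 0)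
      :: ('a::linorder, 'r::comm_ring_1) walg)"
proof (induction "b - i" arbitrary: i rule: less_induct)
  case less
  note ys = less.prems
  have ctrd: "ctr c b (dbd (c ! i # ys)) = cob (fill c b i) ys
    - (if length ys \<ge> 2 then ctr c b (bd ys) else 0)"
    using ctr_dbd[OF ys(1,3), of c b] by (simp add: pos_nth c ys)
  obtain y ys' where yc: "ys = y # ys'" using ys(3) by (cases ys) auto
  obtain k where k: "y = c ! k" "k < length c"
    using ys(2) yc by (auto simp: in_set_conv_nth)
  have ik: "i < k"
    using ys(1) yc k ys(4) sorted_nth_less_iff[OF c, of i k] by auto
  have sys: "sorted_wrt (<) ys" using ys by auto
  have cy: "ctr c b (bd ys) = (fill c b k ys' :: ('a, 'r) walg)" if "2 \<le> length ys"
    using that ctr_simplex[of y ys' c b] sys yc k by (cases ys') (auto simp: pos_nth c)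
  have one: "length ys = 1 \<Longrightarrow> ys = [c ! k]"
    using yc k by auto
  \<comment> \<open>A step towards the base with a new vertex; a step to a vertex already in the
    simplex, where the filling stops; a simplex leaving the base; a simplex beyond the base.\<close>
  consider "i < b" "c ! Suc i < y" | "i < b" "k = Suc i" | "i = b" | "i > b"
    using ik sorted_nth_less_iff[OF c, of "Suc i" k] k b by fastforce
  then show ?case
  proof cases
    case 1
    have hdo: "c ! Suc i < hd (omit r ys)" "c ! Suc i < hd (front r ys)" if "Suc r < length ys" for r
    proof -
      have "hd (omit r ys) \<in> set ys" "hd (front r ys) \<in> set ys"
        using that set_omit[of r ys] set_front[of r ys] by (auto simp: omit_def front_def intro!: subsetD[OF _ hd_in_set])
      then show "c ! Suc i < hd (omit r ys)" "c ! Suc i < hd (front r ys)"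
        using 1 sys yc by auto
    qed
    let ?t = "tree_path c b i :: ('a, 'r) walg"
    let ?f = "\<lambda>z. ?t * bd (c ! i # c ! Suc i # z)"
    have t: "?t * bd [c ! i, c ! Suc i] = tree_path c b (Suc i)"
      using 1(1) by (subst tree_path.simps) (auto simp: mult.assoc bd_inverse2)
    have f: "fill c b i z = ?f z + fill c b (Suc i) z" if "c ! Suc i < hd z" for z
      using 1(1) that by (subst fill.simps) auto
    have "cob (fill c b i) ys = cob (\<lambda>z. ?f z + fill c b (Suc i) z) ys"
      by (rule cob_cong) (simp_all add: f hdo)
    then have cobe: "cob (fill c b i) ys = ?t * cob (\<lambda>z. bd (c ! i # c ! Suc i # z)) ys + cob (fill c b (Suc i)) ys"
      by (simp add: cob_add cob_mult)
    have pf: "pd (?f ys) = ?t * (bd (c ! i # ys) - bd [c ! i, c ! Suc i] * bd (c ! Suc i # ys)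
        - cob (\<lambda>z. bd (c ! i # c ! Suc i # z)) ys)"
    proof -
      show ?thesis
        by (simp add: pd_mult pd_tree_path tau_tree_path pd_bd dbd_Cons_Cons[OF ys(3)])
    qed
    have S: "sorted_wrt (<) (c ! Suc i # ys)" "Suc i < length c"
      using 1 sys yc ik k by auto
    have IH: "pd (fill c b (Suc i) ys) + ctr c b (dbd (c ! Suc i # ys)) =
      (tree_path c b (Suc i) * bd (c ! Suc i # ys) - (if length ys = 1 then tree_path c b (pos c (last ys)) else 0)
        :: ('a, 'r) walg)"
      using less.hyps[of "Suc i"] 1 S ys by auto
    have "ctr c b (dbd (c ! Suc i # ys) :: ('a, 'r) walg) = cob (fill c b (Suc i)) ys
      - (if length ys \<ge> 2 then ctr c b (bd ys) else 0)"
      using ctr_dbd[OF S(1) ys(3), of c b] by (simp add: pos_nth c S)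
    then have IH': "(pd (fill c b (Suc i) ys) :: ('a, 'r) walg) = tree_path c b (Suc i) * bd (c ! Suc i # ys)
      - (if length ys = 1 then tree_path c b (pos c (last ys)) else 0)
      - (cob (fill c b (Suc i)) ys - (if length ys \<ge> 2 then ctr c b (bd ys) else 0))"
      using IH unfolding eq_diff_eq[symmetric] by (simp only:)
    have "fill c b i ys = ?f ys + fill c b (Suc i) ys"
      using f[of ys] 1(2) yc by simp
    then show ?thesis
      unfolding ctrd cobe
      by (simp only: lin_add[OF lin_pd] pf IH' right_diff_distrib mult.assoc[symmetric] t)
        (simp add: algebra_simps)
  next
    case 2
    have z: "fill c b i z = (0 :: ('a, 'r) walg)" if "hd z = c ! k" for z
      using 2 that by (subst fill.simps) auto
    have t: "tree_path c b i * bd [c ! i, c ! k] = (tree_path c b k :: ('a, 'r) walg)"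
      using 2 by (subst tree_path.simps) (auto simp: mult.assoc bd_inverse2)
    \<comment> \<open>Every face or front that still begins with \<open>c ! k\<close> has filling 0,
      so only the face omitting \<open>c ! k\<close> contributes.\<close>
    have "cob (fill c b i) ys = (if length ys \<ge> 2 then fill c b i ys' else 0 :: ('a, 'r) walg)"
    proof (cases "2 \<le> length ys")
      case True
      then have l: "length ys - 1 = Suc (length ys - 2)" by auto
      have "fill c b i (y # v) = (0 :: ('a, 'r) walg)" for v
        using k by (intro z) simp
      note z' = this
      show ?thesis
        using True unfolding cob_def l sum.lessThan_Suc_shift by (simp add: yc cons_simps z')
    next
      case False
      then have "length ys - 1 = 0" by auto
      with False show ?thesis by (simp add: cob_def)
    qed
    moreover have "fill c b i ys' = (tree_path c b i * bd (c ! i # ys) + fill c b k ys' :: ('a, 'r) walg)" if "2 \<le> length ys"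
      using that 2 sys yc k by (subst fill.simps) (cases ys', auto)
    moreover have "fill c b i ys = (0 :: ('a, 'r) walg)"
      using yc k by (intro z) simp
    moreover have "length ys = 1 \<or> 2 \<le> length ys"
      using yc by (cases ys') auto
    ultimately show ?thesis
      unfolding ctrd
      by (elim disjE) (simp_all add: cy one pos_nth c k lin_zero[OF lin_pd] t)
  next
    case 3
    have z: "fill c b b z = (0 :: ('a, 'r) walg)" for z
      by (subst fill.simps) auto
    have "fill c b k ys' = (- bd (c ! i # ys) :: ('a, 'r) walg)"
      using 3 ik yc k by (subst fill.simps) auto
    moreover have "length ys = 1 \<or> 2 \<le> length ys"
      using yc by (cases ys') auto
    moreover have "tree_path c b i = (1 :: ('a, 'r) walg)" "tree_path c b k = (bd [c ! b, c ! k] :: ('a, 'r) walg)"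
      using 3 ik by (subst tree_path.simps; simp)+
    ultimately show ?thesis
      unfolding ctrd
      by (elim disjE) (simp_all add: cy one pos_nth c k lin_zero[OF lin_pd] z cob_def 3)
  next
    case 4
    have z: "fill c b i z = (- bd (c ! b # c ! i # z) :: ('a, 'r) walg)" for z
      using 4 by (subst fill.simps) auto
    have t: "tree_path c b i = (bd [c ! b, c ! i] :: ('a, 'r) walg)"
      "tree_path c b k = (bd [c ! b, c ! k] :: ('a, 'r) walg)"
      using 4 ik by (subst tree_path.simps; auto)+
    have "fill c b k ys' = (- bd (c ! b # ys) :: ('a, 'r) walg)"
      using 4 ik yc k by (subst fill.simps) auto
    moreover have "length ys = 1 \<or> 2 \<le> length ys"
      using yc by (cases ys') auto
    ultimately show ?thesis
      unfolding ctrd z t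
      by (elim disjE)
        (simp_all add: cy one lin_minus[OF lin_pd] cob_uminus pd_bd dbd_Cons_Cons pos_nth c k t ys(3))
  qed
qed

section \<open>The contraction identity for arbitrary paths in a simplex\<close>

lemma bead_full: "sorted_wrt (<) x \<Longrightarrow> set x \<subseteq> set c \<Longrightarrow> 2 \<le> length x \<Longrightarrow> x \<in> beads (full c)"
  by (rule bead_simplex) (auto simp: full_def)

lemma bead_full_rev: "u < v \<Longrightarrow> u \<in> set c \<Longrightarrow> v \<in> set c \<Longrightarrow> [v, u] \<in> beads (full c)"
  by (rule bead_edge_rev) (auto simp: full_def)

lemma beads_full_iff: "x \<in> beads (full c) \<longleftrightarrow> (\<exists>y. sorted_wrt (<) y \<and> set y \<subseteq> set c \<and> 2 \<le> length y
    \<and> (x = y \<or> length y = 2 \<and> x = rev y))"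
  unfolding beads_iff full_def by fastforce

context
  fixes c :: "'a::linorder list" and b :: nat
  assumes c: "sorted_wrt (<) c" and b: "b < length c"
begin

lemma PA_tree_path: "i < length c \<Longrightarrow> (tree_path c b i :: ('a, 'r::comm_ring_1) walg) \<in> PA (beads (full c)) (c ! b) (c ! i) 0"
proof (induction "b - i" arbitrary: i)
  case 0
  then show ?case
    using c b by (subst tree_path.simps)
      (auto intro!: PA_1 PA_bd bead_full simp: sdim_def sorted_nth_less_iff)
next
  case (Suc n)
  have "(tree_path c b (Suc i) * bd [c ! Suc i, c ! i] :: ('a, 'r) walg) \<in> PA (beads (full c)) (c ! b) (c ! i) (0 + 0)"
    using Suc c b by (intro PA_mult[of _ _ _ "c ! Suc i"] Suc.hyps PA_bd bead_full_rev)
      (auto simp: sdim_def sorted_nth_less_iff)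
  then show ?case
    using Suc by (subst tree_path.simps) auto
qed

lemma PA_fill:
  "sorted_wrt (<) (c ! i # ys) \<Longrightarrow> set ys \<subseteq> set c \<Longrightarrow> ys \<noteq> [] \<Longrightarrow> i < length c \<Longrightarrow>
    (fill c b i ys :: ('a, 'r::comm_ring_1) walg) \<in> PA (beads (full c)) (c ! b) (last ys) (length ys)"
proof (induction "b - i" arbitrary: i)
  case 0
  then have "c ! b < c ! i" if "i \<noteq> b"
    using that sorted_nth_less_iff[OF c b, of i] by auto
  with 0 b less_trans[of "c ! b" "c ! i"] show ?case
    by (subst fill.simps) (auto intro!: PA_uminus PA_bd bead_full simp: sdim_def)
next
  case (Suc n)
  show ?case
  proof (cases "c ! Suc i < hd ys")
    case True
    have lt: "c ! i < c ! Suc i"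
      using sorted_nth_less_iff[OF c, of i "Suc i"] Suc b by auto
    have s: "sorted_wrt (<) (c ! Suc i # ys)"
      using True Suc.prems by (cases ys) auto
    have "(tree_path c b i * bd (c ! i # c ! Suc i # ys) :: ('a, 'r) walg) \<in> PA (beads (full c)) (c ! b) (last ys) (0 + length ys)"
      using Suc b s lt
      by (intro PA_mult[of _ _ _ "c ! i"] PA_tree_path PA_bd bead_full) (auto simp: sdim_def)
    moreover have "(fill c b (Suc i) ys :: ('a, 'r) walg) \<in> PA (beads (full c)) (c ! b) (last ys) (length ys)"
      using Suc s b by (intro Suc.hyps) auto
    ultimately show ?thesis
      using Suc by (subst fill.simps) (auto simp: True PA_add)
  next
    case False
    moreover have "i < b" using Suc by auto
    ultimately show ?thesis by (subst fill.simps) simp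
  qed
qed

lemma PA_ctr_bd:
  assumes "x \<in> beads (full c)"
  shows "(ctr c b (bd x) :: ('a, 'r::comm_ring_1) walg) \<in> PA (beads (full c)) (c ! b) (last x) (sdim x)"
proof -
  have s: "(ctr c b (bd y) :: ('a, 'r) walg) \<in> PA (beads (full c)) (c ! b) (last y) (sdim y)"
    if y: "sorted_wrt (<) y" "set y \<subseteq> set c" "2 \<le> length y" for y
  proof -
    obtain v ys where ys: "y = v # ys" "ys \<noteq> []" using y by (cases y; cases "tl y") auto
    obtain i where i: "v = c ! i" "i < length c"
      using y ys by (auto simp: in_set_conv_nth)
    show ?thesis
      using PA_fill[of i ys] y ys i by (auto simp: ctr_simplex pos_nth c sdim_def)
  qed
  consider "sorted_wrt (<) x" "set x \<subseteq> set c" "2 \<le> length x" | u v where "x = [v, u]" "u < v" "u \<in> set c" "v \<in> set c"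
  proof -
    obtain y where y: "sorted_wrt (<) y" "set y \<subseteq> set c" "2 \<le> length y" "x = y \<or> length y = 2 \<and> x = rev y"
      using assms unfolding beads_full_iff by auto
    show ?thesis
    proof (cases "x = y")
      case False
      then obtain u v where "y = [u, v]" using y by (cases y; cases "tl y") auto
      with y False that(2) show ?thesis by auto
    qed (use y that(1) in auto)
  qed
  then show ?thesis
  proof cases
    case 2
    have "(ctr c b (bd [u, v]) * bd [v, u] :: ('a, 'r) walg) \<in> PA (beads (full c)) (c ! b) u (1 + 0)"
      using s[of "[u, v]"] 2 by (intro PA_mult[of _ _ _ v] PA_bd bead_full_rev) (auto simp: sdim_def One_nat_def)
    then show ?thesis
      using 2 by (auto simp: ctr_edge_rev sdim_def One_nat_def intro: PA_uminus)
  qed (rule s)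
qed

lemma contraction_bd:
  assumes "x \<in> beads (full c)"
  shows "pd (ctr c b (bd x)) + ctr c b (dbd x) = tree_path c b (pos c (hd x)) * bd x
    - aug (bd x) * (tree_path c b (pos c (last x)) :: ('a, 'r::comm_ring_1) walg)"
proof -
  have s: "pd (ctr c b (bd y)) + ctr c b (dbd y) = tree_path c b (pos c (hd y)) * bd y
    - aug (bd y) * (tree_path c b (pos c (last y)) :: ('a, 'r) walg)"
    if y: "sorted_wrt (<) y" "set y \<subseteq> set c" "2 \<le> length y" for y
  proof -
    obtain v ys where ys: "y = v # ys" "ys \<noteq> []" using y by (cases y; cases "tl y") auto
    obtain i where i: "v = c ! i" "i < length c"
      using y ys by (auto simp: in_set_conv_nth)
    have "sdim y \<le> 1 \<longleftrightarrow> length ys = 1"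
      using ys by (cases ys) (auto simp: sdim_def)
    then show ?thesis
      using contraction_simplex[OF c b, of i ys] y ys i
      by (auto simp: ctr_simplex pos_nth c aug_bd)
  qed
  obtain y where y: "sorted_wrt (<) y" "set y \<subseteq> set c" "2 \<le> length y" "x = y \<or> length y = 2 \<and> x = rev y"
    using assms unfolding beads_full_iff by auto
  show ?thesis
  proof (cases "x = y")
    case False
    then obtain u v where uv: "y = [u, v]" using y by (cases y; cases "tl y") auto
    then have x: "x = [v, u]" "u < v" using y False by auto
    have d0: "dbd [p, q] = 0" for p q :: 'a
      by (simp add: dbd_def sdim_def)
    \<comment> \<open>For the inverse edge the identity is this one multiplied on the right by
      \<open>- bd [v, u]\<close>.\<close>
    have e: "pd (ctr c b (bd [u, v])) = tree_path c b (pos c u) * bd [u, v]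
       - (tree_path c b (pos c v) :: ('a, 'r) walg)"
      using s[OF y(1-3)] by (simp add: uv d0 aug_bd sdim_def lin_zero[OF lin_ctr])
    show ?thesis
      by (simp add: x ctr_edge_rev d0 aug_bd sdim_def lin_zero[OF lin_ctr] lin_minus[OF lin_pd]
          pd_mult e pd_bd algebra_simps bd_inverse2)
  qed (use s y in auto)
qed

text \<open>In the mixed Leibniz terms the signs cancel, since the contraction raises the degree by
  one and \<open>aug\<close> kills differentials. The tree paths to the joint of \<open>x\<close>
  and \<open>ws\<close> cancel as well: one ends the identity for \<open>x\<close>, the other begins
  that for \<open>ws\<close>.\<close>

lemma contraction_wd:
  "wpath (beads (full c)) u ws v \<Longrightarrow>
    (ctr c b (wd ws) :: ('a, 'r::comm_ring_1) walg) \<in> PA (beads (full c)) (c ! b) v (Suc (\<Sum>x\<leftarrow>ws. sdim x - 1)) \<and>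
    pd (ctr c b (wd ws)) + ctr c b (pd (wd ws)) = tree_path c b (pos c u) * wd ws
    - aug (wd ws) * (tree_path c b (pos c v) :: ('a, 'r) walg)"
proof (induction ws arbitrary: u)
  case (Cons x ws)
  let ?h = "ctr c b :: ('a, 'r) walg \<Rightarrow> _" and ?w = "wd ws :: ('a, 'r) walg" and ?x = "bd x :: ('a, 'r) walg"
  have x: "x \<in> beads (full c)" "hd x = u" "wpath (beads (full c)) (last x) ws v" using Cons by auto
  then have lx: "sdim x \<ge> 1" by (auto simp: beads_iff sdim_def)
  have w: "?w \<in> PA (beads (full c)) (last x) v (\<Sum>x\<leftarrow>ws. sdim x - 1)"
    using x by (intro PA_wd) auto
  have hx: "?h ?x \<in> PA (beads (full c)) (c ! b) (last x) (sdim x)"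
    using PA_ctr_bd x by auto
  note IH = Cons.IH[OF x(3)]
  have 1: "?h (?x * ?w) \<in> PA (beads (full c)) (c ! b) v (Suc (\<Sum>x\<leftarrow>x # ws. sdim x - 1))"
    using PA_mult'[OF hx w] IH lx unfolding ctr_mult
    by (auto simp: aug_bd One_nat_def intro!: PA_add)
  have th: "tau (?h ?x) = - sg (sdim x - 1) (?h ?x)"
    using PA_tau[OF hx] lx by (cases "sdim x") auto
  have ax: "pd (aug ?x) = 0" "tau (aug ?x) = aug ?x" "sg (sdim x - 1) (aug ?x * y) = aug ?x * y" for y
    by (auto simp: aug_bd tau_1 lin_zero[OF lin_pd] lin_zero[OF lin_tau])
  have "pd (?h (?x * ?w)) + ?h (pd (?x * ?w)) =
      (pd (?h ?x) + ?h (dbd x)) * ?w + aug ?x * (pd (?h ?w) + ?h (pd ?w))"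
    by (simp add: ctr_mult pd_mult pd_bd lin_add[OF lin_pd] lin_add[OF lin_ctr] th ax aug_dbd tau_bd
        lin_sg[OF lin_ctr] sg_add algebra_simps)
  also have "\<dots> = tree_path c b (pos c u) * (?x * ?w) - aug (?x * ?w) * tree_path c b (pos c v)"
    using contraction_bd[OF x(1), where 'r = 'r] conjunct2[OF IH] x(2)
    by (simp add: left_diff_distrib right_diff_distrib aug_mult mult.assoc)
  finally show ?case
    using 1 by (simp add: wd_Cons[of x ws])
qed (auto simp: aug_1 lin_zero[OF lin_ctr] lin_zero[OF lin_pd])

lemma PA_ctr: "x \<in> PA (beads (full c)) u v n \<Longrightarrow> ctr c b x \<in> PA (beads (full c)) (c ! b) v (Suc n)"
  by (erule PA_lin[OF _ lin_ctr]) (auto dest: contraction_wd)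

lemma contraction:
  "x \<in> PA (beads (full c)) u v n \<Longrightarrow>
    pd (ctr c b x) + ctr c b (pd x) = tree_path c b (pos c u) * x - aug x * tree_path c b (pos c v)"
  by (erule PA_eq[where f = "\<lambda>x. pd (ctr c b x) + ctr c b (pd x)"])
    (auto intro!: lin_intros lin_compose[OF lin_pd] lin_compose[OF lin_ctr] lin_pd lin_ctr lin_aug
      dest: contraction_wd)

end

section \<open>The path differential squares to zero\<close>

lemma pd_pd_mult: "pd (pd (x * y)) = pd (pd x) * y + x * pd (pd y)"
  by (simp add: pd_mult lin_add[OF lin_pd] tau_pd tau_tau algebra_simps)

text \<open>The contraction \<open>h\<close> based at the first vertex replaces a sign computation.
  It kills \<open>x\<close>, so \<open>h (pd x)\<close> is \<open>x\<close> up to a cycle; applying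
  \<open>pd\<close> and comparing with the homotopy identity for \<open>pd x\<close> gives
  \<open>h (pd (pd x)) = 0\<close>. Moreover \<open>pd (pd (pd x)) = 0\<close>, because the square
  of \<open>pd\<close> satisfies a Leibniz rule and vanishes on the shorter beads in
  \<open>pd x\<close>. The homotopy identity for \<open>pd (pd x)\<close> then has left side 0 and
  right side \<open>pd (pd x)\<close>.\<close>

lemma pd_pd_simplex: "sorted_wrt (<) x \<Longrightarrow> 2 \<le> length x \<Longrightarrow> pd (pd (bd x)) = (0 :: ('a::linorder, 'r::comm_ring_1) walg)"
proof (induction "length x" arbitrary: x rule: less_induct)
  case less
  let ?h = "ctr x 0 :: ('a, 'r) walg \<Rightarrow> _" and ?x = "bd x :: ('a, 'r) walg"
  obtain v ys where x: "x = v # ys" "ys \<noteq> []" using less.prems by (cases x; cases "tl x") auto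
  have xb: "x \<in> beads (full x)" using less by (intro bead_full) auto
  have "?x \<in> PA (beads (full x)) (hd x) (last x) (sdim x - 1)"
    using xb by (intro PA_bd) auto
  note P = this PA_pd[OF asc_full this] PA_pd[OF asc_full PA_pd[OF asc_full this]]
  have p0: "pos x v = 0" and hx: "hd x = v" and l0: "0 < length x" using pos_nth[of x 0] less.prems x by auto
  have "?h ?x = 0"
    using ctr_simplex[of v ys x 0] less.prems x p0 by (subst (asm) fill.simps) auto
  moreover have t0: "tree_path x 0 0 = (1 :: ('a, 'r) walg)"
    by (subst tree_path.simps) simp
  ultimately have 1: "?h (pd ?x) = ?x - aug ?x * tree_path x 0 (pos x (last x))"
    using contraction[OF less.prems(1) l0 P(1)] hx p0 by (auto simp: lin_zero[OF lin_pd])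
  have "pd (?h (pd ?x)) = pd ?x"
    unfolding 1 by (auto simp: lin_diff[OF lin_pd] lin_zero[OF lin_pd] aug_bd pd_tree_path)
  then have 2: "?h (pd (pd ?x)) = 0"
    using contraction[OF less.prems(1) l0 P(2)] hx p0 by (auto simp: aug_pd t0)
  have "pd (pd (bd (front j x) * bd (rear j x) - bd (omit j x))) = (0 :: ('a, 'r) walg)"
    if j: "j \<in> {1..<sdim x}" for j
  proof -
    have "length (front j x) < length x" "length (rear j x) < length x" "length (omit j x) < length x"
      "2 \<le> length (front j x)" "2 \<le> length (rear j x)" "2 \<le> length (omit j x)"
      using j by (auto simp: face_simps sdim_def)
    with less show ?thesis
      by (simp add: lin_diff[OF lin_pd] pd_pd_mult sorted_front sorted_rear sorted_omit)
  qed
  then have "pd (pd (pd ?x)) = 0"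
    unfolding pd_bd dbd_def by (simp add: lin_sum[OF lin_pd] lin_sg[OF lin_pd] lin_zero[OF lin_pd] sum.neutral)
  then show ?case
    using contraction[OF less.prems(1) l0 P(3)] hx p0
    by (auto simp: aug_pd t0 2 lin_zero[OF lin_pd] lin_zero[OF lin_ctr])
qed

lemma pd_pd: "x \<in> PA (beads X) a b n \<Longrightarrow> pd (pd x) = 0"
proof (erule PA_eq[where g = "\<lambda>x. 0"])
  fix ws assume "wpath (beads X) a ws b"
  then show "pd (pd (wd ws)) = (0 :: ('a, 'b) walg)"
  proof (induction ws arbitrary: a)
    case (Cons x ws)
    have "x \<in> beads X" using Cons by simp
    then have "sorted_wrt (<) x \<and> 2 \<le> length x \<or> sdim x \<le> 1"
      by (auto simp: beads_iff sdim_def)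
    then have "pd (pd (bd x)) = (0 :: ('a, 'b) walg)"
      using pd_pd_simplex[of x] by (auto simp: pd_bd_edge lin_zero[OF lin_pd])
    with Cons Cons.IH[of "last x"] show ?case
      by (subst wd_Cons) (simp add: pd_pd_mult)
  qed (simp add: lin_zero[OF lin_pd])
qed (rule lin_compose[OF lin_pd lin_pd], rule lin_const0)

section \<open>Necklaces with coefficients in the path algebra\<close>

text \<open>Gives words back the starting vertex that the path complex records; it is meaningful on
  combinations of words leaving \<open>a\<close>.\<close>

definition pa :: "'a \<Rightarrow> ('a, 'r::comm_ring_1) walg \<Rightarrow> ('a path \<Rightarrow>\<^sub>0 'r)" where
  "pa a = lin_ext (\<lambda>w. basis (a, wbeads w))"

definition nk :: "('a, 'r::comm_ring_1) walg \<Rightarrow> 'a list \<Rightarrow> ('a necklace \<Rightarrow>\<^sub>0 'r)" where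
  "nk x c = lin_ext (\<lambda>w. basis ((last c, wbeads w), c)) x"

lemma lin_pa: "lin (pa a)"
  by (simp add: pa_def lin_lin_ext)

lemma lin_nk: "lin (\<lambda>x. nk x c)"
  by (simp add: nk_def lin_lin_ext)

lemmas pa_lin = lin_simps[OF lin_pa] lin_sg[OF lin_pa]
lemmas nk_lin = lin_simps[OF lin_nk] lin_sg[OF lin_nk]

lemma pa_wd: "reduced ws \<Longrightarrow> pa a (wd ws) = basis (a, ws)"
  by (simp add: pa_def wd_def wbeads_word reduce_reduced)

lemma nk_wd: "reduced ws \<Longrightarrow> nk (wd ws) c = basis ((last c, ws), c)"
  by (simp add: nk_def wd_def wbeads_word reduce_reduced)

lemma reduced_single [simp]: "reduced [x]" and reduced_Nil [simp]: "reduced []"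
  by (auto simp: reduced_def)

lemma basis_seq1: "basis (seq [x]) = pa (hd x) (bd x)"
  by (simp add: seq_def pa_wd)

lemma lin_neck: "lin (\<lambda>x. neck x c)"
  by (simp add: neck_def lin_lin_ext)

lemma neck_pa: "neck (pa (last c) x) c = nk x c"
  by (rule lin_eq[of "\<lambda>x. neck (pa (last c) x) c" "\<lambda>x. nk x c" x])
    (simp_all add: lin_compose[OF lin_neck lin_pa] lin_nk, simp add: pa_def nk_def neck_def)

lemma lin_pmul_left: "lin (\<lambda>x. pmul x y)"
  by (simp add: pmul_def lin_lin_ext)

lemma lin_pmul_right: "lin (pmul x)"
  unfolding pmul_def lin_ext_def[of _ x]
  by (intro lin_sums lin_scaled lin_lin_ext)

lemma wpath_ptgt: "wpath B a ws b \<Longrightarrow> ptgt (a, ws) = b"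
  by (induction ws arbitrary: a) (auto simp: ptgt_def split: if_splits)

text \<open>On composable factors the partial product of paths agrees with the total product of
  words; membership of \<open>x\<close> fixes the vertex at which the second factor has to be
  based.\<close>

lemma pmul_pa:
  assumes "x \<in> PA B a b n"
  shows "pmul (pa a x) (pa b y) = pa a (x * y)"
proof (rule PA_eq[OF assms, where f = "\<lambda>x. pmul (pa a x) (pa b y)" and g = "\<lambda>x. pa a (x * y)"])
  fix ws assume ws: "wpath B a ws b" "reduced ws"
  show "pmul (pa a (wd ws)) (pa b y) = pa a (wd ws * y)"
  proof (rule lin_eq[of "\<lambda>y. pmul (pa a (wd ws)) (pa b y)" "\<lambda>y. pa a (wd ws * y)" y])
    fix w :: "'a rword"
    show "pmul (pa a (wd ws)) (pa b (basis w)) = (pa a (wd ws * basis w) :: _ \<Rightarrow>\<^sub>0 'b)"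
      using wpath_ptgt[OF ws(1)] ws(2)
      by (simp add: pa_wd pmul_def psrc_def)
        (simp add: pa_def wd_def basis_mult plus_rword_def wbeads_word psrc_def reduce_reduced)
  qed (intro lin_compose[OF lin_pmul_right] lin_compose[OF lin_pa] lin_pa lin_mult_right lin_id)+
qed (intro lin_compose[OF lin_pmul_left] lin_compose[OF lin_pa] lin_pa lin_mult_left lin_id)+

lemma reduced_Cons: "reduced (x # ws) \<Longrightarrow> reduced ws"
  by (auto simp: reduced_def successively_Cons)

lemma diff_bead_pa:
  assumes "x \<in> beads X"
  shows "diff_bead x = pa (hd x) (dbd x)"
proof -
  have "basis (seq [omit j x]) = (pa (hd x) (bd (omit j x)) :: _ \<Rightarrow>\<^sub>0 'b) \<and>
     basis (seq [front j x, rear j x]) = (pa (hd x) (bd (front j x) * bd (rear j x)) :: _ \<Rightarrow>\<^sub>0 'b)"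
    if j: "j \<in> {1..<sdim x}" for j
  proof -
    have x: "sorted_wrt (<) x" "3 \<le> length x"
      using assms j by (auto simp: beads_iff sdim_def)
    have h: "hd (omit j x) = hd x" "hd (front j x) = hd x"
      using j x hd_omit[of j x] hd_front[of x j] by fastforce+
    \<comment> \<open>Were the two parts mutually inverse, both would be edges and the last vertex
      of \<open>x\<close> would equal the first, against strict monotonicity.\<close>
    have "reduced [front j x, rear j x]"
    proof (rule ccontr)
      assume "\<not> reduced [front j x, rear j x]"
      then have r: "rear j x = rev (front j x)" "length (front j x) = 2"
        by (auto simp: reduced_def inverse_beads_def)
      moreover have "j < length x" "x \<noteq> []" using j x by (auto simp: sdim_def)
      moreover have "length (rear j x) = 2" using r by simp
      ultimately have "last x = hd x" "length x = 3"
        using hd_front[of x j] last_rear[of j x] length_rear[of j x] length_front[of j x]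
        by (auto simp: last_rev)
      moreover obtain a b c where "x = [a, b, c]"
        using \<open>length x = 3\<close> by (cases x; cases "tl x"; cases "tl (tl x)") auto
      ultimately show False using x by auto
    qed
    moreover have "wd [front j x, rear j x] = (bd (front j x) * bd (rear j x) :: ('a, 'b) walg)"
      using wd_Cons[of "front j x" "[rear j x]"] .
    ultimately show ?thesis
      using h pa_wd[of "[front j x, rear j x]" "hd x"] by (simp add: basis_seq1 seq_def pa_wd[symmetric])
  qed
  then show ?thesis
    unfolding diff_bead_def dbd_def
    by (simp add: pa_lin scale_sign sg_diff sum_subtractf del: atLeastLessThan_iff cong: sum.cong)
qed

lemma diff_path_pa:
  assumes X: "abstract_simplicial_complex X"
  shows "wpath (beads X) a ws b \<Longrightarrow> reduced ws \<Longrightarrow>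
    diff_path a ws = pa a (pd (wd ws) :: ('a::linorder, 'r::comm_ring_1) walg)"
proof (induction ws arbitrary: a)
  case (Cons x ws)
  then have x: "x \<in> beads X" "hd x = a" "wpath (beads X) (last x) ws b" "reduced ws"
    using reduced_Cons by auto
  have 1: "(bd x :: ('a, 'r) walg) \<in> PA (beads X) a (last x) (sdim x - 1)"
    using x by (intro PA_bd) auto
  have 2: "(dbd x :: ('a, 'r) walg) \<in> PA (beads X) a (last x) (sdim x - 2)"
    using PA_dbd[OF X x(1)] x by simp
  show ?case
    using x Cons.IH[of "last x"] pmul_pa[OF 1] pmul_pa[OF 2]
    by (subst wd_Cons) (simp add: diff_bead_pa pd_mult pd_bd tau_bd pa_lin scale_sign basis_seq1
        pa_wd[symmetric])
qed (simp add: pa_lin)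

section \<open>Homogeneous necklace chains\<close>

lemma simplices_iff: "c \<in> simplices X k \<longleftrightarrow> sorted_wrt (<) c \<and> length c = Suc k \<and> set c \<in> X"
  by (simp add: simplices_def)

lemma simplices_sdim: "c \<in> simplices X k \<Longrightarrow> sdim c = k"
  by (simp add: simplices_def sdim_def)

lemma paths_wpath:
  assumes "(a, ws) \<in> paths X"
  shows "wpath (beads X) a ws (ptgt (a, ws))" "reduced ws" "{a} \<in> X"
proof -
  have "set ws \<subseteq> beads X \<Longrightarrow> ws \<noteq> [] \<longrightarrow> hd (hd ws) = a \<Longrightarrow> successively (\<lambda>x y. last x = hd y) ws
     \<Longrightarrow> \<exists>b. wpath (beads X) a ws b"
  proof (induction ws arbitrary: a)
    case (Cons x ws)
    then have "\<exists>b. wpath (beads X) (last x) ws b"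
      by (intro Cons.IH) (auto simp: successively_Cons)
    with Cons show ?case by auto
  qed auto
  then show "wpath (beads X) a ws (ptgt (a, ws))" "reduced ws" "{a} \<in> X"
    using assms wpath_ptgt by (fastforce simp: paths_def)+
qed

lemma wpath_paths: "wpath (beads X) a ws b \<Longrightarrow> reduced ws \<Longrightarrow> {a} \<in> X \<Longrightarrow> (a, ws) \<in> paths X"
proof -
  have "wpath (beads X) a ws b \<Longrightarrow>
    set ws \<subseteq> beads X \<and> (ws \<noteq> [] \<longrightarrow> hd (hd ws) = a) \<and> successively (\<lambda>x y. last x = hd y) ws"
    by (induction ws arbitrary: a) (auto simp: successively_Cons)
  then show "wpath (beads X) a ws b \<Longrightarrow> reduced ws \<Longrightarrow> {a} \<in> X \<Longrightarrow> (a, ws) \<in> paths X"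
    by (auto simp: paths_def)
qed

lemma nk_in:
  assumes X: "abstract_simplicial_complex X" and c: "c \<in> simplices X k"
    and x: "x \<in> PA (beads X) (last c) (hd c) m" and n: "m + k = n"
  shows "nk x c \<in> necklace_chains X n"
  using x
proof (induction rule: PA_induct)
  case (word ws s)
  have "last c \<in> set c" using c by (intro last_in_set) (auto simp: simplices_iff)
  then have "{last c} \<in> X"
    using c asc_subset[OF X, of "set c" "{last c}"] by (auto simp: simplices_iff)
  then have "((last c, ws), c) \<in> necklaces X n"
    using word c n wpath_paths[of X "last c" ws "hd c"] wpath_ptgt[OF word(1)]
    by (auto simp: necklaces_def psrc_def pdeg_def simplices_sdim)
  then show ?case
    using word by (simp add: nk_lin nk_wd necklace_chains_def span_on_scale span_on_basis)
qed (auto simp: nk_lin necklace_chains_def span_on_add)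

lemma necklace_chains_induct [consumes 1, case_names zero add nk]:
  assumes "z \<in> necklace_chains X n" "P 0"
    "\<And>x y. x \<in> necklace_chains X n \<Longrightarrow> y \<in> necklace_chains X n \<Longrightarrow> P x \<Longrightarrow> P y \<Longrightarrow> P (x + y)"
    "\<And>x c k m. c \<in> simplices X k \<Longrightarrow> x \<in> PA (beads X) (last c) (hd c) m \<Longrightarrow> m + k = n \<Longrightarrow> P (nk x c)"
  shows "P z"
  using assms(1) unfolding necklace_chains_def
proof (induction rule: span_on_induct)
  case (basis b s)
  obtain a ws c where b: "b = ((a, ws), c)" by (cases b) auto
  obtain k where k: "(a, ws) \<in> paths X" "c \<in> simplices X k" "ptgt (a, ws) = hd c" "a = last c"
    "pdeg (a, ws) + k = n"
    using basis by (auto simp: b necklaces_def psrc_def simplices_sdim)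
  have "scale s (wd ws) \<in> PA (beads X) (last c) (hd c) (pdeg (a, ws))"
    using paths_wpath[OF k(1)] k by (intro PA_scale PA_wd) (auto simp: pdeg_def)
  then have "P (nk (scale s (wd ws)) c)"
    using assms(4) k by auto
  then show ?case
    using paths_wpath[OF k(1)] by (simp add: nk_lin nk_wd b k)
qed (use assms(2,3) in \<open>auto simp: necklace_chains_def\<close>)

lemma necklace_diff_lin: "lin necklace_diff"
  by (simp add: necklace_diff_def lin_lin_ext)

text \<open>With |c'| = j and |c''| = k - j the exponent m + j + 1 + (k - j - 1)(m + j) equals (m +
  j)(k - j) + 1, which explains the minus sign before the last sum. The conditions that c' or c''
  have positive dimension become the ranges of \<open>j\<close>.\<close>

lemma D_nk:
  assumes X: "abstract_simplicial_complex X" and c: "c \<in> simplices X k"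
    and x: "x \<in> PA (beads X) (last c) (hd c) m"
  shows "necklace_diff (nk x c) = nk (pd x) c
    + sg m (\<Sum>j\<in>{1..<k}. sg j (nk x (omit j c)))
    + sg m (\<Sum>j\<in>{1..k}. nk (x * bd (front j c)) (rear j c))
    - (\<Sum>j<k. sg ((m + j) * (k - j)) (nk (bd (rear j c) * x) (front j c)))"
proof (rule PA_eq[OF x, where f = "\<lambda>x. necklace_diff (nk x c)" and g = "\<lambda>x. nk (pd x) c
    + sg m (\<Sum>j\<in>{1..<k}. sg j (nk x (omit j c)))
    + sg m (\<Sum>j\<in>{1..k}. nk (x * bd (front j c)) (rear j c))
    - (\<Sum>j<k. sg ((m + j) * (k - j)) (nk (bd (rear j c) * x) (front j c)))"])
  fix ws assume ws: "wpath (beads X) (last c) ws (hd c)" "reduced ws" and m: "(\<Sum>x\<leftarrow>ws. sdim x - 1) = m"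
  have l: "length c = Suc k" and k: "sdim c = k" and ne: "c \<noteq> []"
    using c by (auto simp: simplices_iff sdim_def)
  let ?p = "(last c, ws)" and ?w = "wd ws :: ('a, 'b) walg"
  have p: "basis ?p = pa (last c) ?w" using ws by (simp add: pa_wd)
  have w: "?w \<in> PA (beads X) (last c) (hd c) m" using ws m by (intro PA_wd) auto
  have pm: "pdeg ?p = m" using m by (simp add: pdeg_def)
  have 0: "neck (diff_path (last c) ws) c = nk (pd ?w) c"
    by (simp add: diff_path_pa[OF X ws] neck_pa)
  have 1: "basis (?p, omit j c) = nk ?w (omit j c)" if "j \<in> {1..<k}" for j
    using that ws l by (simp add: nk_wd last_omit)
  have 2: "neck (pmul (basis ?p) (basis (seq [front j c]))) (rear j c) = nk (?w * bd (front j c)) (rear j c)"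
    if "j \<in> {1..k}" for j
    using that l ne pmul_pa[OF w, of "bd (front j c)"]
    by (simp add: p basis_seq1 hd_front neck_pa[symmetric] last_rear)
  have 3: "neck (pmul (basis (seq [rear j c])) (basis ?p)) (front j c) = nk (bd (rear j c) * ?w) (front j c)"
    if "j < k" for j
  proof -
    have "(bd (rear j c) :: ('a, 'b) walg) \<in> PA {rear j c} (last (front j c)) (last c) (sdim (rear j c) - 1)"
      using that l by (intro PA_bd) (auto simp: face_simps)
    from pmul_pa[OF this, of ?w] show ?thesis
      using that l
      by (simp add: p basis_seq1 hd_rear neck_pa[symmetric] last_front)
  qed
  have s2: "{j. j \<le> sdim c \<and> sdim (front j c) > 0} = {1..k}" and s3: "{j. j \<le> sdim c \<and> sdim (rear j c) > 0} = {..<k}"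
    using l k by (auto simp: sdim_def length_front length_rear)
  have s4: "sg (m + sdim (front j c) + 1 + (sdim (rear j c) - 1) * (m + sdim (front j c))) y
     = - sg ((m + j) * (k - j)) y" if jk: "j < k" for j and y :: "'a necklace \<Rightarrow>\<^sub>0 'b"
  proof -
    obtain u where u: "k = Suc (j + u)" using jk by (rule less_natE)
    show ?thesis
      using jk l k by (intro sg_minus_cong) (auto simp: sdim_front sdim_rear u)
  qed
  show "necklace_diff (nk ?w c) = nk (pd ?w) c
    + sg m (\<Sum>j\<in>{1..<k}. sg j (nk ?w (omit j c)))
    + sg m (\<Sum>j\<in>{1..k}. nk (?w * bd (front j c)) (rear j c))
    - (\<Sum>j<k. sg ((m + j) * (k - j)) (nk (bd (rear j c) * ?w) (front j c)))"
  proof -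
    have "(\<Sum>j\<in>{1..<k}. sg j (basis (?p, omit j c))) = (\<Sum>j\<in>{1..<k}. sg j (nk ?w (omit j c)))"
      by (intro sum.cong refl) (simp add: 1)
    moreover have "(\<Sum>j\<in>{1..k}. neck (pmul (basis ?p) (basis (seq [front j c]))) (rear j c))
        = (\<Sum>j\<in>{1..k}. nk (?w * bd (front j c)) (rear j c))"
      by (intro sum.cong refl) (simp add: 2)
    moreover have "(\<Sum>j<k. sg (m + sdim (front j c) + 1 + (sdim (rear j c) - 1) * (m + sdim (front j c)))
          (neck (pmul (basis (seq [rear j c])) (basis ?p)) (front j c)))
        = - (\<Sum>j<k. sg ((m + j) * (k - j)) (nk (bd (rear j c) * ?w) (front j c)))"
      unfolding sum_negf[symmetric] by (intro sum.cong refl) (simp only: lessThan_iff s4 3)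
    ultimately show ?thesis
      unfolding nk_wd[OF ws(2)] necklace_diff_def lin_ext_basis prod.case fst_conv snd_conv 0 pm
        scale_sign s2 s3
      by (simp only: diff_conv_add_uminus k)
  qed
qed (intro lin_intros lin_compose[OF necklace_diff_lin] lin_compose[OF lin_nk] lin_nk lin_pd)+

section \<open>The necklace differential squares to zero\<close>

lemma front_front: "i \<le> j \<Longrightarrow> front i (front j c) = front i c"
  and rear_rear: "rear i (rear j c) = rear (i + j) c"
  and rear_front: "i \<le> j \<Longrightarrow> rear i (front j c) = front (j - i) (rear i c)"
  by (auto simp: front_def rear_def min_def drop_take Suc_diff_le)

lemma front_omit_less: "i < j \<Longrightarrow> j < length c \<Longrightarrow> front i (omit j c) = front i c"
  and rear_omit_less: "i < j \<Longrightarrow> j < length c \<Longrightarrow> rear i (omit j c) = omit (j - i) (rear i c)"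
  and front_omit_ge: "j \<le> i \<Longrightarrow> j < length c \<Longrightarrow> front i (omit j c) = omit j (front (Suc i) c)"
  and rear_omit_ge: "j \<le> i \<Longrightarrow> j < length c \<Longrightarrow> rear i (omit j c) = rear (Suc i) c"
  and omit_omit: "i < j \<Longrightarrow> j < length c \<Longrightarrow> omit i (omit j c) = omit (j - 1) (omit i c)"
  subgoal by (rule nth_equalityI) (auto simp: length_front length_omit front_def omit_def nth_append)
  subgoal by (rule nth_equalityI)
    (auto simp: length_rear length_omit rear_def omit_def nth_append Suc_diff_le)
  subgoal by (simp add: front_def omit_def min_def drop_take Suc_diff_le)
  subgoal by (rule nth_equalityI) (auto simp: length_rear length_omit rear_def omit_def nth_append)
  subgoal
    by (rule nth_equalityI)
      (auto simp: length_omit omit_def nth_append min_def One_nat_def dest!: less_imp_Suc_add split: if_splits)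
  done

text \<open>The first index is an omitted position, the second a position in the resulting face. A
  second position \<open>i \<ge> j\<close> is position \<open>i + 1\<close> of the original simplex,
  which causes the shift in the last sum.\<close>

lemma sum_square:
  fixes f :: "nat \<Rightarrow> nat \<Rightarrow> 'm::comm_monoid_add"
  shows "(\<Sum>j\<in>{1..<k}. \<Sum>i\<in>{1..k-1}. f j i)
    = (\<Sum>j\<in>{1..<k}. \<Sum>i\<in>{1..<j}. f j i) + (\<Sum>j\<in>{1..k}. \<Sum>i\<in>{1..<j}. f i (j - 1))"
proof -
  have "(\<Sum>j\<in>{1..<k}. \<Sum>i\<in>{1..k-1}. f j i) = (\<Sum>j\<in>{1..<k}. (\<Sum>i\<in>{1..<j}. f j i) + (\<Sum>i\<in>{j..k-1}. f j i))"
    by (intro sum.cong refl, subst sum.union_disjoint[symmetric]) (auto intro!: sum.cong)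
  moreover have "(\<Sum>j\<in>{1..<k}. \<Sum>i\<in>{j..k-1}. f j i) = (\<Sum>j\<in>{1..k}. \<Sum>i\<in>{1..<j}. f i (j - 1))"
    unfolding sum.Sigma[OF finite_atLeastLessThan, OF ballI[OF finite_atLeastAtMost]]
      sum.Sigma[OF finite_atLeastAtMost, OF ballI[OF finite_atLeastLessThan]]
    by (rule sum.reindex_bij_witness[of _ "\<lambda>(j, i). (i, j - 1)" "\<lambda>(j, i). (i + 1, j)"]) auto
  ultimately show ?thesis by (simp add: sum.distrib)
qed

lemma sum_square':
  fixes f :: "nat \<Rightarrow> nat \<Rightarrow> 'm::comm_monoid_add"
  shows "(\<Sum>j\<in>{1..<k}. \<Sum>i<k-1. f j i)
    = (\<Sum>j\<in>{1..<k}. \<Sum>i<j. f j i) + (\<Sum>j<k. \<Sum>i\<in>{1..<j}. f i (j - 1))"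
proof -
  have "(\<Sum>j\<in>{1..<k}. \<Sum>i<k-1. f j i) = (\<Sum>j\<in>{1..<k}. (\<Sum>i<j. f j i) + (\<Sum>i\<in>{j..<k-1}. f j i))"
    by (intro sum.cong refl, subst sum.union_disjoint[symmetric]) (auto intro!: sum.cong)
  moreover have "(\<Sum>j\<in>{1..<k}. \<Sum>i\<in>{j..<k-1}. f j i) = (\<Sum>j<k. \<Sum>i\<in>{1..<j}. f i (j - 1))"
    unfolding sum.Sigma[OF finite_atLeastLessThan, OF ballI[OF finite_atLeastLessThan]]
      sum.Sigma[OF finite_lessThan, OF ballI[OF finite_atLeastLessThan]]
    by (rule sum.reindex_bij_witness[of _ "\<lambda>(j, i). (i, j - 1)" "\<lambda>(j, i). (i + 1, j)"]) auto
  ultimately show ?thesis by (simp add: sum.distrib)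
qed

lemma sum_triangle:
  fixes f :: "nat \<Rightarrow> nat \<Rightarrow> 'm::comm_monoid_add"
  shows "(\<Sum>j\<in>{1..k}. \<Sum>i\<in>{1..k-j}. f j i) = (\<Sum>j\<in>{1..k}. \<Sum>i\<in>{1..<j}. f i (j - i))"
    and "(\<Sum>j\<in>{1..k}. \<Sum>i\<in>{1..<k-j}. f j i) = (\<Sum>j\<in>{1..<k}. \<Sum>i\<in>{1..<j}. f i (j - i))"
    and "(\<Sum>j<k. \<Sum>i\<in>{1..<k-j}. f j i) = (\<Sum>j<k. \<Sum>i<j. f i (j - i))"
    and "(\<Sum>j\<in>{1..k}. \<Sum>i<k-j. f j i) = (\<Sum>j<k. \<Sum>i\<in>{1..j}. f i (j - i))"
  by (simp_all add: sum.Sigma)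
    (rule sum.reindex_bij_witness[of _ "\<lambda>(j, i). (i, j - i)" "\<lambda>(j, i). (j + i, j)"]; auto)+

lemma faces_in:
  assumes X: "abstract_simplicial_complex X" and c: "c \<in> simplices X k"
  shows "0 < k \<Longrightarrow> j \<le> k \<Longrightarrow> omit j c \<in> simplices X (k - 1)"
    and "j \<le> k \<Longrightarrow> front j c \<in> simplices X j"
    and "j \<le> k \<Longrightarrow> rear j c \<in> simplices X (k - j)"
proof -
  have sub: "y \<in> simplices X l" if "set y \<subseteq> set c" "length y = Suc l" "sorted_wrt (<) y" for y l
  proof -
    have "y \<noteq> []" using that by auto
    then show ?thesis
      using asc_subset[OF X _ that(1)] that c by (auto simp: simplices_iff)
  qed
  have l: "length c = Suc k" "sorted_wrt (<) c" using c by (auto simp: simplices_iff)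
  show "0 < k \<Longrightarrow> j \<le> k \<Longrightarrow> omit j c \<in> simplices X (k - 1)"
    by (rule sub) (auto simp: set_omit length_omit l sorted_omit)
  show "j \<le> k \<Longrightarrow> front j c \<in> simplices X j"
    by (rule sub) (auto simp: set_front length_front l sorted_front)
  show "j \<le> k \<Longrightarrow> rear j c \<in> simplices X (k - j)"
    by (rule sub) (auto simp: set_rear length_rear l sorted_rear)
qed

lemma bead_of_simplex: "c \<in> simplices X k \<Longrightarrow> 0 < k \<Longrightarrow> c \<in> beads X"
  by (auto simp: simplices_iff intro: bead_simplex)

text \<open>Signs see only the parity of the degree of \<open>pd x\<close>. In degree 0 there is no
  predecessor, but \<open>pd x = 0\<close> lies in every degree, so an odd one can be
  chosen.\<close>

lemma PA_pd_parity:
  fixes x :: "('a::linorder, 'b::comm_ring_1) walg"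
  assumes "abstract_simplicial_complex X" "x \<in> PA (beads X) a b m"
  obtains m' where "even m' \<longleftrightarrow> odd m" "pd x \<in> PA (beads X) a b m'"
proof (cases m)
  case 0
  have "pd x = 0"
    using assms(2)
  proof (rule PA_eq[OF _ lin_pd lin_const0])
    fix ws :: "'a list list" assume ws: "(\<Sum>x\<leftarrow>ws. sdim x - 1) = m"
    then show "pd (wd ws) = (0 :: ('a, 'b) walg)"
      unfolding 0
    proof (induction ws)
      case (Cons y ws)
      then show ?case by (subst wd_Cons) (simp add: pd_mult pd_bd_edge)
    qed simp
  qed
  then show ?thesis using that[of 1] 0 by auto
next
  case (Suc n)
  then show ?thesis using that[of n] PA_pd[OF assms] by auto
qed

text \<open>The terms containing \<open>pd x\<close> cancel in pairs, and double omissions cancel as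
  for simplicial chains. For fronts, moving two in succession matches the cuts, and omitting a
  vertex the faces, in the differential of a moved bead (\<open>QU\<close>); rears behave in the
  same way (\<open>QV\<close>). Moving a front and moving a rear anticommute
  (\<open>UV\<close>).\<close>

lemma D_D_nk:
  assumes X: "abstract_simplicial_complex X" and c: "c \<in> simplices X k"
    and x: "x \<in> PA (beads X) (last c) (hd c) m"
  shows "necklace_diff (necklace_diff (nk x c)) = (0 :: 'a::linorder necklace \<Rightarrow>\<^sub>0 'r::comm_ring_1)"
proof -
  let ?D = "necklace_diff :: ('a necklace \<Rightarrow>\<^sub>0 'r) \<Rightarrow> _"
  let ?F = "\<lambda>j. bd (front j c) :: ('a, 'r) walg" and ?R = "\<lambda>j. bd (rear j c) :: ('a, 'r) walg"
  have l: "length c = Suc k" and ne: "c \<noteq> []"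
    using c by (auto simp: simplices_iff)
  obtain m' where m': "even m' \<longleftrightarrow> odd m" and px: "pd x \<in> PA (beads X) (last c) (hd c) m'"
    using PA_pd_parity[OF X x] .
  have tx: "tau x = sg m x" using PA_tau[OF x] .
  \<comment> \<open>The letter is the first operation: \<open>P\<close> differentiates the word,
    \<open>Q\<close> omits an interior vertex, \<open>U\<close> moves a front to the right end of
    the word, \<open>V\<close> moves a rear to its left end. The digit is the other one: 0
    differentiates the moved bead, 1 omits, 2 moves a front, 3 moves a rear.\<close>
  define P1 where "P1 = (\<Sum>j\<in>{1..<k}. sg j (nk (pd x) (omit j c)))"
  define P2 where "P2 = (\<Sum>j\<in>{1..k}. nk (pd x * ?F j) (rear j c))"
  define P3 where "P3 = (\<Sum>j<k. sg ((m + 1 + j) * (k - j)) (nk (?R j * pd x) (front j c)))"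
  define Q1 where "Q1 = (\<Sum>j\<in>{1..<k}. \<Sum>i\<in>{1..<k-1}. sg (j + i) (nk x (omit i (omit j c))))"
  define Q2 where "Q2 = (\<Sum>j\<in>{1..<k}. \<Sum>i\<in>{1..k-1}. sg j (nk (x * bd (front i (omit j c))) (rear i (omit j c))))"
  define Q3 where "Q3 = (\<Sum>j\<in>{1..<k}. \<Sum>i<k-1. sg (j + (m + i) * (k - 1 - i))
      (nk (bd (rear i (omit j c)) * x) (front i (omit j c))))"
  define U0 where "U0 = (\<Sum>j\<in>{1..k}. nk (x * dbd (front j c)) (rear j c))"
  define U1 where "U1 = (\<Sum>j\<in>{1..k}. \<Sum>i\<in>{1..<k-j}. sg (j - 1 + i) (nk (x * ?F j) (omit i (rear j c))))"
  define U2 where "U2 = (\<Sum>j\<in>{1..k}. \<Sum>i\<in>{1..k-j}. sg (j - 1) (nk (x * ?F j * bd (front i (rear j c))) (rear i (rear j c))))"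
  define U3 where "U3 = (\<Sum>j\<in>{1..k}. \<Sum>i<k-j. sg ((m + (j - 1) + i) * (k - j - i))
      (nk (bd (rear i (rear j c)) * (x * ?F j)) (front i (rear j c))))"
  define V0 where "V0 = (\<Sum>j<k. sg ((m + j) * (k - j)) (nk (dbd (rear j c) * x) (front j c)))"
  define V1 where "V1 = (\<Sum>j<k. \<Sum>i\<in>{1..<j}. sg ((m + j) * (k - j) + (m + (k - j - 1)) + i)
      (nk (?R j * x) (omit i (front j c))))"
  define V2 where "V2 = (\<Sum>j<k. \<Sum>i\<in>{1..j}. sg ((m + j) * (k - j) + (m + (k - j - 1)))
      (nk (?R j * x * bd (front i (front j c))) (rear i (front j c))))"
  define V3 where "V3 = (\<Sum>j<k. \<Sum>i<j. sg ((m + j) * (k - j) + (m + (k - j - 1) + i) * (j - i))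
      (nk (bd (rear i (front j c)) * (?R j * x)) (front i (front j c))))"
  have D1: "?D (nk (pd x) c) = - sg m P1 - sg m P2 - P3"
  proof -
    have 1: "sg m' y = - sg m y" for y :: "'a necklace \<Rightarrow>\<^sub>0 'r"
      using m' by (auto simp: sg_def)
    have 2: "(\<Sum>j<k. sg ((m' + j) * (k - j)) (nk (?R j * pd x) (front j c))) = P3"
      unfolding P3_def by (intro sum.cong sg_cong refl) (use m' in auto)
    show ?thesis
      unfolding D_nk[OF X c px] pd_pd[OF x] 1 2 P1_def P2_def by (simp add: nk_lin)
  qed
  have D2: "?D (\<Sum>j\<in>{1..<k}. sg j (nk x (omit j c))) = P1 + sg m Q1 + sg m Q2 - Q3"
  proof -
    have "?D (nk x (omit j c)) = nk (pd x) (omit j c)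
      + sg m (\<Sum>i\<in>{1..<k-1}. sg i (nk x (omit i (omit j c))))
      + sg m (\<Sum>i\<in>{1..k-1}. nk (x * bd (front i (omit j c))) (rear i (omit j c)))
      - (\<Sum>i<k-1. sg ((m + i) * (k - 1 - i)) (nk (bd (rear i (omit j c)) * x) (front i (omit j c))))"
      if "j \<in> {1..<k}" for j
      using that l ne x by (intro D_nk[OF X faces_in(1)[OF X c]]) (auto simp: hd_omit last_omit)
    then have "?D (\<Sum>j\<in>{1..<k}. sg j (nk x (omit j c))) = (\<Sum>j\<in>{1..<k}. sg j (nk (pd x) (omit j c)
      + sg m (\<Sum>i\<in>{1..<k-1}. sg i (nk x (omit i (omit j c))))
      + sg m (\<Sum>i\<in>{1..k-1}. nk (x * bd (front i (omit j c))) (rear i (omit j c)))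
      - (\<Sum>i<k-1. sg ((m + i) * (k - 1 - i)) (nk (bd (rear i (omit j c)) * x) (front i (omit j c))))))"
      by (simp add: lin_sum[OF necklace_diff_lin] lin_sg[OF necklace_diff_lin])
    then show ?thesis
      unfolding P1_def Q1_def Q2_def Q3_def
      by (simp only: sg_add sg_diff sg_sum sum.distrib sum_subtractf sg_sg ac_simps)
  qed
  have D3: "?D (\<Sum>j\<in>{1..k}. nk (x * ?F j) (rear j c)) = P2 + sg m U0 + sg m U1 + sg m U2 - U3"
  proof -
    have "?D (nk (x * ?F j) (rear j c)) = nk (pd x * ?F j) (rear j c) + sg m (nk (x * dbd (front j c)) (rear j c))
      + sg (m + (j - 1)) (\<Sum>i\<in>{1..<k-j}. sg i (nk (x * ?F j) (omit i (rear j c))))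
      + sg (m + (j - 1)) (\<Sum>i\<in>{1..k-j}. nk (x * ?F j * bd (front i (rear j c))) (rear i (rear j c)))
      - (\<Sum>i<k-j. sg ((m + (j - 1) + i) * (k - j - i)) (nk (bd (rear i (rear j c)) * (x * ?F j)) (front i (rear j c))))"
      if j: "j \<in> {1..k}" for j
    proof -
      have "x * ?F j \<in> PA (beads X) (last (rear j c)) (hd (rear j c)) (m + (j - 1))"
        using j l ne x bead_of_simplex[OF faces_in(2)[OF X c]]
        by (intro PA_mult[of _ _ _ "hd c"] PA_bd) (auto simp: face_simps)
      from D_nk[OF X faces_in(3)[OF X c] this] j
      show ?thesis by (simp add: pd_mult pd_bd tx nk_lin)
    qed
    then have "?D (\<Sum>j\<in>{1..k}. nk (x * ?F j) (rear j c)) = (\<Sum>j\<in>{1..k}. nk (pd x * ?F j) (rear j c) + sg m (nk (x * dbd (front j c)) (rear j c))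
      + sg (m + (j - 1)) (\<Sum>i\<in>{1..<k-j}. sg i (nk (x * ?F j) (omit i (rear j c))))
      + sg (m + (j - 1)) (\<Sum>i\<in>{1..k-j}. nk (x * ?F j * bd (front i (rear j c))) (rear i (rear j c)))
      - (\<Sum>i<k-j. sg ((m + (j - 1) + i) * (k - j - i)) (nk (bd (rear i (rear j c)) * (x * ?F j)) (front i (rear j c)))))"
      by (simp add: lin_sum[OF necklace_diff_lin])
    then show ?thesis
      unfolding P2_def U0_def U1_def U2_def U3_def
      by (simp only: sg_add sg_diff sg_sum sum.distrib sum_subtractf sg_sg ac_simps)
  qed
  have D4: "?D (\<Sum>j<k. sg ((m + j) * (k - j)) (nk (?R j * x) (front j c))) = V0 - P3 + V1 + V2 - V3"
  proof -
    have "sg ((m + j) * (k - j)) (?D (nk (?R j * x) (front j c))) =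
      sg ((m + j) * (k - j)) (nk (dbd (rear j c) * x) (front j c))
      - sg ((m + 1 + j) * (k - j)) (nk (?R j * pd x) (front j c))
      + sg ((m + j) * (k - j)) (sg (m + (k - j - 1)) (\<Sum>i\<in>{1..<j}. sg i (nk (?R j * x) (omit i (front j c)))))
      + sg ((m + j) * (k - j)) (sg (m + (k - j - 1)) (\<Sum>i\<in>{1..j}. nk (?R j * x * bd (front i (front j c))) (rear i (front j c))))
      - sg ((m + j) * (k - j)) (\<Sum>i<j. sg ((m + (k - j - 1) + i) * (j - i)) (nk (bd (rear i (front j c)) * (?R j * x)) (front i (front j c))))"
      if j: "j < k" for j
    proof -
      have "?R j * x \<in> PA (beads X) (last (front j c)) (hd (front j c)) (k - j - 1 + m)"
        using j l ne x bead_of_simplex[OF faces_in(3)[OF X c]]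
        by (intro PA_mult[of _ _ _ "last c"] PA_bd) (auto simp: face_simps sdim_def)
      then have R: "?R j * x \<in> PA (beads X) (last (front j c)) (hd (front j c)) (m + (k - j - 1))"
        by (simp add: ac_simps)
      have s: "sg ((m + j) * (k - j)) (sg (sdim (rear j c) - 1) y) = - sg ((m + 1 + j) * (k - j)) y"
        for y :: "'a necklace \<Rightarrow>\<^sub>0 'r"
        using j l by (auto simp: sg_def sdim_rear) (auto simp: sdim_def)
      show ?thesis
        unfolding D_nk[OF X faces_in(2)[OF X c less_imp_le[OF j]] R]
        by (simp only: pd_mult pd_bd tau_bd nk_lin sg_add sg_diff sg_mult_left s diff_conv_add_uminus sg_uminus)
    qed
    then have "?D (\<Sum>j<k. sg ((m + j) * (k - j)) (nk (?R j * x) (front j c))) = (\<Sum>j<k.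
      sg ((m + j) * (k - j)) (nk (dbd (rear j c) * x) (front j c))
      - sg ((m + 1 + j) * (k - j)) (nk (?R j * pd x) (front j c))
      + sg ((m + j) * (k - j)) (sg (m + (k - j - 1)) (\<Sum>i\<in>{1..<j}. sg i (nk (?R j * x) (omit i (front j c)))))
      + sg ((m + j) * (k - j)) (sg (m + (k - j - 1)) (\<Sum>i\<in>{1..j}. nk (?R j * x * bd (front i (front j c))) (rear i (front j c))))
      - sg ((m + j) * (k - j)) (\<Sum>i<j. sg ((m + (k - j - 1) + i) * (j - i)) (nk (bd (rear i (front j c)) * (?R j * x)) (front i (front j c)))))"
      by (simp add: lin_sum[OF necklace_diff_lin] lin_sg[OF necklace_diff_lin])
    then show ?thesis
      unfolding P3_def V0_def V1_def V2_def V3_def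
      by (simp only: sg_sum sum.distrib sum_subtractf sg_sg add.assoc)
  qed
  have Q1: "Q1 = 0"
  proof -
    have "Q1 = (\<Sum>j\<in>{1..<k}. \<Sum>i\<in>{1..k-2}. sg (j + i) (nk x (omit i (omit j c))))"
      unfolding Q1_def by (intro sum.cong refl) auto
    also have "\<dots> = (\<Sum>j\<in>{1..<k}. \<Sum>i\<in>{1..<j}. sg (j + i) (nk x (omit i (omit j c))))
       + (\<Sum>j\<in>{1..<k}. \<Sum>i\<in>{j..k-2}. sg (j + i) (nk x (omit i (omit j c))))"
      unfolding sum.distrib[symmetric]
      by (intro sum.cong refl, subst sum.union_disjoint[symmetric]) (auto intro!: sum.cong)
    also have "(\<Sum>j\<in>{1..<k}. \<Sum>i\<in>{j..k-2}. sg (j + i) (nk x (omit i (omit j c))))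
       = (\<Sum>j\<in>{1..<k}. \<Sum>i\<in>{1..<j}. sg (i + (j - 1)) (nk x (omit (j - 1) (omit i c))))"
      by (simp add: sum.Sigma)
        (rule sum.reindex_bij_witness[of _ "\<lambda>(j, i). (i, j - 1)" "\<lambda>(j, i). (i + 1, j)"]; auto)
    also have "\<dots> = - (\<Sum>j\<in>{1..<k}. \<Sum>i\<in>{1..<j}. sg (j + i) (nk x (omit i (omit j c))))"
      unfolding sum_negf[symmetric]
      by (intro sum.cong refl) (auto intro!: sg_minus_cong simp: omit_omit l)
    finally show ?thesis by simp
  qed
  have dF: "nk (x * dbd (front j c)) (rear j c) =
     (\<Sum>i\<in>{1..<j}. sg i (nk (x * ?F i * bd (front (j - i) (rear i c))) (rear j c)))
     - (\<Sum>i\<in>{1..<j}. sg i (nk (x * bd (omit i (front j c))) (rear j c)))" if "j \<le> k" for j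
    using that l
    by (simp add: dbd_def sdim_front sum_distrib_left nk_lin right_diff_distrib sg_diff sum_subtractf
        front_front rear_front mult.assoc)
  have dR: "nk (dbd (rear j c) * x) (front j c) =
     (\<Sum>i\<in>{1..<k-j}. sg i (nk (bd (front i (rear j c)) * ?R (i + j) * x) (front j c)))
     - (\<Sum>i\<in>{1..<k-j}. sg i (nk (bd (omit i (rear j c)) * x) (front j c)))" if "j \<le> k" for j
    using that l
    by (simp add: dbd_def sdim_rear sum_distrib_right nk_lin left_diff_distrib sg_diff sum_subtractf
        rear_rear mult.assoc) (simp add: sdim_def)
  have QU: "Q2 + U0 + U1 + U2 = 0"
  proof -
    have "Q2 = - U1 + (\<Sum>j\<in>{1..k}. \<Sum>i\<in>{1..<j}. sg i (nk (x * bd (omit i (front j c))) (rear j c)))"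
      unfolding Q2_def U1_def sum_square sum_triangle sum_negf[symmetric]
      by (intro arg_cong2[where f = "(+)"] sum.cong refl)
        (auto intro!: sg_minus_cong simp: front_omit_less rear_omit_less front_omit_ge rear_omit_ge l)
    moreover have "U0 = - U2 - (\<Sum>j\<in>{1..k}. \<Sum>i\<in>{1..<j}. sg i (nk (x * bd (omit i (front j c))) (rear j c)))"
      unfolding U0_def U2_def sum_triangle
      by (simp add: dF sum_subtractf sum_negf[symmetric])
        (intro sum.cong refl; auto intro!: sg_minus_cong simp: rear_rear)
    ultimately show ?thesis by simp
  qed
  have QV: "sg m Q3 + V0 + V1 = V3"
  proof -
    have "sg m Q3 = (\<Sum>j\<in>{1..<k}. \<Sum>i<j. sg ((m + i) * (k - i) + (j - i)) (nk (bd (omit (j - i) (rear i c)) * x) (front i c))) - V1"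
      unfolding Q3_def V1_def sum_square' sg_add sg_sum diff_conv_add_uminus sum_negf[symmetric] sg_sg
    proof (intro arg_cong2[where f = "(+)"] sum.cong refl, goal_cases)
      case (1 j i)
      then have "i < j" "j < k" by auto
      then obtain u v where uv: "j = Suc (i + u)" "k = Suc (j + v)" by (metis less_natE)
      show ?case using l by (auto intro!: sg_cong simp: front_omit_less rear_omit_less uv)
    next
      case (2 j i)
      then have "i < j" "j < k" by auto
      then obtain u v where uv: "j = Suc (i + u)" "k = Suc (j + v)" by (metis less_natE)
      show ?case using l by (auto intro!: sg_minus_cong sg_cong simp: front_omit_ge rear_omit_ge uv)
    qed
    moreover have "V0 = V3 - (\<Sum>j<k. \<Sum>i<j. sg ((m + i) * (k - i) + (j - i)) (nk (bd (omit (j - i) (rear i c)) * x) (front i c)))"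
    proof -
      have "V0 = (\<Sum>j<k. \<Sum>i\<in>{1..<k-j}. sg ((m + j) * (k - j) + i) (nk (bd (front i (rear j c)) * ?R (i + j) * x) (front j c)))
          - (\<Sum>j<k. \<Sum>i\<in>{1..<k-j}. sg ((m + j) * (k - j) + i) (nk (bd (omit i (rear j c)) * x) (front j c)))"
        unfolding V0_def sum_subtractf[symmetric]
        by (intro sum.cong refl) (simp add: dR sg_diff sg_sum sum_subtractf)
      also have "(\<Sum>j<k. \<Sum>i\<in>{1..<k-j}. sg ((m + j) * (k - j) + i) (nk (bd (front i (rear j c)) * ?R (i + j) * x) (front j c))) = V3"
        unfolding sum_triangle V3_def
      proof (intro sum.cong refl, goal_cases)
        case (1 j i)
        then have "i < j" "j < k" by auto
        then obtain u v where uv: "j = Suc (i + u)" "k = Suc (j + v)" by (metis less_natE)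
        show ?case using l by (auto intro!: sg_cong simp: front_front rear_front uv mult.assoc add.commute[of u i])
      qed
      finally show ?thesis unfolding sum_triangle .
    qed
    moreover have "(\<Sum>j<k. \<Sum>i<j. f j i) = (\<Sum>j\<in>{1..<k}. \<Sum>i<j. f j i)" for f :: "nat \<Rightarrow> nat \<Rightarrow> 'a necklace \<Rightarrow>\<^sub>0 'r"
      by (rule sum.mono_neutral_right) (auto simp: not_le)
    ultimately show ?thesis by simp
  qed
  have UV: "sg m U3 + V2 = 0"
  proof -
    have "V2 = - sg m U3"
      unfolding V2_def U3_def sum_triangle sg_sum sum_negf[symmetric] sg_sg
    proof (intro sum.cong refl, goal_cases)
      case (1 j i)
      then have "i \<le> j" "j < k" "1 \<le> i" by auto
      then obtain u v i' where uv: "j = i + u" "k = Suc (j + v)" "i = Suc i'"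
        by (metis le_Suc_ex less_natE One_nat_def not0_implies_Suc not_one_le_zero)
      show ?case using l by (auto intro!: sg_minus_cong sg_cong simp: front_front rear_front rear_rear uv mult.assoc add.commute[of u i'])
    qed
    then show ?thesis by simp
  qed
  have "?D (?D (nk x c)) = (- sg m P1 - sg m P2 - P3) + sg m (P1 + sg m Q1 + sg m Q2 - Q3)
     + sg m (P2 + sg m U0 + sg m U1 + sg m U2 - U3) - (V0 - P3 + V1 + V2 - V3)"
    unfolding D_nk[OF X c x] by (simp only: lin_add[OF necklace_diff_lin] lin_diff[OF necklace_diff_lin] lin_sg[OF necklace_diff_lin] D1 D2 D3 D4)
  also have "\<dots> = Q1 + (Q2 + U0 + U1 + U2) - (sg m Q3 + V0 + V1 - V3) - (sg m U3 + V2)"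
    by (simp add: sg_add sg_diff) (simp add: sg_def)
  also have "\<dots> = 0" unfolding Q1 QU QV UV by simp
  finally show ?thesis .
qed

lemma D_D:
  assumes "abstract_simplicial_complex X" "z \<in> necklace_chains X n"
  shows "necklace_diff (necklace_diff z) = 0"
  using assms(2) by (induction rule: necklace_chains_induct)
    (auto simp: lin_simps[OF necklace_diff_lin] D_D_nk[OF assms(1)])

section \<open>The augmentation to simplicial chains\<close>

definition au :: "('a, 'r::comm_ring_1) walg \<Rightarrow> 'r" where
  "au x = Poly_Mapping.lookup (aug x) 0"

lemma aug_au: "aug x = scale (au x) 1"
proof (rule lin_eq[of aug "\<lambda>x. scale (au x) 1" x])
  show "lin (\<lambda>x. scale (au x) 1)"
    by (rule linI) (auto simp: au_def lin_simps[OF lin_aug] lookup_add lookup_scale scale_add_left)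
  show "aug (basis w) = scale (au (basis w)) (1 :: ('a, 'b) walg)" for w
    by (simp add: au_def) (simp add: aug_def)
qed (rule lin_aug)

lemma au_add: "au (x + y) = au x + au y"
  and au_scale: "au (scale c x) = c * au x"
  and au_zero [simp]: "au 0 = 0"
  and au_1 [simp]: "au 1 = 1"
  by (simp_all add: au_def lin_simps[OF lin_aug] lookup_add lookup_scale aug_1)

lemma au_mult: "au (x * y) = au x * au y"
  by (simp add: au_def aug_mult) (simp add: aug_au scale_mult mult_single)

lemma au_bd: "au (bd x) = (if sdim x \<le> 1 then 1 else 0)"
  by (simp add: au_def aug_bd)

lemma au_pd [simp]: "au (pd x) = 0"
  by (simp add: au_def aug_pd)

lemma PA_au: "x \<in> PA B a b n \<Longrightarrow> n > 0 \<Longrightarrow> au x = 0"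
  by (simp add: au_def PA_aug)

definition neck_aug :: "('a necklace \<Rightarrow>\<^sub>0 'r) \<Rightarrow> ('a list \<Rightarrow>\<^sub>0 'r::comm_ring_1)" where
  "neck_aug = lin_ext (\<lambda>(p, c). if pdeg p = 0 then basis c else 0)"

lemma lin_neck_aug: "lin neck_aug"
  by (simp add: neck_aug_def lin_lin_ext)

lemma neck_aug_nk: "neck_aug (nk x c) = scale (au x) (basis c)"
proof (rule lin_eq[of "\<lambda>x. neck_aug (nk x c)" "\<lambda>x. scale (au x) (basis c)" x])
  show "lin (\<lambda>x. scale (au x) (basis c :: _ \<Rightarrow>\<^sub>0 'b))"
    by (rule linI) (simp_all add: au_add au_scale scale_add_left)
  show "neck_aug (nk (basis w) c) = scale (au (basis w)) (basis c :: _ \<Rightarrow>\<^sub>0 'b)" for w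
    by (auto simp: nk_def neck_aug_def au_def aug_def pdeg_def wdeg_def)
qed (rule lin_compose[OF lin_neck_aug lin_nk])

lemma lin_boundary: "lin simplicial_boundary"
  by (simp add: simplicial_boundary_def lin_lin_ext)

lemma boundary_basis:
  "simplicial_boundary (basis c) = (if sdim c = 0 then 0 else \<Sum>j\<le>sdim c. sg j (basis (omit j c)))"
  by (simp add: simplicial_boundary_def scale_sign)

text \<open>In positive word degree both sides vanish, differentials having augmentation 0. In
  degree 0 only a moved edge survives in the two splitting sums: the initial edge gives the face
  opposite to the first vertex, the final edge the one opposite to the last, and the middle term of
  D gives the inner faces.\<close>

lemma neck_aug_D_nk:
  assumes X: "abstract_simplicial_complex X" and c: "c \<in> simplices X k"
    and x: "x \<in> PA (beads X) (last c) (hd c) m"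
  shows "neck_aug (necklace_diff (nk x c)) = simplicial_boundary (neck_aug (nk x c))"
proof (cases "m = 0 \<and> k > 0")
  case False
  have k: "sdim c = k" "length c = Suc k" using c by (auto simp: simplices_sdim simplices_iff)
  show ?thesis
    unfolding D_nk[OF X c x]
    using False PA_au[OF x]
    by (auto simp: lin_simps[OF lin_neck_aug] lin_sg[OF lin_neck_aug] neck_aug_nk au_mult
        lin_simps[OF lin_boundary] boundary_basis k)
next
  case True
  have k: "sdim c = k" "length c = Suc k" using c by (auto simp: simplices_sdim simplices_iff)
  obtain l where l: "k = Suc l" using True by (cases k) auto
  have "(\<Sum>j\<in>{1..k}. scale (au (x * bd (front j c))) (basis (rear j c))) = (\<Sum>j\<in>{1..k}. if j = 1 then scale (au x) (basis (omit 0 c)) else 0)"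
    using k by (intro sum.cong refl) (auto simp: au_mult au_bd sdim_front rear_def omit_def One_nat_def)
  then have 1: "(\<Sum>j\<in>{1..k}. scale (au (x * bd (front j c))) (basis (rear j c))) = scale (au x) (basis (omit 0 c))"
    using True by (simp add: sum.delta)
  have "(\<Sum>j<k. sg ((m + j) * (k - j)) (scale (au (bd (rear j c) * x)) (basis (front j c))))
    = (\<Sum>j<k. if j = l then sg l (scale (au x) (basis (omit k c))) else 0)"
  proof (intro sum.cong refl)
    fix j assume j: "j \<in> {..<k}"
    then have "sdim (rear j c) \<le> 1 \<longleftrightarrow> j = l" using k l by (auto simp: sdim_rear)
    then show "sg ((m + j) * (k - j)) (scale (au (bd (rear j c) * x)) (basis (front j c))) =
      (if j = l then sg l (scale (au x) (basis (omit k c))) else 0)"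
      using True l k by (auto simp: au_mult au_bd front_def omit_def)
  qed
  then have 2: "(\<Sum>j<k. sg ((m + j) * (k - j)) (scale (au (bd (rear j c) * x)) (basis (front j c))))
    = - sg k (scale (au x) (basis (omit k c)))"
    using l by (simp add: sum.delta)
  have "{..k} = insert 0 (insert k {1..<k})" using True by auto
  then have 3: "(\<Sum>j\<le>k. sg j (basis (omit j c) :: _ \<Rightarrow>\<^sub>0 'b)) = basis (omit 0 c) + sg k (basis (omit k c))
     + (\<Sum>j\<in>{1..<k}. sg j (basis (omit j c)))"
    using True by simp
  have m0: "sg m y = y" for y :: "'a list \<Rightarrow>\<^sub>0 'b"
    using True by simp
  have k0: "k \<noteq> 0" using True by simp
  show ?thesis
    unfolding D_nk[OF X c x]
    by (simp add: lin_simps[OF lin_neck_aug] lin_sg[OF lin_neck_aug] neck_aug_nk 1 2 m0 k0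
        lin_simps[OF lin_boundary] boundary_basis k 3 scale_sum scale_sg)
qed

lemma neck_aug_D:
  assumes "abstract_simplicial_complex X" "z \<in> necklace_chains X n"
  shows "neck_aug (necklace_diff z) = simplicial_boundary (neck_aug z)"
  using assms(2) by (induction rule: necklace_chains_induct)
    (auto simp: lin_simps[OF necklace_diff_lin] lin_simps[OF lin_neck_aug] lin_simps[OF lin_boundary]
      neck_aug_D_nk[OF assms(1)])

lemma nc_simps [simp]: "0 \<in> necklace_chains X n"
  and nc_add: "x \<in> necklace_chains X n \<Longrightarrow> y \<in> necklace_chains X n \<Longrightarrow> x + y \<in> necklace_chains X n"
  and nc_diff: "x \<in> necklace_chains X n \<Longrightarrow> y \<in> necklace_chains X n \<Longrightarrow> x - y \<in> necklace_chains X n"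
  and nc_sg: "x \<in> necklace_chains X n \<Longrightarrow> sg m x \<in> necklace_chains X n"
  and nc_uminus: "x \<in> necklace_chains X n \<Longrightarrow> - x \<in> necklace_chains X n"
  by (auto simp: necklace_chains_def span_on_add span_on_diff span_on_sg span_on_uminus)

lemma nc_sum: "(\<And>i. i \<in> I \<Longrightarrow> f i \<in> necklace_chains X n) \<Longrightarrow> sum f I \<in> necklace_chains X n"
  unfolding necklace_chains_def by (rule span_on_sum)

lemma nc_mono: "x \<in> necklace_chains X n \<Longrightarrow> X \<subseteq> Y \<Longrightarrow> x \<in> necklace_chains Y n"
  unfolding necklace_chains_def
  by (erule span_on_mono)
    (auto simp: necklaces_def paths_def simplices_def dest: subsetD[OF beads_mono])

lemma PA_pd_0: "x \<in> PA B a b 0 \<Longrightarrow> pd x = 0"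
proof (erule PA_eq[OF _ lin_pd lin_const0])
  fix ws :: "'a list list" assume ws: "(\<Sum>x\<leftarrow>ws. sdim x - 1) = 0"
  then show "pd (wd ws) = (0 :: ('a, 'b) walg)"
  proof (induction ws)
    case (Cons y ws)
    then show ?case by (subst wd_Cons) (simp add: pd_mult pd_bd_edge)
  qed simp
qed

lemma D_nk_in:
  assumes X: "abstract_simplicial_complex X" and c: "c \<in> simplices X k"
    and x: "x \<in> PA (beads X) (last c) (hd c) m"
  shows "necklace_diff (nk x c) \<in> necklace_chains X (m + k - 1)"
    and "m + k = 0 \<Longrightarrow> necklace_diff (nk x c) = 0"
proof -
  have k: "length c = Suc k" "c \<noteq> []" using c by (auto simp: simplices_iff)
  have "nk (pd x) c \<in> necklace_chains X (m + k - 1)"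
  proof (cases m)
    case 0
    then show ?thesis using PA_pd_0[of x] x by (simp add: nk_lin)
  next
    case (Suc l)
    then show ?thesis using PA_pd[OF X x] by (intro nk_in[OF X c]) auto
  qed
  moreover have "nk x (omit j c) \<in> necklace_chains X (m + k - 1)" if "j \<in> {1..<k}" for j
    using that x k by (intro nk_in[OF X faces_in(1)[OF X c]]) (auto simp: face_simps)
  moreover have "nk (x * bd (front j c)) (rear j c) \<in> necklace_chains X (m + k - 1)" if "j \<in> {1..k}" for j
    using that x k bead_of_simplex[OF faces_in(2)[OF X c]]
    by (intro nk_in[OF X faces_in(3)[OF X c], where m = "m + (j - 1)"] PA_mult[of _ _ _ "hd c"] PA_bd)
      (auto simp: face_simps)
  moreover have "nk (bd (rear j c) * x) (front j c) \<in> necklace_chains X (m + k - 1)" if "j < k" for j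
    using that x k bead_of_simplex[OF faces_in(3)[OF X c]]
    by (intro nk_in[OF X faces_in(2)[OF X c], where m = "k - j - 1 + m"] PA_mult[of _ _ _ "last c"] PA_bd)
      (auto simp: face_simps sdim_def)
  ultimately show "necklace_diff (nk x c) \<in> necklace_chains X (m + k - 1)"
    unfolding D_nk[OF X c x] by (intro nc_add nc_diff nc_sg nc_sum) auto
  show "m + k = 0 \<Longrightarrow> necklace_diff (nk x c) = 0"
    unfolding D_nk[OF X c x] using PA_pd_0[of x] x by (simp add: nk_lin)
qed

lemma D_in:
  assumes "abstract_simplicial_complex X" "z \<in> necklace_chains X n"
  shows "necklace_diff z \<in> necklace_chains X (n - 1)"
  using assms(2) by (induction rule: necklace_chains_induct)
    (auto simp: lin_simps[OF necklace_diff_lin] nc_add dest: D_nk_in[OF assms(1)])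

lemma D_zero:
  assumes "abstract_simplicial_complex X" "z \<in> necklace_chains X 0"
  shows "necklace_diff z = 0"
  using assms(2) by (induction rule: necklace_chains_induct)
    (auto simp: lin_simps[OF necklace_diff_lin] D_nk_in(2)[OF assms(1)])

section \<open>Coefficients at a marked bead\<close>

text \<open>The starting vertex of the path may be dropped: in a necklace it is the last vertex of
  the marked bead.\<close>

definition coef :: "'a list \<Rightarrow> ('a necklace \<Rightarrow>\<^sub>0 'r) \<Rightarrow> ('a, 'r::comm_ring_1) walg" where
  "coef c = lin_ext (\<lambda>(p, c'). if c' = c then wd (snd p) else 0)"

lemma lin_coef: "lin (coef c)"
  by (simp add: coef_def lin_lin_ext)

lemmas coef_lin = lin_simps[OF lin_coef] lin_sg[OF lin_coef]

lemma coef_nk: "coef c (nk x c') = (if c' = c then x else 0)"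
proof (rule lin_eq[of "\<lambda>x. coef c (nk x c')" "\<lambda>x. if c' = c then x else 0" x])
  show "lin (\<lambda>x :: ('a, 'b) walg. if c' = c then x else 0)"
    by (auto simp: lin_def)
  show "coef c (nk (basis w) c') = (if c' = c then basis w else 0 :: ('a, 'b) walg)" for w
    by (auto simp: nk_def coef_def wd_def)
qed (rule lin_compose[OF lin_coef lin_nk])

lemma nc_expand:
  assumes "z \<in> necklace_chains X n"
  obtains S where "finite S" "S \<subseteq> (\<Union>k\<le>n. simplices X k)" "(\<Sum>c\<in>S. nk (coef c z) c) = z"
    "\<And>c. c \<notin> S \<Longrightarrow> coef c z = 0"
    "\<And>c k. c \<in> S \<Longrightarrow> c \<in> simplices X k \<Longrightarrow> coef c z \<in> PA (beads X) (last c) (hd c) (n - k)"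
proof -
  have "\<exists>S. finite S \<and> S \<subseteq> (\<Union>k\<le>n. simplices X k) \<and> (\<Sum>c\<in>S. nk (coef c z) c) = z \<and> (\<forall>c. c \<notin> S \<longrightarrow> coef c z = 0) \<and>
    (\<forall>c k. c \<in> simplices X k \<longrightarrow> coef c z \<in> PA (beads X) (last c) (hd c) (n - k))"
    using assms
  proof (induction rule: necklace_chains_induct)
    case zero
    then show ?case by (intro exI[of _ "{}"]) (auto simp: coef_lin)
  next
    case (add x y)
    then obtain S T where S: "finite S" "S \<subseteq> (\<Union>k\<le>n. simplices X k)" "(\<Sum>c\<in>S. nk (coef c x) c) = x" "\<forall>c. c \<notin> S \<longrightarrow> coef c x = 0"
      and T: "finite T" "T \<subseteq> (\<Union>k\<le>n. simplices X k)" "(\<Sum>c\<in>T. nk (coef c y) c) = y" "\<forall>c. c \<notin> T \<longrightarrow> coef c y = 0"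
      by blast
    have "(\<Sum>c\<in>S \<union> T. nk (coef c x) c) = (\<Sum>c\<in>S. nk (coef c x) c)"
      by (rule sum.mono_neutral_right) (use S(1,4) T(1) in \<open>auto simp: nk_lin\<close>)
    moreover have "(\<Sum>c\<in>S \<union> T. nk (coef c y) c) = (\<Sum>c\<in>T. nk (coef c y) c)"
      by (rule sum.mono_neutral_right) (use T(1,4) S(1) in \<open>auto simp: nk_lin\<close>)
    ultimately have "(\<Sum>c\<in>S \<union> T. nk (coef c (x + y)) c) = x + y"
      by (simp only: lin_add[OF lin_coef] lin_add[OF lin_nk] sum.distrib S(3) T(3))
    moreover have "\<forall>c. c \<notin> S \<union> T \<longrightarrow> coef c (x + y) = 0" using S(4) T(4) by (simp add: coef_lin)
    moreover have "\<forall>c k. c \<in> simplices X k \<longrightarrow> coef c (x + y) \<in> PA (beads X) (last c) (hd c) (n - k)"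
      using add by (auto simp: coef_lin intro!: PA_add)
    ultimately show ?case
      using S(1,2) T(1,2) by (intro exI[of _ "S \<union> T"] conjI) (simp_all only: finite_Un Un_least)
  next
    case (nk x c k m)
    then show ?case
      by (intro exI[of _ "{c}"]) (auto simp: coef_nk simplices_iff)
  qed
  then show ?thesis using that by blast
qed

text \<open>Every term of D except the differential of the word shortens the marked bead. On the
  largest marked beads D is therefore the path differential, which makes inductions on the dimension
  of the marked bead possible.\<close>

lemma coef_D:
  assumes X: "abstract_simplicial_complex X" and z: "z \<in> necklace_chains X n" and c: "c \<in> simplices X k"
    and top: "\<And>c' k'. c' \<in> simplices X k' \<Longrightarrow> k' > k \<Longrightarrow> coef c' z = 0"
  shows "coef c (necklace_diff z) = pd (coef c z)"
proof -
  obtain S where S: "finite S" "S \<subseteq> (\<Union>k\<le>n. simplices X k)" "(\<Sum>c\<in>S. nk (coef c z) c) = z"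
    "\<And>c. c \<notin> S \<Longrightarrow> coef c z = 0"
    "\<And>c k. c \<in> S \<Longrightarrow> c \<in> simplices X k \<Longrightarrow> coef c z \<in> PA (beads X) (last c) (hd c) (n - k)"
    by (rule nc_expand[OF z]) (rule that)
  have "coef c (necklace_diff (nk (coef c' z) c')) = (if c' = c then pd (coef c z) else 0)" if c': "c' \<in> S" for c'
  proof -
    obtain k' where k': "c' \<in> simplices X k'" using S(2) c' by auto
    show ?thesis
    proof (cases "k' > k")
      case True
      then have "coef c' z = 0" "c' \<noteq> c" using top k' c by (auto simp: simplices_iff)
      then show ?thesis by (simp add: nk_lin lin_zero[OF necklace_diff_lin] coef_lin)
    next
      case False
      have ne: "omit j c' \<noteq> c" "rear (Suc j) c' \<noteq> c" "front j c' \<noteq> c" if "j < k'" for j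
        using that False c k' length_omit[of j c'] length_rear[of "Suc j" c'] length_front[of j c']
        by (auto simp: simplices_iff)
      have "rear j c' \<noteq> c" if "1 \<le> j" "j \<le> k'" for j
        using ne(2)[of "j - 1"] that by auto
      with ne show ?thesis
        unfolding D_nk[OF X k' S(5)[OF c' k']]
        by (auto simp: coef_lin coef_nk)
    qed
  qed
  then have "coef c (necklace_diff z) = (\<Sum>c'\<in>S. if c' = c then pd (coef c z) else 0)"
    by (subst S(3)[symmetric]) (simp add: lin_sum[OF necklace_diff_lin] lin_sum[OF lin_coef])
  also have "\<dots> = pd (coef c z)"
    using S(1) S(4)[of c] by (auto simp: sum.delta lin_zero[OF lin_pd])
  finally show ?thesis .
qed

lemma lookup_neck_aug:
  assumes "z \<in> necklace_chains X n"
  shows "Poly_Mapping.lookup (neck_aug z) c = au (coef c z)"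
  using assms
proof (induction rule: necklace_chains_induct)
  case (nk x c' k m)
  then show ?case
    by (auto simp: neck_aug_nk coef_nk scale_basis lookup_single when_def)
qed (auto simp: lin_simps[OF lin_neck_aug] coef_lin lookup_add au_add)

section \<open>Cycles in the necklace complex of a simplex\<close>

text \<open>Tree paths are products of edges and inverse edges; \<open>y\<close> is the reversed
  path.\<close>

lemma tree_path_inverse:
  assumes c: "sorted_wrt (<) c" and b: "b < length c" and i: "i < length c"
  obtains y :: "('a::linorder, 'r::comm_ring_1) walg" where "y \<in> PA (beads (full c)) (c ! i) (c ! b) 0"
    "y * tree_path c b i = 1"
proof -
  have "i < length c \<Longrightarrow> \<exists>y :: ('a, 'r) walg. y \<in> PA (beads (full c)) (c ! i) (c ! b) 0 \<and> y * tree_path c b i = 1"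
  proof (induction "b - i" arbitrary: i)
    case 0
    show ?case
    proof (cases "i = b")
      case True
      then show ?thesis by (subst tree_path.simps) (auto intro!: exI[of _ 1] PA_1)
    next
      case False
      then show ?thesis
        using 0 c b by (subst tree_path.simps)
          (auto intro!: exI[of _ "bd [c ! i, c ! b]"] PA_bd bead_full_rev simp: sorted_nth_less_iff sdim_def bd_inverse2)
    qed
  next
    case (Suc n)
    have "\<exists>y :: ('a, 'r) walg. y \<in> PA (beads (full c)) (c ! Suc i) (c ! b) 0 \<and> y * tree_path c b (Suc i) = 1"
      by (rule Suc.hyps(1)) (use Suc b in auto)
    then obtain y :: "('a, 'r) walg" where y: "y \<in> PA (beads (full c)) (c ! Suc i) (c ! b) 0" "y * tree_path c b (Suc i) = 1"
      by blast
    have "bd [c ! i, c ! Suc i] * y \<in> PA (beads (full c)) (c ! i) (c ! b) (0 + 0)"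
      using y Suc b c by (intro PA_mult[of _ _ _ "c ! Suc i"] PA_bd bead_full)
        (auto simp: sdim_def sorted_nth_less_iff)
    moreover have "bd [c ! i, c ! Suc i] * y * tree_path c b i = 1"
    proof -
      have "tree_path c b i = (tree_path c b (Suc i) * bd [c ! Suc i, c ! i] :: ('a, 'r) walg)"
        using Suc.hyps(2) by (subst tree_path.simps) auto
      then have "bd [c ! i, c ! Suc i] * y * tree_path c b i
          = bd [c ! i, c ! Suc i] * ((y * tree_path c b (Suc i)) * bd [c ! Suc i, c ! i])"
        by (simp only: mult.assoc)
      then show ?thesis by (simp add: y(2) bd_inverse2)
    qed
    ultimately show ?case by auto
  qed
  then show ?thesis using i that by auto
qed

lemma simplices_full_nth:
  assumes "c \<in> simplices (full c0) k"
  shows "\<exists>i<length c0. last c = c0 ! i" "\<exists>i<length c0. hd c = c0 ! i"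
proof -
  have "c \<noteq> []" "set c \<subseteq> set c0" using assms by (auto simp: simplices_iff full_def)
  then show "\<exists>i<length c0. last c = c0 ! i" "\<exists>i<length c0. hd c = c0 ! i"
    using last_in_set[of c] hd_in_set[of c] by (metis in_set_conv_nth subsetD)+
qed

text \<open>Descending through the dimension of the marked bead, the top coefficient is a cycle of
  augmentation 0 and is killed by some contraction. The homotopy identity for it reduces to
  \<open>tree_path * coef = 0\<close>, and the tree path is invertible. The base enters at each bead
  separately, so it may depend on the bead.\<close>

lemma cycle_eq_0:
  assumes c0: "sorted_wrt (<) c0" and z: "z \<in> necklace_chains (full c0) n"
    and D: "necklace_diff z = 0" and E: "neck_aug z = 0"
    and kill: "\<And>c k. c \<in> simplices (full c0) k \<Longrightarrow> \<exists>b<length c0. ctr c0 b (coef c z) = 0"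
  shows "z = (0 :: 'a::linorder necklace \<Rightarrow>\<^sub>0 'r::comm_ring_1)"
proof -
  obtain S where S: "finite S" "S \<subseteq> (\<Union>k\<le>n. simplices (full c0) k)" "(\<Sum>c\<in>S. nk (coef c z) c) = z"
    "\<And>c. c \<notin> S \<Longrightarrow> coef c z = 0"
    "\<And>c k. c \<in> S \<Longrightarrow> c \<in> simplices (full c0) k \<Longrightarrow> coef c z \<in> PA (beads (full c0)) (last c) (hd c) (n - k)"
    by (rule nc_expand[OF z]) (rule that)
  \<comment> \<open>Downward induction phrased upwards: for \<open>l = 0\<close> the bead dimension
    exceeds the degree \<open>n\<close>, and raising \<open>l\<close> admits beads one dimension
    lower.\<close>
  have "\<forall>c. c \<in> simplices (full c0) k \<longrightarrow> n < k + l \<longrightarrow> coef c z = 0" for k l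
  proof (induction l arbitrary: k)
    case 0
    then show ?case
    proof (intro allI impI)
      fix c assume c: "c \<in> simplices (full c0) k" "n < k + 0"
      have "c \<notin> S"
        using S(2) c by (fastforce simp: simplices_iff)
      then show "coef c z = 0" by (rule S(4))
    qed
  next
    case (Suc l)
    show ?case
    proof (intro allI impI)
      fix c assume c: "c \<in> simplices (full c0) k" "n < k + Suc l"
      have "coef c' z = 0" if "c' \<in> simplices (full c0) k'" "k' > k" for c' k'
        using Suc[of k'] that c by auto
      then have p: "pd (coef c z) = 0"
        using coef_D[OF asc_full z c(1)] D by (simp add: coef_lin)
      obtain b where b: "b < length c0" "ctr c0 b (coef c z) = 0" using kill[OF c(1)] by blast
      have a: "aug (coef c z) = 0"
        using lookup_neck_aug[OF z, of c] E by (simp add: aug_au)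
      have P: "coef c z \<in> PA (beads (full c0)) (last c) (hd c) (n - k)"
        using S(4,5) c(1) by (cases "c \<in> S") auto
      obtain i where i: "i < length c0" "last c = c0 ! i"
        using simplices_full_nth[OF c(1)] by auto
      have t: "tree_path c0 b i * coef c z = 0"
        using contraction[OF c0 b(1) P] by (simp add: b(2) p a lin_simps[OF lin_pd] lin_simps[OF lin_ctr] i pos_nth[OF c0])
      obtain y :: "('a, 'r) walg" where "y * tree_path c0 b i = 1"
        using tree_path_inverse[OF c0 b(1) i(1), where 'r = 'r] by blast
      then have "coef c z = y * (tree_path c0 b i * coef c z)"
        by (simp add: mult.assoc[symmetric])
      then show "coef c z = 0" by (simp add: t)
    qed
  qed
  note zero = this
  have "coef c z = 0" if c: "c \<in> S" for c
  proof -
    obtain k where "c \<in> simplices (full c0) k" using subsetD[OF S(2) c] by auto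
    then show ?thesis using zero[of k "Suc n"] by auto
  qed
  then show ?thesis by (subst S(3)[symmetric]) (simp add: nk_lin)
qed

text \<open>The number \<open>m\<close> bounds the dimension of the marked beads that occur. The
  coefficients in the top dimension are cycles of augmentation 0, hence boundaries by the
  contraction; subtracting D of their fillings leaves a cycle with smaller marked beads. The
  fillings have positive degree and so do not disturb the augmentation.\<close>

lemma acyclic:
  assumes c0: "sorted_wrt (<) c0"
  shows "z \<in> necklace_chains (full c0) n \<Longrightarrow> necklace_diff z = 0 \<Longrightarrow> neck_aug z = 0 \<Longrightarrow>
    \<forall>c k. c \<in> simplices (full c0) k \<longrightarrow> m \<le> k \<longrightarrow> coef c z = 0 \<Longrightarrow>
    \<exists>w \<in> necklace_chains (full c0) (Suc n). neck_aug w = 0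
      \<and> necklace_diff w = (z :: 'a::linorder necklace \<Rightarrow>\<^sub>0 'r::comm_ring_1)"
proof (induction m arbitrary: z)
  case 0
  obtain S where S: "S \<subseteq> (\<Union>k\<le>n. simplices (full c0) k)" "(\<Sum>c\<in>S. nk (coef c z) c) = z"
    by (rule nc_expand[OF 0(1)])
  have "coef c z = 0" if "c \<in> S" for c
    using 0(4) subsetD[OF S(1) that] by auto
  then have "z = 0" by (subst S(2)[symmetric]) (simp add: nk_lin)
  then show ?case
    by (intro bexI[of _ 0]) (auto simp: lin_zero[OF lin_neck_aug] lin_zero[OF necklace_diff_lin])
next
  case (Suc m)
  let ?X = "full c0"
  note z = Suc.prems(1)
  obtain S where S: "finite S" "S \<subseteq> (\<Union>k\<le>n. simplices ?X k)" "(\<Sum>c\<in>S. nk (coef c z) c) = z"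
    "\<And>c. c \<notin> S \<Longrightarrow> coef c z = 0"
    "\<And>c k. c \<in> S \<Longrightarrow> c \<in> simplices ?X k \<Longrightarrow> coef c z \<in> PA (beads ?X) (last c) (hd c) (n - k)"
    by (rule nc_expand[OF z]) (rule that)
  have "\<exists>x. x \<in> PA (beads ?X) (last c) (hd c) (Suc (n - m)) \<and> pd x = coef c z"
    if c: "c \<in> simplices ?X m" "c \<in> S" for c
  proof -
    have P: "coef c z \<in> PA (beads ?X) (last c) (hd c) (n - m)" using S(5) c by auto
    have p: "pd (coef c z) = 0"
      using coef_D[OF asc_full z c(1)] Suc.prems(2,4) by (simp add: coef_lin)
    have a: "aug (coef c z) = 0"
      using lookup_neck_aug[OF z, of c] Suc.prems(3) by (simp add: aug_au)
    obtain i where i: "i < length c0" "last c = c0 ! i"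
      using simplices_full_nth[OF c(1)] by auto
    then have b: "0 < length c0" by auto
    obtain y :: "('a, 'r) walg" where y: "y \<in> PA (beads ?X) (c0 ! i) (c0 ! 0) 0" "y * tree_path c0 0 i = 1"
      using tree_path_inverse[OF c0 b i(1), where 'r = 'r] .
    have "y * ctr c0 0 (coef c z) \<in> PA (beads ?X) (last c) (hd c) (0 + Suc (n - m))"
      using PA_mult[OF y(1) PA_ctr[OF c0 b P]] by (simp add: i)
    \<comment> \<open>The contraction fills the coefficient only up to the tree path; the
      degree-zero factor \<open>y\<close> removes it and commutes with the differential.\<close>
    moreover have "pd (y * ctr c0 0 (coef c z)) = coef c z"
      using contraction[OF c0 b P] PA_pd_0[OF y(1)] PA_tau[OF y(1)] y(2)
      by (simp add: pd_mult p a lin_zero[OF lin_ctr] i pos_nth[OF c0] mult.assoc[symmetric])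
    ultimately show ?thesis by auto
  qed
  then obtain x where x: "\<And>c. c \<in> simplices ?X m \<Longrightarrow> c \<in> S \<Longrightarrow>
      x c \<in> PA (beads ?X) (last c) (hd c) (Suc (n - m)) \<and> pd (x c) = coef c z"
    by metis
  define T where "T = S \<inter> simplices ?X m"
  define w where "w = (\<Sum>c\<in>T. nk (x c) c)"
  have T: "finite T" using S by (simp add: T_def)
  have mn: "m \<le> n" if "c \<in> T" for c
    using S(2) that by (fastforce simp: T_def simplices_iff)
  have w: "w \<in> necklace_chains ?X (Suc n)"
    unfolding w_def
  proof (rule nc_sum)
    fix c assume c: "c \<in> T"
    then show "nk (x c) c \<in> necklace_chains ?X (Suc n)"
      using x[of c] mn by (intro nk_in[OF asc_full, where k = m and m = "Suc (n - m)"]) (auto simp: T_def)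
  qed
  have Ew: "neck_aug w = 0"
    unfolding w_def
    by (auto simp: lin_sum[OF lin_neck_aug] neck_aug_nk T_def PA_au[OF conjunct1[OF x]] intro!: sum.neutral)
  have cw: "coef c w = (if c \<in> T then x c else 0)" for c
    unfolding w_def using T by (auto simp: coef_lin coef_nk sum.delta)
  define z' where "z' = z - necklace_diff w"
  have z': "z' \<in> necklace_chains ?X n" unfolding z'_def
    using D_in[OF asc_full w] z by (intro nc_diff) auto
  have "\<exists>w \<in> necklace_chains ?X (Suc n). neck_aug w = 0 \<and> necklace_diff w = z'"
  proof (rule Suc.IH[OF z'])
    show "necklace_diff z' = 0"
      using D_D[OF asc_full w] Suc.prems(2) by (simp add: z'_def lin_diff[OF necklace_diff_lin])
    show "neck_aug z' = 0"
      using neck_aug_D[OF asc_full w] Ew Suc.prems(3)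
      by (simp add: z'_def lin_diff[OF lin_neck_aug] lin_zero[OF lin_boundary])
    show "\<forall>c k. c \<in> simplices ?X k \<longrightarrow> m \<le> k \<longrightarrow> coef c z' = 0"
    proof (intro allI impI)
      fix c k assume c: "c \<in> simplices ?X k" "m \<le> k"
      have "coef c (necklace_diff w) = pd (coef c w)"
        by (rule coef_D[OF asc_full w c(1)]) (use c in \<open>auto simp: cw T_def simplices_iff\<close>)
      moreover have "pd (coef c w) = coef c z"
      proof (cases "c \<in> T")
        case True
        then show ?thesis using x by (auto simp: cw T_def)
      next
        case False
        have "coef c z = 0"
        proof (cases "k = m")
          case True
          then have "c \<notin> S" using False c by (simp add: T_def)
          then show ?thesis by (rule S(4))
        qed (use Suc.prems(4) c in auto)
        then show ?thesis using False by (simp add: cw lin_zero[OF lin_pd])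
      qed
      ultimately show "coef c z' = 0" by (simp add: z'_def coef_lin)
    qed
  qed
  then obtain w' where w': "w' \<in> necklace_chains ?X (Suc n)" "neck_aug w' = 0" "necklace_diff w' = z'"
    by blast
  show ?case
    by (rule bexI[of _ "w + w'"])
      (use w w' Ew in \<open>auto simp: lin_add[OF lin_neck_aug] lin_add[OF necklace_diff_lin] z'_def intro: nc_add\<close>)
qed

section \<open>Chain maps carried by the necklace complexes of simplices\<close>

text \<open>Stated for arbitrary values \<open>h\<close> on faces, since besides the simplicial
  boundary it is applied to the values of the homotopy.\<close>

lemma boundary_boundary_sum:
  fixes h :: "'a list \<Rightarrow> 'm::ab_group_add"
  assumes "length c = Suc k" "0 < k"
  shows "(\<Sum>j\<le>k. \<Sum>i\<le>k - 1. sg (j + i) (h (omit i (omit j c)))) = 0"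
proof -
  let ?t = "\<lambda>j i. sg (j + i) (h (omit i (omit j c)))"
  have "(\<Sum>j\<le>k. \<Sum>i\<le>k - 1. ?t j i) = (\<Sum>j\<le>k. (\<Sum>i<j. ?t j i) + (\<Sum>i\<in>{j..k-1}. ?t j i))"
    using assms by (intro sum.cong refl, subst sum.union_disjoint[symmetric]) (auto intro!: sum.cong)
  also have "\<dots> = (\<Sum>j\<le>k. \<Sum>i<j. ?t j i) + (\<Sum>j\<le>k. \<Sum>i\<in>{j..k-1}. ?t j i)"
    by (rule sum.distrib)
  also have "(\<Sum>j\<le>k. \<Sum>i\<in>{j..k-1}. ?t j i) = (\<Sum>j\<le>k. \<Sum>i<j. ?t i (j - 1))"
    by (simp add: sum.Sigma)
      (rule sum.reindex_bij_witness[of _ "\<lambda>(j, i). (i, j - 1)" "\<lambda>(j, i). (i + 1, j)"]; use assms in auto)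
  also have "\<dots> = - (\<Sum>j\<le>k. \<Sum>i<j. ?t j i)"
    unfolding sum_negf[symmetric]
    by (intro sum.cong refl) (use assms in \<open>auto intro!: sg_minus_cong simp: omit_omit\<close>)
  finally show ?thesis by simp
qed

lemma boundary_boundary: "length c = Suc k \<Longrightarrow> simplicial_boundary (simplicial_boundary (basis c)) = 0"
proof (cases "k \<le> 1")
  case True
  assume c: "length c = Suc k"
  have "simplicial_boundary (basis (omit j c)) = (0 :: _ \<Rightarrow>\<^sub>0 'b)" if "j \<le> k" for j
    using that True c by (simp add: boundary_basis sdim_def length_omit)
  then show ?thesis
    using c by (auto simp: boundary_basis[of c] sdim_def lin_simps[OF lin_boundary] lin_sg[OF lin_boundary])
next
  case False
  assume c: "length c = Suc k"
  have "simplicial_boundary (simplicial_boundary (basis c)) =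
      (\<Sum>j\<le>k. sg j (simplicial_boundary (basis (omit j c) :: _ \<Rightarrow>\<^sub>0 'b)))"
    using False c by (simp add: boundary_basis[of c] sdim_def lin_sum[OF lin_boundary] lin_sg[OF lin_boundary])
  also have "\<dots> = (\<Sum>j\<le>k. \<Sum>i\<le>k - 1. sg (j + i) (basis (omit i (omit j c))))"
    using False c by (intro sum.cong refl) (simp add: boundary_basis sdim_def length_omit sg_sum)
  also have "\<dots> = 0"
    using False c by (intro boundary_boundary_sum) auto
  finally show ?thesis .
qed

lemma coef_above_degree:
  assumes z: "z \<in> necklace_chains X n" and c: "c \<in> simplices X k" "n < k"
  shows "coef c z = 0"
proof -
  obtain S where S: "finite S" "S \<subseteq> (\<Union>k\<le>n. simplices X k)" "(\<Sum>c\<in>S. nk (coef c z) c) = z"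
    "\<And>c. c \<notin> S \<Longrightarrow> coef c z = 0"
    "\<And>c k. c \<in> S \<Longrightarrow> c \<in> simplices X k \<Longrightarrow> coef c z \<in> PA (beads X) (last c) (hd c) (n - k)"
    by (rule nc_expand[OF z]) (rule that)
  have "c \<notin> S" using S(2) c by (fastforce simp: simplices_iff)
  then show ?thesis by (rule S(4))
qed

lemma full_omit: "full (omit j c) \<subseteq> full c"
  using set_omit[of j c] by (auto simp: full_def)

text \<open>The hypotheses of an acyclic carrier argument: values stay over the simplex itself, and
  a common augmentation makes the difference of two such maps augment to 0.\<close>

definition carried :: "(('a::linorder list \<Rightarrow>\<^sub>0 'r::comm_ring_1) \<Rightarrow> ('a necklace \<Rightarrow>\<^sub>0 'r)) \<Rightarrow> bool" where
  "carried f \<longleftrightarrow> lin f \<and> (\<forall>c. sorted_wrt (<) c \<longrightarrow> c \<noteq> [] \<longrightarrow>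
     f (basis c) \<in> necklace_chains (full c) (sdim c) \<and> neck_aug (f (basis c)) = basis c)"

lemma carried_boundary:
  assumes f: "carried f" and c: "sorted_wrt (<) c" "c \<noteq> []"
  shows "f (simplicial_boundary (basis c)) \<in> necklace_chains (full c) (sdim c - 1)"
    and "neck_aug (f (simplicial_boundary (basis c))) = simplicial_boundary (basis c)"
proof -
  have l: "lin f" using f by (simp add: carried_def)
  have "f (basis (omit j c)) \<in> necklace_chains (full c) (sdim c - 1) \<and> neck_aug (f (basis (omit j c))) = basis (omit j c)"
    if "0 < sdim c" "j \<le> sdim c" for j
  proof -
    have j: "j < length c" "omit j c \<noteq> []"
      using that c length_omit[of j c] by (auto simp: sdim_def simp flip: length_greater_0_conv)
    then have "f (basis (omit j c)) \<in> necklace_chains (full (omit j c)) (sdim c - 1)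
        \<and> neck_aug (f (basis (omit j c))) = basis (omit j c)"
      using f sorted_omit[OF c(1), of j] by (auto simp: carried_def sdim_omit)
    then show ?thesis
      using nc_mono[OF _ full_omit] by blast
  qed
  then show "f (simplicial_boundary (basis c)) \<in> necklace_chains (full c) (sdim c - 1)"
    "neck_aug (f (simplicial_boundary (basis c))) = simplicial_boundary (basis c)"
    by (auto simp: boundary_basis lin_simps[OF l] lin_sg[OF l] lin_simps[OF lin_neck_aug] lin_sg[OF lin_neck_aug]
        intro!: nc_sum nc_sg)
qed

text \<open>By induction on faces the defect of the chain map identity is a cycle over
  \<open>c\<close>, and its augmentation is 0 since both maps composed with \<open>neck_aug\<close>
  give the boundary of \<open>c\<close>. So \<open>cycle_eq_0\<close> applies as soon as
  \<open>kill\<close> provides the contractions.\<close>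

lemma carried_chain_map:
  assumes f: "carried f"
    and kill: "\<And>c e k. sorted_wrt (<) c \<Longrightarrow> 0 < sdim c \<Longrightarrow> e \<in> simplices (full c) k \<Longrightarrow>
      \<exists>b<length c. ctr c b (coef e (necklace_diff (f (basis c)) - f (simplicial_boundary (basis c)))) = 0"
  shows "sorted_wrt (<) c \<Longrightarrow> c \<noteq> [] \<Longrightarrow> necklace_diff (f (basis c)) = f (simplicial_boundary (basis c))"
proof (induction "length c" arbitrary: c rule: less_induct)
  case less
  have l: "lin f" using f by (simp add: carried_def)
  have fc: "f (basis c) \<in> necklace_chains (full c) (sdim c)" "neck_aug (f (basis c)) = basis c"
    using f less.prems by (auto simp: carried_def)
  show ?case
  proof (cases "sdim c = 0")
    case True
    then show ?thesis
      using fc D_zero[OF asc_full, of "f (basis c)" c] by (simp add: boundary_basis lin_zero[OF l])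
  next
    case False
    let ?z = "necklace_diff (f (basis c)) - f (simplicial_boundary (basis c))"
    have "necklace_diff (f (basis (omit j c))) = f (simplicial_boundary (basis (omit j c)))"
      if "j \<le> sdim c" for j
      using that False less.prems length_omit[of j c]
      by (intro less.hyps) (auto simp: sdim_def sorted_omit simp flip: length_greater_0_conv)
    then have "necklace_diff (f (simplicial_boundary (basis c))) = f (simplicial_boundary (simplicial_boundary (basis c)))"
      by (simp add: boundary_basis[of c] lin_simps[OF l] lin_sg[OF l] lin_simps[OF necklace_diff_lin]
          lin_sg[OF necklace_diff_lin] lin_simps[OF lin_boundary] lin_sg[OF lin_boundary])
    then have "necklace_diff (f (simplicial_boundary (basis c))) = 0"
      using less.prems boundary_boundary[of c "sdim c", where 'b = 'b] by (simp add: sdim_def lin_zero[OF l])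
    then have z1: "necklace_diff ?z = 0"
      using D_D[OF asc_full fc(1)] by (simp add: lin_diff[OF necklace_diff_lin])
    have z2: "?z \<in> necklace_chains (full c) (sdim c - 1)"
      using D_in[OF asc_full fc(1)] carried_boundary(1)[OF f less.prems] by (rule nc_diff)
    have z3: "neck_aug ?z = 0"
      using neck_aug_D[OF asc_full fc(1)] carried_boundary(2)[OF f less.prems] fc(2)
      by (simp add: lin_diff[OF lin_neck_aug])
    have "?z = 0"
    proof (rule cycle_eq_0[OF less.prems(1) z2 z1 z3])
      fix e k assume "e \<in> simplices (full c) k"
      then show "\<exists>b<length c. ctr c b (coef e ?z) = 0"
        using kill[OF less.prems(1)] False by auto
    qed
    then show ?thesis by simp
  qed
qed

text \<open>The acyclic carrier construction by recursion over faces. A filling within the necklaces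
  of \<open>c\<close> is taken by choice, since its existence depends on the properties of the
  values on the faces and is shown only afterwards.\<close>

function homotopy :: "(('a::linorder list \<Rightarrow>\<^sub>0 'r) \<Rightarrow> ('a necklace \<Rightarrow>\<^sub>0 'r)) \<Rightarrow> 'a list \<Rightarrow> ('a necklace \<Rightarrow>\<^sub>0 'r::comm_ring_1)" where
  "homotopy d c = (SOME w. w \<in> necklace_chains (full c) (Suc (sdim c)) \<and> neck_aug w = 0 \<and>
     necklace_diff w = d (basis c) - (if sdim c = 0 then 0 else \<Sum>j\<le>sdim c. sg j (homotopy d (omit j c))))"
  by auto
termination
  by (relation "measure (\<lambda>(d, c). length c)") (auto simp: length_omit sdim_def)

declare homotopy.simps [simp del]

text \<open>The chain to be filled is a cycle: by the homotopy formula on the faces, D of the face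
  sum is \<open>d\<close> of the boundary up to a sum over double faces, which cancels.\<close>

lemma homotopy_props:
  fixes d :: "('a::linorder list \<Rightarrow>\<^sub>0 'r::comm_ring_1) \<Rightarrow> ('a necklace \<Rightarrow>\<^sub>0 'r)"
  assumes l: "lin d"
    and d: "\<And>c. sorted_wrt (<) c \<Longrightarrow> c \<noteq> [] \<Longrightarrow> d (basis c) \<in> necklace_chains (full c) (sdim c) \<and>
      neck_aug (d (basis c)) = 0 \<and> necklace_diff (d (basis c)) = d (simplicial_boundary (basis c))"
  shows "sorted_wrt (<) c \<Longrightarrow> c \<noteq> [] \<Longrightarrow> homotopy d c \<in> necklace_chains (full c) (Suc (sdim c)) \<and> neck_aug (homotopy d c) = 0 \<and>
     necklace_diff (homotopy d c) = d (basis c) - (if sdim c = 0 then 0 else \<Sum>j\<le>sdim c. sg j (homotopy d (omit j c)))"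
proof (induction "length c" arbitrary: c rule: less_induct)
  case less
  let ?s = "if sdim c = 0 then 0 else \<Sum>j\<le>sdim c. sg j (homotopy d (omit j c))"
  let ?z = "d (basis c) - ?s"
  have IH: "homotopy d (omit j c) \<in> necklace_chains (full (omit j c)) (Suc (sdim c - 1))"
    "neck_aug (homotopy d (omit j c)) = 0"
    "necklace_diff (homotopy d (omit j c)) = d (basis (omit j c))
       - (if sdim c = 1 then 0 else \<Sum>i\<le>sdim c - 1. sg i (homotopy d (omit i (omit j c))))"
    if "sdim c \<noteq> 0" "j \<le> sdim c" for j
  proof -
    have j: "j < length c" "omit j c \<noteq> []" "length (omit j c) < length c" "sdim (omit j c) = sdim c - 1"
      using that less.prems length_omit[of j c] by (auto simp: sdim_def simp flip: length_greater_0_conv)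
    note less.hyps[OF j(3) sorted_omit[OF less.prems(1)] j(2)]
    then show "homotopy d (omit j c) \<in> necklace_chains (full (omit j c)) (Suc (sdim c - 1))"
      "neck_aug (homotopy d (omit j c)) = 0"
      "necklace_diff (homotopy d (omit j c)) = d (basis (omit j c))
       - (if sdim c = 1 then 0 else \<Sum>i\<le>sdim c - 1. sg i (homotopy d (omit i (omit j c))))"
      using that by (auto simp: j(4))
  qed
  have dc: "d (basis c) \<in> necklace_chains (full c) (sdim c)" "neck_aug (d (basis c)) = 0"
    "necklace_diff (d (basis c)) = d (simplicial_boundary (basis c))"
    using d[OF less.prems] by auto
  have "?s \<in> necklace_chains (full c) (sdim c)"
    using nc_mono[OF IH(1) full_omit] by (auto intro!: nc_sum nc_sg)
  then have 1: "?z \<in> necklace_chains (full c) (sdim c)"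
    using dc by (intro nc_diff)
  have 2: "neck_aug ?z = 0"
    using IH(2) dc by (auto simp: lin_simps[OF lin_neck_aug] lin_sg[OF lin_neck_aug])
  have 3: "necklace_diff ?z = 0"
  proof (cases "sdim c = 0")
    case True
    then show ?thesis
      by (simp add: dc boundary_basis lin_zero[OF l])
  next
    case False
    have "necklace_diff ?s = (\<Sum>j\<le>sdim c. sg j (d (basis (omit j c))))
      - (if sdim c = 1 then 0 else \<Sum>j\<le>sdim c. \<Sum>i\<le>sdim c - 1. sg (j + i) (homotopy d (omit i (omit j c))))"
      using False IH(3)
      by (auto simp: lin_sum[OF necklace_diff_lin] lin_sg[OF necklace_diff_lin] sg_diff sum_subtractf sg_sum)
    also have "(\<Sum>j\<le>sdim c. \<Sum>i\<le>sdim c - 1. sg (j + i) (homotopy d (omit i (omit j c)))) = 0"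
      using False less.prems by (intro boundary_boundary_sum) (auto simp: sdim_def)
    also have "(\<Sum>j\<le>sdim c. sg j (d (basis (omit j c)))) - (if sdim c = 1 then 0 else 0) = d (simplicial_boundary (basis c))"
      using False by (simp add: boundary_basis lin_sum[OF l] lin_sg[OF l])
    finally show ?thesis
      by (simp only: lin_diff[OF necklace_diff_lin] dc(3)) simp
  qed
  \<comment> \<open>Marked beads do not exceed the degree of the chain, so
    \<open>Suc (sdim c)\<close> is an admissible bound for \<open>acyclic\<close>.\<close>
  have "\<exists>w \<in> necklace_chains (full c) (Suc (sdim c)). neck_aug w = 0 \<and> necklace_diff w = ?z"
    using coef_above_degree[OF 1] by (intro acyclic[OF less.prems(1) 1 3 2, of "Suc (sdim c)"]) auto
  then have ex: "\<exists>w. w \<in> necklace_chains (full c) (Suc (sdim c)) \<and> neck_aug w = 0 \<and> necklace_diff w = ?z"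
    by blast
  have e: "homotopy d c = (SOME w. w \<in> necklace_chains (full c) (Suc (sdim c)) \<and> neck_aug w = 0 \<and> necklace_diff w = ?z)"
    by (rule homotopy.simps)
  show ?case
    using someI_ex[OF ex] unfolding e[symmetric] .
qed

lemma full_subset: "abstract_simplicial_complex X \<Longrightarrow> set c \<in> X \<Longrightarrow> full c \<subseteq> X"
  unfolding full_def using asc_subset by blast

lemma simplicial_chains_lin_eq:
  assumes "x \<in> simplicial_chains X n" "lin f" "lin g" "\<And>c. c \<in> simplices X n \<Longrightarrow> f (basis c) = g (basis c)"
  shows "f x = g x"
  using assms lin_eq_on unfolding simplicial_chains_def by blast

lemma simplicial_chains_lin_in:
  assumes "lin f" "\<And>c. c \<in> simplices X n \<Longrightarrow> f (basis c) \<in> necklace_chains X m"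
  shows "f ` simplicial_chains X n \<subseteq> necklace_chains X m"
  using lin_span_on[of _ "simplices X n" f "necklaces X m"] assms
  unfolding simplicial_chains_def necklace_chains_def by blast

theorem carried_homotopic:
  fixes f g :: "('a::linorder list \<Rightarrow>\<^sub>0 'r::comm_ring_1) \<Rightarrow> ('a necklace \<Rightarrow>\<^sub>0 'r)"
  assumes X: "abstract_simplicial_complex X" and f: "carried f" and g: "carried g"
    and Df: "\<And>c. sorted_wrt (<) c \<Longrightarrow> c \<noteq> [] \<Longrightarrow> necklace_diff (f (basis c)) = f (simplicial_boundary (basis c))"
    and Dg: "\<And>c. sorted_wrt (<) c \<Longrightarrow> c \<noteq> [] \<Longrightarrow> necklace_diff (g (basis c)) = g (simplicial_boundary (basis c))"
  shows "chain_homotopic (simplicial_chains X) simplicial_boundary (necklace_chains X) necklace_diff f g"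
proof -
  have lf: "lin f" and lg: "lin g" using f g by (auto simp: carried_def)
  have s: "sorted_wrt (<) c" "c \<noteq> []" "full c \<subseteq> X" "sdim c = n" if "c \<in> simplices X n" for c n
    using that full_subset[OF X, of c] by (auto simp: simplices_iff sdim_def)
  have cm: "chain_map (simplicial_chains X) simplicial_boundary (necklace_chains X) necklace_diff h"
    if "carried h" and Dh: "\<And>c. sorted_wrt (<) c \<Longrightarrow> c \<noteq> [] \<Longrightarrow> necklace_diff (h (basis c)) = h (simplicial_boundary (basis c))"
    for h :: "('a list \<Rightarrow>\<^sub>0 'r) \<Rightarrow> ('a necklace \<Rightarrow>\<^sub>0 'r)"
  proof -
    have lh: "lin h" using that by (simp add: carried_def)
    have "h ` simplicial_chains X n \<subseteq> necklace_chains X n" for n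
    proof (rule simplicial_chains_lin_in[OF lh])
      fix c assume c: "c \<in> simplices X n"
      have "h (basis c) \<in> necklace_chains (full c) n"
        using that(1) s(1,2,4)[OF c] by (auto simp: carried_def)
      then show "h (basis c) \<in> necklace_chains X n"
        by (rule nc_mono[OF _ s(3)[OF c]])
    qed
    moreover have "necklace_diff (h x) = h (simplicial_boundary x)" if x: "x \<in> simplicial_chains X n" for x n
      by (rule simplicial_chains_lin_eq[OF x, of "\<lambda>x. necklace_diff (h x)" "\<lambda>x. h (simplicial_boundary x)"])
        (use Dh s in \<open>auto intro!: lin_compose[OF necklace_diff_lin lh] lin_compose[OF lh lin_boundary]\<close>)
    ultimately show ?thesis
      using lh by (auto simp: chain_map_def lin_module_hom)
  qed
  define d where "d = (\<lambda>x. f x - g x)"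
  have ld: "lin d" unfolding d_def by (intro lin_sub lf lg)
  have d: "d (basis c) \<in> necklace_chains (full c) (sdim c) \<and>
      neck_aug (d (basis c)) = 0 \<and> necklace_diff (d (basis c)) = d (simplicial_boundary (basis c))"
    if "sorted_wrt (<) c" "c \<noteq> []" for c
    using that f g Df Dg
    by (auto simp: d_def carried_def lin_diff[OF necklace_diff_lin] lin_diff[OF lin_neck_aug] intro: nc_diff)
  have h: "homotopy d c \<in> necklace_chains (full c) (Suc (sdim c)) \<and> neck_aug (homotopy d c) = 0 \<and>
     necklace_diff (homotopy d c) = d (basis c) - (if sdim c = 0 then 0 else \<Sum>j\<le>sdim c. sg j (homotopy d (omit j c)))"
    if "sorted_wrt (<) c" "c \<noteq> []" for c
    by (rule homotopy_props[OF ld _ that]) (rule d)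
  define H where "H = lin_ext (homotopy d)"
  have lH: "lin H" by (simp add: H_def lin_lin_ext)
  have "H ` simplicial_chains X n \<subseteq> necklace_chains X (Suc n)" for n
  proof (rule simplicial_chains_lin_in[OF lH])
    fix c assume c: "c \<in> simplices X n"
    have "H (basis c) \<in> necklace_chains (full c) (Suc n)"
      using h[OF s(1,2)[OF c]] s(4)[OF c] by (simp add: H_def)
    then show "H (basis c) \<in> necklace_chains X (Suc n)"
      by (rule nc_mono[OF _ s(3)[OF c]])
  qed
  moreover have "f x - g x = necklace_diff (H x) + H (simplicial_boundary x)"
    if x: "x \<in> simplicial_chains X n" for x n
  proof (rule simplicial_chains_lin_eq[OF x, of "\<lambda>x. f x - g x" "\<lambda>x. necklace_diff (H x) + H (simplicial_boundary x)"])
    fix c assume c: "c \<in> simplices X n"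
    show "f (basis c) - g (basis c) = necklace_diff (H (basis c)) + H (simplicial_boundary (basis c))"
      using h[OF s(1,2)[OF c]]
      by (simp add: H_def d_def[symmetric] boundary_basis lin_simps[OF lin_lin_ext] lin_sg[OF lin_lin_ext])
        (simp add: d_def)
  qed (intro lin_sub lf lg lin_plus lin_compose[OF necklace_diff_lin lH] lin_compose[OF lH lin_boundary])+
  ultimately show ?thesis
    unfolding chain_homotopic_def using cm[OF f Df] cm[OF g Dg] lH
    by (auto simp: lin_module_hom)
qed

section \<open>Chains killed by a contraction\<close>

text \<open>A submodule modulo which the chain map identities are verified. The base
  \<open>\<beta>\<close> depends on the marked bead: it is constantly 0 for \<open>\<rho>\<close>
  and the position of the last vertex of the bead for \<open>\<chi>\<close>.\<close>

definition kz :: "'a::linorder list \<Rightarrow> ('a list \<Rightarrow> nat) \<Rightarrow> ('a necklace \<Rightarrow>\<^sub>0 'r::comm_ring_1) \<Rightarrow> bool" where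
  "kz c \<beta> z \<longleftrightarrow> (\<forall>e. ctr c (\<beta> e) (coef e z) = 0)"

lemma kz_zero: "kz c \<beta> 0"
  and kz_add: "kz c \<beta> x \<Longrightarrow> kz c \<beta> y \<Longrightarrow> kz c \<beta> (x + y)"
  and kz_diff: "kz c \<beta> x \<Longrightarrow> kz c \<beta> y \<Longrightarrow> kz c \<beta> (x - y)"
  and kz_uminus: "kz c \<beta> x \<Longrightarrow> kz c \<beta> (- x)"
  and kz_sg: "kz c \<beta> x \<Longrightarrow> kz c \<beta> (sg n x)"
  by (auto simp: kz_def coef_lin lin_simps[OF lin_ctr] lin_sg[OF lin_ctr])

lemma kz_sum: "(\<And>i. i \<in> I \<Longrightarrow> kz c \<beta> (f i)) \<Longrightarrow> kz c \<beta> (sum f I)"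
  by (auto simp: kz_def coef_lin lin_simps[OF lin_ctr] intro!: sum.neutral)

lemma kz_nk: "ctr c (\<beta> e) x = 0 \<Longrightarrow> kz c \<beta> (nk x e)"
  by (auto simp: kz_def coef_nk lin_zero[OF lin_ctr])

text \<open>Requiring vanishing augmentation as well makes this a right ideal
  (\<open>lk_mult\<close>): a word starting with such an element can be discarded whatever follows.
  By \<open>lk_mult_left\<close> it may also be preceded by factors that the contraction
  kills.\<close>

definition lk :: "'a::linorder list \<Rightarrow> nat \<Rightarrow> ('a, 'r::comm_ring_1) walg \<Rightarrow> bool" where
  "lk c b x \<longleftrightarrow> ctr c b x = 0 \<and> aug x = 0"

lemma lk_zero: "lk c b 0"
  and lk_add: "lk c b x \<Longrightarrow> lk c b y \<Longrightarrow> lk c b (x + y)"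
  and lk_diff: "lk c b x \<Longrightarrow> lk c b y \<Longrightarrow> lk c b (x - y)"
  and lk_sg: "lk c b x \<Longrightarrow> lk c b (sg n x)"
  and lk_uminus: "lk c b x \<Longrightarrow> lk c b (- x)"
  by (auto simp: lk_def lin_simps[OF lin_ctr] lin_simps[OF lin_aug] lin_sg[OF lin_ctr] lin_sg[OF lin_aug])

lemma lk_sum: "(\<And>i. i \<in> I \<Longrightarrow> lk c b (f i)) \<Longrightarrow> lk c b (sum f I)"
  by (auto simp: lk_def lin_simps[OF lin_ctr] lin_simps[OF lin_aug] intro!: sum.neutral)

lemma lk_mult: "lk c b x \<Longrightarrow> lk c b (x * y)"
  by (simp add: lk_def ctr_mult aug_mult)

lemma lk_mult_left: "ctr c b u = 0 \<Longrightarrow> lk c b x \<Longrightarrow> lk c b (u * x)"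
  by (simp add: lk_def ctr_mult aug_mult)

lemma ker_mult: "ctr c b x = 0 \<Longrightarrow> ctr c b y = 0 \<Longrightarrow> ctr c b (x * y) = 0"
  by (simp add: ctr_mult)

lemma ctr_base_bead:
  assumes "sorted_wrt (<) c" "b < length c" "ys \<noteq> []"
  shows "ctr c b (bd (c ! b # y # ys)) = 0"
  using assms by (cases ys) (auto simp: ctr_bd fill_bead_def pos_nth fill.simps[of c b b])

lemma lk_base_bead:
  assumes "sorted_wrt (<) c" "b < length c" "ys \<noteq> []"
  shows "lk c b (bd (c ! b # y # ys))"
  using assms ctr_base_bead[OF assms] by (cases ys) (auto simp: lk_def aug_bd sdim_def)

lemma ctr_base_edge:
  assumes "sorted_wrt (<) c" "b < length c" "c ! b < v"
  shows "ctr c b (bd [c ! b, v]) = 0" "ctr c b (bd [v, c ! b]) = 0"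
proof -
  have e: "ctr c b (bd [c ! b, v]) = 0"
    using assms by (auto simp: ctr_bd fill_bead_def pos_nth fill.simps[of c b b])
  show "ctr c b (bd [c ! b, v]) = 0" by (rule e)
  show "ctr c b (bd [v, c ! b]) = 0"
    using assms by (simp add: ctr_edge_rev e)
qed

text \<open>Apart from the cut and the face at the second vertex, every term begins with a bead of
  dimension at least 2 leaving the base. That face is itself such a bead unless it is an
  edge.\<close>

lemma dbd_mod_lk:
  assumes c: "sorted_wrt (<) c" "b < length c" and ys: "ys \<noteq> []"
  shows "lk c b (dbd (c ! b # v # ys) - ((if length ys = 1 then bd (c ! b # ys) else 0) - bd [c ! b, v] * bd (v # ys)))"
proof -
  have e: "dbd (c ! b # v # ys) - ((if length ys = 1 then bd (c ! b # ys) else 0) - bd [c ! b, v] * bd (v # ys))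
    = (if length ys = 1 then 0 else bd (c ! b # ys)) - cob (\<lambda>z. bd (c ! b # v # z)) ys"
    using ys by (simp add: dbd_Cons_Cons)
  have "lk c b (if length ys = 1 then 0 else bd (c ! b # ys))"
  proof (cases "length ys = 1")
    case False
    then obtain y ys' where "ys = y # ys'" "ys' \<noteq> []" using ys by (cases ys; cases "tl ys") auto
    then show ?thesis using lk_base_bead[OF c] False by simp
  qed (simp add: lk_zero)
  moreover have "lk c b (cob (\<lambda>z. bd (c ! b # v # z)) ys)"
    unfolding cob_def
  proof (intro lk_sum lk_sg lk_diff lk_mult lk_base_bead[OF c])
    fix r assume "r \<in> {..<length ys - 1}"
    then show "omit r ys \<noteq> []" "front r ys \<noteq> []" by (auto simp: omit_def front_def)
  qed
  ultimately show ?thesis unfolding e by (rule lk_diff)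
qed

declare upt_Suc [simp del]

lemma pick_segment: "i \<le> j \<Longrightarrow> j < length c \<Longrightarrow> pick c [i..<Suc j] = front (j - i) (rear i c)"
  by (rule nth_equalityI) (auto simp: pick_def front_def rear_def min_def)

lemma wd_rho_beads: "wd (rho_beads c ((p, q) # (p', q') # s)) =
    bd [c ! q, c ! p] * (bd (pick c ([p..<Suc p'] @ [q..<Suc q'])) * wd (rho_beads c ((p', q') # s)))"
  by (simp, subst wd_Cons, subst wd_Cons) (simp add: pick_def)

lemma dbd_edge: "dbd [u, v] = 0"
  by (simp add: dbd_def sdim_def)

section \<open>The map \<open>\<rho>\<close> is a chain map\<close>

text \<open>All conditions on consecutive pairs in one relation: index sequences become chains, only
  the conditions on the two ends remain global, and pairs can be inserted or removed at the
  head.\<close>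

definition rho_step :: "nat \<times> nat \<Rightarrow> nat \<times> nat \<Rightarrow> bool" where
  "rho_step x y \<longleftrightarrow> fst x \<le> fst y \<and> snd x \<le> snd y \<and> fst x + snd x < fst y + snd y \<and> fst y < snd x"

lemma rho_index_iff: "s \<in> rho_index k \<longleftrightarrow> s \<noteq> [] \<and> successively rho_step s \<and> fst (hd s) = 0 \<and>
    fst (last s) \<le> snd (hd s) \<and> snd (last s) = k"
proof -
  have 1: "sorted_wrt (<) (map (\<lambda>(p, q). p + q) s) \<longleftrightarrow> successively (\<lambda>x y. fst x + snd x < fst y + snd y) s"
    by (subst successively_conv_sorted_wrt[symmetric]) (auto simp: successively_map case_prod_unfold transp_def)
  have 2: "sorted (map f s) \<longleftrightarrow> successively (\<lambda>x y. f x \<le> f y) s" for f :: "nat \<times> nat \<Rightarrow> nat"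
    by (subst successively_conv_sorted_wrt[symmetric]) (auto simp: successively_map transp_def)
  have 3: "(\<forall>r. Suc r < length s \<longrightarrow> fst (s ! Suc r) < snd (s ! r)) \<longleftrightarrow> successively (\<lambda>x y. fst y < snd x) s" for s
  proof (induction s rule: induct_list012)
    case (3 x y zs)
    have "(\<forall>r. Suc r < length (x # y # zs) \<longrightarrow> fst ((x # y # zs) ! Suc r) < snd ((x # y # zs) ! r)) \<longleftrightarrow>
      fst y < snd x \<and> (\<forall>r. Suc r < length (y # zs) \<longrightarrow> fst ((y # zs) ! Suc r) < snd ((y # zs) ! r))"
      (is "(\<forall>r. ?P r) \<longleftrightarrow> ?Q")
    proof -
      have "(\<forall>r. ?P r) \<longleftrightarrow> ?P 0 \<and> (\<forall>r. ?P (Suc r))"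
        by (metis nat.exhaust)
      then show ?thesis by simp
    qed
    with 3 show ?case by simp
  qed auto
  have 4: "successively rho_step s \<longleftrightarrow> successively (\<lambda>x y. fst x \<le> fst y) s \<and> successively (\<lambda>x y. snd x \<le> snd y) s \<and>
     successively (\<lambda>x y. fst x + snd x < fst y + snd y) s \<and> successively (\<lambda>x y. fst y < snd x) s" for s
    by (induction s rule: induct_list012) (auto simp: rho_step_def)
  show ?thesis
    unfolding rho_index_def mem_Collect_eq 3 4 using 1 2[of fst] 2[of snd] by blast
qed

lemma rho_step_le: "successively rho_step s \<Longrightarrow> s \<noteq> [] \<Longrightarrow> snd (hd s) \<le> snd (last s) \<and> fst (hd s) \<le> fst (last s)"
  by (induction s rule: induct_list012) (auto simp: rho_step_def)

text \<open>The sum in the sign exponent by recursion along the list, so that signs can be compared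
  when the head changes.\<close>

fun rho_sum :: "(nat \<times> nat) list \<Rightarrow> nat" where
  "rho_sum (x # y # s) = fst y * (snd y - snd x) + rho_sum (y # s)"
| "rho_sum s = 0"

lemma rho_sign_eq: "rho_sign s = length s + 1 + fst (last s) + snd (hd s) * (snd (last s) + 1) + rho_sum s"
proof -
  have "(\<Sum>j\<in>{1..<length s}. fst (s ! j) * (snd (s ! j) - snd (s ! (j - 1)))) = rho_sum s"
  proof (induction s rule: rho_sum.induct)
    case (1 x y s)
    have "(\<Sum>j\<in>{1..<length (x # y # s)}. fst ((x # y # s) ! j) * (snd ((x # y # s) ! j) - snd ((x # y # s) ! (j - 1))))
      = fst y * (snd y - snd x) + (\<Sum>j\<in>{2..<length (x # y # s)}. fst ((x # y # s) ! j) * (snd ((x # y # s) ! j) - snd ((x # y # s) ! (j - 1))))"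
      by (subst sum.atLeast_Suc_lessThan) (simp_all add: One_nat_def numeral_2_eq_2)
    also have "(\<Sum>j\<in>{2..<length (x # y # s)}. fst ((x # y # s) ! j) * (snd ((x # y # s) ! j) - snd ((x # y # s) ! (j - 1))))
      = (\<Sum>j\<in>{1..<length (y # s)}. fst ((y # s) ! j) * (snd ((y # s) ! j) - snd ((y # s) ! (j - 1))))"
      by (rule sum.reindex_bij_witness[of _ Suc "\<lambda>j. j - 1"]) (auto simp: nth_Cons' One_nat_def)
    finally show ?case using 1 by simp
  qed auto
  then show ?thesis by (simp add: rho_sign_def)
qed

section \<open>Terms of D after \<rho> that survive contraction at the first vertex\<close>

definition rho_mark :: "'a list \<Rightarrow> (nat \<times> nat) list \<Rightarrow> 'a list" where
  "rho_mark c s = pick c [fst (last s)..<Suc (snd (hd s))]"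

text \<open>The word in which the edge from vertex 0 to vertex 1 has been cut off the first higher
  bead. It arises both from the index \<open>(0, q) # t\<close> and from
  \<open>(0, q) # (1, q) # t\<close>, which makes it cancel.\<close>

definition rho_x :: "'a list \<Rightarrow> nat \<Rightarrow> (nat \<times> nat) list \<Rightarrow> ('a necklace \<Rightarrow>\<^sub>0 'r::comm_ring_1)" where
  "rho_x c q t = nk (bd [c ! q, c ! 0] * (bd [c ! 0, c ! 1] *
     (bd (pick c ([1..<Suc (fst (hd t))] @ [q..<Suc (snd (hd t))])) * wd (rho_beads c t)))) (pick c [fst (last t)..<Suc q])"

text \<open>Modulo the kernel only the first bead of dimension at least 2 contributes, with the cut
  at its second vertex and, for a triangle, the face there. If \<open>p' = 0\<close>, the cut-off
  edge from 0 to \<open>q\<close> is annihilated by the preceding inverse edge. If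
  \<open>(p', q') = (1, q)\<close>, the bead is a triangle and its face is annihilated in this way,
  while in the cut term the remaining edge cancels the next inverse edge. Otherwise the second
  vertex is 1 and the cut yields \<open>rho_x\<close>.\<close>

fun rho_d :: "'a list \<Rightarrow> (nat \<times> nat) list \<Rightarrow> ('a necklace \<Rightarrow>\<^sub>0 'r::comm_ring_1)" where
  "rho_d c ((p, q) # (p', q') # r) =
     (if p' = 0 then - nk (bd (pick c [q..<Suc q']) * wd (rho_beads c ((0, q') # r))) (rho_mark c ((p, q) # (p', q') # r))
      else if p' = 1 \<and> q' = q then nk (wd (rho_beads c ((1, q) # r))) (rho_mark c ((p, q) # (p', q') # r))
        - (if r = [] then 0 else rho_x c q r)
      else - rho_x c q ((p', q') # r))"
| "rho_d c s = 0"

text \<open>The term of D that splits the marked bead at vertex \<open>v\<close> and moves its rear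
  to the front of the word, without the leading minus sign.\<close>

definition rho_c :: "'a list \<Rightarrow> nat \<Rightarrow> (nat \<times> nat) list \<Rightarrow> nat \<Rightarrow> ('a necklace \<Rightarrow>\<^sub>0 'r::comm_ring_1)" where
  "rho_c c k s v = sg ((k - (snd (hd s) - v)) * (snd (hd s) - v))
     (nk (bd (pick c [v..<Suc (snd (hd s))]) * wd (rho_beads c s)) (pick c [fst (last s)..<Suc v]))"

text \<open>Index sequences with at least two pairs, sorted by the second pair in parallel with the
  cases of \<open>rho_d\<close>: its first entry is 0, it equals \<open>(1, q1)\<close>, or
  neither.\<close>

definition "rho_a0 k = {(q1, q, r). (0, q1) # (0, q) # r \<in> rho_index k}"
definition "rho_b k = {(q1, r). (0, q1) # (1, q1) # r \<in> rho_index k}"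
definition "rho_a k = {(q1, t). t \<noteq> [] \<and> (0, q1) # t \<in> rho_index k \<and> 0 < fst (hd t) \<and> hd t \<noteq> (1, q1)}"

context
  fixes c :: "'a::linorder list"
  assumes c: "sorted_wrt (<) c"
begin

lemma sorted_pick: "sorted_wrt (<) js \<Longrightarrow> \<forall>j\<in>set js. j < length c \<Longrightarrow> sorted_wrt (<) (pick c js)"
  unfolding pick_def sorted_wrt_map
  by (rule sorted_wrt_mono_rel[of _ "(<)"]) (auto simp: sorted_nth_less_iff[OF c])

lemma set_pick: "\<forall>j\<in>set js. j < length c \<Longrightarrow> set (pick c js) \<subseteq> set c"
  by (auto simp: pick_def)

lemma rho_bead:
  assumes "p \<le> p'" "p' < q" "q \<le> q'" "q' < length c"
  shows "pick c ([p..<Suc p'] @ [q..<Suc q']) \<in> beads (full c)"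
    "hd (pick c ([p..<Suc p'] @ [q..<Suc q'])) = c ! p" "last (pick c ([p..<Suc p'] @ [q..<Suc q'])) = c ! q'"
    "length (pick c ([p..<Suc p'] @ [q..<Suc q'])) = (p' - p) + (q' - q) + 2"
proof -
  show "pick c ([p..<Suc p'] @ [q..<Suc q']) \<in> beads (full c)"
    using assms by (intro bead_full sorted_pick set_pick) (auto simp: sorted_wrt_append pick_def)
  show "hd (pick c ([p..<Suc p'] @ [q..<Suc q'])) = c ! p"
    using assms by (simp add: pick_def upt_conv_Cons del: upt_Suc)
  show "last (pick c ([p..<Suc p'] @ [q..<Suc q'])) = c ! q'"
    using assms by (simp add: pick_def last_map)
  show "length (pick c ([p..<Suc p'] @ [q..<Suc q'])) = (p' - p) + (q' - q) + 2"
    using assms by (simp add: pick_def)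
qed

lemma rho_beads_path:
  assumes "successively rho_step s" "s \<noteq> []" "fst (hd s) < snd (hd s)" "snd (last s) < length c"
  shows "wpath (beads (full c)) (c ! snd (hd s)) (rho_beads c s) (c ! fst (last s)) \<and> reduced (rho_beads c s) \<and>
    (\<Sum>x\<leftarrow>rho_beads c s. sdim x - 1) + fst (hd s) + snd (hd s) = fst (last s) + snd (last s) \<and>
    fst (last s) < snd (last s) \<and> length (hd (rho_beads c s)) = 2 \<and> rho_beads c s \<noteq> []
    \<and> hd (hd (rho_beads c s)) = c ! snd (hd s) \<and> snd (hd s) \<le> snd (last s)"
  using assms
proof (induction s rule: induct_list012)
  case (2 x)
  then show ?case
    using c by (cases x) (auto simp: pick_def sdim_def sorted_nth_less_iff intro!: bead_full_rev)
next
  case (3 x y s)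
  obtain p q p' q' where xy: "x = (p, q)" "y = (p', q')" by (cases x; cases y) auto
  have st: "p \<le> p'" "q \<le> q'" "p + q < p' + q'" "p' < q" "p < q"
    using 3(3,5) by (auto simp: xy rho_step_def)
  have IH: "wpath (beads (full c)) (c ! q') (rho_beads c (y # s)) (c ! fst (last (y # s))) \<and> reduced (rho_beads c (y # s)) \<and>
    (\<Sum>x\<leftarrow>rho_beads c (y # s). sdim x - 1) + p' + q' = fst (last (y # s)) + snd (last (y # s)) \<and>
    fst (last (y # s)) < snd (last (y # s)) \<and> length (hd (rho_beads c (y # s))) = 2 \<and> rho_beads c (y # s) \<noteq> []
    \<and> hd (hd (rho_beads c (y # s))) = c ! q' \<and> q' \<le> snd (last (y # s))"
    using 3(2,3,6) st by (auto simp: xy)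
  have q': "q' < length c" using IH 3(6) by (auto simp: xy)
  note b = rho_bead[OF st(1,4,2) q']
  have e: "pick c [q, p] \<in> beads (full c)" "length (pick c [q, p]) = 2" "hd (pick c [q, p]) = c ! q"
      "last (pick c [q, p]) = c ! p"
    using st q' c by (auto simp: pick_def sorted_nth_less_iff intro!: bead_full_rev)
  have l: "2 < length (pick c ([p..<Suc p'] @ [q..<Suc q']))"
    using b(4) st by auto
  have "reduced (pick c [q, p] # pick c ([p..<Suc p'] @ [q..<Suc q']) # rho_beads c (y # s))"
    using IH l e(2) unfolding reduced_def
    by (auto simp: successively_Cons inverse_beads_def)
  moreover have "sdim (pick c ([p..<Suc p'] @ [q..<Suc q'])) - 1 = (p' - p) + (q' - q)" "sdim (pick c [q, p]) = 1"
    using b(4) e(2) by (auto simp: sdim_def)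
  ultimately show ?case
    using IH b e st by (auto simp: xy)
qed auto

lemma rho_mark_simps:
  assumes "s \<in> rho_index k" "length c = Suc k"
  shows "rho_mark c s \<in> simplices (full c) (snd (hd s) - fst (last s))" "hd (rho_mark c s) = c ! fst (last s)"
    "last (rho_mark c s) = c ! snd (hd s)"
proof -
  have "snd (hd s) \<le> snd (last s)"
    using assms(1) rho_step_le by (auto simp: rho_index_iff)
  then have le: "fst (last s) \<le> snd (hd s)" "snd (hd s) < length c"
    using assms by (auto simp: rho_index_iff)
  then have "set (rho_mark c s) \<subseteq> set c" "sorted_wrt (<) (rho_mark c s)"
    unfolding rho_mark_def by (intro set_pick sorted_pick; auto simp: less_Suc_eq_le simp del: upt_Suc)+
  then show "rho_mark c s \<in> simplices (full c) (snd (hd s) - fst (last s))"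
    using le by (auto simp: simplices_iff full_def rho_mark_def pick_def Suc_diff_le simp del: upt_Suc)
  show "hd (rho_mark c s) = c ! fst (last s)" "last (rho_mark c s) = c ! snd (hd s)"
    using le by (simp_all add: rho_mark_def pick_def hd_map last_map)
qed

lemma rho_path:
  assumes s: "s \<in> rho_index k" and l: "length c = Suc k" and k: "0 < k"
  shows "(wd (rho_beads c s) :: ('a, 'r::comm_ring_1) walg) \<in>
      PA (beads (full c)) (last (rho_mark c s)) (hd (rho_mark c s)) (k - (snd (hd s) - fst (last s)))"
    "rho_term c s = ((last (rho_mark c s), rho_beads c s), rho_mark c s)" "reduced (rho_beads c s)" "0 < snd (hd s)"
    "snd (hd s) \<le> k" "fst (last s) \<le> snd (hd s)"
proof -
  have s': "s \<noteq> []" "successively rho_step s" "fst (hd s) = 0" "fst (last s) \<le> snd (hd s)" "snd (last s) = k"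
    using s by (auto simp: rho_index_iff)
  show q: "0 < snd (hd s)"
    using s' k by (cases s; cases "tl s") (auto simp: rho_step_def)
  note P = rho_beads_path[OF s'(2,1)]
  note P = P[unfolded s'(3,5), OF q]
  show "reduced (rho_beads c s)" using P l by auto
  show "snd (hd s) \<le> k" "fst (last s) \<le> snd (hd s)" using P l s' by auto
  show "(wd (rho_beads c s) :: ('a, 'r) walg) \<in>
      PA (beads (full c)) (last (rho_mark c s)) (hd (rho_mark c s)) (k - (snd (hd s) - fst (last s)))"
    unfolding rho_mark_simps[OF s l] using P l s' by (intro PA_wd) auto
  show "rho_term c s = ((last (rho_mark c s), rho_beads c s), rho_mark c s)"
    unfolding rho_mark_simps[OF s l] using P l by (auto simp: rho_term_def rho_mark_def seq_def)
qed

lemma rho_map_basis: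
  assumes l: "length c = Suc k" and k: "0 < k"
  shows "rho_map (basis c) = (\<Sum>s\<in>rho_index k. sg (rho_sign s) (nk (wd (rho_beads c s)) (rho_mark c s)))"
  using k by (simp add: rho_map_def l sdim_def scale_sign)
    (intro sum.cong refl, simp add: rho_path[OF _ l] nk_wd)

text \<open>Only the one-pair index \<open>(0, k)\<close> has a word of degree 0; its marked bead is
  the whole simplex and its sign exponent k(k + 1) + 2 is even. Longer indices contain a bead of
  dimension at least 2.\<close>

lemma rho_in:
  assumes l: "length c = Suc k" and k: "0 < k"
  shows "rho_map (basis c) \<in> necklace_chains (full c) k" "neck_aug (rho_map (basis c)) = basis c"
proof -
  show "rho_map (basis c) \<in> necklace_chains (full c) k"
    unfolding rho_map_basis[OF assms]
  proof (intro nc_sum nc_sg)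
    fix s assume s: "s \<in> rho_index k"
    show "nk (wd (rho_beads c s)) (rho_mark c s) \<in> necklace_chains (full c) k"
      using rho_path[OF s l k] by (intro nk_in[OF asc_full rho_mark_simps(1)[OF s l]]) auto
  qed
  have "neck_aug (rho_map (basis c)) = (\<Sum>s\<in>rho_index k. if s = [(0, k)] then basis c else 0)"
    unfolding rho_map_basis[OF assms] lin_sum[OF lin_neck_aug] lin_sg[OF lin_neck_aug] neck_aug_nk
  proof (intro sum.cong refl)
    fix s assume s: "s \<in> rho_index k"
    then obtain p q t where pq: "s = (p, q) # t" by (cases s) (auto simp: rho_index_iff)
    show "sg (rho_sign s) (scale (au (wd (rho_beads c s))) (basis (rho_mark c s)))
        = (if s = [(0, k)] then basis c else 0)"
    proof (cases t)
      case Nil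
      then have "s = [(0, k)]" using s pq by (auto simp: rho_index_iff)
      moreover have "pick c [0..<Suc k] = c"
        using pick_segment[of 0 k c] l by (simp add: front_def rear_def)
      ultimately show ?thesis
        using k by (simp add: rho_mark_def rho_sign_eq au_bd sdim_def pick_def sg_def del: upt_Suc)
    next
      case (Cons y t')
      obtain p' q' where y: "y = (p', q')" by (cases y)
      have st: "rho_step (p, q) (p', q')" using s pq Cons y by (auto simp: rho_index_iff)
      have "\<not> length (pick c ([p..<Suc p'] @ [q..<Suc q'])) - 1 \<le> 1"
        using st by (auto simp: pick_def rho_step_def)
      then show ?thesis
        using pq Cons y by (simp add: wd_rho_beads au_mult au_bd sdim_def del: rho_beads.simps(3))
    qed
  qed
  also have "\<dots> = basis c"
    using finite_rho_index[of k] by (simp add: sum.delta) (simp add: rho_index_iff)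
  finally show "neck_aug (rho_map (basis c)) = basis c" .
qed

end

lemma lk_bead_hd:
  assumes "sorted_wrt (<) c" "b < length c" "hd x = c ! b" "3 \<le> length x"
  shows "lk c b (bd x)"
proof -
  obtain y ys where "x = c ! b # y # ys" "ys \<noteq> []"
    using assms by (cases x; cases "tl x"; cases "tl (tl x)") auto
  then show ?thesis using lk_base_bead[OF assms(1,2)] by simp
qed

text \<open>The word opens with an edge into the base vertex, followed for nonempty \<open>t\<close>
  by a bead of dimension at least 2 leaving it. Here \<open>d\<close> is \<open>c\<close> or a face
  with the same first vertex, so that the values of \<open>\<rho>\<close> on such faces are
  covered.\<close>

lemma ctr_rho_word:
  assumes c: "sorted_wrt (<) c" "0 < length c" and d: "sorted_wrt (<) d" "d ! 0 = c ! 0"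
    and "successively rho_step ((0, q) # t)" "0 < q" "snd (last ((0, q) # t)) < length d"
  shows "ctr c 0 (wd (rho_beads d ((0, q) # t))) = 0" "t \<noteq> [] \<Longrightarrow> lk c 0 (wd (rho_beads d ((0, q) # t)))"
proof -
  have q: "q < length d" using rho_step_le[OF assms(5)] assms(7) by auto
  have "d ! 0 < d ! q" using assms(6) q sorted_nth_less_iff[OF d(1), of 0 q] by (cases d) auto
  then have e: "ctr c 0 (bd [d ! q, d ! 0]) = 0" "ctr c 0 (bd (pick d [q, 0])) = 0"
    using ctr_base_edge[OF c, of "d ! q"] by (auto simp: d(2) pick_def)
  have l: "lk c 0 (wd (rho_beads d ((0, q) # t)))" if tn: "t \<noteq> []"
  proof -
    obtain p' q' t' where t: "t = (p', q') # t'" using tn by (cases t) auto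
    have st: "rho_step (0, q) (p', q')" using assms(5) t by auto
    have q': "q' < length d" using rho_step_le[of t] assms t by auto
    have "lk c 0 (bd (pick d ([0..<Suc p'] @ [q..<Suc q'])))"
      using rho_bead[OF d(1), of 0 p' q q'] st q' by (intro lk_bead_hd c) (auto simp: rho_step_def d(2))
    then show ?thesis
      by (simp add: t wd_rho_beads del: rho_beads.simps(3)) (intro lk_mult_left e lk_mult)
  qed
  show "t \<noteq> [] \<Longrightarrow> lk c 0 (wd (rho_beads d ((0, q) # t)))" by (rule l)
  show "ctr c 0 (wd (rho_beads d ((0, q) # t))) = 0"
  proof (cases "t = []")
    case True
    then show ?thesis by (simp add: e)
  qed (simp add: conjunct1[OF l[unfolded lk_def]])
qed

context
  fixes c :: "'a::linorder list"
  assumes c: "sorted_wrt (<) c"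
begin

text \<open>The first edge is killed by the contraction and may stand on the left. In the Leibniz
  rule for the remainder, the derivative of the later beads keeps the first higher bead in front and
  is discarded; the derivative of that bead is known from \<open>dbd_mod_lk\<close>.\<close>

lemma rho_d_kz:
  assumes s: "s \<in> rho_index k" and l: "length c = Suc k" and k: "0 < k"
  shows "kz c (\<lambda>_. 0) (nk (pd (wd (rho_beads c s))) (rho_mark c s) - (rho_d c s :: 'a necklace \<Rightarrow>\<^sub>0 'r::comm_ring_1))"
proof (cases s rule: rho_sum.cases)
  case (1 x y r)
  obtain p q where "x = (p, q)" by (cases x)
  moreover obtain p' q' where "y = (p', q')" by (cases y)
  ultimately have 1: "s = (p, q) # (p', q') # r" using 1 by simp
  have p: "p = 0" using s 1 by (auto simp: rho_index_iff)
  have st: "rho_step (0, q) (p', q')" and ch: "successively rho_step ((p', q') # r)" and q: "0 < q" "q \<le> k"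
    and lk: "snd (last ((p', q') # r)) = k"
    using s rho_path(4,5)[OF c s l k] 1 by (auto simp: rho_index_iff)
  have q': "q' \<le> k" using rho_step_le[OF ch] lk by auto
  have c0: "0 < length c" using l by simp
  let ?e = "bd [c ! q, c ! 0] :: ('a, 'r) walg" and ?R = "wd (rho_beads c ((p', q') # r)) :: ('a, 'r) walg"
  let ?x = "pick c ([0..<Suc p'] @ [q..<Suc q'])"
  let ?m = "rho_mark c s"
  have e: "ctr c 0 ?e = 0"
    using ctr_base_edge[OF c c0, of "c ! q"] q l by (auto simp: sorted_nth_less_iff[OF c])
  have xl: "length ?x = p' + (q' - q) + 2" "3 \<le> length ?x" "hd ?x = c ! 0"
    using rho_bead[OF c, of 0 p' q q'] st q' l by (auto simp: rho_step_def)
  then obtain v ys where x: "?x = c ! 0 # v # ys" "ys \<noteq> []"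
    by (cases ?x; cases "tl ?x"; cases "tl (tl ?x)") auto
  define L :: "('a, 'r) walg" where "L = (if length ys = 1 then bd (c ! 0 # ys) else 0) - bd [c ! 0, v] * bd (v # ys)"
  have W: "wd (rho_beads c s) = ?e * (bd ?x * ?R)"
    by (simp add: 1 p wd_rho_beads del: rho_beads.simps(3))
  have "pd (wd (rho_beads c s)) - ?e * (L * ?R) = ?e * ((dbd ?x - L) * ?R) + ?e * (tau (bd ?x) * pd ?R)"
    unfolding W by (simp add: pd_mult dbd_edge sdim_def tau_bd pd_bd algebra_simps)
  moreover have "lk c 0 (dbd ?x - L)"
    unfolding x(1) L_def by (rule dbd_mod_lk[OF c c0 x(2)])
  moreover have "lk c 0 (tau (bd ?x :: ('a, 'r) walg))"
    unfolding tau_bd by (intro lk_sg lk_bead_hd c c0 xl)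
  ultimately have lkd: "lk c 0 (pd (wd (rho_beads c s)) - ?e * (L * ?R))"
    by (simp only:) (intro lk_add lk_mult_left e lk_mult; assumption)
  have kd: "kz c (\<lambda>_. 0) (nk (pd (wd (rho_beads c s))) ?m - nk (?e * (L * ?R)) ?m)"
    using lkd by (simp add: lk_def kz_nk flip: lin_diff[OF lin_nk])
  have k2: "kz c (\<lambda>_. 0) (nk (?e * (L * ?R)) ?m - rho_d c s)"
  proof (cases "p' = 0")
    case True
    have qq: "q < q'" using st True by (auto simp: rho_step_def)
    have "?x = c ! 0 # pick c [q..<Suc q']" by (simp add: True pick_def upt_rec[of 0 "Suc 0"])
    then have v: "v # ys = pick c [q..<Suc q']" "v = c ! q"
      using x qq by (auto simp: pick_def upt_conv_Cons[of q "Suc q'"] simp del: upt_Suc)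
    have eq: "?e * (L * ?R) = (if length ys = 1 then ?e * (bd (c ! 0 # ys) * ?R) else 0)
        - bd (pick c [q..<Suc q']) * ?R"
      unfolding L_def v(1) by (simp add: v(2) left_diff_distrib right_diff_distrib mult.assoc)
    have "ctr c 0 (if length ys = 1 then ?e * (bd (c ! 0 # ys) * ?R) else 0) = 0"
    proof (cases "length ys = 1")
      case l1: True
      then obtain u where u: "ys = [u]" by (cases ys) auto
      have "ys = pick c [Suc q..<Suc q']"
        using v qq by (simp add: pick_def upt_conv_Cons[of q "Suc q'"])
      moreover have "u \<in> set ys" using u by simp
      ultimately have "u \<in> set (pick c [Suc q..<Suc q'])" by simp
      then obtain i where i: "u = c ! i" "q < i" "i \<le> q'" by (auto simp: pick_def)
      have "ctr c 0 (bd [c ! 0, u]) = (0 :: ('a, 'r) walg)"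
        using ctr_base_edge[OF c c0, of u] i q' l by (auto simp: sorted_nth_less_iff[OF c])
      moreover have "ctr c 0 ?R = 0"
        using ctr_rho_word(1)[OF c c0 c refl, of q' r] ch lk l qq True by auto
      ultimately show ?thesis using e u by (simp add: ker_mult)
    qed (simp add: lin_zero[OF lin_ctr])
    then have "kz c (\<lambda>_. 0) (nk (if length ys = 1 then ?e * (bd (c ! 0 # ys) * ?R) else 0) ?m)"
      by (rule kz_nk)
    moreover have "nk (?e * (L * ?R)) ?m - rho_d c s = nk (if length ys = 1 then ?e * (bd (c ! 0 # ys) * ?R) else 0) ?m"
      unfolding eq lin_diff[OF lin_nk] by (simp add: 1 True p del: upt_Suc)
    ultimately show ?thesis by simp
  next
    case False
    have vx: "v # ys = pick c ([1..<Suc p'] @ [q..<Suc q'])" "v = c ! 1"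
      using x(1) False by (auto simp: pick_def upt_conv_Cons[of 0 "Suc p'"] upt_conv_Cons[of "Suc 0" "Suc p'"] One_nat_def simp del: upt_Suc)
    have ly: "length ys = p' + (q' - q)" using xl(1) x(1) by simp
    show ?thesis
    proof (cases "p' = 1 \<and> q' = q")
      case True
      then have ys: "ys = [c ! q]"
        using vx by (auto simp: pick_def numeral_2_eq_2 One_nat_def upt_rec[of "Suc 0" "Suc (Suc 0)"]
            upt_rec[of "Suc (Suc 0)" "Suc (Suc 0)"] upt_rec[of q "Suc q"] upt_rec[of "Suc q" "Suc q"])
      have eq: "?e * (L * ?R) = ?R - ?e * (bd [c ! 0, c ! 1] * (bd [c ! 1, c ! q] * ?R))"
        unfolding L_def by (simp add: ys vx(2) left_diff_distrib right_diff_distrib mult.assoc)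
      show ?thesis
      proof (cases r)
        case Nil
        have "ctr c 0 (?e * bd [c ! 0, c ! 1]) = 0"
          using ctr_base_edge[OF c c0, of "c ! 1"] e k l by (auto simp: sorted_nth_less_iff[OF c] intro!: ker_mult)
        moreover have "?e * (L * ?R) = ?R - ?e * bd [c ! 0, c ! 1]"
          unfolding eq by (simp add: True Nil pick_def bd_inverse2)
        ultimately show ?thesis
          using True Nil by (simp add: 1 p nk_lin kz_uminus kz_nk)
      next
        case (Cons y r')
        obtain p3 q3 where y: "y = (p3, q3)" by (cases y)
        have "?R = bd [c ! q, c ! 1] * (bd (pick c ([1..<Suc p3] @ [q..<Suc q3])) * wd (rho_beads c r))"
          by (simp add: True Cons y wd_rho_beads del: rho_beads.simps(3))
        then have "?e * (L * ?R) = ?R - ?e * (bd [c ! 0, c ! 1] * (bd (pick c ([1..<Suc p3] @ [q..<Suc q3])) * wd (rho_beads c r)))"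
          unfolding eq by simp
        moreover have "rho_mark c s = pick c [fst (last r)..<Suc q]"
          by (simp add: 1 Cons rho_mark_def del: upt_Suc)
        ultimately show ?thesis
          using True Cons y by (simp add: 1 p nk_lin rho_x_def kz_zero del: upt_Suc)
      qed
    next
      case F2: False
      have "length ys \<noteq> 1" using ly False F2 st by (auto simp: rho_step_def)
      then have "?e * (L * ?R) = - (?e * (bd [c ! 0, c ! 1] * (bd (pick c ([1..<Suc p'] @ [q..<Suc q'])) * ?R)))"
        unfolding L_def vx(1) by (simp add: vx(2) mult.assoc)
      moreover have "rho_mark c s = pick c [fst (last ((p', q') # r))..<Suc q]"
        by (simp add: 1 rho_mark_def)
      moreover have "rho_d c s = - (rho_x c q ((p', q') # r) :: 'a necklace \<Rightarrow>\<^sub>0 'r)"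
        using False F2 by (auto simp: 1)
      ultimately show ?thesis
        by (simp add: nk_lin rho_x_def kz_zero)
    qed
  qed
  show ?thesis using kz_add[OF kd k2] by simp
next
  case "2_1"
  then show ?thesis using s by (simp add: rho_index_iff)
next
  case ("2_2" x)
  then show ?thesis
    by (cases x) (simp add: pd_bd_edge sdim_def pick_def nk_lin kz_zero)
qed

text \<open>Omitting vertices of the marked bead leaves the word unchanged, and moving a front only
  appends to it; both are killed. Among the moved rears the one starting at vertex 0 is killed,
  hence the restriction \<open>0 < v\<close>.\<close>

lemma rho_D_kz:
  assumes s: "s \<in> rho_index k" and l: "length c = Suc k" and k: "0 < k"
  shows "kz c (\<lambda>_. 0) (necklace_diff (nk (wd (rho_beads c s)) (rho_mark c s))
    - (rho_d c s - (\<Sum>v | fst (last s) \<le> v \<and> v < snd (hd s) \<and> 0 < v. rho_c c k s v)) :: 'a necklace \<Rightarrow>\<^sub>0 'r::comm_ring_1)"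
proof -
  let ?W = "wd (rho_beads c s) :: ('a, 'r) walg" and ?m = "rho_mark c s" and ?p = "fst (last s)" and ?q = "snd (hd s)"
  obtain t where t: "s = (0, ?q) # t" using s by (cases s) (auto simp: rho_index_iff prod_eq_iff)
  have c0: "0 < length c" using l by simp
  have c01: "c ! 0 < c ! 1" using k l by (simp add: sorted_nth_less_iff[OF c])
  note P = rho_path[OF c s l k]
  have W: "ctr c 0 ?W = 0" "t \<noteq> [] \<Longrightarrow> lk c 0 ?W"
    using ctr_rho_word[OF c c0 c refl, of ?q t] P s l t by (auto simp: rho_index_iff)
  have dm: "rho_mark c s \<in> simplices (full c) (?q - ?p)" by (rule rho_mark_simps[OF c s l])
  have m: "?m = front (?q - ?p) (rear ?p c)"
    unfolding rho_mark_def using P l by (intro pick_segment) auto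
  have fr: "front j ?m = pick c [?p..<Suc (?p + j)]" "rear j ?m = pick c [?p + j..<Suc ?q]" if "j < ?q - ?p" for j
    using that P l pick_segment[of ?p "?p + j" c] pick_segment[of "?p + j" ?q c] by (auto simp: m front_front rear_front rear_rear add.commute)
  have 1: "kz c (\<lambda>_. 0) (nk (?W * bd (front j ?m)) (rear j ?m))" if j: "j \<in> {1..?q - ?p}" for j
  proof (rule kz_nk)
    show "ctr c 0 (?W * bd (front j ?m)) = 0"
    \<comment> \<open>With a single pair the word is an edge of augmentation 1, so the appended
      front must be killed by itself; it leaves vertex 0. With more pairs the word lies in the right
      ideal.\<close>
    proof (cases "t = []")
      case True
      then have "last s = hd s" "fst (hd s) = 0" "snd (last s) = k" using t s
        by (metis last_ConsL list.sel(1), auto simp: rho_index_iff)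
      then have "?p = 0" "?q = k" by auto
      then have "front j ?m = c ! 0 # c ! 1 # pick c [2..<Suc j]"
        using j l pick_segment[of 0 j c] by (auto simp: m front_front rear_0 pick_def upt_conv_Cons[of 0 "Suc j"]
            upt_conv_Cons[of "Suc 0" "Suc j"] numeral_2_eq_2 One_nat_def)
      moreover have "ctr c 0 (bd (c ! 0 # c ! 1 # pick c [2..<Suc j])) = (0 :: ('a, 'r) walg)"
      proof (cases "pick c [2..<Suc j]")
        case Nil
        then show ?thesis by (simp add: ctr_base_edge(1)[OF c c0 c01])
      qed (simp add: ctr_base_bead[OF c c0])
      ultimately show ?thesis using W(1) by (simp add: ker_mult)
    next
      case False
      then show ?thesis using lk_mult[OF W(2)] by (simp add: lk_def)
    qed
  qed
  have "(\<Sum>j<?q - ?p. sg ((k - (?q - ?p) + j) * (?q - ?p - j)) (nk (bd (rear j ?m) * ?W) (front j ?m)))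
     = (\<Sum>v\<in>{?p..<?q}. rho_c c k s v)"
    unfolding rho_c_def
    by (rule sum.reindex_bij_witness[of _ "\<lambda>v. v - ?p" "\<lambda>j. ?p + j"])
      (use P in \<open>auto simp: fr intro!: sg_cong\<close>)
  also have "\<dots> = (\<Sum>v | ?p \<le> v \<and> v < ?q \<and> 0 < v. rho_c c k s v) + (if ?p = 0 then rho_c c k s 0 else 0)"
  proof (cases "?p = 0")
    case True
    then have "{?p..<?q} = insert 0 {v. ?p \<le> v \<and> v < ?q \<and> 0 < v}" using P(4) by auto
    then show ?thesis using True by (simp add: add.commute)
  next
    case False
    then have "{?p..<?q} = {v. ?p \<le> v \<and> v < ?q \<and> 0 < v}" by auto
    then show ?thesis using False by simp
  qed
  finally have sum: "(\<Sum>j<?q - ?p. sg ((k - (?q - ?p) + j) * (?q - ?p - j)) (nk (bd (rear j ?m) * ?W) (front j ?m)))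
     = (\<Sum>v | ?p \<le> v \<and> v < ?q \<and> 0 < v. rho_c c k s v) + (if ?p = 0 then rho_c c k s 0 else 0)" .
  have 2: "kz c (\<lambda>_. 0) (if ?p = 0 then rho_c c k s 0 else 0 :: 'a necklace \<Rightarrow>\<^sub>0 'r)"
  proof -
    have x: "pick c [0..<Suc ?q] = c ! 0 # c ! 1 # pick c [2..<Suc ?q]"
      using P(4) by (simp add: pick_def upt_conv_Cons[of 0 "Suc ?q"] upt_conv_Cons[of "Suc 0" "Suc ?q"] numeral_2_eq_2 One_nat_def)
    have "ctr c 0 (bd (c ! 0 # c ! 1 # pick c [2..<Suc ?q])) = (0 :: ('a, 'r) walg)"
    proof (cases "pick c [2..<Suc ?q]")
      case Nil
      then show ?thesis by (simp add: ctr_base_edge(1)[OF c c0 c01])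
    qed (simp add: ctr_base_bead[OF c c0])
    then show ?thesis
      by (auto simp: rho_c_def x kz_zero intro!: kz_sg kz_nk ker_mult W(1))
  qed
  have e: "necklace_diff (nk ?W ?m) - (rho_d c s - (\<Sum>v | ?p \<le> v \<and> v < ?q \<and> 0 < v. rho_c c k s v)) =
    (nk (pd ?W) ?m - rho_d c s)
    + sg (k - (?q - ?p)) (\<Sum>j\<in>{1..<?q - ?p}. sg j (nk ?W (omit j ?m)))
    + sg (k - (?q - ?p)) (\<Sum>j\<in>{1..?q - ?p}. nk (?W * bd (front j ?m)) (rear j ?m))
    - (if ?p = 0 then rho_c c k s 0 else 0)"
    unfolding D_nk[OF asc_full dm P(1)] sum by (simp only: algebra_simps)
  show ?thesis
    unfolding e
    by (intro kz_diff kz_add kz_sg kz_sum rho_d_kz[OF s l k] 2; (rule kz_nk[OF W(1)] | rule 1)) simp?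
qed

lemma rho_index_split:
  fixes F :: "(nat \<times> nat) list \<Rightarrow> 'm::comm_monoid_add"
  assumes k: "0 < k"
  shows "(\<Sum>s\<in>rho_index k. F s) = F [(0, k)] + (\<Sum>(q1, q, r)\<in>rho_a0 k. F ((0, q1) # (0, q) # r))
    + (\<Sum>(q1, r)\<in>rho_b k. F ((0, q1) # (1, q1) # r)) + (\<Sum>(q1, t)\<in>rho_a k. F ((0, q1) # t))"
proof -
  let ?f0 = "\<lambda>(q1, q, r). (0, q1) # (0, q) # r :: (nat \<times> nat) list"
  let ?fb = "\<lambda>(q1, r). (0, q1) # (1, q1) # r :: (nat \<times> nat) list"
  let ?fa = "\<lambda>(q1, t). (0, q1) # t :: (nat \<times> nat) list"
  have R: "rho_index k = insert [(0, k)] (?f0 ` rho_a0 k \<union> ?fb ` rho_b k \<union> ?fa ` rho_a k)"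
  proof (intro equalityI subsetI)
    fix s assume s: "s \<in> rho_index k"
    then obtain q1 t where st: "s = (0, q1) # t" by (cases s) (auto simp: rho_index_iff)
    show "s \<in> insert [(0, k)] (?f0 ` rho_a0 k \<union> ?fb ` rho_b k \<union> ?fa ` rho_a k)"
    proof (cases t)
      case Nil
      then show ?thesis using s st by (simp add: rho_index_iff)
    next
      case (Cons y r)
      obtain p q where y: "y = (p, q)" by (cases y)
      consider "p = 0" | "(p, q) = (1, q1)" | "p \<noteq> 0" "(p, q) \<noteq> (1, q1)" by blast
      then show ?thesis
      proof cases
        case 1
        then have "(q1, q, r) \<in> rho_a0 k" "s = ?f0 (q1, q, r)" using s st Cons y by (auto simp: rho_a0_def)
        then show ?thesis by blast
      next
        case 2
        then have "(q1, r) \<in> rho_b k" "s = ?fb (q1, r)" using s st Cons y by (auto simp: rho_b_def)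
        then show ?thesis by blast
      next
        case 3
        then have "(q1, t) \<in> rho_a k" "s = ?fa (q1, t)" using s st Cons y by (auto simp: rho_a_def)
        then show ?thesis by blast
      qed
    qed
  next
    fix s assume "s \<in> insert [(0, k)] (?f0 ` rho_a0 k \<union> ?fb ` rho_b k \<union> ?fa ` rho_a k)"
    moreover have "[(0, k)] \<in> rho_index k" by (simp add: rho_index_iff)
    ultimately show "s \<in> rho_index k" by (auto simp: rho_a0_def rho_b_def rho_a_def)
  qed
  have inj: "inj_on ?f0 (rho_a0 k)" "inj_on ?fb (rho_b k)" "inj_on ?fa (rho_a k)"
    by (auto simp: inj_on_def)
  have fin: "finite (?f0 ` rho_a0 k)" "finite (?fb ` rho_b k)" "finite (?fa ` rho_a k)"
    using finite_rho_index[of k] by (auto simp only: R finite_insert finite_Un)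
  have disj: "?f0 ` rho_a0 k \<inter> ?fb ` rho_b k = {}" "(?f0 ` rho_a0 k \<union> ?fb ` rho_b k) \<inter> ?fa ` rho_a k = {}"
    "[(0, k)] \<notin> ?f0 ` rho_a0 k \<union> ?fb ` rho_b k \<union> ?fa ` rho_a k"
    by (auto simp: rho_a_def)
  have "sum F (?f0 ` rho_a0 k) = (\<Sum>(q1, q, r)\<in>rho_a0 k. F ((0, q1) # (0, q) # r))"
    "sum F (?fb ` rho_b k) = (\<Sum>(q1, r)\<in>rho_b k. F ((0, q1) # (1, q1) # r))"
    "sum F (?fa ` rho_a k) = (\<Sum>(q1, t)\<in>rho_a k. F ((0, q1) # t))"
    by (simp_all add: sum.reindex[OF inj(1)] sum.reindex[OF inj(2)] sum.reindex[OF inj(3)])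
      (auto intro!: sum.cong)
  then show ?thesis
    unfolding R using fin disj by (simp add: sum.union_disjoint add.assoc del: image_eqI)
qed

text \<open>For the index \<open>(0, q1) # (0, q) # r\<close> the surviving cut puts the bead from
  \<open>q1\<close> to \<open>q\<close> before the word of \<open>(0, q) # r\<close>. The same
  necklace arises from \<open>(0, q) # r\<close> by splitting its marked bead at
  \<open>v = q1\<close>.\<close>

lemma rho_cancel_split:
  assumes l: "length c = Suc k" and k: "0 < k"
  shows "(\<Sum>(q1, q, r)\<in>rho_a0 k. sg (rho_sign ((0, q1) # (0, q) # r)) (rho_d c ((0, q1) # (0, q) # r)))
    = (\<Sum>s\<in>rho_index k. sg (rho_sign s) (\<Sum>v | fst (last s) \<le> v \<and> v < snd (hd s) \<and> 0 < v.
        rho_c c k s v :: 'a necklace \<Rightarrow>\<^sub>0 'r::comm_ring_1))"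
proof -
  have fin: "finite {v. fst (last s) \<le> v \<and> v < snd (hd s) \<and> 0 < v}" for s :: "(nat \<times> nat) list"
    by (rule finite_subset[of _ "{..<snd (hd s)}"]) auto
  show ?thesis
    unfolding sg_sum sum.Sigma[OF finite_rho_index ballI[OF fin]]
  proof (rule sum.reindex_bij_witness[of _ "\<lambda>(s, v). (v, snd (hd s), tl s)" "\<lambda>(q1, q, r). ((0, q) # r, q1)"], goal_cases)
    case (1 x)
    then show ?case by (cases x) auto
  next
    case (2 x)
    then show ?case
      by (auto simp: rho_a0_def rho_index_iff rho_step_def split: if_splits)
  next
    case (3 y)
    then show ?case by (cases "fst y") (auto simp: rho_index_iff prod_eq_iff)
  next
    case (4 y)
    obtain s v where y: "y = (s, v)" by (cases y)
    obtain q r where s: "s = (0, q) # r" using 4 y by (cases s) (auto simp: rho_index_iff prod_eq_iff)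
    show ?case using 4 unfolding y s by (auto simp: rho_a0_def rho_index_iff rho_step_def)
  next
    case (5 x)
    obtain q1 q r where x: "x = (q1, q, r)" by (cases x)
    have s: "(0, q1) # (0, q) # r \<in> rho_index k" using 5 by (simp add: x rho_a0_def)
    have q: "0 < q1" "q1 < q" "q \<le> k"
      using s rho_path(4)[OF c s l k] rho_step_le[of "(0, q) # r"] by (auto simp: rho_index_iff rho_step_def)
    obtain u v where uv: "q = q1 + Suc u" "k = q + v"
      using q(2,3) by (metis add_Suc_right le_Suc_ex less_natE)
    have lk: "snd (last ((0, q) # r)) = k" using s by (auto simp: rho_index_iff)
    then show ?case
      using q by (auto simp: x rho_c_def rho_mark_def rho_sign_eq uv sg_def nk_lin algebra_simps)
  qed
qed

lemma rho_a_eq: "rho_a k = {(q1, r) \<in> rho_b k. r \<noteq> []}"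
proof -
  have "t \<noteq> [] \<and> (0, q1) # t \<in> rho_index k \<and> 0 < fst (hd t) \<and> hd t \<noteq> (1, q1) \<longleftrightarrow>
    (0, q1) # (1, q1) # t \<in> rho_index k \<and> t \<noteq> []" for q1 t
    by (cases t) (auto simp: rho_index_iff rho_step_def prod_eq_iff)
  then show ?thesis by (auto simp: rho_a_def rho_b_def)
qed

text \<open>Inserting \<open>(1, q1)\<close> after the head adds one pair and leaves the other
  contributions to the sign unchanged. It matches \<open>rho_a\<close> with the members of
  \<open>rho_b\<close> having nonempty tail, and the \<open>rho_x\<close> terms cancel; the faces of
  the triangles remain.\<close>

lemma rho_cancel_edge:
  "(\<Sum>(q1, r)\<in>rho_b k. sg (rho_sign ((0, q1) # (1, q1) # r)) (rho_d c ((0, q1) # (1, q1) # r)))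
    + (\<Sum>(q1, t)\<in>rho_a k. sg (rho_sign ((0, q1) # t)) (rho_d c ((0, q1) # t)))
    = (\<Sum>(q1, r)\<in>rho_b k. sg (rho_sign ((0, q1) # (1, q1) # r))
        (nk (wd (rho_beads c ((1, q1) # r))) (rho_mark c ((0, q1) # (1, q1) # r)) :: 'a necklace \<Rightarrow>\<^sub>0 'r::comm_ring_1))"
proof -
  have "finite ((\<lambda>(q1, r). (0, q1) # (1, q1) # r) ` rho_b k)"
    by (rule finite_subset[OF _ finite_rho_index[of k]]) (auto simp: rho_b_def)
  then have fin: "finite (rho_b k)"
    by (rule finite_imageD) (auto simp: inj_on_def)
  have "(\<Sum>(q1, t)\<in>rho_a k. sg (rho_sign ((0, q1) # t)) (rho_d c ((0, q1) # t)))
    = (\<Sum>(q1, r)\<in>rho_b k. if r = [] then 0 else sg (rho_sign ((0, q1) # (1, q1) # r)) (rho_x c q1 r :: 'a necklace \<Rightarrow>\<^sub>0 'r))"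
  proof (rule sum.mono_neutral_cong_left[OF fin])
    fix x assume x: "x \<in> rho_a k"
    obtain q1 t where qt: "x = (q1, t)" "t \<noteq> []" "(0, q1) # t \<in> rho_index k" "0 < fst (hd t)" "hd t \<noteq> (1, q1)"
      using x by (auto simp: rho_a_def)
    obtain p' q' r where t: "t = (p', q') # r" using qt by (cases t) auto
    show "(case x of (q1, t) \<Rightarrow> sg (rho_sign ((0, q1) # t)) (rho_d c ((0, q1) # t))) =
      (case x of (q1, r) \<Rightarrow> if r = [] then 0 else sg (rho_sign ((0, q1) # (1, q1) # r)) (rho_x c q1 r :: 'a necklace \<Rightarrow>\<^sub>0 'r))"
      using qt by (auto simp: t rho_sign_eq sg_def)
  qed (auto simp: rho_a_eq)
  then show ?thesis
    by (simp add: sum.distrib[symmetric]) (intro sum.cong refl; auto simp: sg_diff)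
qed

end

section \<open>The surviving terms of \<rho> and the face opposite to the first vertex\<close>

lemma nk_one: "nk 1 c = basis ((last c, []), c)"
  using nk_wd[of "[]" c] by simp

lemma rho_bD:
  assumes "(q, r) \<in> rho_b k"
  shows "successively rho_step ((1, q) # r)" "1 < q" "snd (last ((1, q) # r)) = k" "fst (last ((1, q) # r)) \<le> q"
proof -
  have "rho_step (0, q) (1, q)" using assms by (auto simp: rho_b_def rho_index_iff)
  then show "1 < q" by (auto simp: rho_step_def)
qed (use assms in \<open>auto simp: rho_b_def rho_index_iff\<close>)

text \<open>Removing the head \<open>(0, q1)\<close> and lowering all positions by one turns the
  remaining sequence \<open>(1, q1) # r\<close> into an index for the face, with the same beads and
  the same marked bead; only parity of the sign has to be compared.\<close>

lemma rho_face_zero: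
  assumes c: "sorted_wrt (<) (a # c)" and l: "length c = Suc k" and k: "0 < k"
  shows "(\<Sum>(q1, r)\<in>rho_b (Suc k). sg (rho_sign ((0, q1) # (1, q1) # r))
      (nk (wd (rho_beads (a # c) ((1, q1) # r))) (rho_mark (a # c) ((0, q1) # (1, q1) # r))))
    = (rho_map (basis c) :: 'a::linorder necklace \<Rightarrow>\<^sub>0 'r::comm_ring_1)"
proof -
  let ?S = "map (\<lambda>(p, q). (Suc p, Suc q)) :: (nat \<times> nat) list \<Rightarrow> _"
  let ?P = "map (\<lambda>(p, q). (p - 1, q - 1)) :: (nat \<times> nat) list \<Rightarrow> _"
  have sc: "sorted_wrt (<) c" using c by simp
  have SP: "?S (?P t) = t" if "successively rho_step ((1, q) # t)" "0 < q" for t q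
    using that
  proof (induction t arbitrary: q)
    case (Cons y t)
    obtain p' q' where y: "y = (p', q')" by (cases y)
    have "1 \<le> p'" "q \<le> q'" using Cons(2) y by (auto simp: rho_step_def)
    moreover have "successively rho_step ((1, q') # t)"
      using Cons(2) y by (cases t) (auto simp: rho_step_def)
    ultimately show ?case using Cons(1)[of q'] Cons(3) y by auto
  qed simp
  have PS: "?P (?S t) = t" for t by (induction t) auto
  have step: "successively rho_step (?S t) = successively rho_step t" for t
    by (simp add: successively_map case_prod_unfold rho_step_def)
  have lastS: "t \<noteq> [] \<Longrightarrow> last (?S t) = (Suc (fst (last t)), Suc (snd (last t)))" for t
    by (simp add: last_map case_prod_unfold)
  have pS: "pick (a # c) (map Suc js) = pick c js" for js
    by (simp add: pick_def)
  have word: "rho_beads (a # c) (?S t) = rho_beads c t" for t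
  proof (induction t rule: induct_list012)
    case (3 x y t)
    then show ?case
      using pS[of "[snd x, fst x]"] pS[of "[fst x..<Suc (fst y)] @ [snd x..<Suc (snd y)]"]
      by (cases x; cases y) (simp add: map_Suc_upt)
  next
    case (2 x)
    then show ?case using pS[of "[snd x, fst x]"] by (cases x) simp
  qed simp
  \<comment> \<open>Raising every p by one adds the differences of consecutive q, which
    telescope.\<close>
  have sum: "t \<noteq> [] \<Longrightarrow> successively rho_step t \<Longrightarrow> rho_sum (?S t) = rho_sum t + (snd (last t) - snd (hd t))" for t
  proof (induction t rule: induct_list012)
    case (3 x y t)
    then have "snd x \<le> snd y" "snd y \<le> snd (last (y # t))"
      using rho_step_le[of "y # t"] by (auto simp: rho_step_def)
    then show ?case using 3 by (cases x; cases y) auto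
  qed auto
  show ?thesis
    unfolding rho_map_basis[OF sc l k]
  proof (rule sum.reindex_bij_witness[of _ "\<lambda>s. (Suc (snd (hd s)), ?S (tl s))" "\<lambda>(q1, r). ?P ((1, q1) # r)"], goal_cases)
    case (1 x)
    obtain q r where x: "x = (q, r)" by (cases x)
    have "successively rho_step ((1, q) # r)" "1 < q" using 1 by (auto simp only: x dest: rho_bD)
    then show ?case using SP[of q r] by (simp add: x)
  next
    case (2 x)
    obtain q r where x: "x = (q, r)" by (cases x)
    have h: "successively rho_step ((1, q) # r)" "1 < q" using 2 by (auto simp only: x dest: rho_bD)
    then have e: "(1, q) # r = ?S ((0, q - 1) # ?P r)" using SP[of q r] by (simp add: One_nat_def)
    have "successively rho_step ((0, q - 1) # ?P r)" using h(1) unfolding e step .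
    moreover have "last ((1, q) # r) = (Suc (fst (last ((0, q - 1) # ?P r))), Suc (snd (last ((0, q - 1) # ?P r))))"
      unfolding e by (rule lastS) simp
    moreover have "fst (last ((1, q) # r)) \<le> q" "snd (last ((1, q) # r)) = Suc k"
      using rho_bD(3,4)[OF 2[unfolded x]] by auto
    ultimately show ?case by (auto simp: x rho_index_iff)
  next
    case (3 s)
    then show ?case using PS[of "tl s"] by (cases s) (auto simp: rho_index_iff prod_eq_iff)
  next
    case (4 s)
    have q: "0 < snd (hd s)" by (rule rho_path(4)[OF sc 4 l k])
    obtain q r where s: "s = (0, q) # r" using 4 by (cases s) (auto simp: rho_index_iff prod_eq_iff)
    have "successively rho_step (?S s)" "last (?S s) = (Suc (fst (last s)), Suc (snd (last s)))"
      using 4 lastS[of s] by (auto simp: step rho_index_iff)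
    then show ?case using 4 q by (auto simp: s rho_b_def rho_index_iff rho_step_def One_nat_def)
  next
    case (5 x)
    obtain q r where x: "x = (q, r)" by (cases x)
    have h: "successively rho_step ((1, q) # r)" "1 < q" using 5 by (auto simp only: x dest: rho_bD)
    obtain q' where q': "q = Suc q'" "0 < q'" using h(2) by (cases q) auto
    let ?s = "(0, q') # ?P r"
    have e: "(1, q) # r = ?S ?s" using SP[of q r] h by (simp add: q' One_nat_def)
    have r: "r = ?S (?P r)" using SP[of q r] h by simp
    have ls: "last ((1, q) # r) = (Suc (fst (last ?s)), Suc (snd (last ?s)))"
      unfolding e by (rule lastS) simp
    have st: "successively rho_step ?s" using h(1) unfolding e step .
    have lk: "snd (last ?s) = k" using 5 ls by (auto simp: x rho_b_def rho_index_iff)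
    have le: "q' \<le> k" "fst (last ?s) \<le> q'" using rho_step_le[OF st] lk 5 ls by (auto simp: x q' rho_b_def rho_index_iff)
    obtain u where u: "k = q' + u" using le(1) le_Suc_ex by blast
    have rs: "rho_sum ((1, q) # r) = rho_sum ?s + u" unfolding e using sum[OF _ st] lk u by simp
    have "rho_mark (a # c) ((0, q) # (1, q) # r) = rho_mark c ?s"
      using ls pS[of "[fst (last ?s)..<Suc q']"] by (simp add: rho_mark_def q' map_Suc_upt)
    moreover have "rho_beads (a # c) ((1, q) # r) = rho_beads c ?s" unfolding e by (rule word)
    moreover have "even (rho_sign ((0, q) # (1, q) # r)) = even (rho_sign ?s)"
      using ls rs lk by (simp add: rho_sign_eq q' u) auto
    ultimately show ?case
      by (simp add: x q' sg_def)
  qed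
qed

text \<open>After the two cancellations D of \<open>\<rho>\<close> is congruent to
  \<open>\<rho>\<close> of the face opposite to the first vertex. The other faces keep that vertex
  in front, so the contraction kills \<open>\<rho>\<close> of them.\<close>

lemma rho_kz:
  assumes c: "sorted_wrt (<) c" and l: "length c = Suc k" and k: "0 < k"
  shows "kz c (\<lambda>_. 0) (necklace_diff (rho_map (basis c)) - rho_map (simplicial_boundary (basis c))
    :: 'a::linorder necklace \<Rightarrow>\<^sub>0 'r::comm_ring_1)"
proof -
  have lr: "lin rho_map" by (simp add: rho_map_def lin_lin_ext)
  have c0: "0 < length c" using l by simp
  define B :: "'a necklace \<Rightarrow>\<^sub>0 'r" where "B = (\<Sum>(q1, r)\<in>rho_b k. sg (rho_sign ((0, q1) # (1, q1) # r))
      (nk (wd (rho_beads c ((1, q1) # r))) (rho_mark c ((0, q1) # (1, q1) # r))))"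
  let ?C = "\<lambda>s. \<Sum>v | fst (last s) \<le> v \<and> v < snd (hd s) \<and> 0 < v. rho_c c k s v :: 'a necklace \<Rightarrow>\<^sub>0 'r"
  have "kz c (\<lambda>_. 0) (\<Sum>s\<in>rho_index k. sg (rho_sign s) (necklace_diff (nk (wd (rho_beads c s)) (rho_mark c s))
      - (rho_d c s - ?C s)))"
    by (intro kz_sum kz_sg rho_D_kz c l k)
  also have "(\<Sum>s\<in>rho_index k. sg (rho_sign s) (necklace_diff (nk (wd (rho_beads c s)) (rho_mark c s))
      - (rho_d c s - ?C s))) = necklace_diff (rho_map (basis c))
      - ((\<Sum>s\<in>rho_index k. sg (rho_sign s) (rho_d c s)) - (\<Sum>s\<in>rho_index k. sg (rho_sign s) (?C s)))"
    by (simp add: rho_map_basis[OF c l k] lin_sum[OF necklace_diff_lin] lin_sg[OF necklace_diff_lin] sg_diff sum_subtractf)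
  also have "(\<Sum>s\<in>rho_index k. sg (rho_sign s) (rho_d c s)) = (\<Sum>s\<in>rho_index k. sg (rho_sign s) (?C s)) + B"
    unfolding rho_index_split[OF c k] rho_cancel_split[OF c l k] B_def rho_cancel_edge[OF c, symmetric]
    by (simp add: add.assoc)
  finally have 1: "kz c (\<lambda>_. 0) (necklace_diff (rho_map (basis c)) - B)" by simp
  have 2: "kz c (\<lambda>_. 0) (B - rho_map (simplicial_boundary (basis c)))"
  \<comment> \<open>The faces of an edge are vertices, for which \<open>\<rho>\<close> has its own
    formula; the word there is the unit, killed by every contraction.\<close>
  proof (cases "k = 1")
    case True
    have "B = 0"
      unfolding B_def
    proof (rule sum.neutral, rule ballI)
      fix x assume x: "x \<in> rho_b k"
      obtain q r where qr: "x = (q, r)" by (cases x)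
      have "q \<le> snd (last ((0, q) # (1, q) # r))" "1 < q" "snd (last ((0, q) # (1, q) # r)) = k"
        using x rho_step_le[of "(0, q) # (1, q) # r"] by (auto simp: qr rho_b_def rho_index_iff rho_step_def)
      then show "(case x of (q1, r) \<Rightarrow> sg (rho_sign ((0, q1) # (1, q1) # r))
        (nk (wd (rho_beads c ((1, q1) # r))) (rho_mark c ((0, q1) # (1, q1) # r)))) = (0 :: 'a necklace \<Rightarrow>\<^sub>0 'r)"
        using True by auto
    qed
    moreover have "kz c (\<lambda>_. 0) (rho_map (basis (omit j c)) :: 'a necklace \<Rightarrow>\<^sub>0 'r)" if j: "j \<le> k" for j
    proof -
      have "length (omit j c) = 1" using length_omit[of j c] j l True by simp
      then obtain v where v: "omit j c = [v]" by (cases "omit j c") auto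
      have "rho_map (basis [v]) = (nk 1 [v] :: 'a necklace \<Rightarrow>\<^sub>0 'r)"
        by (simp add: rho_map_def sdim_def nk_one)
      then show ?thesis by (simp add: v kz_nk)
    qed
    ultimately show ?thesis
      using k l by (simp add: boundary_basis sdim_def lin_sum[OF lr] lin_sg[OF lr])
        (intro kz_uminus kz_sum kz_sg, simp)
  next
    case False
    obtain a c' where ac: "c = a # c'" using l by (cases c) auto
    obtain k' where k': "k = Suc k'" "0 < k'" using False k by (cases k) auto
    have B: "B = rho_map (basis (omit 0 c))"
      unfolding B_def using rho_face_zero[of a c' k'] c l k' by (simp add: ac omit_def)
    have "kz c (\<lambda>_. 0) (rho_map (basis (omit j c)) :: 'a necklace \<Rightarrow>\<^sub>0 'r)" if j: "j \<in> {1..k}" for j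
    proof -
      have d: "sorted_wrt (<) (omit j c)" "length (omit j c) = Suc k'" "omit j c ! 0 = c ! 0"
        using sorted_omit[OF c] length_omit[of j c] j l k' by (auto simp: omit_def nth_append)
      show ?thesis
        unfolding rho_map_basis[OF d(1,2) k'(2)]
      proof (intro kz_sum kz_sg kz_nk)
        fix s assume s: "s \<in> rho_index k'"
        obtain q t where qt: "s = (0, q) # t" using s by (cases s) (auto simp: rho_index_iff prod_eq_iff)
        show "ctr c 0 (wd (rho_beads (omit j c) s)) = (0 :: ('a, 'r) walg)"
          using ctr_rho_word(1)[OF c c0 d(1,3), of q t] rho_path(4)[OF d(1) s d(2) k'(2)] s d(2)
          by (auto simp: qt rho_index_iff)
      qed
    qed
    moreover have "{..k} = insert 0 {1..k}" by auto
    ultimately show ?thesis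
      using k l by (simp add: boundary_basis sdim_def lin_sum[OF lr] lin_sg[OF lr] lin_add[OF lr] B)
        (intro kz_uminus kz_sum kz_sg, simp)
  qed
  show ?thesis using kz_add[OF 1 2] by simp
qed

lemma carried_rho: "carried rho_map"
  unfolding carried_def
proof (intro conjI allI impI)
  show lr: "lin rho_map" by (simp add: rho_map_def lin_lin_ext)
  fix c :: "'a list" assume c: "sorted_wrt (<) c" "c \<noteq> []"
  have "(rho_map (basis c) :: 'a necklace \<Rightarrow>\<^sub>0 'b) \<in> necklace_chains (full c) (sdim c)
    \<and> neck_aug (rho_map (basis c)) = (basis c :: _ \<Rightarrow>\<^sub>0 'b)"
  proof (cases "sdim c")
    case 0
    then obtain v where v: "c = [v]" using c by (cases c; cases "tl c") (auto simp: sdim_def)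
    have "rho_map (basis [v]) = (nk 1 [v] :: 'a necklace \<Rightarrow>\<^sub>0 'b)"
      by (simp add: rho_map_def sdim_def nk_one)
    moreover have "(nk 1 [v] :: 'a necklace \<Rightarrow>\<^sub>0 'b) \<in> necklace_chains (full [v]) 0"
      by (rule nk_in[OF asc_full, of "[v]" _ 0 _ 0]) (auto simp: simplices_iff full_def intro: PA_1)
    ultimately show ?thesis by (simp add: v neck_aug_nk sdim_def)
  next
    case (Suc k)
    then have l: "length c = Suc (Suc k)" using c by (cases c) (auto simp: sdim_def)
    show ?thesis by (simp add: Suc rho_in[OF c(1) l])
  qed
  then show "(rho_map (basis c) :: 'a necklace \<Rightarrow>\<^sub>0 'b) \<in> necklace_chains (full c) (sdim c)" "neck_aug (rho_map (basis c)) = (basis c :: _ \<Rightarrow>\<^sub>0 'b)"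
    by auto
qed

lemma rho_chain_map:
  "sorted_wrt (<) (c :: 'a::linorder list) \<Longrightarrow> c \<noteq> [] \<Longrightarrow>
    necklace_diff (rho_map (basis c)) = rho_map (simplicial_boundary (basis c))"
proof (rule carried_chain_map[OF carried_rho])
  fix c e :: "'a list" and k assume c: "sorted_wrt (<) c" "0 < sdim c"
  show "\<exists>b<length c. ctr c b (coef e (necklace_diff (rho_map (basis c)) - rho_map (simplicial_boundary (basis c)))) = (0 :: ('a, 'b) walg)"
    using rho_kz[OF c(1), of "sdim c", where 'r = 'b] c
    by (intro exI[of _ 0]) (auto simp: kz_def sdim_def)
qed

section \<open>Sums over the cuts of a simplex\<close>

lemma sg_comm: "sg n (sg m x) = sg m (sg n x)"
  by (simp add: add.commute)

lemma one_le_iff [simp]: "1 \<le> (n::nat) \<longleftrightarrow> 0 < n"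
  by auto

lemma sdim_pair [simp]: "sdim [u, v] = 1"
  by (simp add: sdim_def One_nat_def)

lemma length_front_rear: "0 < j \<Longrightarrow> j < sdim x \<Longrightarrow> length (rear j x) < length x"
  "j < sdim x \<Longrightarrow> length (front j x) < length x" "j < sdim x \<Longrightarrow> 2 \<le> length (rear j x)"
  "0 < j \<Longrightarrow> j < sdim x \<Longrightarrow> 2 \<le> length (front j x)"
  by (auto simp: sdim_def front_def rear_def)

text \<open>\<open>cut_sum f x\<close> is the sum of \<open>\<plusminus> f bs \<gamma>\<close> over the terms \<open>\<plusminus> (bs) \<otimes> (\<gamma>)\<close> of \<open>\<nabla>\<^sub>0(x)\<close>, organised by
  the first block.\<close>

function cut_sum :: "('a list list \<Rightarrow> 'a list \<Rightarrow> 'm::ab_group_add) \<Rightarrow> 'a list \<Rightarrow> 'm" where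
  "cut_sum f x = f [x] [hd x, last x] + (\<Sum>j\<in>{1..<sdim x}.
     cut_sum (\<lambda>bs \<gamma>. sg (sdim x - j + sdim \<gamma>) (f (front j x # bs) (hd x # \<gamma>))) (rear j x))"
  by auto
termination by (relation "measure (\<lambda>(f, x). length x)") (auto simp: length_front_rear)

declare cut_sum.simps [simp del]

text \<open>The terms over which \<open>cut_sum\<close> ranges, as a relation: congruence and
  closure arguments then may assume the shape of the pair at hand.\<close>

inductive cut_of :: "'a list \<Rightarrow> 'a list list \<Rightarrow> 'a list \<Rightarrow> bool" where
  whole: "cut_of x [x] [hd x, last x]"
| first: "0 < j \<Longrightarrow> j < sdim x \<Longrightarrow> cut_of (rear j x) bs \<gamma> \<Longrightarrow> cut_of x (front j x # bs) (hd x # \<gamma>)"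

lemma cut_sum_induct [case_names less]:
  assumes "\<And>x. (\<And>j. j \<in> {1..<sdim x} \<Longrightarrow> P (rear j x)) \<Longrightarrow> P x"
  shows "P x"
proof (induction "length x" arbitrary: x rule: less_induct)
  case less
  show ?case by (rule assms, rule less) (auto simp: length_front_rear)
qed

lemma cut_sum_cong: "(\<And>bs \<gamma>. cut_of x bs \<gamma> \<Longrightarrow> f bs \<gamma> = g bs \<gamma>) \<Longrightarrow> cut_sum f x = cut_sum g x"
proof (induction x arbitrary: f g rule: cut_sum_induct)
  case (less x)
  have "cut_sum (\<lambda>bs \<gamma>. sg (sdim x - j + sdim \<gamma>) (f (front j x # bs) (hd x # \<gamma>))) (rear j x)
    = cut_sum (\<lambda>bs \<gamma>. sg (sdim x - j + sdim \<gamma>) (g (front j x # bs) (hd x # \<gamma>))) (rear j x)"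
    if "j \<in> {1..<sdim x}" for j
    using that by (intro less(1)) (auto simp: less(2)[OF cut_of.first])
  then show ?case
    by (subst (1 2) cut_sum.simps) (simp add: less(2)[OF cut_of.whole])
qed

lemma cut_sum_closed:
  assumes "\<And>x y. P x \<Longrightarrow> P y \<Longrightarrow> P (x + y)" "\<And>x. P x \<Longrightarrow> P (- x)" "P 0"
  shows "(\<And>bs \<gamma>. cut_of x bs \<gamma> \<Longrightarrow> P (f bs \<gamma>)) \<Longrightarrow> P (cut_sum f x)"
proof (induction x arbitrary: f rule: cut_sum_induct)
  case (less x)
  have s: "(\<And>i. i \<in> I \<Longrightarrow> P (h i)) \<Longrightarrow> P (sum h I)" for h and I :: "nat set"
    by (induction I rule: infinite_finite_induct) (auto intro: assms)
  show ?case
    by (subst cut_sum.simps, intro assms(1) s less)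
      (auto simp: sg_def intro!: assms(2) less(2) cut_of.intros)
qed

lemma cut_sum_hom:
  assumes h: "\<And>x y. h (x + y) = h x + h y"
  shows "h (cut_sum f x) = cut_sum (\<lambda>bs \<gamma>. h (f bs \<gamma>)) x"
proof (induction x arbitrary: f rule: cut_sum_induct)
  case (less x)
  have h0: "h 0 = 0" using h[of 0 0] by simp
  have hm: "h (- x) = - h x" for x using h[of x "- x"] h0 by (simp add: add_eq_0_iff)
  have hs: "h (sum g I) = (\<Sum>i\<in>I. h (g i))" for g and I :: "nat set"
    by (induction I rule: infinite_finite_induct) (auto simp: h0 h)
  have hg: "h (sg n x) = sg n (h x)" for n x by (simp add: sg_def hm)
  show ?case
    by (subst (1 2) cut_sum.simps) (simp add: h hs less hg)
qed

lemma cut_sum_add: "cut_sum (\<lambda>bs \<gamma>. f bs \<gamma> + g bs \<gamma>) x = cut_sum f x + cut_sum g x"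
proof (induction x arbitrary: f g rule: cut_sum_induct)
  case (less x)
  show ?case
    by (subst (1 2 3) cut_sum.simps) (simp add: sg_add less sum.distrib algebra_simps)
qed

lemma cut_sum_zero [simp]: "cut_sum (\<lambda>bs \<gamma>. 0) x = 0"
  using cut_sum_add[of "\<lambda>_ _. 0" "\<lambda>_ _. 0" x] by simp

lemma cut_sum_uminus: "cut_sum (\<lambda>bs \<gamma>. - f bs \<gamma>) x = - cut_sum f x"
  by (simp add: cut_sum_hom[of uminus])

lemma cut_sum_sg: "cut_sum (\<lambda>bs \<gamma>. sg n (f bs \<gamma>)) x = sg n (cut_sum f x)"
  by (simp add: cut_sum_hom[of "sg n"] sg_add)

lemma cut_sum_diff: "cut_sum (\<lambda>bs \<gamma>. f bs \<gamma> - g bs \<gamma>) x = cut_sum f x - cut_sum g x"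
  using cut_sum_add[of f "\<lambda>bs \<gamma>. - g bs \<gamma>" x] by (simp add: cut_sum_uminus)

lemma cut_sum_sum: "cut_sum (\<lambda>bs \<gamma>. \<Sum>i\<in>I. f i bs \<gamma>) x = (\<Sum>i\<in>I. cut_sum (f i) x)"
  by (induction I rule: infinite_finite_induct) (auto simp: cut_sum_add)

lemma cut_sum_mult_left: "cut_sum (\<lambda>bs \<gamma>. y * f bs \<gamma>) x = y * (cut_sum f x :: 'm::ring)"
  by (simp add: cut_sum_hom[of "\<lambda>z. y * z"] distrib_left)

lemma cut_sum_mult_right: "cut_sum (\<lambda>bs \<gamma>. f bs \<gamma> * y) x = (cut_sum f x :: 'm::ring) * y"
  by (simp add: cut_sum_hom[of "\<lambda>z. z * y"] distrib_right)

lemma cut_sum_lin: "lin h \<Longrightarrow> h (cut_sum f x) = cut_sum (\<lambda>bs \<gamma>. h (f bs \<gamma>)) x"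
  by (rule cut_sum_hom) (rule lin_add)

abbreviation bdeg :: "'a list list \<Rightarrow> nat" where
  "bdeg bs \<equiv> (\<Sum>x\<leftarrow>bs. sdim x - 1)"

lemma cut_of_lengths:
  assumes "cut_of x bs \<gamma>" "2 \<le> length x"
  shows "length \<gamma> = Suc (length bs)" "bs \<noteq> []" "bdeg bs + sdim \<gamma> = sdim x" "hd \<gamma> = hd x" "last \<gamma> = last x"
    "hd (hd bs) = hd x"
  using assms
proof (induction rule: cut_of.induct)
  case (first j x bs \<gamma>)
  note l = length_front_rear(3)[OF first(2)]
  { case 1 show ?case using first(4)[OF l] by simp
  next case 2 show ?case by simp
  next case 3 show ?case using first(6)[OF l] first(4)[OF l] first(1,2)
    by (cases \<gamma>) (auto simp: sdim_front sdim_rear sdim_def length_front length_rear)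
  next case 4 show ?case by simp
  next case 5 show ?case using first(8)[OF l] first(4)[OF l] first(2) by (auto simp: last_rear sdim_def)
  next case 6 show ?case using first(2) by (auto simp: sdim_def intro!: hd_front) }
qed (auto simp: sdim_def)

lemma cut_of_sorted:
  fixes x :: "'a::linorder list"
  assumes "cut_of x bs \<gamma>" "2 \<le> length x" "sorted_wrt (<) x"
  shows "sorted_wrt (<) \<gamma> \<and> set \<gamma> \<subseteq> set x \<and> wpath {b. sorted_wrt (<) b \<and> set b \<subseteq> set x \<and> 2 \<le> length b} (hd x) bs (last x)"
  using assms
proof (induction rule: cut_of.induct)
  case (whole x)
  then obtain u v y where x: "x = u # v # y" by (cases x; cases "tl x") auto
  have "last (v # y) \<in> set (v # y)" by (rule last_in_set) simp
  with whole show ?case by (auto simp: x)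
next
  case (first j x bs \<gamma>)
  let ?B = "\<lambda>x. {b. sorted_wrt (<) b \<and> set b \<subseteq> set x \<and> 2 \<le> length b}"
  note l = length_front_rear(3)[OF first(2)]
  obtain u y where x: "x = u # y" using first(2) by (cases x) (auto simp: sdim_def)
  obtain i where j: "j = Suc i" using first(1) by (cases j) auto
  have IH: "sorted_wrt (<) \<gamma>" "set \<gamma> \<subseteq> set (rear j x)" "wpath (?B (rear j x)) (hd (rear j x)) bs (last (rear j x))"
    using first l by (auto simp: sorted_rear)
  have "set (rear j x) \<subseteq> set y" by (simp add: x j rear_def set_drop_subset)
  then have "sorted_wrt (<) (u # \<gamma>)" "set (u # \<gamma>) \<subseteq> set x"
    using IH first(6) by (auto simp: x)
  moreover have "wpath (?B x) (hd (rear j x)) bs (last (rear j x))"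
    using set_rear[of j x] by (intro wpath_mono[OF IH(3)]) auto
  moreover have "front j x \<in> ?B x"
    using first set_front[of j x] by (auto simp: sorted_front length_front_rear)
  ultimately show ?case
    using first(2) by (auto simp: x hd_rear last_front last_rear hd_front sdim_def)
qed

lemma cut_sum_neutral: "(\<And>bs \<gamma>. cut_of x bs \<gamma> \<Longrightarrow> f bs \<gamma> = 0) \<Longrightarrow> cut_sum f x = 0"
  using cut_sum_cong[of x f "\<lambda>_ _. 0"] by simp

lemma cut_of_sdim_le: "cut_of x bs \<gamma> \<Longrightarrow> 2 \<le> length x \<Longrightarrow> sdim \<gamma> \<le> sdim x"
  using cut_of_lengths(3)[of x bs \<gamma>] by simp

fun edges :: "'a list \<Rightarrow> 'a list list" where
  "edges (u # v # x) = [u, v] # edges (v # x)"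
| "edges x = []"

text \<open>The cut into edges is the only one whose second factor has full dimension. Its sign is
  +, since its blocks have no interior vertices.\<close>

lemma cut_sum_top:
  "(\<And>bs \<gamma>. cut_of x bs \<gamma> \<Longrightarrow> sdim \<gamma> \<noteq> sdim x \<Longrightarrow> f bs \<gamma> = 0) \<Longrightarrow> 2 \<le> length x \<Longrightarrow> cut_sum f x = f (edges x) x"
proof (induction x arbitrary: f rule: cut_sum_induct)
  case (less x)
  obtain u v y where x: "x = u # v # y" using less(3) by (cases x; cases "tl x") auto
  show ?case
  proof (cases y)
    case Nil
    then show ?thesis by (simp add: x cut_sum.simps[of f] sdim_def One_nat_def)
  next
    case (Cons w z)
    have f0: "f [x] [hd x, last x] = 0"
      by (rule less(2)[OF cut_of.whole]) (simp add: x Cons sdim_def)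
    let ?t = "\<lambda>j. cut_sum (\<lambda>bs \<gamma>. sg (sdim x - j + sdim \<gamma>) (f (front j x # bs) (hd x # \<gamma>))) (rear j x)"
    have "?t j = 0" if j: "j \<in> {1..<sdim x} - {1}" for j
    proof (rule cut_sum_neutral)
      fix bs \<gamma> assume c: "cut_of (rear j x) bs \<gamma>"
      have "sdim \<gamma> \<le> sdim x - j" using cut_of_sdim_le[OF c] j by (auto simp: length_front_rear sdim_rear)
      moreover have "length \<gamma> = Suc (length bs)" using cut_of_lengths(1)[OF c] j by (auto simp: length_front_rear)
      ultimately have "f (front j x # bs) (hd x # \<gamma>) = 0"
        using j c by (intro less(2) cut_of.intros) (auto simp: sdim_def)
      then show "sg (sdim x - j + sdim \<gamma>) (f (front j x # bs) (hd x # \<gamma>)) = 0" by simp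
    qed
    then have "(\<Sum>j\<in>{1..<sdim x}. ?t j) = ?t 1"
      by (subst sum.remove[of _ 1]) (auto simp: x Cons sdim_def One_nat_def)
    also have "\<dots> = f (front 1 x # edges (rear 1 x)) (hd x # rear 1 x)"
    proof (subst less(1))
      fix bs \<gamma> assume c: "cut_of (rear 1 x) bs \<gamma>" "sdim \<gamma> \<noteq> sdim (rear 1 x)"
      have "length \<gamma> = Suc (length bs)" using cut_of_lengths(1)[OF c(1)] by (auto simp: x Cons rear_def One_nat_def)
      then have "f (front 1 x # bs) (hd x # \<gamma>) = 0"
        using c by (intro less(2) cut_of.intros) (auto simp: sdim_def x Cons rear_def One_nat_def)
      then show "sg (sdim x - 1 + sdim \<gamma>) (f (front 1 x # bs) (hd x # \<gamma>)) = 0" by simp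
    qed (auto simp: x Cons sdim_def rear_def One_nat_def sg_def)
    finally show ?thesis
      by (subst cut_sum.simps, subst f0) (simp add: x front_def rear_def One_nat_def)
  qed
qed

subsection \<open>Faces, splittings and merging\<close>

text \<open>The differential of a sequence is \<open>split_sum\<close> minus
  \<open>face_sum\<close>, with the Koszul sign for passing earlier beads (\<open>pd_wd\<close>).
  Passing \<open>\<gamma>\<close> through makes \<open>face_sum f\<close> again a function on cuts,
  ready to be summed by \<open>cut_sum\<close>.\<close>

primrec face_sum :: "('a list list \<Rightarrow> 'a list \<Rightarrow> 'm::ab_group_add) \<Rightarrow> 'a list list \<Rightarrow> 'a list \<Rightarrow> 'm" where
  "face_sum f [] \<gamma> = 0"
| "face_sum f (b # bs) \<gamma> = (\<Sum>t\<in>{1..<sdim b}. sg t (f (omit t b # bs) \<gamma>))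
     + sg (sdim b - 1) (face_sum (\<lambda>bs'. f (b # bs')) bs \<gamma>)"

primrec split_sum :: "('a list list \<Rightarrow> 'a list \<Rightarrow> 'm::ab_group_add) \<Rightarrow> 'a list list \<Rightarrow> 'a list \<Rightarrow> 'm" where
  "split_sum f [] \<gamma> = 0"
| "split_sum f (b # bs) \<gamma> = (\<Sum>t\<in>{1..<sdim b}. sg t (f (front t b # rear t b # bs) \<gamma>))
     + sg (sdim b - 1) (split_sum (\<lambda>bs'. f (b # bs')) bs \<gamma>)"

lemma face_sum_hom:
  assumes h: "\<And>x y. h (x + y) = h x + h y"
  shows "h (face_sum f bs \<gamma>) = face_sum (\<lambda>bs' \<gamma>'. h (f bs' \<gamma>')) bs \<gamma>"
    "h (split_sum f bs \<gamma>) = split_sum (\<lambda>bs' \<gamma>'. h (f bs' \<gamma>')) bs \<gamma>"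
proof -
  have h0: "h 0 = 0" using h[of 0 0] by simp
  have hm: "h (- x) = - h x" for x using h[of x "- x"] h0 by (simp add: add_eq_0_iff)
  have hs: "h (sum g I) = (\<Sum>i\<in>I. h (g i))" for g and I :: "nat set"
    by (induction I rule: infinite_finite_induct) (auto simp: h0 h)
  have hg: "h (sg n x) = sg n (h x)" for n x by (simp add: sg_def hm)
  show "h (face_sum f bs \<gamma>) = face_sum (\<lambda>bs' \<gamma>'. h (f bs' \<gamma>')) bs \<gamma>"
    "h (split_sum f bs \<gamma>) = split_sum (\<lambda>bs' \<gamma>'. h (f bs' \<gamma>')) bs \<gamma>"
    by (induction bs arbitrary: f) (simp_all add: h0 h hs hg)
qed

lemma face_sum_fixed: "face_sum f bs \<gamma> = face_sum (\<lambda>bs' \<gamma>'. f bs' \<gamma>) bs \<gamma>'"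
  by (induction bs arbitrary: f) simp_all

lemma split_sum_fixed: "split_sum f bs \<gamma> = split_sum (\<lambda>bs' \<gamma>'. f bs' \<gamma>) bs \<gamma>'"
  by (induction bs arbitrary: f) simp_all

lemma sum_upper_triangle:
  fixes h :: "nat \<Rightarrow> nat \<Rightarrow> 'm::comm_monoid_add"
  shows "(\<Sum>j\<in>{1..<k}. \<Sum>i\<in>{1..<k-j}. h j (j + i)) = (\<Sum>l\<in>{1..<k}. \<Sum>j\<in>{1..<l}. h j l)"
  unfolding sum.Sigma[OF finite_atLeastLessThan ballI[OF finite_atLeastLessThan]]
  by (rule sum.reindex_bij_witness[of _ "\<lambda>(l, j). (j, l - j)" "\<lambda>(j, i). (j + i, j)"]) auto

lemma sum_face_square:
  fixes h :: "nat \<Rightarrow> nat \<Rightarrow> 'm::comm_monoid_add"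
  shows "(\<Sum>t\<in>{1..<k}. \<Sum>j\<in>{1..<k-1}. h t j)
    = (\<Sum>j\<in>{1..<k}. \<Sum>s\<in>{1..<k-j}. h (j + s) j) + (\<Sum>j\<in>{1..<k}. \<Sum>t\<in>{1..<j}. h t (j - 1))"
proof -
  have "(\<Sum>j\<in>{1..<k-1}. h t j) = (\<Sum>j\<in>{1..<t}. h t j) + (\<Sum>j\<in>{t..<k-1}. h t j)" if "t \<in> {1..<k}" for t
    using that by (subst sum.atLeastLessThan_concat) auto
  then have "(\<Sum>t\<in>{1..<k}. \<Sum>j\<in>{1..<k-1}. h t j)
    = (\<Sum>t\<in>{1..<k}. \<Sum>j\<in>{1..<t}. h t j) + (\<Sum>t\<in>{1..<k}. \<Sum>j\<in>{t..<k-1}. h t j)"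
    by (simp add: sum.distrib)
  moreover have "(\<Sum>t\<in>{1..<k}. \<Sum>j\<in>{t..<k-1}. h t j) = (\<Sum>j\<in>{1..<k}. \<Sum>t\<in>{1..<j}. h t (j - 1))"
    unfolding sum.Sigma[OF finite_atLeastLessThan ballI[OF finite_atLeastLessThan]]
    by (rule sum.reindex_bij_witness[of _ "\<lambda>(j, t). (t, j - 1)" "\<lambda>(t, j). (Suc j, t)"]) auto
  ultimately show ?thesis
    by (simp only: sum_upper_triangle[of "\<lambda>j l. h l j"])
qed

lemma sum_from_1: "0 < n \<Longrightarrow> (\<Sum>r\<in>{1..<Suc n}. h r) = h 1 + (\<Sum>r\<in>{1..<n}. h (Suc r) :: 'm::comm_monoid_add)"
  by (simp add: sum.atLeast_Suc_lessThan One_nat_def sum.shift_bounds_Suc_ivl del: sum.op_ivl_Suc)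

text \<open>Deleting an interior vertex \<open>t\<close> of a block gives a cut of
  \<open>omit t x\<close>, and each cut of that face arises once, \<open>t\<close> not being a cut
  vertex. The recursion distinguishes whether \<open>t\<close> lies in the first block.\<close>

lemma cut_sum_faces:
  "2 \<le> length x \<Longrightarrow> cut_sum (face_sum f) x = (\<Sum>t\<in>{1..<sdim x}. sg t (cut_sum f (omit t x)))"
proof (induction x arbitrary: f rule: cut_sum_induct)
  case (less x)
  let ?k = "sdim x"
  let ?g = "\<lambda>j bs \<gamma>. sg (?k - j + sdim \<gamma>) (f (front j x # bs) (hd x # \<gamma>))"
  have k: "length x = Suc ?k" "0 < ?k" using less(2) by (auto simp: sdim_def)
  have "cut_sum (\<lambda>bs \<gamma>. sg (?k - j + sdim \<gamma>) (face_sum f (front j x # bs) (hd x # \<gamma>))) (rear j x)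
    = (\<Sum>t\<in>{1..<j}. sg t (cut_sum (\<lambda>bs \<gamma>. sg (?k - j + sdim \<gamma>) (f (omit t (front j x) # bs) (hd x # \<gamma>))) (rear j x)))
      + (\<Sum>s\<in>{1..<?k-j}. sg (j - 1 + s) (cut_sum (?g j) (omit s (rear j x))))" (is "?L = ?R")
    if j: "j \<in> {1..<?k}" for j
  proof -
    have IHj: "cut_sum (face_sum (?g j)) (rear j x) = (\<Sum>s\<in>{1..<?k-j}. sg s (cut_sum (?g j) (omit s (rear j x))))"
      using less(1)[OF j, of "?g j"] j by (simp add: length_front_rear sdim_rear)
    have "?L = cut_sum (\<lambda>bs \<gamma>. (\<Sum>t\<in>{1..<j}. sg t (sg (?k - j + sdim \<gamma>) (f (omit t (front j x) # bs) (hd x # \<gamma>))))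
        + sg (j - 1) (face_sum (?g j) bs \<gamma>)) (rear j x)"
    proof (rule cut_sum_cong)
      fix bs \<gamma>
      have jf: "sdim (front j x) = j" using j k by (simp add: sdim_front)
      have F: "sg (?k - j + sdim \<gamma>) (face_sum (\<lambda>bs'. f (front j x # bs')) bs (hd x # \<gamma>)) = face_sum (?g j) bs \<gamma>"
        by (subst face_sum_hom(1)[of "sg (?k - j + sdim \<gamma>)"])
          (simp_all add: sg_add face_sum_fixed[of _ bs "hd x # \<gamma>" "\<gamma>"] face_sum_fixed[of "?g j" bs \<gamma> \<gamma>])
      show "sg (?k - j + sdim \<gamma>) (face_sum f (front j x # bs) (hd x # \<gamma>))
        = (\<Sum>t\<in>{1..<j}. sg t (sg (?k - j + sdim \<gamma>) (f (omit t (front j x) # bs) (hd x # \<gamma>))))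
          + sg (j - 1) (face_sum (?g j) bs \<gamma>)"
        unfolding face_sum.simps sg_add sg_sum jf F[symmetric]
        by (intro arg_cong2[of _ _ _ _ "(+)"] sum.cong refl; rule sg_comm)
    qed
    also have "\<dots> = ?R"
      unfolding cut_sum_add cut_sum_sum cut_sum_sg IHj sg_sum unfolding sg_sg by (rule refl)
    finally show ?thesis .
  qed
  then have "cut_sum (face_sum f) x = (\<Sum>t\<in>{1..<?k}. sg t (f [omit t x] [hd x, last x])) + ((\<Sum>j\<in>{1..<?k}. \<Sum>t\<in>{1..<j}.
       sg t (cut_sum (\<lambda>bs \<gamma>. sg (?k - j + sdim \<gamma>) (f (omit t (front j x) # bs) (hd x # \<gamma>))) (rear j x)))
      + (\<Sum>j\<in>{1..<?k}. \<Sum>s\<in>{1..<?k-j}. sg (j - 1 + s) (cut_sum (?g j) (omit s (rear j x)))))"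
    by (subst cut_sum.simps) (simp add: sum.distrib del: sg_Suc)
  also have "(\<Sum>j\<in>{1..<?k}. \<Sum>s\<in>{1..<?k-j}. sg (j - 1 + s) (cut_sum (?g j) (omit s (rear j x))))
    = (\<Sum>j\<in>{1..<?k}. \<Sum>s\<in>{1..<?k-j}. sg (j + s) (cut_sum (\<lambda>bs \<gamma>. sg (?k - 1 - j + sdim \<gamma>) (f (front j (omit (j + s) x) # bs) (hd x # \<gamma>))) (rear j (omit (j + s) x))))"
  proof (intro sum.cong refl, goal_cases)
    case (1 j s)
    then have "front j (omit (j + s) x) = front j x" "rear j (omit (j + s) x) = omit s (rear j x)"
      using k by (auto simp: front_omit_less rear_omit_less)
    moreover have "?g j = (\<lambda>bs \<gamma>. - sg (?k - 1 - j + sdim \<gamma>) (f (front j x # bs) (hd x # \<gamma>)))"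
      using 1 by (intro ext sg_minus_cong) (auto simp: One_nat_def even_diff_nat)
    ultimately show ?case using 1 by (simp only: cut_sum_uminus) (auto simp: sg_def)
  qed
  also have "(\<Sum>j\<in>{1..<?k}. \<Sum>t\<in>{1..<j}.
       sg t (cut_sum (\<lambda>bs \<gamma>. sg (?k - j + sdim \<gamma>) (f (omit t (front j x) # bs) (hd x # \<gamma>))) (rear j x)))
    = (\<Sum>j\<in>{1..<?k}. \<Sum>t\<in>{1..<j}. sg t (cut_sum (\<lambda>bs \<gamma>. sg (?k - 1 - (j - 1) + sdim \<gamma>)
        (f (front (j - 1) (omit t x) # bs) (hd x # \<gamma>))) (rear (j - 1) (omit t x))))"
  proof (intro sum.cong refl, goal_cases)
    case (1 j t)
    then have "front (j - 1) (omit t x) = omit t (front j x)" "rear (j - 1) (omit t x) = rear j x"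
      using k by (auto simp: front_omit_ge rear_omit_ge)
    moreover have "?k - 1 - (j - 1) = ?k - j" using 1 by auto
    ultimately show ?case by simp
  qed
  also have "(\<Sum>t\<in>{1..<?k}. sg t (f [omit t x] [hd x, last x])) + ((\<Sum>j\<in>{1..<?k}. \<Sum>t\<in>{1..<j}. sg t (cut_sum (\<lambda>bs \<gamma>. sg (?k - 1 - (j - 1) + sdim \<gamma>)
        (f (front (j - 1) (omit t x) # bs) (hd x # \<gamma>))) (rear (j - 1) (omit t x))))
     + (\<Sum>j\<in>{1..<?k}. \<Sum>s\<in>{1..<?k-j}. sg (j + s) (cut_sum (\<lambda>bs \<gamma>. sg (?k - 1 - j + sdim \<gamma>) (f (front j (omit (j + s) x) # bs) (hd x # \<gamma>))) (rear j (omit (j + s) x)))))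
    = (\<Sum>t\<in>{1..<?k}. sg t (f [omit t x] [hd x, last x])) + (\<Sum>t\<in>{1..<?k}. \<Sum>j\<in>{1..<?k-1}. sg t (cut_sum (\<lambda>bs \<gamma>. sg (?k - 1 - j + sdim \<gamma>)
        (f (front j (omit t x) # bs) (hd x # \<gamma>))) (rear j (omit t x))))"
    by (subst sum_face_square) (simp only: ac_simps)
  also have "\<dots> = (\<Sum>t\<in>{1..<?k}. sg t (cut_sum f (omit t x)))"
    unfolding sum.distrib[symmetric]
  proof (intro sum.cong refl)
    fix t assume "t \<in> {1..<?k}"
    moreover have "x \<noteq> []" using k by auto
    ultimately show "sg t (f [omit t x] [hd x, last x]) + (\<Sum>j\<in>{1..<?k-1}. sg t (cut_sum (\<lambda>bs \<gamma>. sg (?k - 1 - j + sdim \<gamma>)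
        (f (front j (omit t x) # bs) (hd x # \<gamma>))) (rear j (omit t x)))) = sg t (cut_sum f (omit t x))"
      using k by (subst (2) cut_sum.simps) (auto simp: hd_omit last_omit sdim_omit sg_add sg_sum)
  qed
  finally show ?case .
qed

text \<open>Splitting a block at a vertex refines the cut and keeps \<open>\<gamma>\<close>;
  equivalently, take the refined cut and drop that vertex from its second factor. Both sides run
  over cuts with a distinguished inner vertex of the second factor.\<close>

lemma cut_sum_split:
  "2 \<le> length x \<Longrightarrow> cut_sum (split_sum f) x
    = cut_sum (\<lambda>bs \<gamma>. \<Sum>r\<in>{1..<sdim \<gamma>}. sg (bdeg bs + r) (f bs (omit r \<gamma>))) x"
proof (induction x arbitrary: f rule: cut_sum_induct)
  case (less x)
  let ?k = "sdim x"
  let ?g = "\<lambda>j bs \<gamma>. sg (?k - j + sdim \<gamma>) (f (front j x # bs) (hd x # \<gamma>))"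
  let ?M = "\<lambda>j bs \<gamma>. \<Sum>r\<in>{1..<sdim \<gamma>}. sg (j - 1 + (bdeg bs + r)) (?g j bs (omit r \<gamma>))"
  have k: "length x = Suc ?k" "0 < ?k" using less(2) by (auto simp: sdim_def)
  have L: "cut_sum (\<lambda>bs \<gamma>. sg (?k - j + sdim \<gamma>) (split_sum f (front j x # bs) (hd x # \<gamma>))) (rear j x)
    = (\<Sum>t\<in>{1..<j}. sg t (cut_sum (\<lambda>bs \<gamma>. sg (?k - j + sdim \<gamma>) (f (front t (front j x) # rear t (front j x) # bs) (hd x # \<gamma>))) (rear j x)))
      + cut_sum (?M j) (rear j x)" (is "?L = ?R")
    if j: "j \<in> {1..<?k}" for j
  proof -
    have IHj: "cut_sum (split_sum (?g j)) (rear j x) = cut_sum (\<lambda>bs \<gamma>. \<Sum>r\<in>{1..<sdim \<gamma>}. sg (bdeg bs + r) (?g j bs (omit r \<gamma>))) (rear j x)"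
      using less(1)[OF j, of "?g j"] j by (simp add: length_front_rear)
    have M: "cut_sum (?M j) (rear j x) = sg (j - 1) (cut_sum (\<lambda>bs \<gamma>. \<Sum>r\<in>{1..<sdim \<gamma>}. sg (bdeg bs + r) (?g j bs (omit r \<gamma>))) (rear j x))"
      by (simp only: cut_sum_sg[symmetric] sg_sum sg_sg add.assoc)
    have "?L = cut_sum (\<lambda>bs \<gamma>. (\<Sum>t\<in>{1..<j}. sg t (sg (?k - j + sdim \<gamma>) (f (front t (front j x) # rear t (front j x) # bs) (hd x # \<gamma>))))
        + sg (j - 1) (split_sum (?g j) bs \<gamma>)) (rear j x)"
    proof (rule cut_sum_cong)
      fix bs \<gamma>
      have jf: "sdim (front j x) = j" using j k by (simp add: sdim_front)
      have F: "sg (?k - j + sdim \<gamma>) (split_sum (\<lambda>bs'. f (front j x # bs')) bs (hd x # \<gamma>)) = split_sum (?g j) bs \<gamma>"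
        by (subst face_sum_hom(2)[of "sg (?k - j + sdim \<gamma>)"])
          (simp_all add: sg_add split_sum_fixed[of _ bs "hd x # \<gamma>" "\<gamma>"] split_sum_fixed[of "?g j" bs \<gamma> \<gamma>])
      show "sg (?k - j + sdim \<gamma>) (split_sum f (front j x # bs) (hd x # \<gamma>))
        = (\<Sum>t\<in>{1..<j}. sg t (sg (?k - j + sdim \<gamma>) (f (front t (front j x) # rear t (front j x) # bs) (hd x # \<gamma>))))
          + sg (j - 1) (split_sum (?g j) bs \<gamma>)"
        unfolding split_sum.simps sg_add sg_sum jf F[symmetric]
        by (intro arg_cong2[of _ _ _ _ "(+)"] sum.cong refl; rule sg_comm)
    qed
    also have "\<dots> = ?R"
      unfolding cut_sum_add cut_sum_sum cut_sum_sg IHj M by (rule refl)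
    finally show ?thesis .
  qed
  \<comment> \<open>The term \<open>r = 1\<close> drops the end of the first block from the second
    factor and is compared with splittings of that block; the terms with larger \<open>r\<close> are
    handled by the recursion.\<close>
  have R: "cut_sum (\<lambda>bs \<gamma>. sg (?k - j + sdim \<gamma>) (\<Sum>r\<in>{1..<sdim (hd x # \<gamma>)}. sg (bdeg (front j x # bs) + r) (f (front j x # bs) (omit r (hd x # \<gamma>))))) (rear j x)
    = sg j (cut_sum (\<lambda>bs \<gamma>. f (front j x # bs) (hd x # tl \<gamma>)) (rear j x)) + cut_sum (?M j) (rear j x)" (is "?L = _")
    if j: "j \<in> {1..<?k}" for j
  proof -
    have "?L = cut_sum (\<lambda>bs \<gamma>. sg j (f (front j x # bs) (hd x # tl \<gamma>)) + ?M j bs \<gamma>) (rear j x)"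
    proof (rule cut_sum_cong)
      fix bs \<gamma> assume c: "cut_of (rear j x) bs \<gamma>"
      have l: "length \<gamma> = Suc (length bs)" "bs \<noteq> []" "bdeg bs + sdim \<gamma> = ?k - j"
        using cut_of_lengths[OF c] j by (auto simp: length_front_rear sdim_rear)
      obtain g \<gamma>' where g: "\<gamma> = g # \<gamma>'" using l by (cases \<gamma>) auto
      have n: "sdim (hd x # \<gamma>) = Suc (sdim \<gamma>)" "0 < sdim \<gamma>" using l by (auto simp: sdim_def)
      have o: "omit 1 (hd x # \<gamma>) = hd x # tl \<gamma>" by (simp add: g omit_def One_nat_def)
      have j': "sdim (front j x) = j" using j k by (simp add: sdim_front)
      have "sg (?k - j + sdim \<gamma>) (sg (bdeg (front j x # bs) + 1) z) = sg j z" for z :: 'b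
      proof -
        have "?k - j + sdim \<gamma> + (bdeg (front j x # bs) + 1) = 2 * (sdim \<gamma> + bdeg bs) + j"
          using l(3) j by (simp add: j'; arith)
        then show ?thesis by (simp only: sg_sg) (simp add: sg_def)
      qed
      moreover have "sg (?k - j + sdim \<gamma>) (sg (bdeg (front j x # bs) + Suc r) (f (front j x # bs) (omit (Suc r) (hd x # \<gamma>))))
        = sg (j - 1 + (bdeg bs + r)) (?g j bs (omit r \<gamma>))" if "r \<in> {1..<sdim \<gamma>}" for r
      proof -
        obtain s where s: "sdim \<gamma> = Suc s" using n(2) by (cases "sdim \<gamma>") auto
        have "sdim (omit r \<gamma>) = s" using that s l(1) by (subst sdim_omit) (auto simp: sdim_def)
        then show ?thesis by (simp only: sg_sg cons_simps(1) s) (rule sg_cong, simp_all add: j', auto)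
      qed
      ultimately show "sg (?k - j + sdim \<gamma>) (\<Sum>r\<in>{1..<sdim (hd x # \<gamma>)}. sg (bdeg (front j x # bs) + r) (f (front j x # bs) (omit r (hd x # \<gamma>))))
        = sg j (f (front j x # bs) (hd x # tl \<gamma>)) + ?M j bs \<gamma>"
        unfolding n(1) sum_from_1[OF n(2)] o sg_add sg_sum by (intro arg_cong2[of _ _ _ _ "(+)"] sum.cong refl) blast+
    qed
    then show ?thesis by (simp only: cut_sum_add cut_sum_sg)
  qed
  have E: "sg j (cut_sum (\<lambda>bs \<gamma>. f (front j x # bs) (hd x # tl \<gamma>)) (rear j x))
    = sg j (f [front j x, rear j x] [hd x, last x]) + (\<Sum>i\<in>{1..<?k-j}. sg j (cut_sum (\<lambda>bs \<gamma>. sg (?k - (j + i) + sdim \<gamma>)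
        (f (front j (front (j + i) x) # rear j (front (j + i) x) # bs) (hd x # \<gamma>))) (rear (j + i) x)))"
    if j: "j \<in> {1..<?k}" for j
    using j k by (subst cut_sum.simps)
      (auto simp: sg_add sg_sum last_rear sdim_rear rear_rear rear_front front_front ac_simps intro!: sum.cong)
  have SE: "(\<Sum>j\<in>{1..<?k}. sg j (cut_sum (\<lambda>bs \<gamma>. f (front j x # bs) (hd x # tl \<gamma>)) (rear j x)))
    = (\<Sum>j\<in>{1..<?k}. sg j (f [front j x, rear j x] [hd x, last x])) + (\<Sum>j\<in>{1..<?k}. \<Sum>i\<in>{1..<?k-j}. sg j (cut_sum (\<lambda>bs \<gamma>. sg (?k - (j + i) + sdim \<gamma>)
        (f (front j (front (j + i) x) # rear j (front (j + i) x) # bs) (hd x # \<gamma>))) (rear (j + i) x)))"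
    unfolding sum.distrib[symmetric] by (rule sum.cong[OF refl E])
  have "cut_sum (split_sum f) x = (\<Sum>j\<in>{1..<?k}. sg j (f [front j x, rear j x] [hd x, last x])) + (\<Sum>j\<in>{1..<?k}. (\<Sum>t\<in>{1..<j}. sg t (cut_sum (\<lambda>bs \<gamma>. sg (?k - j + sdim \<gamma>) (f (front t (front j x) # rear t (front j x) # bs) (hd x # \<gamma>))) (rear j x)))
      + cut_sum (?M j) (rear j x))"
    by (subst cut_sum.simps, subst sum.cong[OF refl L], assumption) simp
  also have "\<dots> = (\<Sum>j\<in>{1..<?k}. sg j (cut_sum (\<lambda>bs \<gamma>. f (front j x # bs) (hd x # tl \<gamma>)) (rear j x)) + cut_sum (?M j) (rear j x))"
    unfolding sum.distrib SE
      sum_upper_triangle[of "\<lambda>j l. sg j (cut_sum (\<lambda>bs \<gamma>. sg (?k - l + sdim \<gamma>)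
        (f (front j (front l x) # rear j (front l x) # bs) (hd x # \<gamma>))) (rear l x))"]
    by (simp only: add.assoc)
  also have "\<dots> = cut_sum (\<lambda>bs \<gamma>. \<Sum>r\<in>{1..<sdim \<gamma>}. sg (bdeg bs + r) (f bs (omit r \<gamma>))) x"
    by (subst (3) cut_sum.simps, subst sum.cong[OF refl R], assumption) simp
  finally show ?case .
qed

text \<open>Choosing an inner vertex of \<open>\<gamma>\<close> amounts to choosing a vertex of
  \<open>x\<close> and cutting front and rear independently. The sign arises because the blocks of
  the rear have their indices raised by \<open>sdim \<gamma>\<close>, and together have
  \<open>sdim x - j - sdim \<gamma>'\<close> interior vertices.\<close>

lemma cut_sum_marked_split:
  "2 \<le> length x \<Longrightarrow> cut_sum (\<lambda>bs \<gamma>. \<Sum>r\<in>{1..<sdim \<gamma>}. F (take r bs) (front r \<gamma>) (drop r bs) (rear r \<gamma>)) x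
    = (\<Sum>j\<in>{1..<sdim x}. cut_sum (\<lambda>bs \<gamma>. cut_sum (\<lambda>bs' \<gamma>'.
         sg (sdim \<gamma> * (sdim x - j + sdim \<gamma>')) (F bs \<gamma> bs' \<gamma>')) (rear j x)) (front j x))"
proof (induction x arbitrary: F rule: cut_sum_induct)
  case (less x)
  let ?k = "sdim x"
  have k: "length x = Suc ?k" "0 < ?k" using less(2) by (auto simp: sdim_def)
  have x0: "x \<noteq> []" using k by auto
  let ?A = "\<lambda>j. cut_sum (\<lambda>bs \<gamma>. sg (?k - j + sdim \<gamma>) (F [front j x] [hd x, x ! j] bs \<gamma>)) (rear j x)"
  let ?B = "\<lambda>j l. cut_sum (\<lambda>bs \<gamma>. cut_sum (\<lambda>bs' \<gamma>'.
         sg (sdim \<gamma> * (?k - l + sdim \<gamma>') + (?k - j + sdim \<gamma> + sdim \<gamma>')) (F (front j x # bs) (hd x # \<gamma>) bs' \<gamma>')) (rear l x)) (rear j (front l x))"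
  have L: "cut_sum (\<lambda>bs \<gamma>. sg (?k - j + sdim \<gamma>) (\<Sum>r\<in>{1..<sdim (hd x # \<gamma>)}. F (take r (front j x # bs)) (front r (hd x # \<gamma>)) (drop r (front j x # bs)) (rear r (hd x # \<gamma>)))) (rear j x)
    = ?A j + (\<Sum>i\<in>{1..<?k-j}. ?B j (j + i))" (is "?L = _") if j: "j \<in> {1..<?k}" for j
  proof -
    let ?G = "\<lambda>bs \<gamma> bs' \<gamma>'. sg (?k - j + sdim \<gamma> + sdim \<gamma>') (F (front j x # bs) (hd x # \<gamma>) bs' \<gamma>')"
    have "?L = cut_sum (\<lambda>bs \<gamma>. sg (?k - j + sdim \<gamma>) (F [front j x] [hd x, x ! j] bs \<gamma>)
       + (\<Sum>r\<in>{1..<sdim \<gamma>}. ?G (take r bs) (front r \<gamma>) (drop r bs) (rear r \<gamma>))) (rear j x)"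
    proof (rule cut_sum_cong)
      fix bs \<gamma> assume c: "cut_of (rear j x) bs \<gamma>"
      have l: "length \<gamma> = Suc (length bs)" "bs \<noteq> []" "hd \<gamma> = x ! j"
        using cut_of_lengths[OF c] j k by (auto simp: length_front_rear hd_rear)
      obtain g \<gamma>' where g: "\<gamma> = g # \<gamma>'" using l by (cases \<gamma>) auto
      have n: "sdim (hd x # \<gamma>) = Suc (sdim \<gamma>)" "0 < sdim \<gamma>" using l by (auto simp: sdim_def)
      have o: "front 1 (hd x # \<gamma>) = [hd x, x ! j]" "rear 1 (hd x # \<gamma>) = \<gamma>" "take 1 (front j x # bs) = [front j x]" "drop 1 (front j x # bs) = bs"
        using l(3) by (simp_all add: g front_def rear_def One_nat_def)
      have d: "sdim \<gamma> = sdim (front r \<gamma>) + sdim (rear r \<gamma>)" if "r \<in> {1..<sdim \<gamma>}" for r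
        using that by (simp add: sdim_def front_def rear_def)
      show "sg (?k - j + sdim \<gamma>) (\<Sum>r\<in>{1..<sdim (hd x # \<gamma>)}. F (take r (front j x # bs)) (front r (hd x # \<gamma>)) (drop r (front j x # bs)) (rear r (hd x # \<gamma>)))
        = sg (?k - j + sdim \<gamma>) (F [front j x] [hd x, x ! j] bs \<gamma>) + (\<Sum>r\<in>{1..<sdim \<gamma>}. ?G (take r bs) (front r \<gamma>) (drop r bs) (rear r \<gamma>))"
        unfolding n(1) sum_from_1[OF n(2)] o sg_add sg_sum
        by (intro arg_cong2[of _ _ _ _ "(+)"] sum.cong refl) (simp only: cons_simps take_Suc_Cons drop_Suc_Cons d[symmetric] add.assoc sg_sg)
    qed
    also have "\<dots> = ?A j + (\<Sum>i\<in>{1..<?k-j}. ?B j (j + i))"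
      unfolding cut_sum_add using j
      by (subst less(1)[of _ ?G]) (auto simp: length_front_rear sdim_rear rear_rear rear_front ac_simps intro!: sum.cong)
    finally show ?thesis .
  qed
  have R: "cut_sum (\<lambda>bs \<gamma>. cut_sum (\<lambda>bs' \<gamma>'. sg (sdim \<gamma> * (?k - l + sdim \<gamma>')) (F bs \<gamma> bs' \<gamma>')) (rear l x)) (front l x)
    = ?A l + (\<Sum>j\<in>{1..<l}. ?B j l)" if l: "l \<in> {1..<?k}" for l
  proof -
    have "?B j l = cut_sum (\<lambda>bs \<gamma>. sg (l - j + sdim \<gamma>) (cut_sum (\<lambda>bs' \<gamma>'.
         sg (sdim (hd x # \<gamma>) * (?k - l + sdim \<gamma>')) (F (front j (front l x) # bs) (hd x # \<gamma>) bs' \<gamma>')) (rear l x))) (rear j (front l x))"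
      if j: "j \<in> {1..<l}" for j
      unfolding cut_sum_sg[symmetric]
    proof (intro cut_sum_cong, goal_cases)
      case (1 bs \<gamma> bs' \<gamma>')
      have "2 \<le> length (rear j (front l x))" using j l k by (auto simp: length_rear length_front)
      from cut_of_lengths(1,2)[OF 1(1) this] have n: "sdim (hd x # \<gamma>) = Suc (sdim \<gamma>)" by (auto simp: sdim_def)
      obtain a where a: "l = j + a" using j by (metis atLeastLessThan_iff le_Suc_ex less_imp_le)
      obtain b where b: "?k = l + b" using l by (metis atLeastLessThan_iff le_Suc_ex less_imp_le)
      have e: "front j (front l x) = front j x" using j by (simp add: front_front)
      have par: "even (sdim \<gamma> * (?k - l + sdim \<gamma>') + (?k - j + sdim \<gamma> + sdim \<gamma>'))
        = even (l - j + sdim \<gamma> + sdim (hd x # \<gamma>) * (?k - l + sdim \<gamma>'))"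
        by (simp add: n a b) auto
      show ?case unfolding e sg_sg by (rule sg_cong[OF par refl])
    qed
    then show ?thesis
      using l k hd_front[OF x0, of l] by (subst cut_sum.simps[of _ "front l x"]) (simp add: hd_front last_front sdim_front sdim_def[of "[_, _]"])
  qed
  have "cut_sum (\<lambda>bs \<gamma>. \<Sum>r\<in>{1..<sdim \<gamma>}. F (take r bs) (front r \<gamma>) (drop r bs) (rear r \<gamma>)) x
    = (\<Sum>j\<in>{1..<?k}. ?A j + (\<Sum>i\<in>{1..<?k-j}. ?B j (j + i)))"
    by (subst cut_sum.simps, subst sum.cong[OF refl L], assumption) simp
  also have "\<dots> = (\<Sum>l\<in>{1..<?k}. ?A l + (\<Sum>j\<in>{1..<l}. ?B j l))"
    unfolding sum.distrib sum_upper_triangle[of ?B] ..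
  also have "\<dots> = (\<Sum>j\<in>{1..<?k}. cut_sum (\<lambda>bs \<gamma>. cut_sum (\<lambda>bs' \<gamma>'.
         sg (sdim \<gamma> * (?k - j + sdim \<gamma>')) (F bs \<gamma> bs' \<gamma>')) (rear j x)) (front j x))"
    by (rule sum.cong[OF refl R[symmetric]])
  finally show ?case .
qed

section \<open>Cut sums and sums over increasing index sequences\<close>

lemma increasing_between_Cons:
  "increasing_between a b = insert [] (\<Union>j\<in>{a<..<b}. (#) j ` increasing_between j b)"
proof (rule set_eqI)
  fix js
  show "js \<in> increasing_between a b \<longleftrightarrow> js \<in> insert [] (\<Union>j\<in>{a<..<b}. (#) j ` increasing_between j b)"
    by (cases js) (auto simp: increasing_between_def image_iff subset_eq)
qed

lemma sum_increasing_between: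
  "(\<Sum>js\<in>increasing_between a b. h js) = h [] + (\<Sum>j\<in>{a<..<b}. \<Sum>js\<in>increasing_between j b. h (j # js) :: 'm::comm_monoid_add)"
proof -
  have "(\<Sum>js\<in>(\<Union>j\<in>{a<..<b}. (#) j ` increasing_between j b). h js)
    = (\<Sum>j\<in>{a<..<b}. \<Sum>js\<in>increasing_between j b. h (j # js))"
    by (subst sum.UNION_disjoint) (auto simp: finite_increasing_between sum.reindex)
  then show ?thesis
    by (subst increasing_between_Cons, subst sum.insert) (auto intro: finite_increasing_between)
qed

lemma sum_gaps:
  "sorted_wrt (<) (L :: nat list) \<Longrightarrow> L \<noteq> [] \<Longrightarrow>
    (\<Sum>r<length L - 1. L ! Suc r - L ! r - 1) + (length L - 1) + hd L = last L"
proof (induction L rule: induct_list012)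
  case (3 x y L)
  have "(\<Sum>r<length (x # y # L) - 1. (x # y # L) ! Suc r - (x # y # L) ! r - 1)
    = (y - x - 1) + (\<Sum>r<length (y # L) - 1. (y # L) ! Suc r - (y # L) ! r - 1)"
    by (simp add: sum.lessThan_Suc_shift del: sum.lessThan_Suc)
  moreover have "x < y" using 3 by simp
  ultimately show ?case using 3 by simp
qed auto

lemma cut_sign_Cons:
  assumes "sorted_wrt (<) L" "L \<noteq> []"
  shows "cut_sign (a # L) + (length L - 1) + hd L = cut_sign L + last L"
proof -
  have "cut_sign (a # L) = (\<Sum>r<length L - 1. Suc r * (L ! Suc r - L ! r - 1))"
    unfolding cut_sign_def using assms(2) by (cases L) (simp_all add: sum.lessThan_Suc_shift del: sum.lessThan_Suc)
  also have "\<dots> = cut_sign L + (\<Sum>r<length L - 1. L ! Suc r - L ! r - 1)"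
    by (simp add: cut_sign_def sum.distrib)
  finally show ?thesis using sum_gaps[OF assms] by simp
qed

text \<open>A new first block raises the index of every later block by one, so the exponent grows by
  the number of interior vertices of the later blocks, namely \<open>b - j\<close> minus the number
  of those blocks. Modulo 2 this is the sign in the recursion of \<open>cut_sum\<close>.\<close>

lemma sum_cuts:
  assumes "b < length x"
  shows "a < b \<Longrightarrow> (\<Sum>js\<in>increasing_between a b. sg (cut_sign (a # js @ [b])) (f (cuts x (a # js @ [b])) (pick x (a # js @ [b]))))
    = cut_sum f (front (b - a) (rear a x))"
proof (induction "b - a" arbitrary: a f rule: less_induct)
  case less
  let ?y = "front (b - a) (rear a x)"
  let ?h = "\<lambda>j js. sg (b - j + sdim (pick x (j # js @ [b]))) (f (pick x [a..<Suc j] # cuts x (j # js @ [b])) (x ! a # pick x (j # js @ [b])))"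
  have y: "sdim ?y = b - a" "hd ?y = x ! a" "last ?y = x ! b" "?y = pick x [a..<Suc b]"
  proof -
    have l: "b - a < length (rear a x)" using assms less(2) by (auto simp: length_rear)
    then have n: "rear a x \<noteq> []" by auto
    show "sdim ?y = b - a" by (rule sdim_front[OF l])
    show "hd ?y = x ! a" using assms less(2) by (simp add: hd_front[OF n] hd_rear)
    show "last ?y = x ! b" using assms less(2) by (simp add: last_front[OF l]) (simp add: rear_def)
    show "?y = pick x [a..<Suc b]" using assms less(2) by (simp add: pick_segment)
  qed
  have IH: "(\<Sum>js\<in>increasing_between j b. sg (cut_sign (a # j # js @ [b])) (f (cuts x (a # j # js @ [b])) (pick x (a # j # js @ [b]))))
    = cut_sum (\<lambda>bs \<gamma>. sg (b - j + sdim \<gamma>) (f (pick x [a..<Suc j] # bs) (x ! a # \<gamma>))) (front (b - j) (rear j x))"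
    if j: "j \<in> {a<..<b}" for j
  proof -
    have "(\<Sum>js\<in>increasing_between j b. sg (cut_sign (a # j # js @ [b])) (f (cuts x (a # j # js @ [b])) (pick x (a # j # js @ [b]))))
      = (\<Sum>js\<in>increasing_between j b. sg (cut_sign (j # js @ [b])) (?h j js))"
    proof (rule sum.cong[OF refl])
      fix js assume js: "js \<in> increasing_between j b"
      have srt: "sorted_wrt (<) (j # js @ [b])" using js j by (auto simp: increasing_between_def sorted_wrt_append)
      have "cut_sign (a # j # js @ [b]) + (Suc (length js) + j) = cut_sign (j # js @ [b]) + b"
        using cut_sign_Cons[OF srt, of a] by simp
      moreover have "sdim (pick x (j # js @ [b])) = Suc (length js)" by (simp add: pick_def sdim_def)
      moreover have "j < b" using j by simp
      ultimately have "even (cut_sign (a # j # js @ [b])) = even (cut_sign (j # js @ [b]) + (b - j + sdim (pick x (j # js @ [b]))))"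
        by presburger
      moreover have "cuts x (a # j # js @ [b]) = pick x [a..<Suc j] # cuts x (j # js @ [b])" by simp
      moreover have "pick x (a # j # js @ [b]) = x ! a # pick x (j # js @ [b])" by (simp add: pick_def)
      ultimately show "sg (cut_sign (a # j # js @ [b])) (f (cuts x (a # j # js @ [b])) (pick x (a # j # js @ [b])))
        = sg (cut_sign (j # js @ [b])) (?h j js)"
        by (simp only: sg_sg) (rule sg_cong, assumption, rule refl)
    qed
    also have "\<dots> = cut_sum (\<lambda>bs \<gamma>. sg (b - j + sdim \<gamma>) (f (pick x [a..<Suc j] # bs) (x ! a # \<gamma>))) (front (b - j) (rear j x))"
      by (rule less(1)) (use j in auto)
    finally show ?thesis .
  qed
  have "(\<Sum>j\<in>{a<..<b}. cut_sum (\<lambda>bs \<gamma>. sg (b - j + sdim \<gamma>) (f (pick x [a..<Suc j] # bs) (x ! a # \<gamma>))) (front (b - j) (rear j x)))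
    = (\<Sum>i\<in>{1..<b - a}. cut_sum (\<lambda>bs \<gamma>. sg (b - a - i + sdim \<gamma>) (f (front i ?y # bs) (x ! a # \<gamma>))) (rear i ?y))"
  proof (rule sum.reindex_bij_witness[of _ "\<lambda>i. a + i" "\<lambda>j. j - a"], goal_cases)
    case (5 j)
    have "rear (j - a) ?y = front (b - j) (rear j x)" "front (j - a) ?y = pick x [a..<Suc j]"
      using 5 assms by (auto simp: rear_front rear_rear front_front pick_segment)
    then show ?case using 5 by simp
  qed auto
  moreover have "cut_sign [a, b] = 0" "cuts x [a, b] = [?y]" "pick x [a, b] = [hd ?y, last ?y]"
    using y by (simp_all add: cut_sign_def pick_def)
  moreover have "(\<Sum>j\<in>{a<..<b}. \<Sum>js\<in>increasing_between j b. sg (cut_sign (a # (j # js) @ [b]))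
      (f (cuts x (a # (j # js) @ [b])) (pick x (a # (j # js) @ [b]))))
    = (\<Sum>j\<in>{a<..<b}. cut_sum (\<lambda>bs \<gamma>. sg (b - j + sdim \<gamma>) (f (pick x [a..<Suc j] # bs) (x ! a # \<gamma>))) (front (b - j) (rear j x)))"
    by (rule sum.cong[OF refl]) (simp only: append_Cons IH)
  ultimately show ?case
    by (subst sum_increasing_between, subst cut_sum.simps) (simp only: append_Nil sg_0 y(1,2))
qed

lemma sum_cuts_all:
  assumes "2 \<le> length x"
  shows "(\<Sum>js\<in>increasing_between 0 (sdim x). sg (cut_sign (0 # js @ [sdim x])) (f (cuts x (0 # js @ [sdim x])) (pick x (0 # js @ [sdim x]))))
    = cut_sum f x"
proof -
  have "front (sdim x - 0) (rear 0 x) = x" using assms by (simp add: front_def rear_def sdim_def)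
  then show ?thesis using sum_cuts[of "sdim x" x 0 f] assms by (simp add: sdim_def)
qed

section \<open>The antipode\<close>

lemma length_edges: "length (edges x) = length x - 1"
  and nth_edges: "i < length x - 1 \<Longrightarrow> edges x ! i = [x ! i, x ! Suc i]"
  by (induction x arbitrary: i rule: edges.induct) (auto simp: nth_Cons')

definition redges :: "'a list \<Rightarrow> 'a list list" where
  "redges x = map rev (rev (edges x))"

lemma wd_inverse:
  "\<forall>e\<in>set es. length e = 2 \<Longrightarrow> wd es * wd (map rev (rev es)) = (1 :: ('a, 'r::comm_ring_1) walg)"
proof (induction es)
  case (Cons e es)
  have "wd (e # es) * wd (map rev (rev (e # es))) = (bd e * (wd es * wd (map rev (rev es))) * bd (rev e) :: ('a, 'r) walg)"
    by (simp add: wd_append wd_Cons[of e es] mult.assoc)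
  also have "\<dots> = 1" using Cons by (simp add: bd_inverse)
  finally show ?case .
qed simp

lemma length_edge: "e \<in> set (edges x) \<Longrightarrow> length e = 2"
  by (induction x rule: edges.induct) auto

lemma wd_edges: "wd (edges x) * wd (redges x) = 1" "wd (redges x) * wd (edges x) = 1"
proof -
  show "wd (edges x) * wd (redges x) = 1"
    unfolding redges_def by (rule wd_inverse) (simp add: length_edge)
  have "wd (redges x) * wd (map rev (rev (redges x))) = 1"
    by (rule wd_inverse) (auto simp: redges_def length_edge)
  then show "wd (redges x) * wd (edges x) = 1"
    by (simp add: redges_def rev_map map_idI)
qed

lemma redges_eq: "2 \<le> length x \<Longrightarrow> map (\<lambda>j. pick x [j, j - 1]) (rev [1..<Suc (sdim x)]) = redges x"
proof -
  assume "2 \<le> length x"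
  then have "map (\<lambda>j. pick x [j, j - 1]) [1..<Suc (sdim x)] = map rev (edges x)"
    by (intro nth_equalityI) (auto simp: length_edges nth_edges sdim_def pick_def One_nat_def)
  then show ?thesis by (simp add: redges_def rev_map[symmetric])
qed

lemma wpath_redges:
  fixes x :: "'a::linorder list"
  shows "sorted_wrt (<) x \<Longrightarrow> set x \<subseteq> set c \<Longrightarrow> x \<noteq> [] \<Longrightarrow> wpath (beads (full c)) (last x) (redges x) (hd x)"
proof (induction x rule: edges.induct)
  case (1 u v x)
  then show ?case by (auto simp: redges_def wpath_append intro!: bead_full_rev)
qed (auto simp: redges_def)

lemma bdeg_redges: "bdeg (redges x) = 0"
  by (auto simp: redges_def length_edge sdim_def)

lemma reduced_redges: "sorted_wrt (<) (x :: 'a::linorder list) \<Longrightarrow> reduced (redges x)"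
proof (induction x rule: edges.induct)
  case (1 u v x)
  then show ?case
  proof (cases x)
    case (Cons w y)
    have "redges (u # v # x) = redges (v # x) @ [[v, u]]" "redges (v # x) = redges (w # y) @ [[w, v]]"
      by (simp_all add: redges_def Cons)
    with 1 Cons show ?thesis
      by (auto simp: reduced_def successively_append_iff inverse_beads_def)
  qed (simp add: redges_def)
qed (auto simp: redges_def)

abbreviation faces_of :: "'a::linorder list \<Rightarrow> 'a list set" where
  "faces_of x \<equiv> {b. sorted_wrt (<) b \<and> set b \<subseteq> set x \<and> 2 \<le> length b}"

lemma reduced_faces: "wpath (faces_of x) a bs b \<Longrightarrow> reduced bs"
proof (induction bs arbitrary: a rule: induct_list012)
  case (3 u v bs)
  have "v \<noteq> rev u" if h: "length u = 2"
  proof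
    assume v: "v = rev u"
    obtain p q where u: "u = [p, q]" using h by (cases u; cases "tl u") auto
    show False using 3(3) by (auto simp: u v)
  qed
  with 3 show ?case by (simp add: reduced_def inverse_beads_def)
qed auto

lemma faces_of_beads: "set x \<subseteq> set c \<Longrightarrow> faces_of x \<subseteq> beads (full c)"
  by (auto intro: bead_full)

lemma wpath_faces_ends: "wpath B a bs b \<Longrightarrow> bs \<noteq> [] \<Longrightarrow> hd (hd bs) = a"
  by (cases bs) auto

lemma basis_seq_faces:
  assumes "wpath (faces_of x) a bs b" "bs \<noteq> []"
  shows "basis (seq bs) = pa a (wd bs)"
  using assms by (simp add: seq_def wpath_faces_ends[OF assms] pa_wd[OF reduced_faces[OF assms(1)]])

text \<open>The antipode of a bead with its starting vertex forgotten, so that it can be multiplied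
  in the word algebra; \<open>pres\<close> records that nothing is lost.\<close>

definition Sb :: "'a list \<Rightarrow> ('a, 'r::comm_ring_1) walg" where
  "Sb x = lin_ext (\<lambda>p. wd (snd p)) (antipode_bead x)"

lemma word_pa: "lin_ext (\<lambda>p. wd (snd p)) (pa a x) = x"
proof (rule lin_eq[of "\<lambda>x. lin_ext (\<lambda>p. wd (snd p)) (pa a x)" "\<lambda>x. x" x])
  show "lin (\<lambda>x. lin_ext (\<lambda>p. wd (snd p)) (pa a x))" by (rule lin_compose[OF lin_lin_ext lin_pa])
qed (simp_all add: lin_id pa_def wd_def)

lemma Sb_edge: "Sb [u, v] = bd [v, u]"
  by (simp add: Sb_def antipode_bead.simps[of "[u, v]"] seq_def)

text \<open>The sequence excluded in the recursion of the antipode is the only one whose second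
  factor has full dimension, so the exclusion becomes a condition on
  \<open>sdim \<gamma>\<close>.\<close>

lemma pick_top:
  assumes "js \<in> increasing_between 0 k" "0 < k"
  shows "length js = k - 1 \<longleftrightarrow> js = [1..<k]"
proof
  assume l: "length js = k - 1"
  have js: "sorted js" "distinct js" "set js \<subseteq> {1..<k}"
    using assms by (auto simp: increasing_between_def strict_sorted_iff)
  then have "set js = {1..<k}"
    using l by (intro card_subset_eq) (auto simp: distinct_card)
  then show "js = [1..<k]" using js by (intro sorted_distinct_set_unique) auto
qed (use assms in auto)

text \<open>The type token names the coefficient ring, which does not occur in the types of the
  other arguments.\<close>

definition pres :: "'r::comm_ring_1 itself \<Rightarrow> 'a::linorder list \<Rightarrow> 'a list \<Rightarrow> bool" where
  "pres T c x \<longleftrightarrow> antipode_bead x = pa (last x) (Sb x :: ('a, 'r) walg) \<and>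
    (Sb x :: ('a, 'r) walg) \<in> PA (beads (full c)) (last x) (hd x) (sdim x - 1)"

text \<open>The formula and the correct placement of the ends are proved together: the products of
  paths in the recursion can be computed in the word algebra only when the antipodes of the smaller
  second factors are known to be based at the right vertices.\<close>

lemma antipode_bead_rec:
  fixes x :: "'a::linorder list"
  assumes x: "sorted_wrt (<) x" "set x \<subseteq> set c" "2 < length x"
    and IH: "\<And>\<gamma>. sorted_wrt (<) \<gamma> \<Longrightarrow> set \<gamma> \<subseteq> set c \<Longrightarrow> 2 \<le> length \<gamma> \<Longrightarrow> length \<gamma> < length x \<Longrightarrow> pres TYPE('r::comm_ring_1) c \<gamma>"
  shows "Sb x = - (wd (redges x) * cut_sum (\<lambda>bs \<gamma>. if sdim \<gamma> = sdim x then 0 else wd bs * Sb \<gamma>) x :: ('a, 'r) walg)"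
    and "pres TYPE('r) c x"
proof -
  let ?k = "sdim x"
  let ?B = "beads (full c)"
  let ?f = "\<lambda>bs \<gamma>. if sdim \<gamma> = sdim x then 0 else wd bs * Sb \<gamma> :: ('a, 'r) walg"
  let ?g = "\<lambda>bs \<gamma>. if sdim \<gamma> = sdim x then 0 else pmul (basis (seq bs)) (antipode_bead \<gamma>) :: 'a path \<Rightarrow>\<^sub>0 'r"
  have k: "length x = Suc ?k" "2 \<le> ?k" "2 \<le> length x" using x(3) by (auto simp: sdim_def)
  have fg: "?g bs \<gamma> = pa (hd x) (?f bs \<gamma>) \<and> ?f bs \<gamma> \<in> PA ?B (hd x) (hd x) (?k - 1)" if c: "cut_of x bs \<gamma>" for bs \<gamma>
  proof (cases "sdim \<gamma> = ?k")
    case False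
    note l = cut_of_lengths[OF c k(3)] and s = cut_of_sorted[OF c k(3) x(1)]
    have "2 \<le> length \<gamma>" using l(1,2) by (cases bs) auto
    moreover have "length \<gamma> = Suc (sdim \<gamma>)" using l(1) by (simp add: sdim_def)
    then have "length \<gamma> < length x" using cut_of_sdim_le[OF c k(3)] k(1) False by linarith
    ultimately have p: "pres TYPE('r) c \<gamma>" by (intro IH) (use s x(2) in blast)+
    have w: "wpath ?B (hd x) bs (last x)" using s x(2) by (intro wpath_mono[OF _ faces_of_beads[OF x(2)]]) auto
    have P: "(wd bs :: ('a, 'r) walg) \<in> PA ?B (hd x) (last x) (bdeg bs)" by (rule PA_wd[OF w refl])
    have "0 < sdim \<gamma>" using l(1,2) by (cases bs) (auto simp: sdim_def)
    then have "bdeg bs + (sdim \<gamma> - 1) = ?k - 1" using l(3) by linarith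
    then have "wd bs * (Sb \<gamma> :: ('a, 'r) walg) \<in> PA ?B (hd x) (hd x) (?k - 1)"
      using p unfolding pres_def l(4,5) by (intro PA_mult'[OF P, of _ _ "sdim \<gamma> - 1"]) simp_all
    moreover have "pmul (basis (seq bs)) (antipode_bead \<gamma>) = (pa (hd x) (wd bs * Sb \<gamma>) :: 'a path \<Rightarrow>\<^sub>0 'r)"
      using p l basis_seq_faces[OF s[THEN conjunct2, THEN conjunct2] l(2), where 'b='r] by (simp add: pres_def pmul_pa[OF P])
    ultimately show ?thesis using False by simp
  qed (simp add: pa_lin)
  have "(\<Sum>js\<in>increasing_between 0 ?k - {[1..<?k]}. scale ((-1) ^ cut_sign (0 # js @ [?k]))
        (pmul (basis (seq (cuts x (0 # js @ [?k])))) (antipode_bead (pick x (0 # js @ [?k])))))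
    = (\<Sum>js\<in>increasing_between 0 ?k. sg (cut_sign (0 # js @ [?k])) (?g (cuts x (0 # js @ [?k])) (pick x (0 # js @ [?k]))))"
  proof (rule sum.mono_neutral_cong_left)
    have s: "sdim (pick x (0 # js @ [?k])) = Suc (length js)" for js by (simp add: pick_def sdim_def)
    show "\<forall>js\<in>increasing_between 0 ?k - (increasing_between 0 ?k - {[1..<?k]}).
       sg (cut_sign (0 # js @ [?k])) (?g (cuts x (0 # js @ [?k])) (pick x (0 # js @ [?k]))) = 0"
      using k s[of "[1..<?k]"] by auto
    fix js assume js: "js \<in> increasing_between 0 ?k - {[1..<?k]}"
    have "sdim (pick x (0 # js @ [?k])) \<noteq> ?k" using pick_top[of js ?k] js k s[of js] by auto
    then show "scale ((-1) ^ cut_sign (0 # js @ [?k]))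
        (pmul (basis (seq (cuts x (0 # js @ [?k])))) (antipode_bead (pick x (0 # js @ [?k]))))
      = sg (cut_sign (0 # js @ [?k])) (?g (cuts x (0 # js @ [?k])) (pick x (0 # js @ [?k])))"
      by (simp only: scale_sign if_False)
  qed (auto simp: finite_increasing_between)
  also have "\<dots> = cut_sum ?g x" by (rule sum_cuts_all[OF k(3)])
  also have "\<dots> = pa (hd x) (cut_sum ?f x)"
    unfolding cut_sum_lin[OF lin_pa] by (rule cut_sum_cong) (use fg in blast)
  finally have sum: "(\<Sum>js\<in>increasing_between 0 ?k - {[1..<?k]}. scale ((-1) ^ cut_sign (0 # js @ [?k]))
        (pmul (basis (seq (cuts x (0 # js @ [?k])))) (antipode_bead (pick x (0 # js @ [?k]))))) = pa (hd x) (cut_sum ?f x)" .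
  have x0: "x \<noteq> []" using x(3) by auto
  have R: "(wd (redges x) :: ('a, 'r) walg) \<in> PA ?B (last x) (hd x) 0"
    by (rule PA_wd[OF wpath_redges[OF x(1,2) x0]]) (simp only: bdeg_redges)
  have ne: "redges x \<noteq> []" using x(3) length_edges[of x] by (auto simp: redges_def)
  have "basis (seq (redges x)) = (pa (last x) (wd (redges x)) :: 'a path \<Rightarrow>\<^sub>0 'r)"
    by (simp add: seq_def pa_wd[OF reduced_redges[OF x(1)]] wpath_faces_ends[OF wpath_redges[OF x(1,2) x0] ne])
  then have A: "antipode_bead x = (pa (last x) (- (wd (redges x) * cut_sum ?f x)) :: 'a path \<Rightarrow>\<^sub>0 'r)"
    unfolding antipode_bead.simps[of x] redges_eq[OF k(3)] sum using k by (simp add: pmul_pa[OF R] pa_lin)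
  show S: "Sb x = - (wd (redges x) * cut_sum ?f x)"
    unfolding Sb_def A word_pa ..
  have "cut_sum ?f x \<in> PA ?B (hd x) (hd x) (?k - 1)"
    by (rule cut_sum_closed) (auto intro: PA_add PA_uminus simp: fg)
  then show "pres TYPE('r) c x"
    unfolding pres_def S A using R by (auto intro!: PA_uminus PA_mult')
qed

lemma pres:
  fixes x :: "'a::linorder list"
  shows "sorted_wrt (<) x \<Longrightarrow> set x \<subseteq> set c \<Longrightarrow> 2 \<le> length x \<Longrightarrow> pres TYPE('r::comm_ring_1) c x"
proof (induction "length x" arbitrary: x rule: less_induct)
  case less
  show ?case
  proof (cases "length x = 2")
    case True
    then obtain u v where x: "x = [u, v]" by (cases x; cases "tl x") (auto simp: numeral_2_eq_2)
    have "[v, u] \<in> beads (full c)" using less by (auto simp: x intro!: bead_full_rev)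
    then show ?thesis
      by (auto simp: pres_def x Sb_edge antipode_bead.simps[of "[u, v]"] basis_seq1 intro!: PA_bd)
  next
    case False
    then have l: "2 < length x" using less.prems(3) by linarith
    show ?thesis by (rule antipode_bead_rec(2)[OF less.prems(1,2) l]) (rule less.hyps)
  qed
qed

lemma Sb_rec:
  fixes x :: "'a::linorder list"
  assumes "sorted_wrt (<) x" "2 < length x"
  shows "Sb x = - (wd (redges x) * cut_sum (\<lambda>bs \<gamma>. if sdim \<gamma> = sdim x then 0 else wd bs * Sb \<gamma>) x :: ('a, 'r::comm_ring_1) walg)"
  by (rule antipode_bead_rec(1)[OF assms(1) subset_refl assms(2)]) (rule pres)

lemma PA_Sb: "sorted_wrt (<) x \<Longrightarrow> set x \<subseteq> set c \<Longrightarrow> 2 \<le> length x \<Longrightarrow> n = sdim x - 1 \<Longrightarrow>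
    (Sb x :: ('a::linorder, 'r::comm_ring_1) walg) \<in> PA (beads (full c)) (last x) (hd x) n"
  using pres[of x c, where 'r = 'r] by (simp add: pres_def)

section \<open>The antipode of sequences and its differential\<close>

primrec Sl :: "'a list list \<Rightarrow> ('a, 'r::comm_ring_1) walg" where
  "Sl [] = 1"
| "Sl (b # bs) = sg ((sdim b - 1) * bdeg bs) (Sl bs * Sb b)"

lemma Sl_append: "Sl (as @ bs) = sg (bdeg as * bdeg bs) (Sl bs * Sl as)"
  by (induction as) (auto simp: mult.assoc algebra_simps intro!: sg_cong)

lemma PA_Sl:
  fixes x :: "'a::linorder list"
  assumes "set x \<subseteq> set c"
  shows "wpath (faces_of x) a bs b \<Longrightarrow> n = bdeg bs \<Longrightarrow> (Sl bs :: ('a, 'r::comm_ring_1) walg) \<in> PA (beads (full c)) b a n"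
proof (induction bs arbitrary: a n)
  case (Cons y bs)
  then have "(Sb y :: ('a, 'r) walg) \<in> PA (beads (full c)) (last y) a (sdim y - 1)"
    using assms PA_Sb[of y c, where 'r = 'r] by auto
  with Cons show ?case by (auto intro!: PA_sg PA_mult')
qed (simp add: PA_1)

lemma antipode_path:
  fixes x :: "'a::linorder list"
  shows "wpath (faces_of x) a bs b \<Longrightarrow> antipode_path a bs = pa b (Sl bs :: ('a, 'r::comm_ring_1) walg)"
proof (induction bs arbitrary: a)
  case Nil
  have "pa b (wd []) = (basis (b, []) :: 'a path \<Rightarrow>\<^sub>0 'r)" by (rule pa_wd) simp
  with Nil show ?case by simp
next
  case (Cons y bs)
  then have y: "pres TYPE('r) x y" by (intro pres) auto
  have w: "wpath (faces_of x) (last y) bs b" and h: "hd y = a" using Cons by auto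
  show ?case
    using y by (simp add: Cons.IH[OF w] pres_def pmul_pa[OF PA_Sl[OF subset_refl w refl]] pdeg_def scale_sign pa_lin)
qed

lemma antipode_seq:
  fixes x :: "'a::linorder list"
  assumes "wpath (faces_of x) a bs b" "bs \<noteq> []"
  shows "antipode (seq bs) = pa b (Sl bs :: ('a, 'r::comm_ring_1) walg)"
  using antipode_path[OF assms(1), where 'r = 'r] wpath_faces_ends[OF assms] by (simp add: antipode_def seq_def)

text \<open>The antipode applied to the differential of the bead. The cut terms are reversed with
  Koszul sign exponent (j - 1)(k - j - 1).\<close>

definition dSb :: "'a list \<Rightarrow> ('a, 'r::comm_ring_1) walg" where
  "dSb x = (\<Sum>j\<in>{1..<sdim x}. sg (j + (j - 1) * (sdim x - j - 1)) (Sb (rear j x) * Sb (front j x)))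
     - (\<Sum>t\<in>{1..<sdim x}. sg t (Sb (omit t x)))"

lemma tau_wd: "tau (wd bs) = sg (bdeg bs) (wd bs)"
proof (induction bs)
  case (Cons b bs)
  then show ?case by (subst (1 2) wd_Cons) (simp add: tau_mult tau_bd add.commute)
qed (simp add: tau_1)

lemma pd_wd: "pd (wd bs) = (split_sum (\<lambda>bs' _. wd bs') bs \<gamma> - face_sum (\<lambda>bs' _. wd bs') bs \<gamma>
    :: ('a, 'r::comm_ring_1) walg)"
proof (induction bs)
  case (Cons b bs)
  have h: "split_sum (\<lambda>bs' _. wd (b # bs')) bs \<gamma> = (bd b * split_sum (\<lambda>bs' _. wd bs') bs \<gamma> :: ('a, 'r) walg)"
    "face_sum (\<lambda>bs' _. wd (b # bs')) bs \<gamma> = (bd b * face_sum (\<lambda>bs' _. wd bs') bs \<gamma> :: ('a, 'r) walg)"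
    by (subst face_sum_hom[of "\<lambda>z. bd b * z"], simp_all add: distrib_left wd_Cons[symmetric])+
  have "pd (wd (b # bs)) = (dbd b * wd bs + sg (sdim b - 1) (bd b * pd (wd bs)) :: ('a, 'r) walg)"
    by (subst wd_Cons) (simp add: pd_mult pd_bd tau_bd)
  moreover have "wd [front t b] * wd [rear t b] * wd bs = (wd (front t b # rear t b # bs) :: ('a, 'r) walg)"
    "wd [omit t b] * wd bs = (wd (omit t b # bs) :: ('a, 'r) walg)" for t
    by (simp_all add: wd_append[symmetric])
  ultimately show ?case
    by (simp add: Cons h dbd_def sum_distrib_right sg_diff right_diff_distrib left_diff_distrib sum_subtractf)
qed simp

text \<open>The composite of \<open>\<nabla>\<^sub>0\<close>, the antipode on the second factor, and
  the product.\<close>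

definition cut_antipode :: "'a list \<Rightarrow> ('a, 'r::comm_ring_1) walg" where
  "cut_antipode x = cut_sum (\<lambda>bs \<gamma>. wd bs * Sb \<gamma>) x"

lemma bdeg_edges: "bdeg (edges x) = 0"
  by (auto simp: length_edge sdim_def)

text \<open>The recursion of the antipode read backwards: the top term
  \<open>wd (edges x) * Sb x\<close> cancels all the others, because the word of reversed edges in
  the recursion is inverse to \<open>wd (edges x)\<close>.\<close>

lemma cut_antipode:
  fixes x :: "'a::linorder list"
  assumes x: "sorted_wrt (<) x" "2 \<le> length x"
  shows "cut_antipode x = (if length x = 2 then 1 else 0 :: ('a, 'r::comm_ring_1) walg)"
proof (cases "length x = 2")
  case True
  then obtain u v where x: "x = [u, v]" by (cases x; cases "tl x") (auto simp: numeral_2_eq_2)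
  show ?thesis by (simp add: cut_antipode_def x cut_sum.simps[of _ "[u, v]"] Sb_edge bd_inverse2)
next
  case False
  let ?f = "\<lambda>bs \<gamma>. wd bs * Sb \<gamma> :: ('a, 'r) walg"
  have "cut_antipode x = cut_sum (\<lambda>bs \<gamma>. (if sdim \<gamma> = sdim x then ?f bs \<gamma> else 0) + (if sdim \<gamma> = sdim x then 0 else ?f bs \<gamma>)) x"
    unfolding cut_antipode_def by (rule cut_sum_cong) simp
  also have "\<dots> = wd (edges x) * Sb x + cut_sum (\<lambda>bs \<gamma>. if sdim \<gamma> = sdim x then 0 else ?f bs \<gamma>) x"
    by (simp add: cut_sum_add, subst cut_sum_top) (use x in auto)
  also have "\<dots> = 0"
    using Sb_rec[OF x(1), where 'r = 'r] x(2) False by (simp add: wd_edges(1) flip: mult.assoc)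
  finally show ?thesis using False by simp
qed

lemma sdim_Suc: "2 \<le> length x \<Longrightarrow> length x = Suc (sdim x)"
  by (simp add: sdim_def)

text \<open>The antipode commutes with the differential. The sum \<open>cut_antipode x\<close>
  vanishes above dimension 1, and so does its derivative. In it, splittings of blocks cancel the
  face terms of the second factors, faces of blocks give \<open>cut_antipode\<close> of faces, and
  products of two antipodes collapse by \<open>cut_antipode\<close> of rears. By induction the claim
  holds for every smaller second factor, so only \<open>wd (edges x) * (pd (Sb x) - dSb x)\<close>
  remains, with an invertible factor in front.\<close>

lemma pd_Sb:
  fixes x :: "'a::linorder list"
  shows "sorted_wrt (<) x \<Longrightarrow> 2 \<le> length x \<Longrightarrow> pd (Sb x) = (dSb x :: ('a, 'r::comm_ring_1) walg)"
proof (induction "length x" arbitrary: x rule: less_induct)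
  case less
  note x = less.prems
  show ?case
  proof (cases "length x = 2")
    case True
    then obtain u v where x: "x = [u, v]" by (cases x; cases "tl x") (auto simp: numeral_2_eq_2)
    show ?thesis by (simp add: x Sb_edge pd_bd dbd_edge dSb_def)
  next
    case False
    let ?k = "sdim x"
    have k: "length x = Suc ?k" "2 \<le> ?k" using False x(2) by (auto simp: sdim_def)
    let ?f = "\<lambda>bs \<gamma>. wd bs * Sb \<gamma> :: ('a, 'r) walg"
    let ?C = "cut_sum (\<lambda>bs \<gamma>. sg (bdeg bs) (wd bs * pd (Sb \<gamma>))) x :: ('a, 'r) walg"
    let ?C1 = "cut_sum (\<lambda>bs \<gamma>. sg (bdeg bs) (wd bs * dSb \<gamma>)) x :: ('a, 'r) walg"
    let ?T = "cut_sum (\<lambda>bs \<gamma>. \<Sum>j\<in>{1..<sdim \<gamma>}. sg (bdeg bs + (j + (j - 1) * (sdim \<gamma> - j - 1)))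
        (wd bs * (Sb (rear j \<gamma>) * Sb (front j \<gamma>)))) x :: ('a, 'r) walg"
    let ?N = "cut_antipode :: 'a list \<Rightarrow> ('a, 'r) walg"
    have "pd (cut_sum ?f x) = 0"
      using cut_antipode[OF x, where 'r = 'r] False by (simp add: cut_antipode_def pd_lin)
    then have "0 = cut_sum (\<lambda>bs \<gamma>. pd (?f bs \<gamma>)) x" by (simp add: cut_sum_lin[OF lin_pd])
    also have "\<dots> = cut_sum (\<lambda>bs \<gamma>. split_sum ?f bs \<gamma> - face_sum ?f bs \<gamma> + sg (bdeg bs) (wd bs * pd (Sb \<gamma>))) x"
    proof (rule cut_sum_cong)
      fix bs \<gamma>
      have "split_sum ?f bs \<gamma> = split_sum (\<lambda>bs' _. wd bs') bs \<gamma> * (Sb \<gamma> :: ('a, 'r) walg)"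
        by (subst face_sum_hom(2)[of "\<lambda>z. z * Sb \<gamma>"]) (simp_all add: distrib_right split_sum_fixed[of ?f bs \<gamma> \<gamma>])
      moreover have "face_sum ?f bs \<gamma> = face_sum (\<lambda>bs' _. wd bs') bs \<gamma> * (Sb \<gamma> :: ('a, 'r) walg)"
        by (subst face_sum_hom(1)[of "\<lambda>z. z * Sb \<gamma>"]) (simp_all add: distrib_right face_sum_fixed[of ?f bs \<gamma> \<gamma>])
      ultimately show "pd (?f bs \<gamma>) = split_sum ?f bs \<gamma> - face_sum ?f bs \<gamma> + sg (bdeg bs) (wd bs * pd (Sb \<gamma>))"
        by (simp add: pd_mult tau_wd pd_wd[of bs \<gamma>] left_diff_distrib)
    qed
    finally have 0: "cut_sum (split_sum ?f) x - cut_sum (face_sum ?f) x + ?C = 0"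
      by (simp add: cut_sum_add cut_sum_diff)
    have "?C - ?C1 = cut_sum (\<lambda>bs \<gamma>. sg (bdeg bs) (wd bs * (pd (Sb \<gamma>) - dSb \<gamma>))) x"
      by (simp add: cut_sum_diff[symmetric] right_diff_distrib sg_diff)
    also have "\<dots> = wd (edges x) * (pd (Sb x) - dSb x)"
    proof (subst cut_sum_top)
      fix bs \<gamma> assume c: "cut_of x bs \<gamma>" and n: "sdim \<gamma> \<noteq> sdim x"
      note l = cut_of_lengths(1,2)[OF c x(2)]
      have "2 \<le> length \<gamma>" "length \<gamma> = Suc (sdim \<gamma>)" using l by (cases bs; simp add: sdim_def)+
      then have "pd (Sb \<gamma>) = (dSb \<gamma> :: ('a, 'r) walg)"
        using cut_of_sdim_le[OF c x(2)] n k(1) cut_of_sorted[OF c x(2,1)] by (intro less.hyps) auto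
      then show "sg (bdeg bs) (wd bs * (pd (Sb \<gamma>) - dSb \<gamma> :: ('a, 'r) walg)) = 0" by simp
    qed (use x in \<open>simp_all add: bdeg_edges del: sum_list_eq_0_iff\<close>)
    finally have C: "?C = ?C1 + wd (edges x) * (pd (Sb x) - dSb x)" by (simp add: algebra_simps)
    have S: "cut_sum (split_sum ?f) x = cut_sum (\<lambda>bs \<gamma>. \<Sum>r\<in>{1..<sdim \<gamma>}. sg (bdeg bs + r) (wd bs * Sb (omit r \<gamma>))) x"
      by (rule cut_sum_split[OF x(2)])
    have C1: "?C1 = ?T - cut_sum (split_sum ?f) x"
      unfolding S cut_sum_diff[symmetric]
      by (simp add: dSb_def right_diff_distrib sg_diff sum_distrib_left sg_sum)
    let ?F = "\<lambda>bs \<gamma> bs' \<gamma>'. sg (bdeg bs + bdeg bs' + (sdim \<gamma> + (sdim \<gamma> - 1) * (sdim \<gamma>' - 1)))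
        (wd bs * (wd bs' * Sb \<gamma>') * Sb \<gamma>) :: ('a, 'r) walg"
    \<comment> \<open>After separating front and rear of \<open>x\<close>, the sum over cuts of the
      rear is \<open>cut_antipode (rear j x)\<close>. It vanishes unless the rear is an edge, that
      is, unless \<open>j = ?k - 1\<close>.\<close>
    have "?T = cut_sum (\<lambda>bs \<gamma>. \<Sum>j\<in>{1..<sdim \<gamma>}. ?F (take j bs) (front j \<gamma>) (drop j bs) (rear j \<gamma>)) x"
    proof (intro cut_sum_cong sum.cong refl)
      fix bs :: "'a list list" and \<gamma> :: "'a list" and j assume j: "j \<in> {1..<sdim \<gamma>}"
      have b: "bdeg bs = bdeg (take j bs) + bdeg (drop j bs)"
        by (subst append_take_drop_id[of j bs, symmetric], simp only: map_append sum_list_append)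
      have w: "wd bs = (wd (take j bs) * wd (drop j bs) :: ('a, 'r) walg)"
        by (simp flip: wd_append)
      have "sdim (front j \<gamma>) = j" "sdim (rear j \<gamma>) = sdim \<gamma> - j"
        using j by (auto simp: sdim_def front_def rear_def)
      then show "sg (bdeg bs + (j + (j - 1) * (sdim \<gamma> - j - 1))) (wd bs * (Sb (rear j \<gamma>) * Sb (front j \<gamma>)))
        = ?F (take j bs) (front j \<gamma>) (drop j bs) (rear j \<gamma>)"
        by (simp only: b w mult.assoc)
    qed
    also have "\<dots> = (\<Sum>j\<in>{1..<?k}. cut_sum (\<lambda>bs \<gamma>. cut_sum (\<lambda>bs' \<gamma>'.
         sg (sdim \<gamma> * (?k - j + sdim \<gamma>')) (?F bs \<gamma> bs' \<gamma>')) (rear j x)) (front j x))"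
      by (rule cut_sum_marked_split[OF x(2)])
    also have "\<dots> = (\<Sum>j\<in>{1..<?k}. cut_sum (\<lambda>bs \<gamma>. sg (sdim \<gamma> * (?k - j) + ?k + sdim \<gamma> + 1) (wd bs * ?N (rear j x) * Sb \<gamma>)) (front j x))"
    proof (intro sum.cong refl cut_sum_cong)
      fix j bs \<gamma> assume j: "j \<in> {1..<?k}" and c: "cut_of (front j x) bs \<gamma>"
      have lr: "2 \<le> length (front j x)" "2 \<le> length (rear j x)" using j by (auto simp: length_front_rear)
      have j': "sdim (front j x) = j" "sdim (rear j x) = ?k - j" using j k by (auto simp: sdim_front sdim_rear)
      obtain e where e: "?k = j + e" using j by (metis atLeastLessThan_iff le_Suc_ex less_imp_le)
      note l = cut_of_lengths(1-3)[OF c lr(1)]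
      have "0 < sdim \<gamma>" using l by (cases bs) (auto simp: sdim_def)
      then obtain p where p: "sdim \<gamma> = Suc p" by (cases "sdim \<gamma>") auto
      have "cut_sum (\<lambda>bs' \<gamma>'. sg (sdim \<gamma> * (?k - j + sdim \<gamma>')) (?F bs \<gamma> bs' \<gamma>')) (rear j x)
        = cut_sum (\<lambda>bs' \<gamma>'. sg (sdim \<gamma> * (?k - j) + ?k + sdim \<gamma> + 1) (wd bs * (wd bs' * Sb \<gamma>') * Sb \<gamma>)) (rear j x)"
      proof (rule cut_sum_cong)
        fix bs' \<gamma>' assume c': "cut_of (rear j x) bs' \<gamma>'"
        note l' = cut_of_lengths(1-3)[OF c' lr(2)]
        have "0 < sdim \<gamma>'" using l' by (cases bs') (auto simp: sdim_def)
        then obtain q where q: "sdim \<gamma>' = Suc q" by (cases "sdim \<gamma>'") auto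
        have b: "bdeg bs + Suc p = j" "bdeg bs' + Suc q = e" using l(3) l'(3) by (simp_all add: p q j' e)
        have "even (sdim \<gamma> * (?k - j + sdim \<gamma>') + (bdeg bs + bdeg bs' + (sdim \<gamma> + (sdim \<gamma> - 1) * (sdim \<gamma>' - 1))))
          = even (sdim \<gamma> * (?k - j) + ?k + sdim \<gamma> + 1)"
          unfolding p q e b[symmetric]
          by (cases "even p"; cases "even q"; cases "even (bdeg bs)"; cases "even (bdeg bs')"; simp)
        then show "sg (sdim \<gamma> * (?k - j + sdim \<gamma>')) (?F bs \<gamma> bs' \<gamma>')
          = sg (sdim \<gamma> * (?k - j) + ?k + sdim \<gamma> + 1) (wd bs * (wd bs' * Sb \<gamma>') * Sb \<gamma> :: ('a, 'r) walg)"
          by (simp only: sg_sg) (rule sg_cong, assumption, rule refl)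
      qed
      also have "\<dots> = sg (sdim \<gamma> * (?k - j) + ?k + sdim \<gamma> + 1) (wd bs * ?N (rear j x) * Sb \<gamma>)"
        unfolding cut_sum_sg cut_sum_mult_left cut_sum_mult_right cut_antipode_def ..
      finally show "cut_sum (\<lambda>bs' \<gamma>'. sg (sdim \<gamma> * (?k - j + sdim \<gamma>')) (?F bs \<gamma> bs' \<gamma>')) (rear j x)
        = sg (sdim \<gamma> * (?k - j) + ?k + sdim \<gamma> + 1) (wd bs * ?N (rear j x) * Sb \<gamma>)" .
    qed
    also have "\<dots> = (\<Sum>j\<in>{1..<?k}. if j = ?k - 1 then sg (?k + 1) (?N (front j x)) else 0)"
    proof (intro sum.cong refl)
      fix j assume j: "j \<in> {1..<?k}"
      have n: "?N (rear j x) = (if j = ?k - 1 then 1 else 0)"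
        using j k by (subst cut_antipode) (auto simp: sorted_rear x length_front_rear length_rear)
      show "cut_sum (\<lambda>bs \<gamma>. sg (sdim \<gamma> * (?k - j) + ?k + sdim \<gamma> + 1) (wd bs * ?N (rear j x) * Sb \<gamma>)) (front j x)
        = (if j = ?k - 1 then sg (?k + 1) (?N (front j x)) else 0)"
      proof (cases "j = ?k - 1")
        case True
        then have "?k - j = 1" using k by simp
        then show ?thesis
          using True unfolding n by (simp only: if_True) (auto simp: cut_antipode_def cut_sum_uminus sg_def)
      qed (simp add: n)
    qed
    also have "\<dots> = sg (?k + 1) (?N (front (?k - 1) x))"
      using k by (simp add: sum.delta)
    finally have T: "?T = sg (?k + 1) (?N (front (?k - 1) x))" .
    have "wd (edges x) * (pd (Sb x) - dSb x) = cut_sum (face_sum ?f) x - ?T"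
      using 0 unfolding C C1 by (simp add: algebra_simps)
    also have "cut_sum (face_sum ?f) x = (\<Sum>t\<in>{1..<?k}. sg t (?N (omit t x)))"
      unfolding cut_antipode_def by (rule cut_sum_faces[OF x(2)])
    \<comment> \<open>Both terms vanish unless \<open>?k = 2\<close>, where each equals -1.\<close>
    also have "\<dots> - ?T = 0"
    proof -
      have o: "?N (omit t x) = (if ?k = 2 then 1 else 0)" if "t \<in> {1..<?k}" for t
        using that k by (subst cut_antipode) (auto simp: sorted_omit x length_omit)
      have f: "?N (front (?k - 1) x) = (if ?k = 2 then 1 else 0)"
        using k by (subst cut_antipode) (auto simp: sorted_front x length_front)
      have "(\<Sum>t\<in>{1..<?k}. sg t (?N (omit t x))) = (\<Sum>t\<in>{1..<?k}. sg t (if ?k = 2 then 1 else 0))"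
        by (intro sum.cong refl) (simp add: o)
      then show ?thesis
        unfolding T f by (cases "?k = 2") (auto simp: numeral_2_eq_2 One_nat_def)
    qed
    finally have z: "wd (edges x) * (pd (Sb x) - dSb x) = (0 :: ('a, 'r) walg)" .
    have "pd (Sb x) - dSb x = wd (redges x) * (wd (edges x) * (pd (Sb x) - dSb x) :: ('a, 'r) walg)"
      by (simp add: wd_edges(2) flip: mult.assoc)
    then show ?thesis unfolding z by simp
  qed
qed

text \<open>The Leibniz rule for the antipode of a sequence, with the derivative on single beads
  left as a parameter: additivity in \<open>g\<close> then separates face terms from cut
  terms.\<close>

primrec dSl :: "('a list \<Rightarrow> ('a, 'r::comm_ring_1) walg) \<Rightarrow> 'a list list \<Rightarrow> ('a, 'r) walg" where
  "dSl g [] = 0"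
| "dSl g (b # bs) = sg ((sdim b - 1) * bdeg bs) (dSl g bs * Sb b + sg (bdeg bs) (Sl bs * g b))"

lemma pd_Sl:
  fixes x :: "'a::linorder list"
  shows "wpath (faces_of x) a bs b \<Longrightarrow> pd (Sl bs) = (dSl (\<lambda>b. pd (Sb b)) bs :: ('a, 'r::comm_ring_1) walg)"
proof (induction bs arbitrary: a)
  case (Cons y bs)
  then have w: "wpath (faces_of x) (last y) bs b" by simp
  have t: "tau (Sl bs) = sg (bdeg bs) (Sl bs :: ('a, 'r) walg)"
    by (rule PA_tau[OF PA_Sl[OF subset_refl w refl]])
  show ?case by (simp add: lin_sg[OF lin_pd] pd_mult t Cons.IH[OF w])
qed simp

lemma dSl_add: "(\<And>b. b \<in> set bs \<Longrightarrow> g b = g1 b + g2 b) \<Longrightarrow> dSl g bs = dSl g1 bs + dSl g2 bs"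
  by (induction bs) (simp_all add: sg_add distrib_left distrib_right algebra_simps)

lemma face_sum_cong:
  "(\<And>bs'. Suc (bdeg bs') = bdeg bs \<Longrightarrow> f bs' \<gamma> = g bs' \<gamma>) \<Longrightarrow> face_sum f bs \<gamma> = face_sum g bs \<gamma>"
proof (induction bs arbitrary: f g)
  case (Cons b bs)
  have "f (omit t b # bs) \<gamma> = g (omit t b # bs) \<gamma>" if "t \<in> {1..<sdim b}" for t
    using that by (intro Cons.prems) (auto simp: sdim_def omit_def)
  moreover have "face_sum (\<lambda>bs'. f (b # bs')) bs \<gamma> = face_sum (\<lambda>bs'. g (b # bs')) bs \<gamma>"
    by (rule Cons.IH) (auto intro: Cons.prems)
  ultimately show ?case by simp
qed simp

text \<open>The face part of the commutation of antipode and differential on sequences, with the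
  factor (-1)^degree that occurs in \<open>\<chi>\<close>. A face lowers the degree by one, which
  accounts for the minus sign.\<close>

lemma face_sum_Sl:
  "face_sum (\<lambda>bs' _. sg (bdeg bs') (Sl bs')) bs \<gamma>
    = (sg (bdeg bs) (dSl (\<lambda>b. - (\<Sum>t\<in>{1..<sdim b}. sg t (Sb (omit t b)))) bs) :: ('a, 'r::comm_ring_1) walg)"
proof (induction bs)
  case (Cons b bs)
  let ?m = "sdim b - 1" and ?B = "bdeg bs"
  let ?g = "\<lambda>b. - (\<Sum>t\<in>{1..<sdim b}. sg t (Sb (omit t b))) :: ('a, 'r) walg"
  have "face_sum (\<lambda>bs' _. sg (bdeg (b # bs')) (Sl (b # bs'))) bs \<gamma>
    = (face_sum (\<lambda>bs' _. sg (?m * ?B) (sg (bdeg bs') (Sl bs') * Sb b)) bs \<gamma> :: ('a, 'r) walg)"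
  proof (rule face_sum_cong)
    fix bs' :: "'a list list" assume "Suc (bdeg bs') = bdeg bs"
    then have e: "bdeg bs = Suc (bdeg bs')" by simp
    show "sg (bdeg (b # bs')) (Sl (b # bs')) = (sg (?m * ?B) (sg (bdeg bs') (Sl bs') * Sb b) :: ('a, 'r) walg)"
      unfolding e by (simp add: ac_simps)
  qed
  also have "\<dots> = sg (?m * ?B) (face_sum (\<lambda>bs' _. sg (bdeg bs') (Sl bs')) bs \<gamma> * Sb b)"
    by (subst face_sum_hom(1)[of "\<lambda>z. sg (?m * ?B) (z * Sb b)"]) (simp_all add: distrib_right sg_add)
  finally have 1: "face_sum (\<lambda>bs' _. sg (bdeg (b # bs')) (Sl (b # bs'))) bs \<gamma>
    = (sg (?m * ?B + ?B) (dSl ?g bs * Sb b) :: ('a, 'r) walg)"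
    by (simp add: Cons)
  have 2: "(\<Sum>t\<in>{1..<sdim b}. sg t (sg (bdeg (omit t b # bs)) (Sl (omit t b # bs))))
    = (sg (?m * ?B + ?m) (Sl bs * ?g b) :: ('a, 'r) walg)"
    unfolding mult_minus_right sum_distrib_left sg_uminus sg_sum sum_negf[symmetric]
  proof (intro sum.cong refl)
    fix t assume t: "t \<in> {1..<sdim b}"
    then obtain p where p: "sdim b = Suc (Suc p)" by (cases "sdim b"; cases "sdim b - 1") (auto simp: One_nat_def)
    have "sdim (omit t b) = Suc p" using t p by (subst sdim_omit) (auto simp: sdim_def)
    then show "sg t (sg (bdeg (omit t b # bs)) (Sl (omit t b # bs))) = - sg (?m * ?B + ?m) (Sl bs * sg t (Sb (omit t b)) :: ('a, 'r) walg)"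
      by (simp add: p sg_def)
  qed
  show ?case
    unfolding face_sum.simps(2) 1 2 by (simp add: sg_add sg_uminus ac_simps sg_def)
qed simp

section \<open>The homotopy \<open>\<nabla>\<^sub>1\<close>\<close>

lemma sorted_join:
  fixes as bs :: "'a::linorder list"
  assumes "sorted_wrt (<) as" "sorted_wrt (<) bs" "as \<noteq> []" "bs \<noteq> []" "last as = hd bs"
  shows "sorted_wrt (<) (as @ tl bs)"
proof -
  obtain h t where b: "bs = h # t" using assms(4) by (cases bs) auto
  have a: "as = butlast as @ [h]" using assms(3,5) b append_butlast_last_id[of as] by simp
  have "sorted_wrt (<) (butlast as @ [h])" using assms(1) a by simp
  then have "sorted_wrt (<) ((butlast as @ [h]) @ t)"
    using assms(2) b by (fastforce simp: sorted_wrt_append intro: less_trans)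
  then show ?thesis using a b by simp
qed

lemma butlast_join: "as \<noteq> [] \<Longrightarrow> bs \<noteq> [] \<Longrightarrow> last as = hd bs \<Longrightarrow> butlast as @ bs = as @ tl bs"
  by (cases bs; cases as rule: rev_cases) auto

text \<open>One summand of \<open>\<nabla>\<^sub>1\<close> with the antipode applied to its second
  factor, from cuts of front and rear at \<open>l\<close>. The first factor joins
  \<open>\<gamma>\<close> to the first block of \<open>bs'\<close>, the second joins the last block
  of \<open>bs\<close> to \<open>\<gamma>'\<close>. Of the sign only (m + l)(n + k) is explicit,
  with m and n one less than the dimensions of \<open>\<gamma>\<close> and \<open>\<gamma>'\<close>;
  the rest is part of \<open>cut_sum\<close>.\<close>

definition ut :: "nat \<Rightarrow> nat \<Rightarrow> 'a list list \<Rightarrow> 'a list \<Rightarrow> 'a list list \<Rightarrow> 'a list \<Rightarrow> ('a, 'r::comm_ring_1) walg" where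
  "ut l k bs \<gamma> bs' \<gamma>' = sg ((sdim \<gamma> - 1 + l) * (sdim \<gamma>' - 1 + k))
     (bd (butlast \<gamma> @ hd bs') * (wd (tl bs') * Sl (butlast bs @ [last bs @ tl \<gamma>'])))"

text \<open>\<open>U x\<close> is \<open>\<mu>(id \<otimes> S)\<nabla>\<^sub>1(x)\<close>.\<close>

definition U :: "'a list \<Rightarrow> ('a, 'r::comm_ring_1) walg" where
  "U x = (\<Sum>l\<in>{1..<sdim x}. cut_sum (\<lambda>bs \<gamma>. cut_sum (ut l (sdim x) bs \<gamma>) (rear l x)) (front l x))"

lemma cut_pair:
  fixes x :: "'a::linorder list"
  assumes x: "sorted_wrt (<) x" and l: "l \<in> {1..<sdim x}"
    and c: "cut_of (front l x) bs \<gamma>" "cut_of (rear l x) bs' \<gamma>'"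
  shows "wpath (faces_of x) (hd x) ((butlast \<gamma> @ hd bs') # tl bs') (last x)" (is ?A)
    and "wpath (faces_of x) (hd x) (butlast bs @ [last bs @ tl \<gamma>']) (last x)" (is ?B)
    and "bdeg ((butlast \<gamma> @ hd bs') # tl bs') + bdeg (butlast bs @ [last bs @ tl \<gamma>']) = sdim x" (is ?C)
    and "3 \<le> length (butlast \<gamma> @ hd bs')" (is ?D)
proof -
  have x0: "x \<noteq> []" "length x = Suc (sdim x)" using l by (auto simp: sdim_def)
  have lr: "2 \<le> length (front l x)" "2 \<le> length (rear l x)" using l by (auto simp: length_front_rear)
  have e: "hd (front l x) = hd x" "last (front l x) = x ! l" "hd (rear l x) = x ! l" "last (rear l x) = last x"
    "sdim (front l x) = l" "sdim (rear l x) = sdim x - l"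
    using l x0 by (auto simp: hd_front last_front hd_rear last_rear sdim_front sdim_rear)
  note f = cut_of_lengths[OF c(1) lr(1), unfolded e] and f' = cut_of_lengths[OF c(2) lr(2), unfolded e]
  note s = cut_of_sorted[OF c(1) lr(1) sorted_front[OF x], unfolded e]
  note s' = cut_of_sorted[OF c(2) lr(2) sorted_rear[OF x], unfolded e]
  obtain y bt where y: "bs' = y # bt" using f'(2) by (cases bs') auto
  obtain bi z where z: "bs = bi @ [z]" using f(2) by (cases bs rule: rev_cases) auto
  have g: "\<gamma> \<noteq> []" "\<gamma>' \<noteq> []" "2 \<le> length \<gamma>" "2 \<le> length \<gamma>'" using f(1) f'(1) by (auto simp: y z)
  have ss: "set (front l x) \<subseteq> set x" "set (rear l x) \<subseteq> set x" by (rule set_front set_rear)+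
  have y': "sorted_wrt (<) y" "set y \<subseteq> set x" "2 \<le> length y" "hd y = x ! l" "wpath (faces_of (rear l x)) (last y) bt (last x)"
    using s' ss(2) by (auto simp: y)
  obtain a where a: "wpath (faces_of (front l x)) (hd x) bi a" "hd z = a"
    and z': "sorted_wrt (<) z" "set z \<subseteq> set x" "2 \<le> length z" "last z = x ! l"
    using s ss(1) by (auto simp: z wpath_append)
  have yn: "y \<noteq> []" "z \<noteq> []" using y' z' by auto
  have Y: "butlast \<gamma> @ y = \<gamma> @ tl y" using g yn y' f by (intro butlast_join) auto
  have "sorted_wrt (<) (\<gamma> @ tl y)" using s y' g yn f by (intro sorted_join) auto
  moreover have "set (\<gamma> @ tl y) \<subseteq> set x" using s ss y'(2) yn by (cases y) auto
  moreover have "hd (\<gamma> @ tl y) = hd x" "last (\<gamma> @ tl y) = last y" "length (\<gamma> @ tl y) = length \<gamma> + length y - 1"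
    using g f y' yn by (cases y; auto simp: last_append)+
  moreover have "wpath (faces_of x) (last y) bt (last x)"
    by (rule wpath_mono[OF y'(5)]) (use ss in auto)
  ultimately show ?A ?D using g y'(3) by (simp_all add: y Y)
  have "sorted_wrt (<) (z @ tl \<gamma>')" using s' z' g yn f' by (intro sorted_join) auto
  moreover have "set (z @ tl \<gamma>') \<subseteq> set x" using s' ss z'(2) g(2) by (cases \<gamma>') auto
  moreover have "hd (z @ tl \<gamma>') = a" "last (z @ tl \<gamma>') = last x" "length (z @ tl \<gamma>') = length z + length \<gamma>' - 1"
    using g f' a yn by (cases \<gamma>'; auto simp: last_append)+
  moreover have "wpath (faces_of x) (hd x) bi a"
    by (rule wpath_mono[OF a(1)]) (use ss in auto)
  ultimately show ?B using g z'(3) by (auto simp: z wpath_append)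
  have d: "sdim (\<gamma> @ tl y) - 1 = sdim \<gamma> + (sdim y - 1)" "sdim (z @ tl \<gamma>') - 1 = sdim \<gamma>' + (sdim z - 1)"
    using y'(3) z'(3) g by (auto simp: sdim_def)
  have "bdeg bs + sdim \<gamma> = l" "bdeg bs' + sdim \<gamma>' = sdim x - l" by (rule f(3), rule f'(3))
  then show ?C using l by (simp add: y z Y d; arith)
qed

lemma PA_ut:
  fixes x :: "'a::linorder list"
  assumes x: "sorted_wrt (<) x" and l: "l \<in> {1..<sdim x}" and s: "set x \<subseteq> set c"
    and c: "cut_of (front l x) bs \<gamma>" "cut_of (rear l x) bs' \<gamma>'"
  shows "(ut l k bs \<gamma> bs' \<gamma>' :: ('a, 'r::comm_ring_1) walg) \<in> PA (beads (full c)) (hd x) (hd x) (sdim x)"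
proof -
  note p = cut_pair[OF x l c]
  have "(wd ((butlast \<gamma> @ hd bs') # tl bs') :: ('a, 'r) walg) \<in> PA (beads (full c)) (hd x) (last x) (bdeg ((butlast \<gamma> @ hd bs') # tl bs'))"
    by (rule PA_wd[OF wpath_mono[OF p(1) faces_of_beads[OF s]] refl])
  moreover have "(Sl (butlast bs @ [last bs @ tl \<gamma>']) :: ('a, 'r) walg) \<in> PA (beads (full c)) (last x) (hd x) (bdeg (butlast bs @ [last bs @ tl \<gamma>']))"
    by (rule PA_Sl[OF s p(2) refl])
  ultimately have "wd ((butlast \<gamma> @ hd bs') # tl bs') * (Sl (butlast bs @ [last bs @ tl \<gamma>']) :: ('a, 'r) walg) \<in> PA (beads (full c)) (hd x) (hd x) (sdim x)"
    by (rule PA_mult') (rule p(3)[symmetric])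
  then show ?thesis
    unfolding ut_def by (intro PA_sg) (simp only: wd_Cons[of _ "tl bs'"] mult.assoc)
qed

lemma PA_U:
  fixes x :: "'a::linorder list"
  assumes "sorted_wrt (<) x" "set x \<subseteq> set c" "n = sdim x"
  shows "(U x :: ('a, 'r::comm_ring_1) walg) \<in> PA (beads (full c)) (hd x) (hd x) n"
  unfolding U_def assms(3)
proof (rule PA_sum)
  fix l assume l: "l \<in> {1..<sdim x}"
  let ?P = "\<lambda>z. z \<in> PA (beads (full c)) (hd x) (hd x) (sdim x)"
  show "?P (cut_sum (\<lambda>bs \<gamma>. cut_sum (ut l (sdim x) bs \<gamma>) (rear l x)) (front l x) :: ('a, 'r) walg)"
    by (rule cut_sum_closed[of ?P], erule (1) PA_add, erule PA_uminus, rule PA_zero,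
      rule cut_sum_closed[of ?P], erule (1) PA_add, erule PA_uminus, rule PA_zero, rule PA_ut[OF assms(1) l assms(2)])
qed

section \<open>Differentiating \<open>U\<close> modulo the right ideal of a base vertex\<close>

lemma lk_cut_sum:
  assumes "\<And>bs \<gamma>. cut_of x bs \<gamma> \<Longrightarrow> lk c b (f bs \<gamma>)"
  shows "lk c b (cut_sum f x)"
  by (rule cut_sum_closed[of "lk c b", OF lk_add lk_uminus lk_zero assms])

lemma lk_cut_sum_diff:
  assumes "\<And>bs \<gamma>. cut_of x bs \<gamma> \<Longrightarrow> lk c b (f bs \<gamma> - g bs \<gamma>)"
  shows "lk c b (cut_sum f x - cut_sum g x)"
  unfolding cut_sum_diff[symmetric] by (rule lk_cut_sum[OF assms])

lemma lk_sum_diff: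
  assumes "\<And>i. i \<in> I \<Longrightarrow> lk c b (f i - g i)"
  shows "lk c b (sum f I - sum g I)"
  unfolding sum_subtractf[symmetric] by (rule lk_sum[OF assms])

lemma lk_sg_diff: "lk c b (x - y) \<Longrightarrow> lk c b (sg n x - sg n y)"
  unfolding sg_diff[symmetric] by (rule lk_sg)

lemma lk_pd_bead:
  assumes c: "sorted_wrt (<) c" "b < length c" and ys: "ys \<noteq> []"
  shows "lk c b (pd (bd (c ! b # v # ys) * Z)
    - ((if length ys = 1 then bd (c ! b # ys) else 0) - bd [c ! b, v] * bd (v # ys)) * Z)"
proof -
  have "lk c b (bd (c ! b # v # ys))"
    by (rule lk_bead_hd[OF c]) (use ys in \<open>cases ys; simp\<close>)+
  then have "lk c b (sg (sdim (c ! b # v # ys) - 1) (bd (c ! b # v # ys) * pd Z))"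
    by (intro lk_sg lk_mult)
  moreover note lk_mult[OF dbd_mod_lk[OF c ys, of v], of Z]
  ultimately have "lk c b (sg (sdim (c ! b # v # ys) - 1) (bd (c ! b # v # ys) * pd Z) +
    (dbd (c ! b # v # ys) - ((if length ys = 1 then bd (c ! b # ys) else 0) - bd [c ! b, v] * bd (v # ys))) * Z)"
    by (rule lk_add)
  then show ?thesis
    by (simp only: pd_mult pd_bd tau_bd sg_mult_left left_diff_distrib add_diff_eq add.commute)
qed

context
  fixes c x :: "'a::linorder list" and b :: nat
  assumes c: "sorted_wrt (<) c" "b < length c" and x: "sorted_wrt (<) x" and hx: "hd x = c ! b"
begin

text \<open>Each summand begins with a bead of dimension at least 2 leaving
  \<open>hd x\<close>.\<close>

lemma lk_U: "lk c b (U x :: ('a, 'r::comm_ring_1) walg)"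
  unfolding U_def
proof (intro lk_sum lk_cut_sum)
  fix l bs \<gamma> bs' \<gamma>' assume l: "l \<in> {1..<sdim x}" and "cut_of (front l x) bs \<gamma>" "cut_of (rear l x) bs' \<gamma>'"
  then have p: "wpath (faces_of x) (hd x) ((butlast \<gamma> @ hd bs') # tl bs') (last x)" "3 \<le> length (butlast \<gamma> @ hd bs')"
    using cut_pair[OF x] by blast+
  show "lk c b (ut l (sdim x) bs \<gamma> bs' \<gamma>' :: ('a, 'r) walg)"
    unfolding ut_def using p hx by (intro lk_sg lk_mult lk_bead_hd[OF c]) auto
qed

text \<open>The two terms surviving when a summand with \<open>\<gamma>\<close> an edge is
  differentiated: \<open>ub\<close> comes from the face at the second vertex \<open>x ! l\<close> of
  the first bead, nonzero only if that bead is a triangle, and \<open>uv\<close> from the cut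
  there.\<close>

private abbreviation (input) "ub l bs' \<gamma>' \<equiv> sg (l * (sdim \<gamma>' - 1 + sdim x))
    ((if length (hd bs') = 2 then bd [hd x, last (hd bs')] else 0) * (wd (tl bs') * Sb (front l x @ tl \<gamma>')))"
private abbreviation (input) "uv l bs' \<gamma>' \<equiv> sg (l * (sdim \<gamma>' - 1 + sdim x)) (bd [hd x, x ! l] * (wd bs' * Sb (front l x @ tl \<gamma>')))"

lemma pd_ut_base:
  assumes l: "l \<in> {1..<sdim x}" and c': "cut_of (rear l x) bs' \<gamma>'"
  shows "lk c b (pd (ut l (sdim x) [front l x] [hd x, x ! l] bs' \<gamma>') - (ub l bs' \<gamma>' - uv l bs' \<gamma>') :: ('a, 'r::comm_ring_1) walg)"
proof -
  have lr: "2 \<le> length (rear l x)" using l by (auto simp: length_front_rear)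
  have w: "wpath (faces_of (rear l x)) (hd (rear l x)) bs' (last (rear l x))"
    using cut_of_sorted[OF c' lr sorted_rear[OF x]] by simp
  have hr: "hd (rear l x) = x ! l" using l by (subst hd_rear) (auto simp: sdim_def)
  obtain y bt where y: "bs' = y # bt" using cut_of_lengths(2)[OF c' lr] by (cases bs') auto
  obtain ys where ys: "y = x ! l # ys" "ys \<noteq> []" using w hr by (cases y; cases "tl y") (auto simp: y)
  have lys: "length ys = 1 \<Longrightarrow> ys = [last ys]" by (cases ys) (auto simp: One_nat_def)
  have "lk c b (pd (bd (c ! b # x ! l # ys) * (wd bt * Sb (front l x @ tl \<gamma>')))
    - ((if length ys = 1 then bd (c ! b # ys) else 0) - bd [c ! b, x ! l] * bd (x ! l # ys)) * (wd bt * Sb (front l x @ tl \<gamma>')) :: ('a, 'r) walg)"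
    by (rule lk_pd_bead[OF c ys(2)])
  also have "((if length ys = 1 then bd (c ! b # ys) else 0) - bd [c ! b, x ! l] * bd (x ! l # ys)) * (wd bt * Sb (front l x @ tl \<gamma>'))
    = ((if length (hd bs') = 2 then bd [hd x, last (hd bs')] else 0) * (wd (tl bs') * Sb (front l x @ tl \<gamma>'))
      - bd [hd x, x ! l] * (wd bs' * Sb (front l x @ tl \<gamma>')) :: ('a, 'r) walg)"
    using ys(2) lys by (auto simp: y ys hx left_diff_distrib mult.assoc wd_Cons[of _ bt] One_nat_def)
  finally have "lk c b (sg (l * (sdim \<gamma>' - 1 + sdim x)) (pd (bd (c ! b # x ! l # ys) * (wd bt * Sb (front l x @ tl \<gamma>'))))
     - (ub l bs' \<gamma>' - uv l bs' \<gamma>') :: ('a, 'r) walg)"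
    unfolding sg_diff[symmetric] by (rule lk_sg)
  then show ?thesis
    by (simp add: ut_def y ys hx lin_sg[OF lin_pd])
qed

text \<open>If the front is cut first at \<open>i < l\<close>, the leading bead has second vertex
  \<open>x ! i\<close> and at least four vertices, so only the cut at \<open>x ! i\<close> survives.
  After the cut-off edge stands a summand of \<open>U (rear i x)\<close>, and the first block
  \<open>front i x\<close> contributes its antipode as the last factor.\<close>

lemma pd_ut_step:
  assumes l: "l \<in> {1..<sdim x}" and i: "i \<in> {1..<l}" and c1: "cut_of (rear i (front l x)) bs \<gamma>" and c': "cut_of (rear l x) bs' \<gamma>'"
  shows "lk c b (sg (l - i + sdim \<gamma>) (pd (ut l (sdim x) (front i (front l x) # bs) (hd x # \<gamma>) bs' \<gamma>'))
    - sg (sdim x * Suc i) (bd [hd x, x ! i] * (ut (l - i) (sdim x - i) bs \<gamma> bs' \<gamma>' * Sb (front i x))) :: ('a, 'r::comm_ring_1) walg)"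
proof -
  have lx: "length x = Suc (sdim x)" using l by (auto simp: sdim_def)
  have lr: "2 \<le> length (rear i (front l x))" "2 \<le> length (rear l x)" using l i lx by (auto simp: length_front_rear length_rear length_front)
  have e: "front i (front l x) = front i x" "sdim (front i x) = i" "sdim (rear i (front l x)) = l - i" "hd (rear i (front l x)) = x ! i"
    using i l lx by (auto simp: front_front sdim_front sdim_rear hd_rear length_front) (auto simp: front_def)
  note f = cut_of_lengths[OF c1 lr(1), unfolded e] and f' = cut_of_lengths[OF c' lr(2)]
  have e': "sdim (rear l x) = sdim x - l" by (simp add: sdim_rear)
  have w: "wpath (faces_of (rear l x)) (hd (rear l x)) bs' (last (rear l x))"
    using cut_of_sorted[OF c' lr(2) sorted_rear[OF x]] by simp
  obtain y bt where y: "bs' = y # bt" using f'(2) by (cases bs') auto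
  have yl: "2 \<le> length y" using w by (simp add: y)
  obtain bi z where z: "bs = bi @ [z]" using f(2) by (cases bs rule: rev_cases) auto
  have "2 \<le> length \<gamma>" using f(1) by (simp add: z)
  then obtain \<gamma>r where g: "\<gamma> = x ! i # \<gamma>r" "\<gamma>r \<noteq> []" using f(4) by (cases \<gamma>; cases "tl \<gamma>") auto
  let ?Z = "wd bt * Sl (front i x # bi @ [z @ tl \<gamma>']) :: ('a, 'r) walg"
  let ?ys = "butlast \<gamma>r @ y"
  have ys: "?ys \<noteq> []" "length ?ys \<noteq> 1" using yl by auto
  have zl: "2 \<le> length z"
    using cut_of_sorted[OF c1 lr(1) sorted_rear[OF sorted_front[OF x]]] by (auto simp: z wpath_append)
  have gp: "0 < sdim \<gamma>" "0 < sdim \<gamma>'" using f(1,2) f'(1,2) by (auto simp: sdim_def)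
  obtain s s' where s: "sdim \<gamma> = Suc s" "sdim \<gamma>' = Suc s'" using gp by (metis Suc_pred)
  obtain a where a: "l = i + a" using i by (metis atLeastLessThan_iff le_Suc_ex less_imp_le)
  obtain t where t: "sdim x = l + t" using l by (metis atLeastLessThan_iff le_Suc_ex less_imp_le)
  obtain i' where i': "i = Suc i'" using i by (cases i) auto
  have bz: "bdeg (bi @ [z @ tl \<gamma>']) + sdim \<gamma> = a + sdim \<gamma>'"
  proof -
    have "sdim (z @ tl \<gamma>') - 1 = sdim \<gamma>' + (sdim z - 1)" using zl f'(1) by (auto simp: sdim_def)
    then show ?thesis using f(3) by (simp add: z a)
  qed
  have par: "odd (l - i + sdim \<gamma> + (sdim (hd x # \<gamma>) - 1 + l) * (sdim \<gamma>' - 1 + sdim x) + ((i - 1) * bdeg (bi @ [z @ tl \<gamma>'])))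
    = even (sdim x * Suc i + (sdim \<gamma> - 1 + (l - i)) * (sdim \<gamma>' - 1 + (sdim x - i)))"
  proof -
    have "even (bdeg (bi @ [z @ tl \<gamma>'])) = even (a + s + s')"
      using bz s by presburger
    moreover have "sdim (hd x # \<gamma>) = Suc (Suc s)" using s(1) by (simp add: sdim_def g)
    ultimately show ?thesis
      unfolding s a t i' by (cases "even i'"; cases "even a"; cases "even t"; cases "even s"; cases "even s'"; simp)
  qed
  have "lk c b (pd (bd (c ! b # x ! i # ?ys) * ?Z)
    - ((if length ?ys = 1 then bd (c ! b # ?ys) else 0) - bd [c ! b, x ! i] * bd (x ! i # ?ys)) * ?Z)"
    by (rule lk_pd_bead[OF c ys(1)])
  then have 1: "lk c b (pd (bd (c ! b # x ! i # ?ys) * ?Z) - - (bd [hd x, x ! i] * (bd (x ! i # ?ys) * ?Z)))"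
    by (simp only: ys(2) if_False diff_0 mult_minus_left mult.assoc hx)
  have 2: "ut l (sdim x) (front i (front l x) # bs) (hd x # \<gamma>) bs' \<gamma>'
    = (sg ((sdim (hd x # \<gamma>) - 1 + l) * (sdim \<gamma>' - 1 + sdim x)) (bd (c ! b # x ! i # ?ys) * ?Z) :: ('a, 'r) walg)"
    by (simp add: ut_def y z g hx e)
  have 3: "ut (l - i) (sdim x - i) bs \<gamma> bs' \<gamma>' * Sb (front i x)
    = (sg ((sdim \<gamma> - 1 + (l - i)) * (sdim \<gamma>' - 1 + (sdim x - i)) + (i - 1) * bdeg (bi @ [z @ tl \<gamma>'])) (bd (x ! i # ?ys) * ?Z) :: ('a, 'r) walg)"
  proof -
    have "Sl (bi @ [z @ tl \<gamma>']) * Sb (front i x)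
      = (sg ((i - 1) * bdeg (bi @ [z @ tl \<gamma>'])) (Sl (front i x # bi @ [z @ tl \<gamma>'])) :: ('a, 'r) walg)"
      unfolding Sl.simps(2) e sg_sg by (simp add: sg_def)
    then show ?thesis
      unfolding ut_def y z butlast_snoc last_snoc list.sel sg_mult_left mult.assoc by (simp only: sg_mult_right sg_sg) (simp add: g(2), simp add: g)
  qed
  have 4: "sg (sdim x * Suc i) (bd [hd x, x ! i] * (ut (l - i) (sdim x - i) bs \<gamma> bs' \<gamma>' * Sb (front i x)))
    = (sg (l - i + sdim \<gamma> + (sdim (hd x # \<gamma>) - 1 + l) * (sdim \<gamma>' - 1 + sdim x)) (- (bd [hd x, x ! i] * (bd (x ! i # ?ys) * ?Z))) :: ('a, 'r) walg)"
    unfolding 3 sg_mult_right sg_sg using par by (auto simp only: sg_def even_add minus_minus split: if_split)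
  show ?thesis
    unfolding 4 2 lin_sg[OF lin_pd] sg_sg by (rule lk_sg_diff[OF 1])
qed

text \<open>The face term needs the first block of the rear to be the edge from \<open>l\<close> to
  \<open>l + 1\<close>. What remains is a cut of the rear at \<open>l + 1\<close>, with
  \<open>x ! Suc l\<close> passing into the argument of the antipode: exactly the cut term for
  \<open>Suc l\<close>. At the last \<open>l\<close> the argument of the antipode becomes
  \<open>x\<close> itself.\<close>

lemma cut_sum_ub:
  assumes l: "l \<in> {1..<sdim x}"
  shows "cut_sum (\<lambda>bs' \<gamma>'. ub l bs' \<gamma>') (rear l x)
    = (if l = sdim x - 1 then bd [hd x, last x] * Sb x else cut_sum (\<lambda>bs' \<gamma>'. uv (Suc l) bs' \<gamma>') (rear (Suc l) x) :: ('a, 'r::comm_ring_1) walg)"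
proof -
  have lx: "length x = Suc (sdim x)" using l by (auto simp: sdim_def)
  have e: "sdim (rear l x) = sdim x - l" "length (rear l x) = Suc (sdim x - l)" "last (rear l x) = last x"
    using l lx by (auto simp: sdim_rear length_rear last_rear)
  show ?thesis
  proof (cases "l = sdim x - 1")
    case True
    then have s: "sdim x = Suc l" "sdim x - l = 1" using l by auto
    have "front l x @ [last x] = x"
    proof -
      have "butlast x = front l x" using lx s by (simp add: butlast_conv_take front_def)
      moreover have "x \<noteq> []" using lx by auto
      ultimately show ?thesis using append_butlast_last_id[of x] by simp
    qed
    then show ?thesis
      using s(1) by (subst cut_sum.simps) (simp add: e sg_def)
  next
    case False
    then have n: "1 < sdim x - l" "1 \<in> {1..<sdim x - l}" using l by auto
    let ?t = "\<lambda>j. cut_sum (\<lambda>bs \<gamma>. sg (sdim (rear l x) - j + sdim \<gamma>) (ub l (front j (rear l x) # bs) (hd (rear l x) # \<gamma>))) (rear j (rear l x)) :: ('a, 'r) walg"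
    have "?t j = 0" if "j \<in> {1..<sdim x - l} - {1}" for j
      using that e by (simp add: length_front)
    then have "(\<Sum>j\<in>{1..<sdim x - l}. ?t j) = ?t 1"
      using n(2) by (subst sum.remove[of _ 1]) auto
    also have "\<dots> = cut_sum (\<lambda>bs' \<gamma>'. uv (Suc l) bs' \<gamma>') (rear (Suc l) x)"
    proof -
      have r: "rear 1 (rear l x) = rear (Suc l) x" by (simp add: rear_rear One_nat_def)
      have h: "last (front 1 (rear l x)) = x ! Suc l" "length (front 1 (rear l x)) = 2"
        using n e lx l by (auto simp: last_front length_front rear_def One_nat_def)
      show ?thesis
        unfolding r
      proof (rule cut_sum_cong)
        fix bs \<gamma> assume c: "cut_of (rear (Suc l) x) bs \<gamma>"
        have "2 \<le> length (rear (Suc l) x)" using n lx by (auto simp: length_rear)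
        note f = cut_of_lengths[OF c this]
        have hg: "hd \<gamma> = x ! Suc l" using f(4) n lx by (simp add: hd_rear)
        obtain \<gamma>r where g: "\<gamma> = x ! Suc l # \<gamma>r" using f(1) hg by (cases \<gamma>) auto
        have "0 < sdim \<gamma>" using f(1,2) by (auto simp: sdim_def)
        then obtain q where q: "sdim \<gamma> = Suc q" by (cases "sdim \<gamma>") auto
        have q': "sdim (hd (rear l x) # \<gamma>) = Suc (Suc q)" using q by (simp add: sdim_def g)
        have fr: "front (Suc l) x @ tl \<gamma> = front l x @ \<gamma>"
          using n lx by (simp add: g front_def take_Suc_conv_app_nth[of "Suc l" x])
        obtain a where a: "sdim x = l + Suc a" using n by (metis Suc_diff_Suc add.commute le_add_diff_inverse2 less_imp_le l atLeastLessThan_iff)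
        have P: "even (sdim x - l - 1 + sdim \<gamma> + l * (sdim (hd (rear l x) # \<gamma>) - 1 + sdim x)) = even (Suc l * (sdim \<gamma> - 1 + sdim x))"
          unfolding q q' a by (cases "even l"; cases "even a"; cases "even q"; simp)
        show "sg (sdim (rear l x) - 1 + sdim \<gamma>) (ub l (front 1 (rear l x) # bs) (hd (rear l x) # \<gamma>)) = (uv (Suc l) bs \<gamma> :: ('a, 'r) walg)"
          unfolding e sg_sg list.sel h fr by (simp only: if_True simp_thms) (rule sg_cong[OF P refl])
      qed
    qed
    finally show ?thesis
      using False n by (subst cut_sum.simps) (simp add: e)
  qed
qed

text \<open>This is the part of \<open>cut_antipode x\<close> whose first block is the initial edge.
  The other parts begin with a bead of dimension at least 2 leaving the base, and the total is
  0.\<close>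

lemma uv_first:
  assumes k: "2 \<le> sdim x"
  shows "lk c b (cut_sum (\<lambda>bs' \<gamma>'. uv 1 bs' \<gamma>') (rear 1 x) :: ('a, 'r::comm_ring_1) walg)"
proof -
  have lx: "length x = Suc (sdim x)" "x \<noteq> []" using k by (auto simp: sdim_def)
  let ?k = "sdim x"
  let ?t = "\<lambda>j. cut_sum (\<lambda>bs \<gamma>. sg (?k - j + sdim \<gamma>) (wd (front j x # bs) * Sb (hd x # \<gamma>))) (rear j x) :: ('a, 'r) walg"
  have hf: "hd (front j x) = c ! b" for j using lx hx by (simp add: hd_front)
  have 1: "?t 1 = cut_sum (\<lambda>bs' \<gamma>'. uv 1 bs' \<gamma>') (rear 1 x)"
  proof (rule cut_sum_cong)
    fix bs \<gamma> assume c: "cut_of (rear 1 x) bs \<gamma>"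
    have "2 \<le> length (rear 1 x)" using lx k by (auto simp: length_rear)
    note f = cut_of_lengths[OF c this]
    have hg: "hd \<gamma> = x ! 1" using f(4) k lx by (simp add: hd_rear)
    obtain \<gamma>r where g: "\<gamma> = x ! 1 # \<gamma>r" using f(1) hg by (cases \<gamma>) auto
    obtain u v y where x: "x = u # v # y" using lx k by (cases x; cases "tl x") auto
    have "0 < sdim \<gamma>" using f(1,2) by (auto simp: sdim_def)
    then obtain q where q: "sdim \<gamma> = Suc q" by (cases "sdim \<gamma>") auto
    obtain p where p: "?k = Suc p" using k by (cases ?k) auto
    have "even (?k - 1 + sdim \<gamma>) = even (1 * (sdim \<gamma> - 1 + ?k))" unfolding q p by auto
    moreover have "wd (front 1 x # bs) * Sb (hd x # \<gamma>) = (bd [hd x, x ! 1] * (wd bs * Sb (front 1 x @ tl \<gamma>)) :: ('a, 'r) walg)"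
      by (subst wd_Cons) (simp add: x g front_def One_nat_def mult.assoc)
    ultimately show "sg (?k - 1 + sdim \<gamma>) (wd (front 1 x # bs) * Sb (hd x # \<gamma>)) = (uv 1 bs \<gamma> :: ('a, 'r) walg)"
      by (rule sg_cong)
  qed
  have "cut_antipode x = (0 :: ('a, 'r) walg)"
    using k lx by (subst cut_antipode[OF x]) auto
  then have 2: "bd x * Sb [hd x, last x] + (?t 1 + (\<Sum>j\<in>{1..<?k} - {1}. ?t j)) = 0"
    unfolding cut_antipode_def using k
    by (subst (asm) cut_sum.simps, subst (asm) sum.remove[of _ 1]) auto
  have "lk c b (bd x * Sb [hd x, last x] + (\<Sum>j\<in>{1..<?k} - {1}. ?t j) :: ('a, 'r) walg)"
  proof (intro lk_add lk_sum lk_cut_sum)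
    show "lk c b (bd x * Sb [hd x, last x] :: ('a, 'r) walg)"
      by (intro lk_mult lk_bead_hd[OF c]) (use hx k lx in auto)
    fix j bs \<gamma> assume j: "j \<in> {1..<?k} - {1}"
    show "lk c b (sg (?k - j + sdim \<gamma>) (wd (front j x # bs) * Sb (hd x # \<gamma>)) :: ('a, 'r) walg)"
      by (subst wd_Cons, intro lk_sg lk_mult lk_bead_hd[OF c hf]) (use j lx in \<open>auto simp: length_front\<close>)
  qed
  then have "lk c b (- (bd x * Sb [hd x, last x] + (\<Sum>j\<in>{1..<?k} - {1}. ?t j)) :: ('a, 'r) walg)"
    by (rule lk_uminus)
  also have "- (bd x * Sb [hd x, last x] + (\<Sum>j\<in>{1..<?k} - {1}. ?t j)) = ?t 1"
  proof -
    have "- (u + w) = v" if "u + (v + w) = 0" for u v w :: "('a, 'r) walg"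
      using that by (metis add.left_commute eq_neg_iff_add_eq_0)
    then show ?thesis using 2 by blast
  qed
  finally show ?thesis unfolding 1 .
qed

text \<open>Face and cut terms of consecutive \<open>l\<close> telescope: the last face term gives
  the edge from the first to the last vertex times the antipode of \<open>x\<close>, and the first
  cut term lies in the ideal. The remaining terms reassemble into \<open>U\<close> of rears.\<close>

lemma pd_U:
  assumes k: "2 \<le> sdim x"
  shows "lk c b (pd (U x) - (bd [hd x, last x] * Sb x +
    (\<Sum>i\<in>{1..<sdim x}. sg (sdim x * Suc i) (bd [hd x, x ! i] * (U (rear i x) * Sb (front i x))))) :: ('a, 'r::comm_ring_1) walg)"
proof -
  let ?k = "sdim x"
  have lx: "length x = Suc ?k" "x \<noteq> []" using k by (auto simp: sdim_def)
  let ?p = "\<lambda>l bs \<gamma>. cut_sum (\<lambda>bs' \<gamma>'. pd (ut l ?k bs \<gamma> bs' \<gamma>')) (rear l x) :: ('a, 'r) walg"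
  let ?A = "\<lambda>l. cut_sum (\<lambda>bs' \<gamma>'. pd (ut l ?k [front l x] [hd x, x ! l] bs' \<gamma>')) (rear l x) :: ('a, 'r) walg"
  let ?B = "\<lambda>l i. cut_sum (\<lambda>bs \<gamma>. sg (l - i + sdim \<gamma>) (?p l (front i (front l x) # bs) (hd x # \<gamma>))) (rear i (front l x))"
  let ?UB = "\<lambda>l. cut_sum (\<lambda>bs' \<gamma>'. ub l bs' \<gamma>') (rear l x) :: ('a, 'r) walg"
  let ?UV = "\<lambda>l. cut_sum (\<lambda>bs' \<gamma>'. uv l bs' \<gamma>') (rear l x) :: ('a, 'r) walg"
  let ?R = "\<lambda>l i. cut_sum (\<lambda>bs \<gamma>. cut_sum (\<lambda>bs' \<gamma>'. sg (?k * Suc i) (bd [hd x, x ! i] * (ut (l - i) (?k - i) bs \<gamma> bs' \<gamma>' * Sb (front i x)))) (rear l x)) (rear i (front l x)) :: ('a, 'r) walg"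
  have "pd (U x) = (\<Sum>l\<in>{1..<?k}. cut_sum (?p l) (front l x))"
    unfolding U_def lin_sum[OF lin_pd] cut_sum_lin[OF lin_pd] ..
  also have "\<dots> = (\<Sum>l\<in>{1..<?k}. ?A l + (\<Sum>i\<in>{1..<l}. ?B l i))"
    using lx by (intro sum.cong refl, subst cut_sum.simps) (simp add: sdim_front hd_front last_front)
  finally have 1: "pd (U x) = (\<Sum>l\<in>{1..<?k}. ?A l + (\<Sum>i\<in>{1..<l}. ?B l i))" .
  have A: "lk c b (?A l - (?UB l - ?UV l))" if "l \<in> {1..<?k}" for l
    unfolding cut_sum_diff[symmetric] by (rule lk_cut_sum) (rule pd_ut_base[OF that])
  have B: "lk c b (?B l i - ?R l i)" if "l \<in> {1..<?k}" "i \<in> {1..<l}" for l i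
    unfolding cut_sum_sg[symmetric] by (intro lk_cut_sum_diff) (rule pd_ut_step[OF that])
  have 2: "lk c b ((\<Sum>l\<in>{1..<?k}. ?A l + (\<Sum>i\<in>{1..<l}. ?B l i)) - (\<Sum>l\<in>{1..<?k}. (?UB l - ?UV l) + (\<Sum>i\<in>{1..<l}. ?R l i)))"
    by (intro lk_sum_diff, subst add_diff_add, intro lk_add lk_sum_diff A B)
  have 3: "(\<Sum>l\<in>{1..<?k}. ?UB l - ?UV l) = bd [hd x, last x] * Sb x - ?UV 1"
  proof -
    obtain m where m: "?k = Suc (Suc m)" using k by (metis add_2_eq_Suc le_Suc_ex)
    have "(\<Sum>l\<in>{1..<Suc n}. ?UB l) = (\<Sum>l\<in>{1..<Suc n}. ?UV (Suc l))" if "n \<le> m" for n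
      by (intro sum.cong refl, subst cut_sum_ub) (use that m in auto)
    from this[of m] have "(\<Sum>l\<in>{1..<?k}. ?UB l) = bd [hd x, last x] * Sb x + (\<Sum>l\<in>{1..<Suc m}. ?UV (Suc l))"
      using cut_sum_ub[of "Suc m"] by (simp add: m)
    moreover have "(\<Sum>l\<in>{1..<?k}. ?UV l) = ?UV 1 + (\<Sum>l\<in>{1..<Suc m}. ?UV (Suc l))"
      unfolding m by (rule sum_from_1) simp
    ultimately show ?thesis by (simp only: sum_subtractf) simp
  qed
  have 4: "(\<Sum>l\<in>{1..<?k}. \<Sum>i\<in>{1..<l}. ?R l i) = (\<Sum>i\<in>{1..<?k}. sg (?k * Suc i) (bd [hd x, x ! i] * (U (rear i x) * Sb (front i x))))"
  proof -
    have "(\<Sum>l\<in>{1..<?k}. \<Sum>i\<in>{1..<l}. ?R l i) = (\<Sum>i\<in>{1..<?k}. \<Sum>l\<in>{1..<?k-i}. ?R (i + l) i)"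
      by (rule sum_upper_triangle[of "\<lambda>i l. ?R l i", symmetric])
    also have "\<dots> = (\<Sum>i\<in>{1..<?k}. sg (?k * Suc i) (bd [hd x, x ! i] * (U (rear i x) * Sb (front i x))))"
    proof (intro sum.cong refl)
      fix i assume i: "i \<in> {1..<?k}"
      have "?R (i + l) i = sg (?k * Suc i) (bd [hd x, x ! i] * (cut_sum (\<lambda>bs \<gamma>. cut_sum (ut l (?k - i) bs \<gamma>) (rear l (rear i x))) (front l (rear i x)) * Sb (front i x)))" for l
        by (simp add: cut_sum_sg cut_sum_mult_left cut_sum_mult_right rear_rear rear_front add.commute[of l i])
      then show "(\<Sum>l\<in>{1..<?k-i}. ?R (i + l) i) = sg (?k * Suc i) (bd [hd x, x ! i] * (U (rear i x) * Sb (front i x)))"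
        by (simp only: U_def sdim_rear sum_distrib_left sum_distrib_right sg_sum)
    qed
    finally show ?thesis .
  qed
  have 5: "(\<Sum>l\<in>{1..<?k}. (?UB l - ?UV l) + (\<Sum>i\<in>{1..<l}. ?R l i)) = (bd [hd x, last x] * Sb x +
    (\<Sum>i\<in>{1..<?k}. sg (?k * Suc i) (bd [hd x, x ! i] * (U (rear i x) * Sb (front i x))))) - ?UV 1"
    unfolding sum.distrib 3 4 by simp
  show ?thesis
    using lk_diff[OF 2[folded 1, unfolded 5] uv_first[OF k]] by simp
qed

end

section \<open>The map \<open>\<chi>\<close> in terms of cut sums\<close>

lemma nabla0_cut:
  fixes F :: "'a path \<times> 'a path \<Rightarrow> ('c \<Rightarrow>\<^sub>0 'r::comm_ring_1)"
  assumes "2 \<le> length x"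
  shows "lin_ext F (nabla0 x) = cut_sum (\<lambda>bs \<gamma>. F (seq bs, seq [\<gamma>])) x"
proof -
  have "nabla0 x = (cut_sum (\<lambda>bs \<gamma>. basis (seq bs, seq [\<gamma>])) x :: _ \<Rightarrow>\<^sub>0 'r)"
    by (simp add: nabla0_def Let_def scale_sign sum_cuts_all[OF assms, symmetric])
  then show ?thesis by (simp add: cut_sum_lin[OF lin_lin_ext])
qed

lemma cuts_snoc: "cuts x (j # js @ [l]) = cuts x (j # js) @ [pick x [last (j # js)..<Suc l]]"
  by (induction js arbitrary: j) auto

lemma pick_append: "pick x (as @ bs) = pick x as @ pick x bs"
  by (simp add: pick_def)

text \<open>The two index sequences on either side of \<open>l\<close> are a cut of the front and a
  cut of the rear at \<open>l\<close>, and the first two parts of the sign exponent are those of the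
  two cuts.\<close>

lemma nabla1_cut:
  "nabla1 x = (\<Sum>l\<in>{1..<sdim x}. cut_sum (\<lambda>bs \<gamma>. cut_sum (\<lambda>bs' \<gamma>'. sg ((sdim \<gamma> - 1 + l) * (sdim \<gamma>' - 1 + sdim x))
     (basis (seq ((butlast \<gamma> @ hd bs') # tl bs'), seq (butlast bs @ [last bs @ tl \<gamma>']))))
     (rear l x)) (front l x))"
  unfolding nabla1_def Let_def
proof (intro sum.cong refl)
  fix l assume l: "l \<in> {1..<sdim x}"
  let ?k = "sdim x"
  let ?t = "\<lambda>bs \<gamma> bs' \<gamma>'. sg ((sdim \<gamma> - 1 + l) * (sdim \<gamma>' - 1 + ?k))
     (basis (seq ((butlast \<gamma> @ hd bs') # tl bs'), seq (butlast bs @ [last bs @ tl \<gamma>'])) :: _ \<Rightarrow>\<^sub>0 'b)"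
  have lk: "?k < length x" "l < length x" "l < ?k" "0 < l" using l by (auto simp: sdim_def)
  have r: "front (?k - l) (rear l x) = rear l x" "front (l - 0) (rear 0 x) = front l x"
    using lk by (auto simp: front_def rear_def sdim_def)
  have "(\<Sum>ps\<in>increasing_between 0 l. \<Sum>js\<in>increasing_between l ?k.
       scale ((-1) ^ (cut_sign (0 # ps @ [l]) + cut_sign (l # js @ [?k]) + (length ps + l) * (length js + ?k)))
         (basis (seq (pick x (0 # ps @ [l..<Suc (hd (js @ [?k]))]) # cuts x (js @ [?k])),
            seq (cuts x (0 # ps) @ [pick x ([last (0 # ps)..<Suc l] @ js @ [?k])]))))
    = (\<Sum>ps\<in>increasing_between 0 l. sg (cut_sign (0 # ps @ [l])) (\<Sum>js\<in>increasing_between l ?k. sg (cut_sign (l # js @ [?k]))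
        (?t (cuts x (0 # ps @ [l])) (pick x (0 # ps @ [l])) (cuts x (l # js @ [?k])) (pick x (l # js @ [?k])))))"
    unfolding sg_sum
  proof (intro sum.cong refl)
    fix ps js
    have 1: "butlast (pick x (0 # ps @ [l])) @ hd (cuts x (l # js @ [?k])) = pick x (0 # ps @ [l..<Suc (hd (js @ [?k]))])"
      "tl (cuts x (l # js @ [?k])) = cuts x (js @ [?k])"
      by (cases js; simp add: pick_def butlast_append)+
    have 2: "butlast (cuts x (0 # ps @ [l])) = cuts x (0 # ps)"
      "last (cuts x (0 # ps @ [l])) = pick x [last (0 # ps)..<Suc l]"
      by (simp_all only: cuts_snoc butlast_snoc last_snoc)
    have 3: "tl (pick x (l # js @ [?k])) = pick x (js @ [?k])"
      "sdim (pick x (0 # ps @ [l])) - 1 = length ps" "sdim (pick x (l # js @ [?k])) - 1 = length js"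
      by (simp_all add: pick_def sdim_def One_nat_def)
    show "scale ((-1) ^ (cut_sign (0 # ps @ [l]) + cut_sign (l # js @ [?k]) + (length ps + l) * (length js + ?k)))
         (basis (seq (pick x (0 # ps @ [l..<Suc (hd (js @ [?k]))]) # cuts x (js @ [?k])),
            seq (cuts x (0 # ps) @ [pick x ([last (0 # ps)..<Suc l] @ js @ [?k])])))
      = sg (cut_sign (0 # ps @ [l])) (sg (cut_sign (l # js @ [?k]))
        (?t (cuts x (0 # ps @ [l])) (pick x (0 # ps @ [l])) (cuts x (l # js @ [?k])) (pick x (l # js @ [?k]))))"
      by (simp only: 1 2 3 scale_sign sg_sg pick_append add.assoc)
  qed
  also have "\<dots> = cut_sum (\<lambda>bs \<gamma>. cut_sum (?t bs \<gamma>) (rear l x)) (front l x)"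
  proof -
    have inner: "(\<Sum>js\<in>increasing_between l ?k. sg (cut_sign (l # js @ [?k])) (?t bs \<gamma> (cuts x (l # js @ [?k])) (pick x (l # js @ [?k]))))
      = cut_sum (?t bs \<gamma>) (rear l x)" for bs \<gamma>
      by (rule sum_cuts[OF lk(1,3), of "?t bs \<gamma>", unfolded r(1)])
    show ?thesis
      unfolding inner by (rule sum_cuts[OF lk(2,4), of "\<lambda>bs \<gamma>. cut_sum (?t bs \<gamma>) (rear l x)", unfolded r(2)])
  qed
  finally show "(\<Sum>ps\<in>increasing_between 0 l. \<Sum>js\<in>increasing_between l ?k.
       scale ((-1) ^ (cut_sign (0 # ps @ [l]) + cut_sign (l # js @ [?k]) + (length ps + l) * (length js + ?k)))
         (basis (seq (pick x (0 # ps @ [l..<Suc (hd (js @ [?k]))]) # cuts x (js @ [?k])),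
            seq (cuts x (0 # ps) @ [pick x ([last (0 # ps)..<Suc l] @ js @ [?k])]))))
    = cut_sum (\<lambda>bs \<gamma>. cut_sum (?t bs \<gamma>) (rear l x)) (front l x)" .
qed

lemma nabla1_antipode:
  fixes x :: "'a::linorder list" and h :: "('a path \<Rightarrow>\<^sub>0 'r::comm_ring_1) \<Rightarrow> ('c \<Rightarrow>\<^sub>0 'r)"
  assumes x: "sorted_wrt (<) x" and h: "lin h"
  shows "lin_ext (\<lambda>(p, q). h (pmul (basis p) (antipode q))) (nabla1 x) = h (pa (hd x) (U x))"
  unfolding nabla1_cut U_def lin_sum[OF lin_lin_ext] lin_sum[OF lin_pa] lin_sum[OF h]
proof (intro sum.cong refl)
  fix l assume l: "l \<in> {1..<sdim x}"
  show "lin_ext (\<lambda>(p, q). h (pmul (basis p) (antipode q))) (cut_sum (\<lambda>bs \<gamma>. cut_sum (\<lambda>bs' \<gamma>'. sg ((sdim \<gamma> - 1 + l) * (sdim \<gamma>' - 1 + sdim x))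
     (basis (seq ((butlast \<gamma> @ hd bs') # tl bs'), seq (butlast bs @ [last bs @ tl \<gamma>'])))) (rear l x)) (front l x))
    = h (pa (hd x) (cut_sum (\<lambda>bs \<gamma>. cut_sum (ut l (sdim x) bs \<gamma>) (rear l x)) (front l x)))"
    unfolding cut_sum_lin[OF lin_lin_ext] cut_sum_lin[OF lin_pa] cut_sum_lin[OF h]
  proof (intro cut_sum_cong)
    fix bs \<gamma> bs' \<gamma>' assume c: "cut_of (front l x) bs \<gamma>" "cut_of (rear l x) bs' \<gamma>'"
    let ?P = "(butlast \<gamma> @ hd bs') # tl bs'" and ?Q = "butlast bs @ [last bs @ tl \<gamma>']"
    note p = cut_pair[OF x l c]
    have 1: "basis (seq ?P) = (pa (hd x) (wd ?P) :: 'a path \<Rightarrow>\<^sub>0 'r)"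
      by (rule basis_seq_faces[OF p(1)]) simp
    have 2: "antipode (seq ?Q) = (pa (last x) (Sl ?Q) :: 'a path \<Rightarrow>\<^sub>0 'r)"
      by (rule antipode_seq[OF p(2)]) simp
    have "(wd ?P :: ('a, 'r) walg) \<in> PA (beads (full x)) (hd x) (last x) (bdeg ?P)"
      by (rule PA_wd[OF wpath_mono[OF p(1) faces_of_beads[OF subset_refl]] refl])
    then have 3: "pmul (basis (seq ?P)) (antipode (seq ?Q)) = (pa (hd x) (wd ?P * Sl ?Q) :: 'a path \<Rightarrow>\<^sub>0 'r)"
      unfolding 1 2 by (rule pmul_pa)
    have 4: "ut l (sdim x) bs \<gamma> bs' \<gamma>' = sg ((sdim \<gamma> - 1 + l) * (sdim \<gamma>' - 1 + sdim x)) (wd ?P * Sl ?Q :: ('a, 'r) walg)"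
      by (simp only: ut_def wd_Cons[of _ "tl bs'"] mult.assoc)
    show "lin_ext (\<lambda>(p, q). h (pmul (basis p) (antipode q))) (sg ((sdim \<gamma> - 1 + l) * (sdim \<gamma>' - 1 + sdim x)) (basis (seq ?P, seq ?Q)))
      = h (pa (hd x) (ut l (sdim x) bs \<gamma> bs' \<gamma>'))"
      unfolding 4 lin_sg[OF lin_lin_ext] lin_sg[OF lin_pa] lin_sg[OF h] by (simp only: lin_ext_basis prod.case 3)
  qed
qed

text \<open>The first and the third term of \<open>\<chi>\<close>; the second one is \<open>nk (U c) [hd c]\<close>.\<close>

definition chi1 :: "'a list \<Rightarrow> ('a necklace \<Rightarrow>\<^sub>0 'r::comm_ring_1)" where
  "chi1 x = cut_sum (\<lambda>bs \<gamma>. sg (bdeg bs) (nk (Sl bs) \<gamma>)) x"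

definition chi3 :: "'a list \<Rightarrow> nat \<Rightarrow> ('a necklace \<Rightarrow>\<^sub>0 'r::comm_ring_1)" where
  "chi3 x j = cut_sum (\<lambda>bs \<gamma>. sg (j * (sdim x - j) + bdeg bs) (nk (U (rear j x) * Sl bs) \<gamma>)) (front j x)"

lemma chi_map_basis:
  fixes c :: "'a::linorder list"
  assumes c: "sorted_wrt (<) c" and k: "0 < sdim c"
  shows "chi_map (basis c) = chi1 c + nk (U c) [hd c] + (\<Sum>j\<in>{1..<sdim c}. chi3 c j :: 'a necklace \<Rightarrow>\<^sub>0 'r::comm_ring_1)"
proof -
  have lc: "2 \<le> length c" "length c = Suc (sdim c)" using k by (auto simp: sdim_def)
  have 1: "lin_ext (\<lambda>(p, q). scale ((-1) ^ pdeg p) (neck (antipode p) (hd (snd q)))) (nabla0 c) = (chi1 c :: 'a necklace \<Rightarrow>\<^sub>0 'r)"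
    unfolding nabla0_cut[OF lc(1)] chi1_def
  proof (rule cut_sum_cong)
    fix bs \<gamma> assume cut: "cut_of c bs \<gamma>"
    note l = cut_of_lengths[OF cut lc(1)]
    have "wpath (faces_of c) (hd c) bs (last \<gamma>)" using cut_of_sorted[OF cut lc(1) c] l(5) by simp
    then have "antipode (seq bs) = (pa (last \<gamma>) (Sl bs) :: 'a path \<Rightarrow>\<^sub>0 'r)" using l(2) by (rule antipode_seq)
    then show "(case (seq bs, seq [\<gamma>]) of (p, q) \<Rightarrow> scale ((-1) ^ pdeg p) (neck (antipode p) (hd (snd q)))) = (sg (bdeg bs) (nk (Sl bs) \<gamma>) :: 'a necklace \<Rightarrow>\<^sub>0 'r)"
      by (simp add: seq_def[of "[\<gamma>]"] neck_pa scale_sign) (simp add: seq_def pdeg_def)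
  qed
  have 2: "lin_ext (\<lambda>(p, q). neck (pmul (basis p) (antipode q)) [hd c]) (nabla1 c) = (nk (U c) [hd c] :: 'a necklace \<Rightarrow>\<^sub>0 'r)"
    unfolding nabla1_antipode[OF c lin_neck] using neck_pa[of "[hd c]"] by simp
  have 3: "lin_ext (\<lambda>(p, q). lin_ext (\<lambda>(u, v).
                scale ((-1) ^ (sdim (front j c) * sdim (rear j c) + pdeg p))
                  (neck (pmul (pmul (basis u) (antipode v)) (antipode p)) (hd (snd q))))
              (nabla1 (rear j c))) (nabla0 (front j c)) = (chi3 c j :: 'a necklace \<Rightarrow>\<^sub>0 'r)" if j: "j \<in> {1..<sdim c}" for j
  proof -
    have lr: "2 \<le> length (front j c)" using j by (simp add: length_front_rear)
    have e: "sdim (front j c) = j" "sdim (rear j c) = sdim c - j" "hd (rear j c) = c ! j" "last (front j c) = c ! j"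
      using j lc by (auto simp: sdim_front sdim_rear hd_rear last_front)
    show ?thesis
      unfolding nabla0_cut[OF lr] chi3_def
    proof (rule cut_sum_cong)
      fix bs \<gamma> assume cut: "cut_of (front j c) bs \<gamma>"
      note l = cut_of_lengths[OF cut lr, unfolded e]
      let ?h = "\<lambda>z. scale ((-1) ^ (sdim (front j c) * sdim (rear j c) + pdeg (seq bs))) (neck (pmul z (antipode (seq bs))) \<gamma>) :: 'a necklace \<Rightarrow>\<^sub>0 'r"
      have h: "lin ?h" by (rule lin_scaled, rule lin_compose[OF lin_neck lin_pmul_left])
      have w: "wpath (faces_of (front j c)) (hd (front j c)) bs (last \<gamma>)"
        using cut_of_sorted[OF cut lr sorted_front[OF c]] l(5) e(4) by simp
      have a: "antipode (seq bs) = (pa (last \<gamma>) (Sl bs) :: 'a path \<Rightarrow>\<^sub>0 'r)" using w l(2) by (rule antipode_seq)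
      have "(U (rear j c) :: ('a, 'r) walg) \<in> PA (beads (full (rear j c))) (last \<gamma>) (last \<gamma>) (sdim c - j)"
        using PA_U[OF sorted_rear[OF c] subset_refl, of _ j, where 'r = 'r] unfolding e l(5) by simp
      then have m: "pmul (pa (last \<gamma>) (U (rear j c))) (antipode (seq bs)) = (pa (last \<gamma>) (U (rear j c) * Sl bs) :: 'a path \<Rightarrow>\<^sub>0 'r)"
        unfolding a by (rule pmul_pa)
      have "lin_ext (\<lambda>(u, v). ?h (pmul (basis u) (antipode v))) (nabla1 (rear j c)) = ?h (pa (last \<gamma>) (U (rear j c)))"
        using nabla1_antipode[OF sorted_rear[OF c] h, of j] e(3) l(5) by (simp only:)
      also have "\<dots> = sg (j * (sdim c - j) + bdeg bs) (nk (U (rear j c) * Sl bs) \<gamma>)"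
        unfolding m neck_pa scale_sign e by (simp add: seq_def pdeg_def)
      finally show "(case (seq bs, seq [\<gamma>]) of (p, q) \<Rightarrow> lin_ext (\<lambda>(u, v).
                scale ((-1) ^ (sdim (front j c) * sdim (rear j c) + pdeg p))
                  (neck (pmul (pmul (basis u) (antipode v)) (antipode p)) (hd (snd q))))
              (nabla1 (rear j c))) = (sg (j * (sdim c - j) + bdeg bs) (nk (U (rear j c) * Sl bs) \<gamma>) :: 'a necklace \<Rightarrow>\<^sub>0 'r)"
        by (simp add: seq_def[of "[\<gamma>]"])
    qed
  qed
  have J: "{j. j \<le> sdim c \<and> sdim (front j c) > 0 \<and> sdim (rear j c) > 0} = {1..<sdim c}"
    using lc by (auto simp: sdim_rear sdim_front)
  show ?thesis
    using k unfolding chi_map_def lin_ext_basis J 1 2 by (simp add: 3)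
qed

section \<open>Consecutive faces\<close>

text \<open>Faces on consecutive vertices of \<open>c\<close>, ending at position \<open>b\<close>
  at the latest. The contraction based at \<open>b\<close> vanishes on them; for this the tree joins
  earlier vertices to their successors.\<close>

definition segment :: "'a list \<Rightarrow> nat \<Rightarrow> 'a list \<Rightarrow> bool" where
  "segment c b y \<longleftrightarrow> (\<exists>i m. y = front m (rear i c) \<and> 0 < m \<and> i + m \<le> b)"

lemma segment_cut:
  "cut_of x bs \<gamma> \<Longrightarrow> x = front m (rear i c) \<Longrightarrow> i + m \<le> b \<Longrightarrow> b < length c \<Longrightarrow> 0 < m \<Longrightarrow> \<forall>y\<in>set bs. segment c b y"
proof (induction arbitrary: i m rule: cut_of.induct)
  case (whole x)
  then show ?case by (auto simp: segment_def)
next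
  case (first j x bs \<gamma>)
  have m: "sdim x = m" unfolding first.prems(1) using first.prems by (intro sdim_front) (simp add: length_rear)
  have rj: "rear j x = front (m - j) (rear (i + j) c)"
    using first m by (simp add: rear_front rear_rear add.commute[of j i])
  have "\<forall>y\<in>set bs. segment c b y"
    by (rule first.IH[OF rj]) (use first(1,2,6,7) m in auto)
  moreover have "front j x = front j (rear i c)" using first m by (simp add: front_front)
  then have "segment c b (front j x)"
    unfolding segment_def using first(1,2,6) m by (intro exI[of _ i] exI[of _ j]) simp
  ultimately show ?case by simp
qed

lemma aug_wd: "aug (wd bs) = (if bdeg bs = 0 then 1 else 0)"
  by (simp add: wd_def aug_def wdeg_word del: sum_list_eq_0_iff)

lemma segment_simps:
  assumes "segment c b y" "b < length c"
  shows "2 \<le> length y" "set y \<subseteq> set c"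
  using assms set_front set_rear by (fastforce simp: segment_def length_front length_rear)+

lemma segment_faces:
  assumes "segment c b y" "b < length c" "j \<in> {1..<sdim y}"
  shows "segment c b (front j y)" "segment c b (rear j y)"
proof -
  obtain i m where y: "y = front m (rear i c)" "0 < m" "i + m \<le> b" using assms(1) by (auto simp: segment_def)
  have m: "sdim y = m" using y assms(2) by (simp add: sdim_front length_rear)
  have "front j y = front j (rear i c)" "rear j y = front (m - j) (rear (i + j) c)"
    using y m assms(3) by (auto simp: front_front rear_front rear_rear add.commute[of j i])
  then show "segment c b (front j y)" "segment c b (rear j y)"
    using y m assms(3) unfolding segment_def by (metis atLeastLessThan_iff le_trans add_le_cancel_left less_imp_le one_le_iff,
      intro exI[of _ "i + j"] exI[of _ "m - j"], auto)
qed

context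
  fixes c :: "'a::linorder list" and b :: nat
  assumes c: "sorted_wrt (<) c" and b: "b < length c"
begin

lemma segment_sorted: "segment c b y \<Longrightarrow> sorted_wrt (<) y"
  using c by (auto simp: segment_def intro: sorted_front sorted_rear)

text \<open>The second vertex is the successor of the first, so \<open>fill\<close> stops at once
  with 0.\<close>

lemma ctr_segment:
  assumes "segment c b y"
  shows "ctr c b (bd y) = (0 :: ('a, 'r::comm_ring_1) walg)"
proof -
  obtain i m where y: "y = front m (rear i c)" "0 < m" "i + m \<le> b" using assms by (auto simp: segment_def)
  obtain m' where m': "m = Suc m'" using y(2) by (cases m) auto
  have "rear i c = c ! i # c ! Suc i # drop (Suc (Suc i)) c"
    using y b by (simp add: rear_def Cons_nth_drop_Suc)
  then have e: "y = c ! i # c ! Suc i # take m' (drop (Suc (Suc i)) c)"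
    by (simp add: y(1) front_def m')
  then show ?thesis
    using segment_sorted[OF assms] y b c unfolding e
    by (subst ctr_simplex) (auto simp: pos_nth fill.simps[of c b i])
qed

lemma ctr_segment_wd: "\<forall>y\<in>set bs. segment c b y \<Longrightarrow> ctr c b (wd bs) = (0 :: ('a, 'r::comm_ring_1) walg)"
proof (induction bs)
  case (Cons y bs)
  then show ?case by (subst wd_Cons) (simp add: ker_mult ctr_segment)
qed simp

lemma ctr_segment_Sb:
  assumes y: "segment c b y"
  shows "ctr c b (Sb y) = (0 :: ('a, 'r::comm_ring_1) walg)"
proof -
  note s = segment_sorted[OF y] and l = segment_simps(1)[OF y b]
  show ?thesis
  proof (cases "length y = 2")
    case True
    then obtain u v where uv: "y = [u, v]" by (cases y; cases "tl y") (auto simp: numeral_2_eq_2)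
    then show ?thesis using ctr_segment[OF y, where 'r = 'r] s by (simp add: Sb_edge ctr_edge_rev)
  next
    case False
    obtain i m where im: "y = front m (rear i c)" "0 < m" "i + m \<le> b" using y by (auto simp: segment_def)
    have "0 = ctr c b (cut_antipode y :: ('a, 'r) walg)"
      using cut_antipode[OF s l, where 'r = 'r] False by (simp add: lin_zero[OF lin_ctr])
    also have "\<dots> = cut_sum (\<lambda>bs \<gamma>. aug (wd bs) * ctr c b (Sb \<gamma>)) y"
      unfolding cut_antipode_def cut_sum_lin[OF lin_ctr]
      by (rule cut_sum_cong) (simp add: ctr_mult ctr_segment_wd[OF segment_cut[OF _ im(1) im(3) b im(2)]])
    also have "\<dots> = ctr c b (Sb y)"
      by (subst cut_sum_top[OF _ l]) (auto simp: aug_wd bdeg_edges dest: cut_of_lengths(3)[OF _ l] simp del: sum_list_eq_0_iff)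
    finally show ?thesis ..
  qed
qed

lemma ctr_segment_Sl: "\<forall>y\<in>set bs. segment c b y \<Longrightarrow> ctr c b (Sl bs) = (0 :: ('a, 'r::comm_ring_1) walg)"
  by (induction bs) (simp_all add: lin_sg[OF lin_ctr] ker_mult ctr_segment_Sb)

lemma ctr_segment_dSl:
  "\<forall>y\<in>set bs. segment c b y \<Longrightarrow> (\<And>y. segment c b y \<Longrightarrow> ctr c b (g y) = 0) \<Longrightarrow> ctr c b (dSl g bs) = (0 :: ('a, 'r::comm_ring_1) walg)"
  by (induction bs)
    (simp_all add: lin_zero[OF lin_ctr] lin_sg[OF lin_ctr] lin_add[OF lin_ctr] ker_mult ctr_segment_Sb ctr_segment_Sl)

lemma ctr_segment_dSb:
  assumes y: "segment c b y"
  shows "ctr c b (\<Sum>j\<in>{1..<sdim y}. sg (n j) (Sb (rear j y) * Sb (front j y))) = (0 :: ('a, 'r::comm_ring_1) walg)"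
  unfolding lin_sum[OF lin_ctr] lin_sg[OF lin_ctr]
  by (intro sum.neutral ballI) (simp add: ker_mult ctr_segment_Sb segment_faces[OF y b])

end

section \<open>The map \<open>\<chi>\<close> is a chain map\<close>

text \<open>\<open>aw Q q s bs \<gamma>\<close> collects, up to the sign \<open>s\<close>, the terms \<open>(c''|\<alpha>)c'\<close> of the differential of
  \<open>(\<alpha>)\<gamma>\<close>, where \<open>\<alpha>\<close> is \<open>Q\<close> followed by the antipode of \<open>bs\<close>, and \<open>q = |Q|\<close>.\<close>

definition aw :: "('a, 'r::comm_ring_1) walg \<Rightarrow> nat \<Rightarrow> nat \<Rightarrow> 'a list list \<Rightarrow> 'a list \<Rightarrow> ('a necklace \<Rightarrow>\<^sub>0 'r)" where
  "aw Q q s bs \<gamma> = sg (s + bdeg bs) (\<Sum>r<sdim \<gamma>. sg ((q + bdeg bs + r) * (sdim \<gamma> - r))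
     (nk (bd (rear r \<gamma>) * (Q * Sl bs)) (front r \<gamma>)))"

text \<open>The representative of \<open>pd (U x)\<close> modulo the right ideal, as computed in
  \<open>pd_U\<close>.\<close>

definition RU :: "'a list \<Rightarrow> ('a, 'r::comm_ring_1) walg" where
  "RU x = bd [hd x, last x] * Sb x +
    (\<Sum>i\<in>{1..<sdim x}. sg (sdim x * Suc i) (bd [hd x, x ! i] * (U (rear i x) * Sb (front i x))))"

lemma ab_cancel: "p + a + b - t - (p - t) = a + (b :: 'm::ab_group_add)"
  by (simp add: algebra_simps)

lemma wpath_set: "wpath B a bs z \<Longrightarrow> set bs \<subseteq> B"
  by (induction bs arbitrary: a) auto

lemma cut_of_top:
  fixes x :: "'a::linorder list"
  assumes "cut_of x bs \<gamma>" "2 \<le> length x" "sorted_wrt (<) x" "bdeg bs = 0"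
  shows "\<gamma> = x"
proof -
  note l = cut_of_lengths[OF assms(1,2)] and s = cut_of_sorted[OF assms(1-3)]
  have "length \<gamma> = Suc (sdim \<gamma>)" using l(1) by (simp add: sdim_def)
  then have "length \<gamma> = length x" using l(3) assms(4) sdim_Suc[OF assms(2)] by linarith
  moreover have "card (set \<gamma>) = length \<gamma>" "card (set x) = length x"
    using s assms(3) by (auto simp: strict_sorted_iff distinct_card)
  ultimately have "set \<gamma> = set x" using s by (intro card_subset_eq) auto
  then show ?thesis using s assms(3) by (intro sorted_distinct_set_unique) (auto simp: strict_sorted_iff)
qed

context
  fixes c :: "'a::linorder list" and k :: nat
  assumes c: "sorted_wrt (<) c" and lc: "length c = Suc k" and k: "0 < k"
begin

text \<open>The base is the last vertex of the marked bead, where the word of the necklace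
  starts.\<close>

private abbreviation "K z \<equiv> kz c (\<lambda>e. pos c (last e)) z"

lemma ends: "c \<noteq> []" "hd c = c ! 0" "last c = c ! k"
proof -
  show "c \<noteq> []" using lc by auto
  then show "hd c = c ! 0" "last c = c ! k" by (simp_all add: hd_conv_nth last_conv_nth lc)
qed

lemma K_nk: "last e = c ! i \<Longrightarrow> i \<le> k \<Longrightarrow> ctr c i x = 0 \<Longrightarrow> K (nk x e)"
  by (rule kz_nk) (simp add: pos_nth[OF c] lc)

lemma K_nk_lk: "last e = c ! i \<Longrightarrow> i \<le> k \<Longrightarrow> lk c i x \<Longrightarrow> K (nk x e)"
  by (rule K_nk) (auto simp: lk_def)

lemma K_cut_sum: "(\<And>bs \<gamma>. cut_of x bs \<gamma> \<Longrightarrow> K (f bs \<gamma>)) \<Longrightarrow> K (cut_sum f x)"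
  by (rule cut_sum_closed[of "\<lambda>z. K z"]) (auto intro: kz_add kz_uminus kz_zero)

lemma K_cut_sum_diff: "(\<And>bs \<gamma>. cut_of x bs \<gamma> \<Longrightarrow> K (f bs \<gamma> - g bs \<gamma>)) \<Longrightarrow> K (cut_sum f x - cut_sum g x)"
  unfolding cut_sum_diff[symmetric] by (rule K_cut_sum)

lemma K_sum_diff: "(\<And>i. i \<in> I \<Longrightarrow> K (f i - g i)) \<Longrightarrow> K (sum f I - sum g I)"
  unfolding sum_subtractf[symmetric] by (rule kz_sum)

lemma K_trans: "K (x - y) \<Longrightarrow> K (y - z) \<Longrightarrow> K (x - z)"
  using kz_add[of c _ "x - y" "y - z"] by simp

lemma K_add_diff: "K (x - y) \<Longrightarrow> K (x' - y') \<Longrightarrow> K (x + x' - (y + y'))"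
  using kz_add[of c _ "x - y" "x' - y'"] by (simp add: algebra_simps)

lemma K_diff_diff: "K (x - y) \<Longrightarrow> K (x' - y') \<Longrightarrow> K (x - x' - (y - y'))"
  using kz_diff[of c _ "x - y" "x' - y'"] by (simp add: algebra_simps)

text \<open>The trivial cut is the only one whose second factor is an edge.\<close>

lemma K_whole:
  assumes "\<And>bs \<gamma>. 3 \<le> length \<gamma> \<Longrightarrow> hd \<gamma> = hd x \<Longrightarrow> K (f bs \<gamma>)"
  shows "K (cut_sum f x - f [x] [hd x, last x])"
proof -
  have "K (\<Sum>j\<in>{1..<sdim x}. cut_sum (\<lambda>bs \<gamma>. sg (sdim x - j + sdim \<gamma>) (f (front j x # bs) (hd x # \<gamma>))) (rear j x))"
  proof (intro kz_sum K_cut_sum kz_sg assms)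
    fix j bs \<gamma> assume "j \<in> {1..<sdim x}" "cut_of (rear j x) bs \<gamma>"
    then have "length \<gamma> = Suc (length bs)" "bs \<noteq> []"
      using cut_of_lengths(1,2)[of "rear j x" bs \<gamma>] by (auto simp: length_front_rear)
    then show "3 \<le> length (hd x # \<gamma>)" by (cases bs) auto
  qed simp
  then show ?thesis by (subst cut_sum.simps) simp
qed

text \<open>A moved rear of dimension at least 2 leaves the base and is killed, so the rear must be
  an edge. If all of \<open>\<gamma>\<close> is moved, the cut is trivial. Otherwise
  \<open>cut_sum_marked_split\<close> separates the cuts of front and rear at a vertex
  \<open>l\<close>, and the cut of the rear has to be trivial.\<close>

lemma aw_sum:
  fixes Q :: "('a, 'r::comm_ring_1) walg"
  assumes j: "j \<in> {1..k}"
  shows "K (cut_sum (aw Q q s) (front j c) -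
    (sg (s + q) (nk (bd [hd c, c ! j] * (Q * Sb (front j c))) [hd c])
     + (\<Sum>l\<in>{1..<j}. cut_sum (\<lambda>bs \<gamma>. sg (s + q + l * (j - l) + bdeg bs)
          (nk (bd [c ! l, c ! j] * (Q * (Sb (rear l (front j c)) * Sl bs))) \<gamma>)) (front l c))))"
proof -
  let ?x = "front j c"
  have c0: "c \<noteq> []" "hd c = c ! 0" using ends by auto
  have x: "length ?x = Suc j" "hd ?x = hd c" "last ?x = c ! j" "sdim ?x = j" "2 \<le> length ?x"
    using j lc c0 by (auto simp: length_front hd_front last_front sdim_front)
  let ?E = "\<lambda>bs \<gamma>. sg (s + bdeg bs + (q + bdeg bs) * sdim \<gamma>) (nk (bd \<gamma> * (Q * Sl bs)) [hd \<gamma>])"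
  let ?F = "\<lambda>bs \<gamma> bs' \<gamma>'. sg (s + (bdeg bs + bdeg bs') + (q + (bdeg bs + bdeg bs') + sdim \<gamma>) * sdim \<gamma>' + bdeg bs * bdeg bs')
    (nk (bd \<gamma>' * (Q * (Sl bs' * Sl bs))) \<gamma>)"
  have "cut_sum (aw Q q s) ?x = cut_sum (\<lambda>bs \<gamma>. ?E bs \<gamma> + (\<Sum>r\<in>{1..<sdim \<gamma>}. ?F (take r bs) (front r \<gamma>) (drop r bs) (rear r \<gamma>))) ?x"
  proof (rule cut_sum_cong)
    fix bs \<gamma> assume cut: "cut_of ?x bs \<gamma>"
    note l = cut_of_lengths(1,2)[OF cut x(5)]
    have "0 < sdim \<gamma>" using l by (auto simp: sdim_def)
    then have i: "{..<sdim \<gamma>} = insert 0 {1..<sdim \<gamma>}" by auto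
    obtain g g' where g: "\<gamma> = g # g'" using l(1) by (cases \<gamma>) auto
    have 0: "rear 0 \<gamma> = \<gamma>" "front 0 \<gamma> = [hd \<gamma>]" by (simp_all add: g cons_simps)
    have b: "bdeg bs = bdeg (take r bs) + bdeg (drop r bs)" for r
      by (subst append_take_drop_id[of r bs, symmetric], simp only: map_append sum_list_append)
    have s: "Sl bs = sg (bdeg (take r bs) * bdeg (drop r bs)) (Sl (drop r bs) * Sl (take r bs) :: ('a, 'r) walg)" for r
      by (subst append_take_drop_id[of r bs, symmetric], rule Sl_append)
    have "sg (s + bdeg bs) (sg ((q + bdeg bs + r) * (sdim \<gamma> - r)) (nk (bd (rear r \<gamma>) * (Q * Sl bs)) (front r \<gamma>)))
      = ?F (take r bs) (front r \<gamma>) (drop r bs) (rear r \<gamma>)" if r: "r \<in> {1..<sdim \<gamma>}" for r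
    proof -
      have "sdim (front r \<gamma>) = r" "sdim (rear r \<gamma>) = sdim \<gamma> - r"
        using r by (auto simp: sdim_def front_def rear_def)
      then show ?thesis
        by (simp only: s[of r] b[of r] sg_mult_right nk_lin sg_sg add.assoc)
    qed
    then show "aw Q q s bs \<gamma> = ?E bs \<gamma> + (\<Sum>r\<in>{1..<sdim \<gamma>}. ?F (take r bs) (front r \<gamma>) (drop r bs) (rear r \<gamma>))"
      unfolding aw_def i by (subst sum.insert) (simp_all only: finite_atLeastLessThan 0 sg_add sg_sum sg_sg add_0_right diff_zero, simp_all)
  qed
  also have "\<dots> = cut_sum ?E ?x + cut_sum (\<lambda>bs \<gamma>. \<Sum>r\<in>{1..<sdim \<gamma>}. ?F (take r bs) (front r \<gamma>) (drop r bs) (rear r \<gamma>)) ?x"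
    by (rule cut_sum_add)
  also have "cut_sum (\<lambda>bs \<gamma>. \<Sum>r\<in>{1..<sdim \<gamma>}. ?F (take r bs) (front r \<gamma>) (drop r bs) (rear r \<gamma>)) ?x
    = (\<Sum>l\<in>{1..<j}. cut_sum (\<lambda>bs \<gamma>. cut_sum (\<lambda>bs' \<gamma>'. sg (sdim \<gamma> * (j - l + sdim \<gamma>')) (?F bs \<gamma> bs' \<gamma>')) (rear l ?x)) (front l ?x))"
    using cut_sum_marked_split[OF x(5), of ?F] unfolding x(4) .
  finally have S: "cut_sum (aw Q q s) ?x = cut_sum ?E ?x
    + (\<Sum>l\<in>{1..<j}. cut_sum (\<lambda>bs \<gamma>. cut_sum (\<lambda>bs' \<gamma>'. sg (sdim \<gamma> * (j - l + sdim \<gamma>')) (?F bs \<gamma> bs' \<gamma>')) (rear l ?x)) (front l ?x))" .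
  have E: "K (cut_sum ?E ?x - sg (s + q) (nk (bd [hd c, c ! j] * (Q * Sb ?x)) [hd c]))"
  proof -
    have "K (cut_sum ?E ?x - ?E [?x] [hd ?x, last ?x])"
    proof (intro K_whole kz_sg)
      fix bs and \<gamma> :: "'a list" assume "3 \<le> length \<gamma>" "hd \<gamma> = hd ?x"
      then show "K (nk (bd \<gamma> * (Q * Sl bs)) [hd \<gamma>])"
        using c0 x lc by (intro K_nk_lk[of _ 0] lk_mult lk_bead_hd[OF c]) auto
    qed
    moreover have "?E [?x] [hd ?x, last ?x] = sg (s + q) (nk (bd [hd c, c ! j] * (Q * Sb ?x)) [hd c])"
    proof -
      have b: "bdeg [?x] = j - 1" and sl: "Sl [?x] = (Sb ?x :: ('a, 'r) walg)" by (simp_all add: x(4))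
      have "even (s + (j - 1) + (q + (j - 1)) * 1) = even (s + q)"
        by (cases "even (j - 1)"; cases "even s"; cases "even q"; simp)
      then show ?thesis
        unfolding b sl x(2,3) sdim_pair list.sel by (rule sg_cong) (rule refl)
    qed
    ultimately show ?thesis by simp
  qed
  have F: "K (cut_sum (\<lambda>bs' \<gamma>'. sg (sdim \<gamma> * (j - l + sdim \<gamma>')) (?F bs \<gamma> bs' \<gamma>')) (rear l ?x)
    - sg (s + q + l * (j - l) + bdeg bs) (nk (bd [c ! l, c ! j] * (Q * (Sb (rear l ?x) * Sl bs))) \<gamma>))"
    if l: "l \<in> {1..<j}" and cut: "cut_of (front l c) bs \<gamma>" for l bs \<gamma>
  proof -
    have lr: "2 \<le> length (front l c)" "sdim (front l c) = l" "last (front l c) = c ! l" "hd (rear l ?x) = c ! l" "last (rear l ?x) = c ! j" "sdim (rear l ?x) = j - l"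
      using l j lc x by (auto simp: length_front sdim_front last_front hd_rear last_rear sdim_rear) (auto simp: front_def)
    note f = cut_of_lengths[OF cut lr(1), unfolded lr]
    let ?f = "\<lambda>bs' \<gamma>'. sg (sdim \<gamma> * (j - l + sdim \<gamma>')) (?F bs \<gamma> bs' \<gamma>')"
    have "K (cut_sum ?f (rear l ?x) - ?f [rear l ?x] [hd (rear l ?x), last (rear l ?x)])"
    proof (intro K_whole kz_sg)
      fix bs' and \<gamma>' :: "'a list" assume "3 \<le> length \<gamma>'" "hd \<gamma>' = hd (rear l ?x)"
      then show "K (nk (bd \<gamma>' * (Q * (Sl bs' * Sl bs))) \<gamma>)"
        using f l j lr(4) lc by (intro K_nk_lk[of _ l] lk_mult lk_bead_hd[OF c]) auto
    qed
    moreover have "?f [rear l ?x] [hd (rear l ?x), last (rear l ?x)]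
      = sg (s + q + l * (j - l) + bdeg bs) (nk (bd [c ! l, c ! j] * (Q * (Sb (rear l ?x) * Sl bs))) \<gamma>)"
    proof -
      obtain a where a: "j - l = Suc a" using l by (cases "j - l") auto
      have b: "bdeg [rear l ?x] = a" by (simp add: lr a)
      have s: "Sl [rear l ?x] = (Sb (rear l ?x) :: ('a, 'r) walg)" by simp
      have l': "l = bdeg bs + sdim \<gamma>" using f(3) by simp
      have "even (sdim \<gamma> * (j - l + 1) + (s + (bdeg bs + a) + (q + (bdeg bs + a) + sdim \<gamma>) * 1 + bdeg bs * a))
        = even (s + q + l * (j - l) + bdeg bs)"
        unfolding a by (subst l') (cases "even s"; cases "even q"; cases "even a"; cases "even (bdeg bs)"; cases "even (sdim \<gamma>)"; simp)
      then show ?thesis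
        unfolding s b lr sdim_pair sg_sg by (rule sg_cong) (rule refl)
    qed
    ultimately show ?thesis by simp
  qed
  have fx: "front l ?x = front l c" if "l \<in> {1..<j}" for l
    using that by (simp add: front_front)
  have "K ((\<Sum>l\<in>{1..<j}. cut_sum (\<lambda>bs \<gamma>. cut_sum (\<lambda>bs' \<gamma>'. sg (sdim \<gamma> * (j - l + sdim \<gamma>')) (?F bs \<gamma> bs' \<gamma>')) (rear l ?x)) (front l ?x))
    - (\<Sum>l\<in>{1..<j}. cut_sum (\<lambda>bs \<gamma>. sg (s + q + l * (j - l) + bdeg bs)
          (nk (bd [c ! l, c ! j] * (Q * (Sb (rear l (front j c)) * Sl bs))) \<gamma>)) (front l c)))"
    by (intro K_sum_diff, simp only: fx, intro K_cut_sum_diff F)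
  then show ?thesis unfolding S by (rule K_add_diff[OF E])
qed

text \<open>Omitting an inner vertex of the marked bead or moving a front keeps its last vertex,
  hence the base, and the assumptions \<open>z\<close> kill these terms. The differential of the
  word and the moved rears survive.\<close>

lemma D_term_K:
  fixes Q :: "('a, 'r::comm_ring_1) walg"
  assumes j: "j \<in> {1..k}" and cut: "cut_of (front j c) bs \<gamma>" and Q: "Q \<in> PA (beads (full c)) (c ! j) (c ! j) q"
    and z: "ctr c j (Q * Sl bs) = 0" "\<And>r. r \<in> {1..sdim \<gamma>} \<Longrightarrow> ctr c j (Q * Sl bs * bd (front r \<gamma>)) = 0"
  shows "K (sg (s + bdeg bs) (necklace_diff (nk (Q * Sl bs) \<gamma>)) - (sg (s + bdeg bs) (nk (pd (Q * Sl bs)) \<gamma>) - aw Q q s bs \<gamma>))"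
proof -
  have x: "2 \<le> length (front j c)" "hd (front j c) = hd c" "last (front j c) = c ! j" "sdim (front j c) = j" "c \<noteq> []"
    using j lc ends(1) by (auto simp: length_front hd_front last_front sdim_front)
  note l = cut_of_lengths[OF cut x(1), unfolded x]
  note t = cut_of_sorted[OF cut x(1) sorted_front[OF c], unfolded x]
  have g: "length \<gamma> = Suc (sdim \<gamma>)" "\<gamma> \<noteq> []" using l(1) by (auto simp: sdim_def)
  have sub: "set (front j c) \<subseteq> set c" by (rule set_front)
  have "set \<gamma> \<subseteq> set c" using t sub by blast
  then have S: "\<gamma> \<in> simplices (full c) (sdim \<gamma>)" using t g by (auto simp: simplices_iff full_def)
  have "(Sl bs :: ('a, 'r) walg) \<in> PA (beads (full c)) (last \<gamma>) (hd \<gamma>) (bdeg bs)"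
    using PA_Sl[OF sub, of "hd c" bs "c ! j", OF _ refl] t by (simp add: l)
  then have P: "Q * Sl bs \<in> PA (beads (full c)) (last \<gamma>) (hd \<gamma>) (q + bdeg bs)"
    using Q unfolding l by (rule PA_mult[rotated])
  have "necklace_diff (nk (Q * Sl bs) \<gamma>) = nk (pd (Q * Sl bs)) \<gamma>
    + sg (q + bdeg bs) (\<Sum>r\<in>{1..<sdim \<gamma>}. sg r (nk (Q * Sl bs) (omit r \<gamma>)))
    + sg (q + bdeg bs) (\<Sum>r\<in>{1..sdim \<gamma>}. nk (Q * Sl bs * bd (front r \<gamma>)) (rear r \<gamma>))
    - (\<Sum>r<sdim \<gamma>. sg ((q + bdeg bs + r) * (sdim \<gamma> - r)) (nk (bd (rear r \<gamma>) * (Q * Sl bs)) (front r \<gamma>)))"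
    by (rule D_nk[OF asc_full S P])
  then have e: "sg (s + bdeg bs) (necklace_diff (nk (Q * Sl bs) \<gamma>)) - (sg (s + bdeg bs) (nk (pd (Q * Sl bs)) \<gamma>) - aw Q q s bs \<gamma>)
    = sg (s + bdeg bs) (sg (q + bdeg bs) (\<Sum>r\<in>{1..<sdim \<gamma>}. sg r (nk (Q * Sl bs) (omit r \<gamma>)))
     + sg (q + bdeg bs) (\<Sum>r\<in>{1..sdim \<gamma>}. nk (Q * Sl bs * bd (front r \<gamma>)) (rear r \<gamma>)))"
    unfolding aw_def sg_diff[symmetric] by (simp only: ab_cancel)
  show ?thesis
    unfolding e
  proof (intro kz_sg kz_add kz_sum)
    fix r assume "r \<in> {1..<sdim \<gamma>}"
    then show "K (nk (Q * Sl bs) (omit r \<gamma>))"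
      using j z(1) g l by (intro K_nk[of _ j]) (auto simp: last_omit)
  next
    fix r assume r: "r \<in> {1..sdim \<gamma>}"
    then show "K (nk (Q * Sl bs * bd (front r \<gamma>)) (rear r \<gamma>))"
      using j z(2)[OF r] g l by (intro K_nk[of _ j]) (auto simp: last_rear)
  qed
qed

lemma cut_segments: "j \<in> {1..k} \<Longrightarrow> cut_of (front j c) bs \<gamma> \<Longrightarrow> \<forall>y\<in>set bs. segment c j y"
  by (rule segment_cut[of "front j c" bs \<gamma> j 0 c j]) (auto simp: rear_0 lc)

text \<open>All marked beads end at the last vertex of \<open>c\<close>, and all blocks are segments
  for that base. In the differential of their antipodes the products of antipodes of segments are
  killed; the face terms reassemble into the first part of \<open>\<chi>\<close> on inner faces by
  \<open>cut_sum_faces\<close>.\<close>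

lemma D_chi1:
  "K (necklace_diff (chi1 c) - ((\<Sum>t\<in>{1..<k}. sg t (chi1 (omit t c))) - cut_sum (aw 1 0 0) c) :: 'a necklace \<Rightarrow>\<^sub>0 'r::comm_ring_1)"
proof -
  have fc: "front k c = c" "last c = c ! k" "2 \<le> length c" "sdim c = k" "k \<in> {1..k}" "k < length c"
    using lc k ends by (auto simp: front_def sdim_def)
  let ?F = "\<lambda>bs \<gamma>. sg (bdeg bs) (nk (Sl bs) \<gamma>) :: 'a necklace \<Rightarrow>\<^sub>0 'r"
  let ?g1 = "\<lambda>b. - (\<Sum>t\<in>{1..<sdim b}. sg t (Sb (omit t b))) :: ('a, 'r) walg"
  let ?g2 = "\<lambda>b. \<Sum>j\<in>{1..<sdim b}. sg (j + (j - 1) * (sdim b - j - 1)) (Sb (rear j b) * Sb (front j b)) :: ('a, 'r) walg"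
  have "K (sg (bdeg bs) (necklace_diff (nk (Sl bs) \<gamma>)) - (face_sum ?F bs \<gamma> - aw 1 0 0 bs \<gamma>))" if cut: "cut_of c bs \<gamma>" for bs \<gamma>
  proof -
    have seg: "\<forall>y\<in>set bs. segment c k y" using cut_segments[of k bs \<gamma>] cut fc by simp
    note l = cut_of_lengths[OF cut fc(3)] and t = cut_of_sorted[OF cut fc(3) c]
    have z: "ctr c k (Sl bs) = (0 :: ('a, 'r) walg)" by (rule ctr_segment_Sl[OF c fc(6) seg])
    have z': "ctr c k (Sl bs * bd (front r \<gamma>)) = (0 :: ('a, 'r) walg)" if r: "r \<in> {1..sdim \<gamma>}" for r
    \<comment> \<open>A word of positive degree has augmentation 0, so the appended front does not
      matter. In degree 0 the marked bead is \<open>c\<close> and its fronts are segments.\<close>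
    proof (cases "bdeg bs = 0")
      case True
      then have g: "\<gamma> = c" by (rule cut_of_top[OF cut fc(3) c])
      have "segment c k (front r c)"
        unfolding segment_def using r unfolding g fc(4) by (intro exI[of _ 0] exI[of _ r]) (simp add: rear_0)
      then have "ctr c k (bd (front r c)) = (0 :: ('a, 'r) walg)" by (rule ctr_segment[OF c fc(6)])
      then show ?thesis unfolding g using z by (rule ker_mult[rotated])
    next
      case False
      have "(Sl bs :: ('a, 'r) walg) \<in> PA (beads (full c)) (last c) (hd c) (bdeg bs)"
        using t by (intro PA_Sl[OF subset_refl _ refl]) auto
      moreover have "0 < bdeg bs" using False by linarith
      ultimately have "aug (Sl bs) = (0 :: ('a, 'r) walg)" by (rule PA_aug)
      then show ?thesis by (simp add: ctr_mult z)
    qed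
    have 1: "K (sg (bdeg bs) (necklace_diff (nk (Sl bs) \<gamma>)) - (sg (bdeg bs) (nk (pd (Sl bs)) \<gamma>) - aw 1 0 0 bs \<gamma>) :: 'a necklace \<Rightarrow>\<^sub>0 'r)"
      using D_term_K[OF fc(5), of bs \<gamma> "1 :: ('a, 'r) walg" 0 0] cut z z' by (simp add: fc(1) PA_1)
    have "pd (Sl bs) = dSl (\<lambda>b. pd (Sb b)) bs" using t by (intro pd_Sl) auto
    also have "\<dots> = dSl ?g2 bs + dSl ?g1 bs"
    proof (rule dSl_add)
      fix y assume "y \<in> set bs"
      then have "y \<in> faces_of c" using wpath_set[OF t[THEN conjunct2, THEN conjunct2]] by (rule rev_subsetD)
      then show "pd (Sb y) = ?g2 y + ?g1 y" by (simp add: pd_Sb dSb_def)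
    qed
    finally have p: "pd (Sl bs) = dSl ?g2 bs + dSl ?g1 bs" .
    have "face_sum ?F bs \<gamma> = nk (face_sum (\<lambda>bs' _. sg (bdeg bs') (Sl bs')) bs \<gamma>) \<gamma>"
      by (subst face_sum_hom(1)[of "\<lambda>z. nk z \<gamma>"]) (simp_all add: nk_lin face_sum_fixed[of ?F bs \<gamma> \<gamma>])
    then have f: "face_sum ?F bs \<gamma> = sg (bdeg bs) (nk (dSl ?g1 bs) \<gamma>)"
      unfolding face_sum_Sl by (simp add: nk_lin)
    have "K (nk (dSl ?g2 bs) \<gamma>)"
    proof (rule K_nk[of _ k])
      show "last \<gamma> = c ! k" using l(5) fc(2) by simp
      show "ctr c k (dSl ?g2 bs) = 0"
        by (rule ctr_segment_dSl[OF c fc(6) seg]) (rule ctr_segment_dSb[OF c fc(6)])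
    qed simp
    then have "K (sg (bdeg bs) (nk (dSl ?g2 bs) \<gamma>))" by (rule kz_sg)
    then have "K (sg (bdeg bs) (nk (pd (Sl bs)) \<gamma>) - face_sum ?F bs \<gamma>)"
      unfolding f p by (simp add: nk_lin sg_add)
    from K_diff_diff[OF this, of "aw 1 0 0 bs \<gamma>" "aw 1 0 0 bs \<gamma>"] show ?thesis
      by (intro K_trans[OF 1]) (simp add: kz_zero)
  qed
  then have "K (cut_sum (\<lambda>bs \<gamma>. sg (bdeg bs) (necklace_diff (nk (Sl bs) \<gamma>))) c - cut_sum (\<lambda>bs \<gamma>. face_sum ?F bs \<gamma> - aw 1 0 0 bs \<gamma>) c)"
    by (rule K_cut_sum_diff)
  moreover have "cut_sum (\<lambda>bs \<gamma>. face_sum ?F bs \<gamma> - aw 1 0 0 bs \<gamma>) c = (\<Sum>t\<in>{1..<k}. sg t (chi1 (omit t c))) - cut_sum (aw 1 0 0) c"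
    unfolding cut_sum_diff chi1_def using cut_sum_faces[OF fc(3), of ?F] fc(4) by simp
  ultimately show ?thesis
    unfolding chi1_def[of c] cut_sum_lin[OF necklace_diff_lin] by (simp add: lin_sg[OF necklace_diff_lin])
qed

text \<open>For an edge \<open>U\<close> is an empty sum whereas \<open>RU\<close> is 1, so the
  difference is -1, not in the right ideal; the factor \<open>z\<close> in the kernel is present to
  cover this case.\<close>

lemma pd_U_ctr:
  assumes x: "sorted_wrt (<) x" "2 \<le> length x" "hd x = c ! i" "i \<le> k" and z: "ctr c i z = (0 :: ('a, 'r::comm_ring_1) walg)"
  shows "ctr c i ((pd (U x) - RU x) * z) = (0 :: ('a, 'r) walg)"
proof (cases "length x = 2")
  case True
  then obtain u v where uv: "x = [u, v]" by (cases x; cases "tl x") (auto simp: numeral_2_eq_2)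
  have "pd (U x) - RU x = (- 1 :: ('a, 'r) walg)"
    by (simp add: uv U_def RU_def pd_lin Sb_edge bd_inverse2)
  then show ?thesis using z by (simp add: lin_minus[OF lin_ctr])
next
  case False
  then have "2 \<le> sdim x" using x(2) by (simp add: sdim_def)
  then have "lk c i (pd (U x) - RU x :: ('a, 'r) walg)"
    unfolding RU_def using x lc by (intro pd_U[OF c]) auto
  then show ?thesis using lk_mult[of c i "pd (U x) - RU x" z] by (simp add: lk_def)
qed

lemma D_chi2:
  "K (necklace_diff (nk (U c) [hd c]) - (nk (bd [hd c, c ! k] * Sb c) [hd c]
    + (\<Sum>i\<in>{1..<k}. sg (k * Suc i) (nk (bd [hd c, c ! i] * (U (rear i c) * Sb (front i c))) [hd c])))
    :: 'a necklace \<Rightarrow>\<^sub>0 'r::comm_ring_1)"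
proof -
  have c0: "c \<noteq> []" "hd c = c ! 0" "last c = c ! k" "sdim c = k" "2 \<le> length c"
    using lc k ends by (auto simp: sdim_def)
  have S: "[hd c] \<in> simplices (full c) 0" using c0(1) by (simp add: simplices_iff full_def)
  have P: "(U c :: ('a, 'r) walg) \<in> PA (beads (full c)) (last [hd c]) (hd [hd c]) k"
    using PA_U[OF c subset_refl, of k, where 'r = 'r] c0(4) by simp
  have "ctr c 0 ((pd (U c) - RU c) * 1) = (0 :: ('a, 'r) walg)"
    by (rule pd_U_ctr[OF c c0(5,2)]) simp_all
  then have "K (nk (pd (U c) - RU c) [hd c] :: 'a necklace \<Rightarrow>\<^sub>0 'r)"
    using c0(2) by (intro K_nk[of _ 0]) simp_all
  moreover have "necklace_diff (nk (U c) [hd c]) = (nk (pd (U c)) [hd c] :: 'a necklace \<Rightarrow>\<^sub>0 'r)"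
    using D_nk[OF asc_full S P] by simp
  moreover have "nk (RU c) [hd c] = (nk (bd [hd c, c ! k] * Sb c) [hd c]
    + (\<Sum>i\<in>{1..<k}. sg (k * Suc i) (nk (bd [hd c, c ! i] * (U (rear i c) * Sb (front i c))) [hd c])) :: 'a necklace \<Rightarrow>\<^sub>0 'r)"
    by (simp only: RU_def nk_lin c0(3,4))
  ultimately show ?thesis by (simp only: nk_lin)
qed

text \<open>With base \<open>c ! j\<close> the factor \<open>U\<close> lies in the right ideal, so
  terms still beginning with it vanish. There remain its differential, replaced by
  \<open>RU\<close>, and the moved rears collected in \<open>aw\<close>.\<close>

lemma D_chi3:
  assumes j: "j \<in> {1..<k}"
  shows "K (necklace_diff (chi3 c j) -
    (cut_sum (\<lambda>bs \<gamma>. sg (j * (k - j) + bdeg bs) (nk (bd [c ! j, c ! k] * (Sb (rear j c) * Sl bs)) \<gamma>)) (front j c)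
     + (\<Sum>i\<in>{1..<k-j}. cut_sum (\<lambda>bs \<gamma>. sg ((j + i) * (k - (j + i)) + (k - (j + i)) + j * (j + i - j) + bdeg bs)
         (nk (bd [c ! j, c ! (j + i)] * (U (rear (j + i) c) * (Sb (rear j (front (j + i) c)) * Sl bs))) \<gamma>)) (front j c))
     - cut_sum (aw (U (rear j c)) (k - j) (j * (k - j))) (front j c)) :: 'a necklace \<Rightarrow>\<^sub>0 'r::comm_ring_1)"
proof -
  let ?x = "rear j c"
  let ?U = "U ?x :: ('a, 'r) walg"
  have e: "hd ?x = c ! j" "last ?x = c ! k" "sdim ?x = k - j" "2 \<le> length ?x" "sdim c = k" "j < length c" "2 \<le> length (front j c)" "last (front j c) = c ! j"
    using j lc ends by (auto simp: hd_rear last_rear length_rear length_front last_front sdim_def)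
  have xi: "?x ! i = c ! (j + i)" for i using e(6) by (simp add: rear_def)
  have lkU: "lk c j (?U * z)" for z
    by (rule lk_mult[OF lk_U[OF c e(6) sorted_rear[OF c] e(1)]])
  have PU: "?U \<in> PA (beads (full c)) (c ! j) (c ! j) (k - j)"
    using PA_U[OF sorted_rear[OF c] set_rear, of "k - j" j, where 'r = 'r] e by simp
  have j': "j \<in> {1..k}" using j by simp
  let ?Y = "\<lambda>bs \<gamma>. sg (j * (k - j) + bdeg bs) (nk (bd [c ! j, c ! k] * (Sb (rear j c) * Sl bs)) \<gamma>) :: 'a necklace \<Rightarrow>\<^sub>0 'r"
  let ?X = "\<lambda>i bs \<gamma>. sg ((j + i) * (k - (j + i)) + (k - (j + i)) + j * (j + i - j) + bdeg bs)
         (nk (bd [c ! j, c ! (j + i)] * (U (rear (j + i) c) * (Sb (rear j (front (j + i) c)) * Sl bs))) \<gamma>) :: 'a necklace \<Rightarrow>\<^sub>0 'r"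
  let ?aw = "aw ?U (k - j) (j * (k - j))"
  have "K (sg (j * (k - j) + bdeg bs) (necklace_diff (nk (?U * Sl bs) \<gamma>)) - (?Y bs \<gamma> + (\<Sum>i\<in>{1..<k-j}. ?X i bs \<gamma>) - ?aw bs \<gamma>))"
    if cut: "cut_of (front j c) bs \<gamma>" for bs \<gamma>
  proof -
    let ?n = "j * (k - j) + bdeg bs"
    have lg: "last \<gamma> = c ! j" using cut_of_lengths(5)[OF cut e(7)] e(8) by simp
    have z: "ctr c j (Sl bs) = (0 :: ('a, 'r) walg)"
      by (rule ctr_segment_Sl[OF c e(6) cut_segments[OF j' cut]])
    have R: "RU ?x * Sl bs = (bd [c ! j, c ! k] * (Sb ?x * Sl bs) + (\<Sum>i\<in>{1..<k-j}. sg ((k - j) * Suc i)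
        (bd [c ! j, c ! (j + i)] * (U (rear i ?x) * (Sb (front i ?x) * Sl bs)))) :: ('a, 'r) walg)"
      by (simp only: RU_def e(1-3) xi distrib_right sum_distrib_right sg_mult_left mult.assoc)
    have 1: "K (sg ?n (necklace_diff (nk (?U * Sl bs) \<gamma>)) - (sg ?n (nk (pd (?U * Sl bs)) \<gamma>) - ?aw bs \<gamma>))"
      using lkU by (intro D_term_K[OF j' cut PU]) (auto simp: lk_def mult.assoc)
    have p: "pd (?U * Sl bs) = (pd ?U - RU ?x) * Sl bs + RU ?x * Sl bs + sg (k - j) (?U * pd (Sl bs))"
      by (simp add: pd_mult PA_tau[OF PU] left_diff_distrib)
    have "K (nk ((pd ?U - RU ?x) * Sl bs) \<gamma>)"
      using j by (intro K_nk[OF lg] pd_U_ctr[OF sorted_rear[OF c] e(4,1) _ z]) auto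
    moreover have "K (sg (k - j) (nk (?U * pd (Sl bs)) \<gamma>))"
      using j by (intro kz_sg K_nk_lk[OF lg] lkU) auto
    ultimately have "K (sg ?n (nk ((pd ?U - RU ?x) * Sl bs) \<gamma> + sg (k - j) (nk (?U * pd (Sl bs)) \<gamma>)))"
      by (rule kz_sg[OF kz_add])
    also have "sg ?n (nk ((pd ?U - RU ?x) * Sl bs) \<gamma> + sg (k - j) (nk (?U * pd (Sl bs)) \<gamma>))
      = sg ?n (nk (pd (?U * Sl bs)) \<gamma>) - sg ?n (nk (RU ?x * Sl bs) \<gamma>)"
      unfolding p sg_diff[symmetric] nk_lin by (rule arg_cong[where f = "sg ?n"]) simp
    also have "sg ?n (nk (RU ?x * Sl bs) \<gamma>) = ?Y bs \<gamma> + (\<Sum>i\<in>{1..<k-j}. ?X i bs \<gamma>)"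
      unfolding R nk_lin sg_add sg_sum sg_sg
    proof (intro arg_cong2[of _ _ _ _ "(+)"] refl sum.cong)
      fix i assume i: "i \<in> {1..<k-j}"
      obtain a where a: "k = j + i + a" using i by (metis atLeastLessThan_iff le_Suc_ex less_diff_conv less_imp_le add.commute)
      have "even (?n + (k - j) * Suc i) = even ((j + i) * (k - (j + i)) + (k - (j + i)) + j * (j + i - j) + bdeg bs)"
        unfolding a by (cases "even i"; cases "even j"; cases "even a"; simp)
      moreover have "rear i (rear j c) = rear (j + i) c" "front i (rear j c) = rear j (front (j + i) c)"
        by (simp_all add: rear_rear rear_front add.commute)
      ultimately show "sg (?n + (k - j) * Suc i) (nk (bd [c ! j, c ! (j + i)] * (U (rear i (rear j c)) * (Sb (front i (rear j c)) * Sl bs))) \<gamma>) = ?X i bs \<gamma>"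
        by (simp only:) (rule sg_cong, assumption, rule refl)
    qed
    finally have 2: "K (sg ?n (nk (pd (?U * Sl bs)) \<gamma>) - (?Y bs \<gamma> + (\<Sum>i\<in>{1..<k-j}. ?X i bs \<gamma>)))" .
    have "K (?aw bs \<gamma> - ?aw bs \<gamma>)" by (simp add: kz_zero)
    from K_diff_diff[OF 2 this] show ?thesis by (rule K_trans[OF 1])
  qed
  then have "K (cut_sum (\<lambda>bs \<gamma>. sg (j * (k - j) + bdeg bs) (necklace_diff (nk (?U * Sl bs) \<gamma>))) (front j c)
    - cut_sum (\<lambda>bs \<gamma>. ?Y bs \<gamma> + (\<Sum>i\<in>{1..<k-j}. ?X i bs \<gamma>) - ?aw bs \<gamma>) (front j c))"
    by (rule K_cut_sum_diff)
  then show ?thesis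
    unfolding chi3_def e(5) cut_sum_lin[OF necklace_diff_lin] lin_sg[OF necklace_diff_lin] cut_sum_diff cut_sum_add cut_sum_sum .
qed

text \<open>The moved rears of the first part (\<open>A1\<close>) are cancelled by the edge terms of
  the second and third parts (\<open>B0\<close>, \<open>SY\<close>), those of the third part
  (\<open>SA\<close>) by the remaining terms with \<open>U\<close> (\<open>SW\<close>,
  \<open>SX\<close>). Only the first part of \<open>\<chi>\<close> on inner faces is left.\<close>

lemma D_chi:
  "K (necklace_diff (chi_map (basis c)) - (\<Sum>t\<in>{1..<k}. sg t (chi1 (omit t c))) :: 'a necklace \<Rightarrow>\<^sub>0 'r::comm_ring_1)"
proof -
  have fc: "front k c = c" "sdim c = k" "k \<in> {1..k}" using lc k by (auto simp: front_def sdim_def)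
  let ?W = "\<lambda>j. nk (bd [hd c, c ! j] * (U (rear j c) * Sb (front j c))) [hd c] :: 'a necklace \<Rightarrow>\<^sub>0 'r"
  let ?Y = "\<lambda>j. cut_sum (\<lambda>bs \<gamma>. sg (j * (k - j) + bdeg bs) (nk (bd [c ! j, c ! k] * (Sb (rear j c) * Sl bs)) \<gamma>)) (front j c) :: 'a necklace \<Rightarrow>\<^sub>0 'r"
  let ?X = "\<lambda>l j. cut_sum (\<lambda>bs \<gamma>. sg (j * (k - j) + (k - j) + l * (j - l) + bdeg bs)
          (nk (bd [c ! l, c ! j] * (U (rear j c) * (Sb (rear l (front j c)) * Sl bs))) \<gamma>)) (front l c) :: 'a necklace \<Rightarrow>\<^sub>0 'r"
  let ?A = "\<lambda>j. cut_sum (aw (U (rear j c)) (k - j) (j * (k - j))) (front j c) :: 'a necklace \<Rightarrow>\<^sub>0 'r"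
  define F A1 B0 where "F = (\<Sum>t\<in>{1..<k}. sg t (chi1 (omit t c)) :: 'a necklace \<Rightarrow>\<^sub>0 'r)"
    and "A1 = (cut_sum (aw 1 0 0) c :: 'a necklace \<Rightarrow>\<^sub>0 'r)" and "B0 = (nk (bd [hd c, c ! k] * Sb c) [hd c] :: 'a necklace \<Rightarrow>\<^sub>0 'r)"
  define SW SY SX SA where "SW = (\<Sum>i\<in>{1..<k}. sg (k * Suc i) (?W i))" and "SY = sum ?Y {1..<k}"
    and "SX = (\<Sum>j\<in>{1..<k}. \<Sum>l\<in>{1..<j}. ?X l j)" and "SA = sum ?A {1..<k}"
  define D1 D2 D3 where "D1 = (necklace_diff (chi1 c) :: 'a necklace \<Rightarrow>\<^sub>0 'r)"
    and "D2 = (necklace_diff (nk (U c) [hd c]) :: 'a necklace \<Rightarrow>\<^sub>0 'r)" and "D3 = (\<Sum>j\<in>{1..<k}. necklace_diff (chi3 c j) :: 'a necklace \<Rightarrow>\<^sub>0 'r)"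
  have 1: "K (D1 - (F - A1))" unfolding D1_def F_def A1_def by (rule D_chi1)
  have 2: "K (D2 - (B0 + SW))" unfolding D2_def B0_def SW_def by (rule D_chi2)
  have "K (D3 - (\<Sum>j\<in>{1..<k}. ?Y j + (\<Sum>i\<in>{1..<k-j}. ?X j (j + i)) - ?A j))"
    unfolding D3_def by (intro K_sum_diff D_chi3)
  also have "(\<Sum>j\<in>{1..<k}. ?Y j + (\<Sum>i\<in>{1..<k-j}. ?X j (j + i)) - ?A j) = SY + SX - SA"
    unfolding sum_subtractf sum.distrib sum_upper_triangle[of ?X] SY_def SX_def SA_def ..
  finally have 3: "K (D3 - (SY + SX - SA))" .
  have 4: "K (A1 - (B0 + SY))"
    using aw_sum[OF fc(3), of "1 :: ('a, 'r) walg" 0 0] unfolding A1_def B0_def SY_def by (simp add: fc(1))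
  have "K (SA - (\<Sum>j\<in>{1..<k}. sg (j * (k - j) + (k - j)) (?W j) + (\<Sum>l\<in>{1..<j}. ?X l j)))"
    unfolding SA_def by (intro K_sum_diff aw_sum) simp
  also have "(\<Sum>j\<in>{1..<k}. sg (j * (k - j) + (k - j)) (?W j) + (\<Sum>l\<in>{1..<j}. ?X l j)) = SW + SX"
    unfolding sum.distrib SW_def SX_def
  proof (intro arg_cong2[of _ _ _ _ "(+)"] refl sum.cong sg_cong)
    fix j assume "j \<in> {1..<k}"
    then obtain a where a: "k = j + a" by (metis atLeastLessThan_iff le_Suc_ex less_imp_le)
    show "even (j * (k - j) + (k - j)) = even (k * Suc j)"
      unfolding a by (cases "even j"; cases "even a"; simp)
  qed
  finally have 5: "K (SA - (SW + SX))" .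
  have "K ((D1 - (F - A1)) + (D2 - (B0 + SW)) + (D3 - (SY + SX - SA)) - (A1 - (B0 + SY)) - (SA - (SW + SX)))"
    by (intro kz_diff kz_add 1 2 3 4 5)
  also have "(D1 - (F - A1)) + (D2 - (B0 + SW)) + (D3 - (SY + SX - SA)) - (A1 - (B0 + SY)) - (SA - (SW + SX)) = D1 + D2 + D3 - F"
    by (simp add: algebra_simps)
  also have "D1 + D2 + D3 = necklace_diff (chi_map (basis c))"
    using k by (simp add: chi_map_basis[OF c] fc(2) lin_add[OF necklace_diff_lin] lin_sum[OF necklace_diff_lin] D1_def D2_def D3_def)
  finally show ?thesis unfolding F_def .
qed

section \<open>Values of \<chi> on the faces of the simplex\<close>

lemma K_nk_U:
  assumes "sorted_wrt (<) x" "hd x \<in> set c" "last e = hd x"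
  shows "K (nk (U x * z) e)"
proof -
  obtain i where i: "i < length c" "hd x = c ! i" using assms(2) by (auto simp: in_set_conv_nth)
  show ?thesis
    using i assms(3) lc by (intro K_nk_lk[of _ i] lk_mult lk_U[OF c i(1) assms(1) i(2)]) auto
qed

text \<open>The second and third parts have words beginning with \<open>U\<close>, which lies in the
  right ideal of its own starting vertex, the last vertex of the marked bead.\<close>

lemma K_chi_face:
  assumes y: "sorted_wrt (<) y" "set y \<subseteq> set c" "0 < sdim y"
  shows "K (chi_map (basis y) - chi1 y :: 'a necklace \<Rightarrow>\<^sub>0 'r::comm_ring_1)"
proof -
  have y0: "y \<noteq> []" using y(3) by (auto simp: sdim_def)
  have h: "hd y \<in> set c" using y(2) y0 hd_in_set by blast
  have "K (nk (U y) [hd y] + (\<Sum>j\<in>{1..<sdim y}. chi3 y j) :: 'a necklace \<Rightarrow>\<^sub>0 'r)"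
  proof (intro kz_add kz_sum)
    show "K (nk (U y) [hd y] :: 'a necklace \<Rightarrow>\<^sub>0 'r)"
      using K_nk_U[OF y(1) h, of "[hd y]" "1 :: ('a, 'r) walg"] by simp
    fix j assume j: "j \<in> {1..<sdim y}"
    then have e: "hd (rear j y) = y ! j" "last (front j y) = y ! j" "j < length y" "2 \<le> length (front j y)"
      by (auto simp: sdim_def hd_rear last_front length_front)
    have hc: "hd (rear j y) \<in> set c" using e(1,3) y(2) by auto
    show "K (chi3 y j :: 'a necklace \<Rightarrow>\<^sub>0 'r)"
      unfolding chi3_def
    proof (intro K_cut_sum kz_sg)
      fix bs \<gamma> assume "cut_of (front j y) bs \<gamma>"
      from cut_of_lengths(5)[OF this e(4)] have "last \<gamma> = hd (rear j y)" using e by simp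
      then show "K (nk (U (rear j y) * Sl bs) \<gamma> :: 'a necklace \<Rightarrow>\<^sub>0 'r)" by (rule K_nk_U[OF sorted_rear[OF y(1)] hc])
    qed
  qed
  then show ?thesis by (simp add: chi_map_basis[OF y(1,3)] add.assoc)
qed

text \<open>The blocks of any cut are again segments, so their antipodes are killed by the
  contraction based at their common end.\<close>

lemma K_chi1_segment:
  assumes "i + m \<le> k" "0 < m"
  shows "K (chi1 (front m (rear i c)) :: 'a necklace \<Rightarrow>\<^sub>0 'r::comm_ring_1)"
  unfolding chi1_def
proof (intro K_cut_sum kz_sg)
  fix bs \<gamma> assume cut: "cut_of (front m (rear i c)) bs \<gamma>"
  have im: "i + m < length c" using assms lc by simp
  have "2 \<le> length (front m (rear i c))" "last (front m (rear i c)) = c ! (i + m)"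
    using assms lc by (auto simp: length_front length_rear last_front) (auto simp: rear_def)
  then have "last \<gamma> = c ! (i + m)" using cut_of_lengths(5)[OF cut] by simp
  then show "K (nk (Sl bs) \<gamma> :: 'a necklace \<Rightarrow>\<^sub>0 'r)"
    by (rule K_nk) (use assms in \<open>auto intro!: ctr_segment_Sl[OF c im] segment_cut[OF cut refl le_refl im]\<close>)
qed

text \<open>On faces only the first part of \<open>\<chi>\<close> counts, and the two outer faces
  consist of consecutive vertices and are killed. The inner faces give exactly the sum found in
  \<open>D_chi\<close>.\<close>

lemma chi_kz:
  "K (necklace_diff (chi_map (basis c)) - chi_map (simplicial_boundary (basis c)) :: 'a necklace \<Rightarrow>\<^sub>0 'r::comm_ring_1)"
proof -
  have lr: "lin chi_map" by (simp add: chi_map_def lin_lin_ext)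
  have sc: "sdim c = k" using lc by (simp add: sdim_def)
  let ?S = "\<Sum>t\<in>{1..<k}. sg t (chi1 (omit t c)) :: 'a necklace \<Rightarrow>\<^sub>0 'r"
  have B: "chi_map (simplicial_boundary (basis c)) = (\<Sum>t\<le>k. sg t (chi_map (basis (omit t c))) :: 'a necklace \<Rightarrow>\<^sub>0 'r)"
    using k by (simp add: boundary_basis sc lin_sum[OF lr] lin_sg[OF lr])
  have "K (chi_map (simplicial_boundary (basis c)) - ?S)"
  proof (cases "k = 1")
    case True
    have "K (chi_map (basis (omit t c)) :: 'a necklace \<Rightarrow>\<^sub>0 'r)" if t: "t \<le> k" for t
    proof -
      have "length (omit t c) = 1" using length_omit[of t c] t lc True by simp
      then obtain v where v: "omit t c = [v]" by (cases "omit t c") auto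
      have "v \<in> set c" using set_omit[of t c] v by auto
      then obtain i where i: "i < length c" "v = c ! i" by (auto simp: in_set_conv_nth)
      have "chi_map (basis [v]) = (nk 1 [v] :: 'a necklace \<Rightarrow>\<^sub>0 'r)"
        by (simp add: chi_map_def sdim_def nk_one)
      then show ?thesis using i lc unfolding v by (simp add: K_nk[of _ i])
    qed
    then show ?thesis unfolding B using True by (intro kz_diff kz_sum kz_sg) (auto simp: kz_zero)
  next
    case False
    have o: "sorted_wrt (<) (omit t c)" "set (omit t c) \<subseteq> set c" "0 < sdim (omit t c)" if "t \<le> k" for t
      using that sorted_omit[OF c] set_omit[of t c] sdim_omit[of t c] False k lc sc by auto
    have 1: "K (chi_map (simplicial_boundary (basis c)) - (\<Sum>t\<le>k. sg t (chi1 (omit t c))) :: 'a necklace \<Rightarrow>\<^sub>0 'r)"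
      unfolding B by (intro K_sum_diff) (simp only: sg_diff[symmetric] atMost_iff, intro kz_sg K_chi_face o)
    have e: "{..k} = insert 0 (insert k {1..<k})" using k by auto
    have f: "omit 0 c = front (k - 1) (rear 1 c)" "omit k c = front (k - 1) (rear 0 c)"
      using lc k by (auto simp: omit_def front_def rear_def One_nat_def)
    have "K (sg 0 (chi1 (omit 0 c)) + sg k (chi1 (omit k c)) :: 'a necklace \<Rightarrow>\<^sub>0 'r)"
      unfolding f using False k by (intro kz_add kz_sg K_chi1_segment) auto
    also have "sg 0 (chi1 (omit 0 c)) + sg k (chi1 (omit k c)) = (\<Sum>t\<le>k. sg t (chi1 (omit t c))) - ?S"
      unfolding e using k by (subst sum.insert, simp, simp, subst sum.insert) (simp_all add: algebra_simps)
    finally show ?thesis by (rule K_trans[OF 1])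
  qed
  from K_diff_diff[OF D_chi this] show ?thesis by simp
qed

end

section \<open>Support and augmentation of \<chi>\<close>

lemma au_Sl_edges: "\<forall>b\<in>set bs. length b = 2 \<Longrightarrow> au (Sl bs) = 1"
proof (induction bs)
  case (Cons b bs)
  then obtain u v where b: "b = [u, v]" by (cases b; cases "tl b") (auto simp: numeral_2_eq_2)
  show ?case using Cons by (simp add: b au_mult Sb_edge au_bd)
qed simp

text \<open>The augmentation sees only the cut of \<open>c\<close> into edges in the first part;
  other cuts and every word containing \<open>U\<close> have positive degree.\<close>

lemma chi_in:
  fixes c :: "'a::linorder list"
  assumes c: "sorted_wrt (<) c" and k: "0 < sdim c"
  shows "(chi_map (basis c) :: 'a necklace \<Rightarrow>\<^sub>0 'r::comm_ring_1) \<in> necklace_chains (full c) (sdim c)"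
    and "neck_aug (chi_map (basis c)) = (basis c :: _ \<Rightarrow>\<^sub>0 'r)"
proof -
  let ?k = "sdim c"
  have lc: "2 \<le> length c" "length c = Suc ?k" "c \<noteq> []" using k by (auto simp: sdim_def)
  have nc: "(\<And>bs \<gamma>. cut_of x bs \<gamma> \<Longrightarrow> f bs \<gamma> \<in> necklace_chains (full c) n) \<Longrightarrow> cut_sum f x \<in> necklace_chains (full c) n"
    for f :: "'a list list \<Rightarrow> 'a list \<Rightarrow> 'a necklace \<Rightarrow>\<^sub>0 'r" and x n
    by (rule cut_sum_closed[of "\<lambda>z. z \<in> necklace_chains (full c) n"]) (auto intro: nc_add nc_uminus)
  have cut: "\<gamma> \<in> simplices (full c) (sdim \<gamma>)" "(Sl bs :: ('a, 'r) walg) \<in> PA (beads (full c)) (last \<gamma>) (hd \<gamma>) (bdeg bs)"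
    if x: "cut_of x bs \<gamma>" "sorted_wrt (<) x" "set x \<subseteq> set c" "2 \<le> length x" for x bs \<gamma>
  proof -
    note l = cut_of_lengths[OF x(1,4)] and t = cut_of_sorted[OF x(1,4,2)]
    have "length \<gamma> = Suc (sdim \<gamma>)" "\<gamma> \<noteq> []" using l(1) by (auto simp: sdim_def)
    then show "\<gamma> \<in> simplices (full c) (sdim \<gamma>)" using t x(3) by (auto simp: simplices_iff full_def)
    show "(Sl bs :: ('a, 'r) walg) \<in> PA (beads (full c)) (last \<gamma>) (hd \<gamma>) (bdeg bs)"
      using t l by (intro PA_Sl[OF x(3) _ refl]) auto
  qed
  have 1: "(chi1 c :: 'a necklace \<Rightarrow>\<^sub>0 'r) \<in> necklace_chains (full c) ?k"
    unfolding chi1_def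
  proof (intro nc nc_sg)
    fix bs \<gamma> assume x: "cut_of c bs \<gamma>"
    show "(nk (Sl bs) \<gamma> :: 'a necklace \<Rightarrow>\<^sub>0 'r) \<in> necklace_chains (full c) ?k"
      by (rule nk_in[OF asc_full cut[OF x c subset_refl lc(1)] cut_of_lengths(3)[OF x lc(1)]])
  qed
  have PU: "(U c :: ('a, 'r) walg) \<in> PA (beads (full c)) (hd c) (hd c) ?k" by (rule PA_U[OF c subset_refl refl])
  have 2: "(nk (U c) [hd c] :: 'a necklace \<Rightarrow>\<^sub>0 'r) \<in> necklace_chains (full c) ?k"
    using lc(3) PU by (intro nk_in[OF asc_full, of "[hd c]" _ 0 _ ?k]) (auto simp: simplices_iff full_def)
  have PU': "(U (rear j c) :: ('a, 'r) walg) \<in> PA (beads (full c)) (c ! j) (c ! j) (?k - j)" if "j \<in> {1..<?k}" for j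
    using PA_U[OF sorted_rear[OF c] set_rear, of "?k - j" j, where 'r = 'r] that lc by (simp add: sdim_rear hd_rear)
  have 3: "(chi3 c j :: 'a necklace \<Rightarrow>\<^sub>0 'r) \<in> necklace_chains (full c) ?k" if j: "j \<in> {1..<?k}" for j
    unfolding chi3_def
  proof (intro nc nc_sg)
    fix bs \<gamma> assume x: "cut_of (front j c) bs \<gamma>"
    have f: "2 \<le> length (front j c)" "last (front j c) = c ! j" "sdim (front j c) = j"
      using j lc by (auto simp: length_front last_front sdim_front)
    note l = cut_of_lengths[OF x f(1), unfolded f] and p = cut[OF x sorted_front[OF c] set_front f(1)]
    have "(U (rear j c) * Sl bs :: ('a, 'r) walg) \<in> PA (beads (full c)) (last \<gamma>) (hd \<gamma>) (?k - j + bdeg bs)"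
      using PU'[OF j] p(2) unfolding l(5) by (rule PA_mult)
    then show "(nk (U (rear j c) * Sl bs) \<gamma> :: 'a necklace \<Rightarrow>\<^sub>0 'r) \<in> necklace_chains (full c) ?k"
      by (rule nk_in[OF asc_full p(1)]) (use l(3) j in simp)
  qed
  show "(chi_map (basis c) :: 'a necklace \<Rightarrow>\<^sub>0 'r) \<in> necklace_chains (full c) ?k"
    unfolding chi_map_basis[OF c k] by (intro nc_add nc_sum 1 2 3)
  have a1: "neck_aug (chi1 c) = (basis c :: _ \<Rightarrow>\<^sub>0 'r)"
    unfolding chi1_def cut_sum_lin[OF lin_neck_aug] lin_sg[OF lin_neck_aug] neck_aug_nk
  proof (subst cut_sum_top)
    fix bs \<gamma> assume x: "cut_of c bs \<gamma>" "sdim \<gamma> \<noteq> ?k"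
    have "0 < bdeg bs" using cut_of_lengths(3)[OF x(1) lc(1)] x(2) by linarith
    then have "au (Sl bs) = (0 :: 'r)" using cut(2)[OF x(1) c subset_refl lc(1)] by (rule PA_au[rotated])
    then show "sg (bdeg bs) (scale (au (Sl bs)) (basis \<gamma>)) = (0 :: _ \<Rightarrow>\<^sub>0 'r)" by simp
  next
    have "au (Sl (edges c)) = (1 :: 'r)" by (rule au_Sl_edges) (auto dest: length_edge)
    then show "sg (bdeg (edges c)) (scale (au (Sl (edges c))) (basis c)) = (basis c :: _ \<Rightarrow>\<^sub>0 'r)"
      unfolding bdeg_edges by simp
  qed (rule lc(1))
  have a2: "au (U c) = (0 :: 'r)" by (rule PA_au[OF PU k])
  have a3: "neck_aug (chi3 c j) = (0 :: _ \<Rightarrow>\<^sub>0 'r)" if j: "j \<in> {1..<?k}" for j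
  proof -
    have "au (U (rear j c)) = (0 :: 'r)" using j by (intro PA_au[OF PU'[OF j]]) simp
    then show ?thesis
      by (simp add: chi3_def cut_sum_lin[OF lin_neck_aug] lin_sg[OF lin_neck_aug] neck_aug_nk au_mult)
  qed
  show "neck_aug (chi_map (basis c)) = (basis c :: _ \<Rightarrow>\<^sub>0 'r)"
    unfolding chi_map_basis[OF c k] lin_add[OF lin_neck_aug] lin_sum[OF lin_neck_aug] by (simp add: a1 a2 a3 neck_aug_nk)
qed

lemma carried_chi: "carried chi_map"
  unfolding carried_def
proof (intro conjI allI impI)
  show "lin chi_map" by (simp add: chi_map_def lin_lin_ext)
  fix c :: "'a list" assume c: "sorted_wrt (<) c" "c \<noteq> []"
  have "(chi_map (basis c) :: 'a necklace \<Rightarrow>\<^sub>0 'b) \<in> necklace_chains (full c) (sdim c)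
    \<and> neck_aug (chi_map (basis c)) = (basis c :: _ \<Rightarrow>\<^sub>0 'b)"
  proof (cases "sdim c = 0")
    case True
    then obtain v where v: "c = [v]" using c by (cases c; cases "tl c") (auto simp: sdim_def)
    have "chi_map (basis [v]) = (nk 1 [v] :: 'a necklace \<Rightarrow>\<^sub>0 'b)"
      by (simp add: chi_map_def sdim_def nk_one)
    moreover have "(nk 1 [v] :: 'a necklace \<Rightarrow>\<^sub>0 'b) \<in> necklace_chains (full [v]) 0"
      by (rule nk_in[OF asc_full, of "[v]" _ 0 _ 0]) (auto simp: simplices_iff full_def intro: PA_1)
    ultimately show ?thesis by (simp add: v neck_aug_nk sdim_def)
  next
    case False
    then show ?thesis by (simp add: chi_in[OF c(1)])
  qed
  then show "(chi_map (basis c) :: 'a necklace \<Rightarrow>\<^sub>0 'b) \<in> necklace_chains (full c) (sdim c)" "neck_aug (chi_map (basis c)) = (basis c :: _ \<Rightarrow>\<^sub>0 'b)"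
    by auto
qed

lemma chi_chain_map:
  "sorted_wrt (<) (c :: 'a::linorder list) \<Longrightarrow> c \<noteq> [] \<Longrightarrow>
    necklace_diff (chi_map (basis c)) = chi_map (simplicial_boundary (basis c))"
proof (rule carried_chain_map[OF carried_chi])
  fix c e :: "'a list" and n assume c: "sorted_wrt (<) c" "0 < sdim c" and e: "e \<in> simplices (full c) n"
  have lc: "length c = Suc (sdim c)" using c(2) by (simp add: sdim_def)
  have "e \<noteq> []" "set e \<subseteq> set c" using e by (auto simp: simplices_iff full_def)
  then have "last e \<in> set c" using last_in_set by blast
  then obtain i where i: "i < length c" "last e = c ! i" by (auto simp: in_set_conv_nth)
  show "\<exists>b<length c. ctr c b (coef e (necklace_diff (chi_map (basis c)) - chi_map (simplicial_boundary (basis c)))) = (0 :: ('a, 'b) walg)"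
    using chi_kz[OF c(1) lc c(2), where 'r = 'b] i by (intro exI[of _ i]) (auto simp: kz_def pos_nth[OF c(1)] dest!: spec[of _ e])
qed

theorem theorem1p3:
  fixes X :: "'a::linorder set set"
  assumes "abstract_simplicial_complex X"
  shows "chain_homotopic
           (simplicial_chains X :: nat \<Rightarrow> ('a list \<Rightarrow>\<^sub>0 'r::comm_ring_1) set) simplicial_boundary
           (necklace_chains X) necklace_diff
           rho_map chi_map"
  by (rule carried_homotopic[OF assms carried_rho carried_chi rho_chain_map chi_chain_map])

end
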